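(* Let $\sigma^2=\sum_{u=1}^{2U}\sigma_u^2$, where for $1\le m\le M$ and $(m-1)T<t\le mT$, $$\sigma_{2t-1}^2=E_q\big\{[f_{m,t}^2(\mathbf X_{m,t})-f_{m,t-1}^2(\mathbf X_{m,t-1})]\,h_{m,t-1}(\mathbf X_{m,t-1})\big\},$$ $$\sigma_{2t}^2=E_q\big\{[f_{m,t}(\mathbf X_{m,t})h_{m,t}(\mathbf X_{m,t})-f_0]^2/h_{m,t}(\mathbf X_{m,t})\big\}.$$ Assume that $E_q\{f_t^2(\mathbf X_t)[h_t(\mathbf X_t)+h_{t-1}(\mathbf X_{t-1})]\}<\infty$ for $1\le t\le U$. Then $\sigma^2<\infty$ and $$\sqrt K(\widehat\psi_U-\psi_U)\Rightarrow N(0,\sigma^2)\quad\text{as }K\to\infty$$ (convergence in distribution, with $M$, $T$, $\theta$ and the observations fixed).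
   Context: Model. Let $M,T\ge1$ be integers and $U=MT>1$. A hidden Markov model has latent states $X_t$ in a space $\mathsf X$ with dominating measure (written $dx$), initial density $p_\theta(x_1)$ (also written $p_\theta(x_t|x_{t-1})$ for $t=1$), transition density $p_\theta(x_t|x_{t-1})$, and observation density $g_\theta(Y_t|x_t)$. The parameter $\theta$ and the observations $\mathbf Y_U=(Y_1,\dots,Y_U)$ are fixed. Write $\mathbf x_t=(x_1,\dots,x_t)$ and, for $(m-1)T<t\le mT$, $\mathbf x_{m,t}=(x_{(m-1)T+1},\dots,x_t)$ (and $\mathbf x_{m,(m-1)T}$ is empty); similarly for capital letters. Let $$p_\theta(\mathbf x_U|\mathbf Y_U)=\prod_{t=1}^U[p_\theta(x_t|x_{t-1})g_\theta(Y_t|x_t)]\big/\lambda(\theta),$$ where $\lambda(\theta)\in(0,\infty)$ is the normalizing constant (likelihood). Let $\psi:\mathsf X^U\to\mathbb R$ be measurable with $\psi_U:=E_p[\psi(\mathbf X_U)|\mathbf Y_U]=\int\psi(\mathbf x_U)p_\theta(\mathbf x_U|\mathbf Y_U)\,d\mathbf x_U$ existing and finite. Importance densities and weights. For each $t$, $q_t(\cdot|\mathbf x_{t-1})$ is a probability density on $\mathsf X$ with $q_t(x_t|\mathbf x_{t-1})>0$ whenever $p_\theta(x_t|x_{t-1})>0$, and $w_t(\mathbf x_t)>0$ is a resampling weight. For $(m-1)T<t\le mT$, neither depends on $\mathbf x_{(m-1)T}$, so we write $q_t(\cdot|\mathbf x_{m,t-1})$ and $w_t(\mathbf x_{m,t})$.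 $E_q$ denotes expectation when $\mathbf X_U$ has density $\prod_{t=1}^Uq_t(x_t|\mathbf x_{t-1})$ (no resampling). Let $\eta_0=1$ and assume $\eta_t:=E_q[\prod_{u=1}^tw_u(\mathbf X_u)]<\infty$ for $1\le t\le U$. Let $\eta_{m,t}=\eta_t/\eta_{(m-1)T}$ and $$h_t(\mathbf x_t)=\eta_t\Big/\prod_{u=1}^tw_u(\mathbf x_u),\qquad h_{m,t}(\mathbf x_{m,t})=\eta_{m,t}\Big/\prod_{u=(m-1)T+1}^tw_u(\mathbf x_{m,u}),$$ with $h_0=1$ and $h_{m,(m-1)T}=1$. Algorithm. Let $K\ge 1$. The $M$ particle filters are run independently. Filter $m$, at stages $t=(m-1)T+1,\dots,mT$: (1) for $1\le k\le K$ sample (independently given the past) $\widetilde X_t^k\sim q_t(\cdot|\mathbf X_{m,t-1}^k)$ and put $\widetilde{\mathbf X}_{m,t}^k=(\mathbf X_{m,t-1}^k,\widetilde X_t^k)$ (just $\widetilde X_t^k$ if $t=(m-1)T+1$); (2) let $\bar w_t=K^{-1}\sum_kw_t(\widetilde{\mathbf X}_{m,t}^k)$, $W_t^j=w_t(\widetilde{\mathbf X}_{m,t}^j)/(K\bar w_t)$, and generate conditionally i.i.d. $B_t^1,\dots,B_t^K$ with $P\{B_t^1=j\}=W_t^j$; (3) with $B(k)=B_t^k$ set $\mathbf X_{m,t}^k=\widetilde{\mathbf X}_{m,t}^{B(k)}$, $\widetilde H_{m,t}^j=H_{m,t-1}^j/(KW_t^j)$, $H_{m,t}^k=\widetilde H_{m,t}^{B(k)}$,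 with initial convention $H_{m,(m-1)T}^k=1$. Joined paths and estimator. $\mathsf Z^M=\{1,\dots,K\}^M$; for $\mathbf k=(k(1),\dots,k(M))\in\mathsf Z^M$, $\mathbf X_U^{\mathbf k}=(\mathbf X_{1,T}^{k(1)},\dots,\mathbf X_{M,MT}^{k(M)})$ and $H_U^{\mathbf k}=\prod_{n=1}^MH_{n,nT}^{k(n)}$. Let $L(\mathbf x_U)=p_\theta(\mathbf x_U|\mathbf Y_U)/\prod_{t=1}^Uq_t(x_t|\mathbf x_{t-1})$ and $$\widehat\psi_U=K^{-M}\sum_{\mathbf k\in\mathsf Z^M}L(\mathbf X_U^{\mathbf k})\psi(\mathbf X_U^{\mathbf k})H_U^{\mathbf k}.$$ Functions $f$. $f_0=\psi_U$ (a constant), $f_t(\mathbf x_t)=E_q[\psi(\mathbf X_U)L(\mathbf X_U)|\mathbf X_t=\mathbf x_t]$ for $1\le t\le U$, and for $(m-1)T<t\le mT$, $f_{m,t}(\mathbf x_{m,t})=E_q[f_t(\mathbf X_t)|\mathbf X_{m,t}=\mathbf x_{m,t}]$, with $f_{m,(m-1)T}=f_0$. $N(0,\sigma^2)$ is the normal distribution with mean $0$ and variance $\sigma^2$ (degenerate at $0$ if $\sigma^2=0$). *)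

theory Defs
  imports "HOL-Probability.Probability"
begin

text \<open>
  A hidden Markov model with a fixed parameter and fixed observations, together with the proposal
  densities, resampling weights and test function of a block particle filter.  There are \<open>M\<close> blocks
  of \<open>T\<close> time points; time runs through \<open>{1..M * T}\<close> and block \<open>m\<close> consists of the
  times \<open>{(m - 1) * T<..m * T}\<close>.  A path over a set \<open>I\<close> of times is an element of the product space
  over \<open>I\<close>, so that times keep their global index inside a block.
\<close>

record ('x, 'y) smc =
  n_blocks :: nat
  blk_len :: nat
  state_measure :: "'x measure"
  obs_measure :: "'y measure"
  init_dens :: "'x \<Rightarrow> real"
  trans_dens :: "'x \<Rightarrow> 'x \<Rightarrow> real"  \<comment> \<open>\<open>trans_dens S x y\<close> is the density at \<open>y\<close> given the previous state \<open>x\<close>\<close>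
  obs_dens :: "'x \<Rightarrow> 'y \<Rightarrow> real"  \<comment> \<open>\<open>obs_dens S x y\<close> is the density at the observation \<open>y\<close> given the state \<open>x\<close>\<close>
  obs :: "nat \<Rightarrow> 'y"
  prop_dens :: "nat \<Rightarrow> (nat \<Rightarrow> 'x) \<Rightarrow> 'x \<Rightarrow> real"
    \<comment> \<open>\<open>prop_dens S t z y\<close>: density at \<open>y\<close> given the part \<open>z\<close> of the path inside the block of \<open>t\<close> before \<open>t\<close>\<close>
  weight :: "nat \<Rightarrow> (nat \<Rightarrow> 'x) \<Rightarrow> real"
    \<comment> \<open>\<open>weight S t z\<close>: \<open>z\<close> is the part of the path inside the block of \<open>t\<close> up to and including \<open>t\<close>\<close>
  test_fun :: "(nat \<Rightarrow> 'x) \<Rightarrow> real"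

definition horizon :: "('x, 'y) smc \<Rightarrow> nat" where
  "horizon S = n_blocks S * blk_len S"

definition blk_start :: "('x, 'y) smc \<Rightarrow> nat \<Rightarrow> nat" where
  "blk_start S m = (m - 1) * blk_len S"

text \<open>For \<open>t \<ge> 1\<close> this is the unique \<open>m\<close> with \<open>(m - 1) * T < t \<le> m * T\<close>.\<close>
definition blk :: "('x, 'y) smc \<Rightarrow> nat \<Rightarrow> nat" where
  "blk S t = (t - 1) div blk_len S + 1"

definition paths :: "('x, 'y) smc \<Rightarrow> nat set \<Rightarrow> (nat \<Rightarrow> 'x) measure" where
  "paths S I = PiM I (\<lambda>_. state_measure S)"

subsection \<open>Target distribution\<close>

definition trans_at :: "('x, 'y) smc \<Rightarrow> nat \<Rightarrow> (nat \<Rightarrow> 'x) \<Rightarrow> real" where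
  "trans_at S t x = (if t = 1 then init_dens S (x 1) else trans_dens S (x (t - 1)) (x t))"

definition joint_dens :: "('x, 'y) smc \<Rightarrow> (nat \<Rightarrow> 'x) \<Rightarrow> real" where
  "joint_dens S x = (\<Prod>t\<in>{1..horizon S}. trans_at S t x * obs_dens S (x t) (obs S t))"

definition lik :: "('x, 'y) smc \<Rightarrow> real" where
  "lik S = (\<integral>x. joint_dens S x \<partial>paths S {1..horizon S})"

definition post_dens :: "('x, 'y) smc \<Rightarrow> (nat \<Rightarrow> 'x) \<Rightarrow> real" where
  "post_dens S x = joint_dens S x / lik S"

definition post_mean :: "('x, 'y) smc \<Rightarrow> real" where
  "post_mean S = (\<integral>x. test_fun S x * post_dens S x \<partial>paths S {1..horizon S})"

subsection \<open>Importance distribution without resampling\<close>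

definition prop_at :: "('x, 'y) smc \<Rightarrow> nat \<Rightarrow> (nat \<Rightarrow> 'x) \<Rightarrow> real" where
  "prop_at S t x = prop_dens S t (restrict x {blk_start S (blk S t)<..<t}) (x t)"

definition weight_at :: "('x, 'y) smc \<Rightarrow> nat \<Rightarrow> (nat \<Rightarrow> 'x) \<Rightarrow> real" where
  "weight_at S t x = weight S t (restrict x {blk_start S (blk S t)<..t})"

definition prop_law :: "('x, 'y) smc \<Rightarrow> (nat \<Rightarrow> 'x) measure" where
  "prop_law S = density (paths S {1..horizon S}) (\<lambda>x. ennreal (\<Prod>t\<in>{1..horizon S}. prop_at S t x))"

definition lik_ratio :: "('x, 'y) smc \<Rightarrow> (nat \<Rightarrow> 'x) \<Rightarrow> real" where
  "lik_ratio S x = post_dens S x / (\<Prod>t\<in>{1..horizon S}. prop_at S t x)"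

locale smc_model =
  fixes S :: "('x, 'y) smc"
  assumes n_blocks_pos: "1 \<le> n_blocks S"
    and blk_len_pos: "1 \<le> blk_len S"
    and horizon_gt_1: "1 < horizon S"
    and sigma_finite_state: "sigma_finite_measure (state_measure S)"
    and init_measurable: "init_dens S \<in> borel_measurable (state_measure S)"
    and init_nonneg: "\<And>x. x \<in> space (state_measure S) \<Longrightarrow> 0 \<le> init_dens S x"
    and init_total: "(\<integral>\<^sup>+x. ennreal (init_dens S x) \<partial>state_measure S) = 1"
    and trans_measurable:
      "(\<lambda>(x, y). trans_dens S x y) \<in> borel_measurable (state_measure S \<Otimes>\<^sub>M state_measure S)"
    and trans_nonneg: "\<And>x y. x \<in> space (state_measure S) \<Longrightarrow> y \<in> space (state_measure S) \<Longrightarrow>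
        0 \<le> trans_dens S x y"
    and trans_total: "\<And>x. x \<in> space (state_measure S) \<Longrightarrow>
        (\<integral>\<^sup>+y. ennreal (trans_dens S x y) \<partial>state_measure S) = 1"
    and obs_measurable:
      "(\<lambda>(x, y). obs_dens S x y) \<in> borel_measurable (state_measure S \<Otimes>\<^sub>M obs_measure S)"
    and obs_nonneg: "\<And>x y. x \<in> space (state_measure S) \<Longrightarrow> y \<in> space (obs_measure S) \<Longrightarrow>
        0 \<le> obs_dens S x y"
    and obs_total: "\<And>x. x \<in> space (state_measure S) \<Longrightarrow>
        (\<integral>\<^sup>+y. ennreal (obs_dens S x y) \<partial>obs_measure S) = 1"
    and obs_space: "\<And>t. t \<in> {1..horizon S} \<Longrightarrow> obs S t \<in> space (obs_measure S)"
    and joint_integrable: "integrable (paths S {1..horizon S}) (joint_dens S)"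
    and lik_pos: "0 < lik S"
    and test_measurable: "test_fun S \<in> borel_measurable (paths S {1..horizon S})"
    and test_integrable:
      "integrable (paths S {1..horizon S}) (\<lambda>x. test_fun S x * post_dens S x)"
    and prop_measurable: "\<And>t. t \<in> {1..horizon S} \<Longrightarrow>
        (\<lambda>(z, y). prop_dens S t z y) \<in>
          borel_measurable (paths S {blk_start S (blk S t)<..<t} \<Otimes>\<^sub>M state_measure S)"
    and prop_nonneg: "\<And>t z y. t \<in> {1..horizon S} \<Longrightarrow>
        z \<in> space (paths S {blk_start S (blk S t)<..<t}) \<Longrightarrow> y \<in> space (state_measure S) \<Longrightarrow>
        0 \<le> prop_dens S t z y"
    and prop_total: "\<And>t z. t \<in> {1..horizon S} \<Longrightarrow>
        z \<in> space (paths S {blk_start S (blk S t)<..<t}) \<Longrightarrow>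
        (\<integral>\<^sup>+y. ennreal (prop_dens S t z y) \<partial>state_measure S) = 1"
    and prop_pos: "\<And>t x. t \<in> {1..horizon S} \<Longrightarrow> x \<in> space (paths S {1..t}) \<Longrightarrow>
        0 < trans_at S t x \<Longrightarrow> 0 < prop_at S t x"
    and weight_measurable: "\<And>t. t \<in> {1..horizon S} \<Longrightarrow>
        weight S t \<in> borel_measurable (paths S {blk_start S (blk S t)<..t})"
    and weight_pos: "\<And>t z. t \<in> {1..horizon S} \<Longrightarrow>
        z \<in> space (paths S {blk_start S (blk S t)<..t}) \<Longrightarrow> 0 < weight S t z"
    and weight_integrable: "\<And>t. t \<in> {1..horizon S} \<Longrightarrow>
        integrable (prop_law S) (\<lambda>x. \<Prod>u\<in>{1..t}. weight_at S u x)"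

definition eta :: "('x, 'y) smc \<Rightarrow> nat \<Rightarrow> real" where
  "eta S t = (\<integral>x. (\<Prod>u\<in>{1..t}. weight_at S u x) \<partial>prop_law S)"

definition eta_blk :: "('x, 'y) smc \<Rightarrow> nat \<Rightarrow> nat \<Rightarrow> real" where
  "eta_blk S m t = eta S t / eta S (blk_start S m)"

definition h_fun :: "('x, 'y) smc \<Rightarrow> nat \<Rightarrow> (nat \<Rightarrow> 'x) \<Rightarrow> real" where
  "h_fun S t x = eta S t / (\<Prod>u\<in>{1..t}. weight_at S u x)"

definition h_blk :: "('x, 'y) smc \<Rightarrow> nat \<Rightarrow> nat \<Rightarrow> (nat \<Rightarrow> 'x) \<Rightarrow> real" where
  "h_blk S m t x = eta_blk S m t / (\<Prod>u\<in>{blk_start S m<..t}. weight_at S u x)"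

text \<open>
  The conditional expectations given sub-paths are random variables on \<open>prop_law S\<close>, i.e.\ functions
  of the full path that are measurable with respect to the coordinates in question.
\<close>

definition coord_alg :: "('x, 'y) smc \<Rightarrow> nat set \<Rightarrow> (nat \<Rightarrow> 'x) measure" where
  "coord_alg S I = vimage_algebra (space (prop_law S)) (\<lambda>x. restrict x I) (paths S I)"

definition f_fun :: "('x, 'y) smc \<Rightarrow> nat \<Rightarrow> (nat \<Rightarrow> 'x) \<Rightarrow> real" where
  "f_fun S t =
    (if t = 0 then (\<lambda>_. post_mean S)
     else real_cond_exp (prop_law S) (coord_alg S {1..t}) (\<lambda>x. test_fun S x * lik_ratio S x))"

definition f_blk :: "('x, 'y) smc \<Rightarrow> nat \<Rightarrow> nat \<Rightarrow> (nat \<Rightarrow> 'x) \<Rightarrow> real" where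
  "f_blk S m t =
    (if t = blk_start S m then f_fun S 0
     else real_cond_exp (prop_law S) (coord_alg S {blk_start S m<..t}) (f_fun S t))"

text \<open>The indices \<open>u = 2 * t - 1\<close> and \<open>u = 2 * t\<close> belong to time \<open>t\<close>.\<close>
definition sig_integrand :: "('x, 'y) smc \<Rightarrow> nat \<Rightarrow> (nat \<Rightarrow> 'x) \<Rightarrow> real" where
  "sig_integrand S u x =
    (let t = (u + 1) div 2; m = blk S t in
     if odd u then ((f_blk S m t x)\<^sup>2 - (f_blk S m (t - 1) x)\<^sup>2) * h_blk S m (t - 1) x
     else (f_blk S m t x * h_blk S m t x - f_fun S 0 x)\<^sup>2 / h_blk S m t x)"

definition sig2 :: "('x, 'y) smc \<Rightarrow> nat \<Rightarrow> real" where
  "sig2 S u = (\<integral>x. sig_integrand S u x \<partial>prop_law S)"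

subsection \<open>The particle filters\<close>

text \<open>A cloud assigns to every particle \<open>k \<in> {1..K}\<close> its path within the block and its value of \<open>H\<close>.\<close>
definition cloud_space ::
    "('x, 'y) smc \<Rightarrow> nat \<Rightarrow> nat \<Rightarrow> nat \<Rightarrow> (nat \<Rightarrow> (nat \<Rightarrow> 'x) \<times> real) measure" where
  "cloud_space S K m t = PiM {1..K} (\<lambda>_. paths S {blk_start S m<..t} \<Otimes>\<^sub>M borel)"

definition norm_weight :: "('x, 'y) smc \<Rightarrow> nat \<Rightarrow> nat \<Rightarrow> (nat \<Rightarrow> nat \<Rightarrow> 'x) \<Rightarrow> nat \<Rightarrow> real" where
  "norm_weight S K t z j =
    weight S t (z j) / (real K * ((\<Sum>k\<in>{1..K}. weight S t (z k)) / real K))"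

text \<open>
  One stage: independent proposals \<open>y\<close>, extended paths \<open>z\<close>, conditionally i.i.d.\ ancestor indices
  \<open>b\<close>, and the resampled paths and values of \<open>H\<close>.
\<close>
definition filter_step ::
    "('x, 'y) smc \<Rightarrow> nat \<Rightarrow> nat \<Rightarrow> nat \<Rightarrow> (nat \<Rightarrow> (nat \<Rightarrow> 'x) \<times> real) \<Rightarrow>
      (nat \<Rightarrow> (nat \<Rightarrow> 'x) \<times> real) measure" where
  "filter_step S K m t c = do {
     y \<leftarrow> PiM {1..K} (\<lambda>k. density (state_measure S) (\<lambda>v. ennreal (prop_dens S t (fst (c k)) v)));
     let z = (\<lambda>k. (fst (c k))(t := y k));
     b \<leftarrow> PiM {1..K} (\<lambda>_. point_measure {1..K} (\<lambda>j. ennreal (norm_weight S K t z j)));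
     return (cloud_space S K m t)
       (\<lambda>k\<in>{1..K}. (z (b k), snd (c (b k)) / (real K * norm_weight S K t z (b k))))
   }"

primrec filter_law ::
    "('x, 'y) smc \<Rightarrow> nat \<Rightarrow> nat \<Rightarrow> nat \<Rightarrow> (nat \<Rightarrow> (nat \<Rightarrow> 'x) \<times> real) measure" where
  "filter_law S K m 0 =
     return (cloud_space S K m (blk_start S m)) (\<lambda>k\<in>{1..K}. (\<lambda>_. undefined, 1))"
| "filter_law S K m (Suc n) = filter_law S K m n \<bind> filter_step S K m (blk_start S m + Suc n)"

definition smc_law ::
    "('x, 'y) smc \<Rightarrow> nat \<Rightarrow> (nat \<Rightarrow> nat \<Rightarrow> (nat \<Rightarrow> 'x) \<times> real) measure" where
  "smc_law S K = PiM {1..n_blocks S} (\<lambda>m. filter_law S K m (blk_len S))"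

definition joined_path ::
    "('x, 'y) smc \<Rightarrow> (nat \<Rightarrow> nat \<Rightarrow> (nat \<Rightarrow> 'x) \<times> real) \<Rightarrow> (nat \<Rightarrow> nat) \<Rightarrow> nat \<Rightarrow> 'x" where
  "joined_path S \<omega> k = (\<lambda>t\<in>{1..horizon S}. fst (\<omega> (blk S t) (k (blk S t))) t)"

definition joined_H ::
    "('x, 'y) smc \<Rightarrow> (nat \<Rightarrow> nat \<Rightarrow> (nat \<Rightarrow> 'x) \<times> real) \<Rightarrow> (nat \<Rightarrow> nat) \<Rightarrow> real" where
  "joined_H S \<omega> k = (\<Prod>n\<in>{1..n_blocks S}. snd (\<omega> n (k n)))"

definition psi_hat ::
    "('x, 'y) smc \<Rightarrow> nat \<Rightarrow> (nat \<Rightarrow> nat \<Rightarrow> (nat \<Rightarrow> 'x) \<times> real) \<Rightarrow> real" where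
  "psi_hat S K \<omega> =
    (\<Sum>k\<in>{1..n_blocks S} \<rightarrow>\<^sub>E {1..K}.
       lik_ratio S (joined_path S \<omega> k) * test_fun S (joined_path S \<omega> k) * joined_H S \<omega> k)
    / real K ^ n_blocks S"

definition normal_law :: "real \<Rightarrow> real measure" where
  "normal_law v =
    (if v = 0 then return borel 0
     else density lborel (\<lambda>x. ennreal (normal_density 0 (sqrt v) x)))"

end

theory Submission
  imports Defs "HOL-Real_Asymp.Real_Asymp"
begin

text \<open>
Within a block, each stage averages terms that are independent given the past, so a conditional
characteristic function bound gives the central limit theorem; the weights \<open>H\<close> equal \<open>h\<close> up to a common
factor tending to \<open>1\<close>. Over the blocks, write the error after \<open>j + 1\<close> blocks as the error after \<open>j\<close> blocks, plus the
error of block \<open>j + 1\<close> for the test function averaged over the earlier coordinates, plus a remainder. Given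
the first \<open>j\<close> filters the remainder is a single-filter error for a test function tending to \<open>0\<close> in mean square,
so it vanishes, the characteristic functions multiply, and Levy's theorem applies.
\<close>

text \<open>Only E_q f_t^2 (h_t + h_{t-1}) is assumed finite, and this shapes three choices.
  \<open>H\<close> contains the random normalisers of all stages, so no second moment of the
  estimator under the filter law is available; moment estimates are therefore truncated by
  \<open>min 1\<close> or restricted to the event that the common factor \<open>cc\<close> is at
  most 2, whose probability tends to 1. There one factor \<open>H\<close> is at most
  \<open>2 * h\<close> and the other is integrated out by unbiasedness, which turns the square of
  \<open>H\<close> into the weight \<open>h\<close> of the hypothesis. Secondly, the conditional
  expectations in the variance are determined only up to null sets, while a filter evaluates
  functions at points. They are replaced by versions built from transition kernels
  (\<open>fh\<close>, \<open>gs\<close>, \<open>gn\<close>), and unbiasedness together with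
  positivity of \<open>H\<close> shows that particles almost surely avoid null sets. Thirdly, the
  test function of the remainder depends on the earlier filters, so a limit theorem for a fixed test
  function does not apply to it; \<open>moment_bound\<close> holds for each \<open>K\<close> and
  sees the test function only through weighted second moments.\<close>

lemmas mcs = measurable_cong_sets
lemmas mcomp = measurable_compose

abbreviation bm :: "'a measure => ('a => 'b::topological_space) set" where
 "bm M \<equiv> borel_measurable M"

declare One_nat_def [simp del]

section \<open>Integrals over two-stage laws and finite products of kernels\<close>

lemma
 fixes f :: "'b => real"
 assumes K[measurable]: "K : M \<rightarrow>\<^sub>M prob_algebra N" and ne: "space M ~= {}"
  and f: "integrable (M \<bind> K) f"
 shows AE_integrable_bind: "AE x in M. integrable (K x) f"
  and integrable_integral_bind: "integrable M (%x. LINT y|K x. f y)"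
  and integral_bind: "(LINT y|(M \<bind> K). f y) = (LINT x|M. LINT y|K x. f y)"
proof -
 have K'[measurable]: "K : M \<rightarrow>\<^sub>M subprob_algebra N" by (rule measurable_prob_algebraD[OF K])
 have sb: "sets (M \<bind> K) = sets N" by (rule sets_bind[OF sets_kernel[OF K'] ne])
 have fm[measurable]: "f : bm N" using f sb by (auto dest!: borel_measurable_integrable cong: mcs)
 have bnd: "(\<integral>\<^sup>+x. \<integral>\<^sup>+y. norm (f y) \<partial>K x \<partial>M) < \<infinity>"
  using f by (subst nn_integral_bind[symmetric, where B=N]) (auto simp: integrable_iff_bounded)
 have fin: "AE x in M. (\<integral>\<^sup>+y. norm (f y) \<partial>K x) ~= \<infinity>" using bnd by (intro nn_integral_PInf_AE) (auto simp: less_top)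
 have setsK: "sets (K x) = sets N" if "x : space M" for x using sets_kernel[OF K' that] .
 have fK: "f : bm (K x)" if "x : space M" for x using fm setsK[OF that] by (simp cong: mcs)
 show AE: "AE x in M. integrable (K x) f" using fin by (rule AE_mp) (auto intro!: AE_I2 simp: integrable_iff_bounded fK less_top)
 have m1: "(%x. LINT y|K x. f y) : bm M" by measurable
 have le: "ennreal (norm (LINT y|K x. f y)) <= (\<integral>\<^sup>+y. norm (f y) \<partial>K x)" for x using integral_norm_bound_ennreal[of "K x" f]
  by (cases "integrable (K x) f") (auto simp: not_integrable_integral_eq)
 show int: "integrable M (%x. LINT y|K x. f y)" unfolding integrable_iff_bounded using m1 le_less_trans[OF nn_integral_mono[OF le] bnd] by auto
 \<comment> \<open>The positive and the negative part of \<open>f\<close> are both dominated by its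
   absolute value, so one statement about such a \<open>g\<close> covers both.
   \<open>enn2real\<close> sends the value infinity, which occurs only on a null set of
   \<open>x\<close>, to 0.\<close>
 have p: "integrable M (%x. enn2real (\<integral>\<^sup>+y. g y \<partial>K x))
   & enn2real (\<integral>\<^sup>+y. g y \<partial>(M \<bind> K)) = (LINT x|M. enn2real (\<integral>\<^sup>+y. g y \<partial>K x))"
  if [measurable]: "g : bm N" and g: "\<And>y. g y <= ennreal (norm (f y))" for g
 proof -
  have b: "(\<integral>\<^sup>+x. \<integral>\<^sup>+y. g y \<partial>K x \<partial>M) < \<infinity>"
   by (rule le_less_trans[OF _ bnd]) (intro nn_integral_mono g)
  have fin: "AE x in M. (\<integral>\<^sup>+y. g y \<partial>K x) ~= \<infinity>" using b by (intro nn_integral_PInf_AE) (auto simp: less_top)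
  have e: "(\<integral>\<^sup>+x. ennreal (enn2real (\<integral>\<^sup>+y. g y \<partial>K x)) \<partial>M) = (\<integral>\<^sup>+x. \<integral>\<^sup>+y. g y \<partial>K x \<partial>M)"
   using fin by (intro nn_integral_cong_AE) (auto elim!: eventually_mono simp: less_top)
  have "integrable M (%x. enn2real (\<integral>\<^sup>+y. g y \<partial>K x))" unfolding integrable_iff_bounded using b e by auto
  moreover have "(LINT x|M. enn2real (\<integral>\<^sup>+y. g y \<partial>K x)) = enn2real (\<integral>\<^sup>+x. \<integral>\<^sup>+y. g y \<partial>K x \<partial>M)"
   by (subst integral_eq_nn_integral) (auto simp: e)
  ultimately show ?thesis by (subst nn_integral_bind[where B=N]) auto
 qed
 have "(LINT y|(M \<bind> K). f y) = enn2real (\<integral>\<^sup>+y. f y \<partial>(M \<bind> K)) - enn2real (\<integral>\<^sup>+y. - f y \<partial>(M \<bind> K))"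
  by (rule real_lebesgue_integral_def[OF f])
 also have "... = (LINT x|M. enn2real (\<integral>\<^sup>+y. f y \<partial>K x) - enn2real (\<integral>\<^sup>+y. - f y \<partial>K x))"
  using p[of "%y. ennreal (f y)"] p[of "%y. ennreal (- f y)"] by (simp add: ennreal_leI Bochner_Integration.integral_diff)
 also have "... = (LINT x|M. LINT y|K x. f y)" using AE by (intro integral_cong_AE) (auto elim!: eventually_mono simp: real_lebesgue_integral_def)
 finally show "(LINT y|(M \<bind> K). f y) = (LINT x|M. LINT y|K x. f y)" .
qed

lemma integral_bind_complex:
 fixes f :: "'b => complex"
 assumes K[measurable]: "K : M \<rightarrow>\<^sub>M prob_algebra N" and M: "prob_space M"
  and f[measurable]: "f : bm N" and bnd: "\<And>y. y : space N ==> norm (f y) <= B"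
 shows "(LINT y|(M \<bind> K). f y) = (LINT x|M. LINT y|K x. f y)"
proof -
 interpret M: prob_space M by fact
 have K'[measurable]: "K : M \<rightarrow>\<^sub>M subprob_algebra N" by (rule measurable_prob_algebraD[OF K])
 have M': "M : space (prob_algebra M)" by (simp add: space_prob_algebra M)
 interpret MK: prob_space "M \<bind> K" by (rule prob_space_bind'[OF M' K])
 have setsK: "sets (K x) = sets N" and pK: "prob_space (K x)" if "x : space M" for x
  using measurable_space[OF K that] by (auto simp: space_prob_algebra)
 have sb: "sets (M \<bind> K) = sets N" by (rule sets_bind'[OF M' K])
 have 1: "integrable (M \<bind> K) f" using sets_eq_imp_space_eq[OF sb] bnd
  by (intro MK.integrable_const_bound[of _ B]) (auto simp: mcs[OF sb refl])
 have 2: "integrable (K x) f" if "x : space M" for x using sets_eq_imp_space_eq[OF setsK[OF that]] bnd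
  by (intro finite_measure.integrable_const_bound[of _ _ B] prob_space.finite_measure pK[OF that])
   (auto simp: mcs[OF setsK[OF that] refl])
 have B: "norm (LINT y|K x. f y) <= B" if "x : space M" for x
 proof -
  interpret Kx: prob_space "K x" by (rule pK[OF that])
  have "norm (LINT y|K x. f y) <= (LINT y|K x. norm (f y))" by simp
  also have "... <= (LINT y|K x. B)" using 2[OF that] sets_eq_imp_space_eq[OF setsK[OF that]] bnd by (intro integral_mono) auto
  finally show ?thesis by (simp add: Kx.prob_space)
 qed
 have 3: "integrable M (%x. LINT y|K x. f y)" using B by (intro M.integrable_const_bound[of _ B]) auto
 show ?thesis
 proof (rule complex_eqI)
  have "(LINT x|M. Re (LINT y|K x. f y)) = (LINT x|M. (LINT y|K x. Re (f y)))" by (rule Bochner_Integration.integral_cong) (auto simp: 2)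
  then show "Re (LINT y|(M \<bind> K). f y) = Re (LINT x|M. LINT y|K x. f y)" unfolding integral_Re[OF 1, symmetric] integral_Re[OF 3, symmetric]
    integral_bind[OF K M.not_empty integrable_Re[OF 1]] by (rule sym)
  have "(LINT x|M. Im (LINT y|K x. f y)) = (LINT x|M. (LINT y|K x. Im (f y)))" by (rule Bochner_Integration.integral_cong) (auto simp: 2)
  then show "Im (LINT y|(M \<bind> K). f y) = Im (LINT x|M. LINT y|K x. f y)" unfolding integral_Im[OF 1, symmetric] integral_Im[OF 3, symmetric]
    integral_bind[OF K M.not_empty integrable_Im[OF 1]] by (rule sym)
 qed
qed

text \<open>The locale \<open>product_prob_space\<close> asks for a probability measure at every
  index. A point mass is put at the indices outside \<open>I\<close>, and \<open>PiM_extend\<close>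
  shows that the product over \<open>I\<close> does not see it.\<close>

lemma product_prob_space_extend:
 assumes "\<And>i. i : I ==> prob_space (M i)"
 shows "product_prob_space (%i. if i : I then M i else return (count_space UNIV) undefined)"
 by (intro product_prob_spaceI) (auto intro: assms prob_space_return)

lemma PiM_extend:
 "PiM I (%i. if i : I then M i else return (count_space UNIV) undefined) = PiM I M" by (rule PiM_cong) auto

text \<open>Measurability of a kernel has to be tested only on a generator stable under
  intersections. On boxes the product measure is a finite product of measurable functions of
  \<open>c\<close>.\<close>

lemma measurable_PiM_kernel:
 assumes I: "finite I" and rho: "\<And>i. i : I ==> (%c. rho c i) : L \<rightarrow>\<^sub>M prob_algebra (E i)"
 shows "(%c. PiM I (rho c)) : L \<rightarrow>\<^sub>M prob_algebra (PiM I E)"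
proof (rule measurable_prob_algebra_generated[OF sets_PiM Int_stable_prod_algebra prod_algebra_sets_into_space])
 fix c assume c: "c : space L"
 have *: "prob_space (rho c i)" "sets (rho c i) = sets (E i)" if "i : I" for i
  using measurable_space[OF rho[OF that] c] by (auto simp: space_prob_algebra)
 then show "prob_space (PiM I (rho c))" by (intro prob_space_PiM) auto
 show "sets (PiM I (rho c)) = sets (PiM I E)" using * by (intro sets_PiM_cong) auto
next
 fix A assume "A : prod_algebra I E"
 then obtain B where B: "A = Pi\<^sub>E I B" "\<And>i. i : I ==> B i : sets (E i)" by (elim prod_algebraE_all) (auto simp: Pi_iff)
 have "emeasure (PiM I (rho c)) A = (\<Prod>i\<in>I. emeasure (rho c i) (B i))" if c: "c : space L" for c
 proof -
  have *: "prob_space (rho c i)" "sets (rho c i) = sets (E i)" if "i : I" for i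
   using measurable_space[OF rho[OF that] c] by (auto simp: space_prob_algebra)
  interpret P: product_prob_space "%i. if i : I then rho c i else return (count_space UNIV) undefined" by (intro product_prob_space_extend *)
  show ?thesis unfolding B(1) PiM_extend[of I "rho c", symmetric] using * B(2) by (subst P.emeasure_PiM[OF I]) (auto intro!: prod.cong)
 qed
 moreover have "(%c. \<Prod>i\<in>I. emeasure (rho c i) (B i)) : bm L"
 proof (rule borel_measurable_prod_ennreal)
  fix i assume i: "i : I"
  note [measurable] = measurable_prob_algebraD[OF rho[OF i]] B(2)[OF i]
  show "(%c. emeasure (rho c i) (B i)) : bm L" by measurable
 qed
 ultimately show "(%c. emeasure (PiM I (rho c)) A) : bm L" by (simp cong: measurable_cong)
qed

text \<open>Needed to recognise a stage of the filter, which first draws all states or all ancestor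
  indices and transforms them afterwards, as an independent draw of complete particles. Both sides
  agree on boxes.\<close>

lemma distr_PiM_componentwise:
 assumes I: "finite I" and M: "\<And>i. i : I ==> prob_space (M i)"
  and f: "\<And>i. i : I ==> f i : M i \<rightarrow>\<^sub>M N i"
 shows "distr (PiM I M) (PiM I N) (%x. \<lambda>i\<in>I. f i (x i)) = PiM I (%i. distr (M i) (N i) (f i))"
proof -
 let ?D = "%i. distr (M i) (N i) (f i)"
 interpret P: product_prob_space "%i. if i : I then ?D i else return (count_space UNIV) undefined"
  by (intro product_prob_space_extend prob_space.prob_space_distr M f)
 interpret Q: product_prob_space "%i. if i : I then M i else return (count_space UNIV) undefined" by (intro product_prob_space_extend M)
 note f[measurable]
 have m[measurable]: "(%x. \<lambda>i\<in>I. f i (x i)) : PiM I M \<rightarrow>\<^sub>M PiM I N" by (rule measurable_restrict) measurable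
 have "distr (PiM I M) (PiM I N) (%x. \<lambda>i\<in>I. f i (x i)) = PiM I (%i. if i : I then ?D i else return (count_space UNIV) undefined)"
 proof (rule P.PiM_eqI[OF I])
  show "sets (distr (PiM I M) (PiM I N) (%x. \<lambda>i\<in>I. f i (x i)))
   = sets (PiM I (%i. if i : I then ?D i else return (count_space UNIV) undefined))" unfolding PiM_extend sets_distr by (rule sets_PiM_cong) auto
 next
  fix A assume "\<And>i. i : I ==> A i : sets (if i : I then ?D i else return (count_space UNIV) undefined)"
  then have A[measurable]: "i : I ==> A i : sets (N i)" for i by simp
  have "(%x. \<lambda>i\<in>I. f i (x i)) -` Pi\<^sub>E I A \<inter> space (PiM I M) = Pi\<^sub>E I (%i. f i -` A i \<inter> space (M i))"
   by (auto simp: space_PiM PiE_iff)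
  then have "emeasure (distr (PiM I M) (PiM I N) (%x. \<lambda>i\<in>I. f i (x i))) (Pi\<^sub>E I A)
   = emeasure (PiM I M) (Pi\<^sub>E I (%i. f i -` A i \<inter> space (M i)))" by (subst emeasure_distr) (auto intro!: sets_PiM_I_finite I)
  also have "... = (\<Prod>i\<in>I. emeasure (M i) (f i -` A i \<inter> space (M i)))" unfolding PiM_extend[of I M, symmetric]
   by (subst Q.emeasure_PiM[OF I]) (auto intro!: prod.cong measurable_sets[OF f])
  also have "... = (\<Prod>i\<in>I. emeasure (if i : I then ?D i else return (count_space UNIV) undefined) (A i))"
   by (intro prod.cong) (auto simp: emeasure_distr)
  finally show "emeasure (distr (PiM I M) (PiM I N) (%x. \<lambda>i\<in>I. f i (x i))) (Pi\<^sub>E I A) = ..." .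
 qed
 then show ?thesis by (simp add: PiM_extend)
qed

subsection \<open>Convergence in probability\<close>

text \<open>Exceptional sets are measurable supersets, so that no measurability of the event is required.\<close>
definition whp :: "(nat => 'a measure) => (nat => 'a => bool) => bool" where
 "whp P \<Phi> \<longleftrightarrow> (\<forall>e>0. \<forall>\<^sub>F K in sequentially. \<exists>B\<in>sets (P K). measure (P K) B < e \<and>
  (\<forall>om\<in>space (P K) - B. \<Phi> K om))"

text \<open>"Tends in probability" to a constant. The spaces \<open>P K\<close> vary with
  \<open>K\<close>, so there is no common space on which the \<open>X K\<close> live.\<close>

definition tip :: "(nat => 'a measure) => (nat => 'a => 'b::metric_space) => 'b => bool" where
 "tip P X l \<longleftrightarrow> (\<forall>d>0. whp P (%K om. dist (X K om) l < d))"

lemma whp_mono: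
 assumes "whp P \<Phi>" and "\<forall>\<^sub>F K in sequentially. \<forall>om\<in>space (P K). \<Phi> K om --> \<Psi> K om"
 shows "whp P \<Psi>" unfolding whp_def
proof (intro allI impI)
 fix e :: real assume "e > 0"
 then have "\<forall>\<^sub>F K in sequentially. \<exists>B\<in>sets (P K). measure (P K) B < e & (\<forall>om\<in>space (P K) - B. \<Phi> K om)"
  using assms(1) by (simp add: whp_def)
 with assms(2) show "\<forall>\<^sub>F K in sequentially. \<exists>B\<in>sets (P K). measure (P K) B < e & (\<forall>om\<in>space (P K) - B. \<Psi> K om)"
  by eventually_elim blast
qed

lemma whp_imp: "whp P \<Phi> ==> (\<And>K om. om : space (P K) ==> \<Phi> K om ==> \<Psi> K om) ==> whp P \<Psi>"
 by (erule whp_mono) (simp add: always_eventually)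

lemma whpD:
 "whp P \<Phi> ==> e > 0 ==> \<forall>\<^sub>F K in sequentially. \<exists>B\<in>sets (P K). measure (P K) B < e \<and>
  (\<forall>om\<in>space (P K) - B. \<Phi> K om)" by (simp add: whp_def)

lemma tipD: "tip P X l ==> d > 0 ==> whp P (%K om. dist (X K om) l < d)" by (simp add: tip_def)

lemma whp_all:
 assumes "\<forall>\<^sub>F K in sequentially. \<forall>om\<in>space (P K). \<Phi> K om"
 shows "whp P \<Phi>" unfolding whp_def
proof (intro allI impI)
 fix e :: real assume "e > 0"
 show "\<forall>\<^sub>F K in sequentially. \<exists>B\<in>sets (P K). measure (P K) B < e & (\<forall>om\<in>space (P K) - B. \<Phi> K om)"
  using assms by eventually_elim (rule bexI[of _ "{}"], use \<open>e > 0\<close> in auto)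
qed

lemma whp_AE:
 assumes "\<forall>\<^sub>F K in sequentially. AE om in P K. \<Phi> K om"
 shows "whp P \<Phi>" unfolding whp_def
proof (intro allI impI)
 fix e :: real assume e: "e > 0"
 show "\<forall>\<^sub>F K in sequentially. \<exists>B\<in>sets (P K). measure (P K) B < e & (\<forall>om\<in>space (P K) - B. \<Phi> K om)"
  using assms
 proof eventually_elim
  case (elim K)
  then obtain N where "{om\<in>space (P K). \<not> \<Phi> K om} \<subseteq> N" "emeasure (P K) N = 0" "N : sets (P K)" by (rule AE_E)
  then show ?case using e by (intro bexI[of _ N]) (auto simp: measure_def)
 qed
qed

lemma whp_conj:
 assumes P: "\<And>K. prob_space (P K)" and 1: "whp P \<Phi>" and 2: "whp P \<Psi>"
 shows "whp P (%K om. \<Phi> K om & \<Psi> K om)" unfolding whp_def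
proof (intro allI impI)
 fix e :: real assume e: "e > 0"
 then have "e / 2 > 0" by simp
 then have "\<forall>\<^sub>F K in sequentially. \<exists>B\<in>sets (P K). measure (P K) B < e / 2 & (\<forall>om\<in>space (P K) - B. \<Phi> K om)"
  and "\<forall>\<^sub>F K in sequentially. \<exists>B\<in>sets (P K). measure (P K) B < e / 2 & (\<forall>om\<in>space (P K) - B. \<Psi> K om)"
  using whpD[OF 1] whpD[OF 2] by blast+
 then show "\<forall>\<^sub>F K in sequentially. \<exists>B\<in>sets (P K). measure (P K) B < e & (\<forall>om\<in>space (P K) - B. \<Phi> K om & \<Psi> K om)"
 proof eventually_elim
  case (elim K)
  interpret prob_space "P K" by (rule P)
  from elim obtain A B where AB: "A : events" "B : events" "prob A < e / 2" "prob B < e / 2"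
   "\<forall>om\<in>space (P K) - A. \<Phi> K om" "\<forall>om\<in>space (P K) - B. \<Psi> K om" by blast
  then have "prob (A \<union> B) < e" using measure_Un_le[of A "P K" B] by linarith
  then show ?case using AB by (intro bexI[of _ "A \<union> B"]) auto
 qed
qed

lemma tip_const: "x \<longlonglongrightarrow> l ==> tip P (%K om. x K) l"
 unfolding tip_def by (auto intro!: whp_all elim!: eventually_mono dest!: tendstoD)

lemma tip_cong:
 assumes P: "\<And>K. prob_space (P K)" and "tip P X l" and "whp P (%K om. Y K om = X K om)"
 shows "tip P Y l" unfolding tip_def
proof (intro allI impI)
 fix d :: real assume "d > 0"
 then have "whp P (%K om. dist (X K om) l < d)" using assms by (simp add: tip_def)
 from whp_conj[OF P this assms(3)] show "whp P (%K om. dist (Y K om) l < d)" by (rule whp_mono) auto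
qed

lemma tip_Pair:
 assumes P: "\<And>K. prob_space (P K)" and X: "tip P X l" and Y: "tip P Y m"
 shows "tip P (%K om. (X K om, Y K om)) (l, m)" unfolding tip_def
proof (intro allI impI)
 fix d :: real assume "d > 0"
 then have "d / 2 > 0" by simp
 then have "whp P (%K om. dist (X K om) l < d / 2)" "whp P (%K om. dist (Y K om) m < d / 2)"
  using X Y unfolding tip_def by blast+
 from whp_conj[OF P this] show "whp P (%K om. dist (X K om, Y K om) (l, m) < d)"
 proof (rule whp_mono, intro always_eventually allI ballI impI)
  fix K om assume "dist (X K om) l < d / 2 & dist (Y K om) m < d / 2"
  then show "dist (X K om, Y K om) (l, m) < d" using sqrt_sum_squares_le_sum[of "dist (X K om) l" "dist (Y K om) m"]
   by (simp add: dist_Pair_Pair)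
 qed
qed

lemma tip_continuous:
 assumes X: "tip P X l" and f: "isCont f l"
 shows "tip P (%K om. f (X K om)) (f l)" unfolding tip_def
proof (intro allI impI)
 fix d :: real assume "d > 0"
 with f obtain e where e: "e > 0" "\<And>x. dist x l < e ==> dist (f x) (f l) < d" unfolding continuous_at_eps_delta by blast
 then have "whp P (%K om. dist (X K om) l < e)" using X by (simp add: tip_def)
 then show "whp P (%K om. dist (f (X K om)) (f l) < d)" by (rule whp_imp) (auto intro: e)
qed

lemma tip_continuous2:
 assumes P: "\<And>K. prob_space (P K)" and X: "tip P X l" and Y: "tip P Y m"
  and f: "isCont (%(x, y). f x y) (l, m)"
 shows "tip P (%K om. f (X K om) (Y K om)) (f l m)" using tip_continuous[OF tip_Pair[OF P X Y] f] by simp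

lemma tip_mult:
 fixes l m :: real
 assumes "\<And>K. prob_space (P K)" "tip P X l" "tip P Y m"
 shows "tip P (%K om. X K om * Y K om) (l * m)"
 by (rule tip_continuous2[OF assms]) (auto simp: case_prod_unfold intro!: continuous_intros)

lemma tip_diff:
 fixes l m :: real
 assumes "\<And>K. prob_space (P K)" "tip P X l" "tip P Y m"
 shows "tip P (%K om. X K om - Y K om) (l - m)"
 by (rule tip_continuous2[OF assms]) (auto simp: case_prod_unfold intro!: continuous_intros)

lemma tip_divide:
 fixes l m :: real
 assumes "\<And>K. prob_space (P K)" "tip P X l" "tip P Y m" "m ~= 0"
 shows "tip P (%K om. X K om / Y K om) (l / m)"
 using assms(4) by (intro tip_continuous2[OF assms(1-3)]) (auto simp: case_prod_unfold intro!: continuous_intros)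

lemma tip_less:
 fixes l :: real
 assumes "tip P X l" "l < u"
 shows "whp P (%K om. X K om < u)"
proof -
 have "whp P (%K om. dist (X K om) l < u - l)" using assms by (simp add: tip_def)
 then show ?thesis by (rule whp_imp) (auto simp: dist_real_def)
qed

text \<open>Bounded convergence along varying spaces. Off a set of measure less than
  \<open>d\<close> the integrand is within \<open>e / 2\<close> of \<open>l\<close>; on that set it
  deviates by at most \<open>abs B + abs l\<close>, and \<open>d\<close> is chosen to make this
  contribution smaller than \<open>e / 2\<close>.\<close>

lemma tip_integral:
 fixes X :: "nat => 'a => real"
 assumes P: "\<And>K. prob_space (P K)" and X: "tip P X l"
  and m: "\<And>K. X K : bm (P K)" and b: "\<And>K om. om : space (P K) ==> (abs (X K om)) <= B"
 shows "(%K. LINT om|P K. X K om) \<longlonglongrightarrow> l"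
proof (rule tendstoI)
 fix e :: real assume e: "e > 0"
 define d where "d = e / (2 * (1 + abs B + abs l))"
 have d: "d > 0" using e by (simp add: d_def add_pos_nonneg)
 have "whp P (%K om. dist (X K om) l < e / 2)" using e by (intro tipD[OF X]) simp
 then have "\<forall>\<^sub>F K in sequentially. \<exists>A\<in>sets (P K). measure (P K) A < d & (\<forall>om\<in>space (P K) - A. dist (X K om) l < e / 2)"
  using d by (simp add: whp_def)
 then show "\<forall>\<^sub>F K in sequentially. dist (LINT om|P K. X K om) l < e"
 proof eventually_elim
  case (elim K)
  interpret prob_space "P K" by (rule P)
  note [measurable] = m
  from elim obtain A where A[measurable]: "A : events" and Ad: "prob A < d"
   and AX: "\<And>om. om : space (P K) - A ==> dist (X K om) l < e / 2" by blast
  have iX: "integrable (P K) (X K)" by (rule integrable_const_bound[of _ B]) (auto simp: b)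
  have "dist (LINT om|P K. X K om) l = abs (LINT om|P K. X K om - l)" using iX by (simp add: dist_real_def prob_space)
  also have "... <= (LINT om|P K. abs (X K om - l))" by simp
  also have "... <= (LINT om|P K. e / 2 + (abs B + abs l) * indicator A om)"
  proof (rule integral_mono)
   fix om assume w: "om : space (P K)"
   show "abs (X K om - l) <= e / 2 + (abs B + abs l) * indicator A om"
    using b[OF w] AX[of om] w e by (auto simp: dist_real_def split: split_indicator)
  qed (use iX in \<open>auto simp: less_top[symmetric]\<close>)
  also have "... = e / 2 + (abs B + abs l) * prob A" by (subst Bochner_Integration.integral_add) (auto simp: prob_space less_top[symmetric])
  also have "... < e"
  proof -
   have "(abs B + abs l) * prob A <= (abs B + abs l) * d" using Ad by (intro mult_left_mono) auto
   also have "... < (1 + abs B + abs l) * d" using d by (simp add: algebra_simps)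
   also have "... = e / 2" by (simp add: d_def field_simps add_pos_nonneg)
   finally show ?thesis by simp
  qed
  finally show ?case .
 qed
qed

lemma tip_zero_if_integral:
 fixes X :: "nat => 'a => real"
 assumes P: "\<And>K. prob_space (P K)"
  and m: "\<And>K. integrable (P K) (X K)" and b: "\<And>K om. om : space (P K) ==> 0 <= X K om"
  and lim: "(%K. LINT om|P K. X K om) \<longlonglongrightarrow> 0"
 shows "tip P X 0" unfolding tip_def whp_def
proof (intro allI impI)
 fix d e :: real assume de: "d > 0" "e > 0"
 then have "\<forall>\<^sub>F K in sequentially. (LINT om|P K. X K om) < d * e" by (intro order_tendstoD(2)[OF lim]) simp
 then show "\<forall>\<^sub>F K in sequentially. \<exists>B\<in>sets (P K). measure (P K) B < e & (\<forall>om\<in>space (P K) - B. dist (X K om) 0 < d)"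
 proof eventually_elim
  case (elim K)
  interpret prob_space "P K" by (rule P)
  have [measurable]: "X K : bm (P K)" using m by auto
  have "prob {om\<in>space (P K). d <= X K om} <= (LINT om|P K. X K om) / d"
   using de b by (intro integral_Markov_inequality_measure[OF m, of "space (P K)"]) auto
  also have "... < e" using elim de by (simp add: field_simps)
  finally show ?case by (intro bexI[of _ "{om\<in>space (P K). d <= X K om}"]) (auto simp: b)
 qed
qed

lemma tip_min_oneD:
 assumes "tip P (%K om. min 1 (dist (X K om) l)) 0"
 shows "tip P X l" unfolding tip_def
proof (intro allI impI)
 fix d :: real assume "d > 0"
 then have "whp P (%K om. dist (min 1 (dist (X K om) l)) 0 < min d 1)" using \<open>d > 0\<close> by (intro tipD[OF assms]) simp
 then show "whp P (%K om. dist (X K om) l < d)" by (rule whp_imp) (auto simp: min_def split: if_splits)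
qed

text \<open>The truncated distance is bounded, so convergence in probability of its conditional mean
  passes to its total mean by \<open>tip_integral\<close>, and Markov's inequality turns the total
  mean back into convergence in probability.\<close>

lemma tip_bind:
 fixes X :: "nat => 'b => real"
 assumes P: "\<And>K. prob_space (P K)" and kp: "\<And>K. kp K : P K \<rightarrow>\<^sub>M prob_algebra (N K)"
  and X[measurable]: "\<And>K. X K : bm (N K)"
  and lim: "tip P (%K om. LINT y|kp K om. min 1 (abs (X K y - l))) 0"
 shows "tip (%K. P K \<bind> kp K) X l"
proof -
 note [measurable] = kp measurable_prob_algebraD[OF kp]
 have PP: "P K : space (prob_algebra (P K))" for K by (simp add: space_prob_algebra P)
 have PB: "prob_space (P K \<bind> kp K)" for K by (rule prob_space_bind'[OF PP kp])
 have sb: "sets (P K \<bind> kp K) = sets (N K)" for K by (rule sets_bind'[OF PP kp])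
 have mX: "X K : bm (P K \<bind> kp K)" for K using X by (simp add: mcs[OF sb refl])
 have i: "integrable M (%y. min 1 (abs (X K y - l)))" if "prob_space M" "X K : bm M" for K M
  using that(2) by (intro finite_measure.integrable_const_bound[of _ _ 1] prob_space.finite_measure that) auto
 have pk: "prob_space (kp K om)" "sets (kp K om) = sets (N K)" if "om : space (P K)" for K om
  using measurable_space[OF kp that] by (auto simp: space_prob_algebra)
 have "(%K. LINT om|P K. LINT y|kp K om. min 1 (abs (X K y - l))) \<longlonglongrightarrow> 0"
 proof (rule tip_integral[OF P lim, of 1])
  show "(%om. LINT y|kp K om. min 1 (abs (X K y - l))) : bm (P K)" for K by measurable
  show "\<bar>\<integral>y. min 1 \<bar>X K y - l\<bar> \<partial>kp K om\<bar> <= 1" if w: "om : space (P K)" for K om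
  proof -
   interpret prob_space "kp K om" by (rule pk[OF w])
   have "X K : bm (kp K om)" using X by (simp add: mcs[OF pk(2)[OF w] refl])
   from i[OF pk(1)[OF w] this] have "(LINT y|kp K om. min 1 (abs (X K y - l))) <= (LINT y|kp K om. 1)"
    by (intro integral_mono) auto
   then show ?thesis by (simp add: prob_space)
  qed
 qed
 then have "(%K. LINT y|(P K \<bind> kp K). min 1 (dist (X K y) l)) \<longlonglongrightarrow> 0" unfolding dist_real_def
  by (subst integral_bind[OF kp prob_space.not_empty[OF P] i[OF PB mX]])
 then show ?thesis by (rule tip_min_oneD[OF tip_zero_if_integral[OF PB, rotated 2]])
   (simp_all add: dist_real_def i[OF PB mX])
qed

subsection \<open>Sums of independent terms\<close>

lemma
 fixes f :: "'b => real"
 assumes "\<And>i. i : I ==> prob_space (M i)" and i: "i : I" and f: "f : bm (M i)"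
 shows integral_PiM_component: "(LINT x|PiM I M. f (x i)) = (LINT x|M i. f x)"
  and integrable_PiM_component: "integrable (PiM I M) (%x. f (x i)) \<longleftrightarrow> integrable (M i) f"
 using integral_distr[of "%x. x i" "PiM I M" "M i" f] integrable_distr_eq[of "%x. x i" "PiM I M" "M i" f]
  distr_PiM_component[of I M i] assms by (auto simp: measurable_component_singleton)

lemma nn_integral_PiM_component:
 assumes "\<And>i. i : I ==> prob_space (M i)" and i: "i : I" and f: "f : bm (M i)"
 shows "(\<integral>\<^sup>+x. f (x i) \<partial>PiM I M) = (\<integral>\<^sup>+x. f x \<partial>M i)"
 using nn_integral_distr[of "%x. x i" "PiM I M" "M i" f]
  distr_PiM_component[of I M i] assms by (auto simp: measurable_component_singleton)

lemma integral_PiM_two_components: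
 fixes f g :: "'b => real"
 assumes I: "finite I" and M: "\<And>i. i : I ==> prob_space (M i)" and ij: "i : I" "j : I" "i ~= j"
  and f: "integrable (M i) f" and g: "integrable (M j) g"
 shows "(LINT x|PiM I M. f (x i) * g (x j)) = (LINT x|M i. f x) * (LINT x|M j. g x)"
proof -
 interpret P: product_prob_space "%i. if i : I then M i else return (count_space UNIV) undefined" by (intro product_prob_space_extend M)
 \<comment> \<open>The product formula wants one factor per index; all indices other than
   \<open>i\<close> and \<open>j\<close> get the constant 1.\<close>
 define F where "F k = (if k = i then f else if k = j then g else (%_. 1))" for k
 have iF: "integrable (if k : I then M k else return (count_space UNIV) undefined) (F k)" if "k : I" for k
  using that f g finite_measure.integrable_const[OF prob_space.finite_measure[OF M[OF that]]] by (auto simp: F_def)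
 have prod: "(\<Prod>k\<in>I. H k) = H i * H j" if "\<And>k. k : I ==> k ~= i ==> k ~= j ==> H k = 1" for H :: "_ => real"
 proof -
  have "(\<Prod>k\<in>I. H k) = (\<Prod>k\<in>{i, j}. H k)" using that ij I by (intro prod.mono_neutral_right) auto
  then show ?thesis using ij by simp
 qed
 have "(LINT x|PiM I M. (\<Prod>k\<in>I. F k (x k)))
  = (\<Prod>k\<in>I. integral\<^sup>L (if k : I then M k else return (count_space UNIV) undefined) (F k))"
  unfolding PiM_extend[of I M, symmetric] by (rule P.product_integral_prod[OF I iF])
 then show ?thesis using ij prob_space.prob_space[OF M] by (subst (asm) (1 2) prod) (auto simp: F_def)
qed

text \<open>The centred terms are pairwise orthogonal, and centring does not increase a second
  moment. The bound keeps the uncentred moments, which are easier to control later.\<close>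

lemma
 fixes xi :: "'i => 'b => real"
 assumes I: "finite I" and M: "\<And>i. i : I ==> prob_space (M i)"
  and m[measurable]: "\<And>i. i : I ==> xi i : bm (M i)"
  and sq: "\<And>i. i : I ==> integrable (M i) (%x. (xi i x)\<^sup>2)"
 shows integrable_indep_sum_sq:
   "integrable (PiM I M) (%x. ((\<Sum>i\<in>I. xi i (x i)) - (\<Sum>i\<in>I. LINT y|M i. xi i y))\<^sup>2)" (is ?A)
  and integral_indep_sum_sq_le:
   "(LINT x|PiM I M. ((\<Sum>i\<in>I. xi i (x i)) - (\<Sum>i\<in>I. LINT y|M i. xi i y))\<^sup>2)
    <= (\<Sum>i\<in>I. LINT y|M i. (xi i y)\<^sup>2)" (is ?B)
proof -
 define b where "b i = (LINT y|M i. xi i y)" for i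
 define \<zeta> where "\<zeta> i y = xi i y - b i" for i y
 have i1: "integrable (M i) (xi i)" if "i : I" for i
  using finite_measure.square_integrable_imp_integrable[OF prob_space.finite_measure[OF M[OF that]] m[OF that] sq[OF that]] .
 note fin = finite_measure.integrable_const[OF prob_space.finite_measure[OF M]]
 have z2e: "(\<zeta> i y)^2 = (xi i y)^2 - 2 * b i * xi i y + (b i)^2" for i y by (simp add: \<zeta>_def power2_eq_square algebra_simps)
 have z1: "integrable (M i) (\<zeta> i)" "(LINT y|M i. \<zeta> i y) = 0"
  and z2: "integrable (M i) (%y. (\<zeta> i y)\<^sup>2)" "(LINT y|M i. (\<zeta> i y)\<^sup>2) <= (LINT y|M i. (xi i y)\<^sup>2)" if i: "i : I" for i
 proof -
  interpret prob_space "M i" by (rule M[OF i])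
  show "integrable (M i) (\<zeta> i)" "(LINT y|M i. \<zeta> i y) = 0" using i1[OF i] by (auto simp: \<zeta>_def[abs_def] prob_space b_def)
  show "integrable (M i) (%y. (\<zeta> i y)\<^sup>2)" unfolding z2e using i1[OF i] sq[OF i] by auto
  have "(LINT y|M i. (\<zeta> i y)\<^sup>2) = (LINT y|M i. (xi i y)\<^sup>2) - 2 * b i * b i + (b i)^2"
   unfolding z2e using i1[OF i] sq[OF i] by (simp add: prob_space b_def)
  also have "... <= (LINT y|M i. (xi i y)\<^sup>2)" by (simp add: power2_eq_square)
  finally show "(LINT y|M i. (\<zeta> i y)\<^sup>2) <= (LINT y|M i. (xi i y)\<^sup>2)" .
 qed
 have mz[measurable]: "\<zeta> i : bm (M i)" if "i : I" for i using z1(1)[OF that] by auto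
 have c2: "integrable (PiM I M) (%x. (\<zeta> i (x i))\<^sup>2)" if "i : I" for i
  using z2(1)[OF that] that by (subst integrable_PiM_component[OF M that, where f="%y. (\<zeta> i y)\<^sup>2"]) auto
 have cc: "integrable (PiM I M) (%x. \<zeta> i (x i) * \<zeta> j (x j))" if ij: "i : I" "j : I" for i j
 proof (rule Bochner_Integration.integrable_bound)
  show "integrable (PiM I M) (%x. (\<zeta> i (x i))\<^sup>2 + (\<zeta> j (x j))^2)" using c2 ij by auto
  have "abs (u * v) <= u\<^sup>2 + v\<^sup>2" for u v :: real
  proof -
   have "2 * (abs u * abs v) <= \<bar>u\<bar>\<^sup>2 + \<bar>v\<bar>\<^sup>2" using sum_squares_bound[of "abs u" "abs v"] by simp
   moreover have "0 <= abs u * abs v" by simp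
   ultimately show ?thesis unfolding abs_mult by (simp only: power2_abs) 
  qed
  then show "AE x in PiM I M. norm (\<zeta> i (x i) * \<zeta> j (x j)) <= norm ((\<zeta> i (x i))^2 + (\<zeta> j (x j))^2)"
   by (intro AE_I2) (simp add: abs_of_nonneg)
 qed (use ij in measurable)
 have eq: "((\<Sum>i\<in>I. xi i (x i)) - (\<Sum>i\<in>I. LINT y|M i. xi i y))^2 = (\<Sum>i\<in>I. \<Sum>j\<in>I. \<zeta> i (x i) * \<zeta> j (x j))" for x
  by (simp add: \<zeta>_def b_def power2_eq_square sum_product flip: sum_subtractf)
 show ?A unfolding eq using cc by auto
 have "(LINT x|PiM I M. (\<Sum>i\<in>I. \<Sum>j\<in>I. \<zeta> i (x i) * \<zeta> j (x j)))
  = (\<Sum>i\<in>I. \<Sum>j\<in>I. LINT x|PiM I M. \<zeta> i (x i) * \<zeta> j (x j))" using cc by (simp add: Bochner_Integration.integral_sum)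
 also have "... = (\<Sum>i\<in>I. \<Sum>j\<in>I. if j = i then \<integral>y. (\<zeta> i y)\<^sup>2 \<partial>M i else 0)"
 proof (intro sum.cong refl)
  fix i j assume ij: "i : I" "j : I"
  show "(LINT x|PiM I M. \<zeta> i (x i) * \<zeta> j (x j)) = (if j = i then \<integral>y. (\<zeta> i y)\<^sup>2 \<partial>M i else 0)"
  proof (cases "i = j")
   case True
   then show ?thesis using integral_PiM_component[OF M ij(1), where f="%y. (\<zeta> i y)\<^sup>2"] mz[OF ij(1)] by (simp add: power2_eq_square)
  next
   case False
   then show ?thesis using integral_PiM_two_components[OF I M ij False z1(1) z1(1)] z1(2) ij by auto
  qed
 qed
 also have "... <= (\<Sum>i\<in>I. LINT y|M i. (xi i y)\<^sup>2)" using z2(2) I by (simp add: sum.delta sum_mono)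
 finally show ?B unfolding eq .
qed

text \<open>Truncation at level \<open>C\<close> makes the bound usable under a first moment condition only.\<close>
lemma indep_average_deviation:
 fixes xi :: "'b => real" and rho :: "nat => 'b measure"
 assumes K: "K >= 1" and M: "\<And>k. k : {1..K} ==> prob_space (rho k)"
  and m[measurable]: "\<And>k. k : {1..K} ==> xi : bm (rho k)"
  and int: "\<And>k. k : {1..K} ==> integrable (rho k) xi" and C: "C > 0"
 shows "(LINT x|PiM {1..K} rho. \<bar>(\<Sum>k=1..K. xi (x k)) / K - (\<Sum>k=1..K. LINT y|rho k. xi y) / K\<bar>)
  <= C / sqrt K + 2 * ((\<Sum>k=1..K. LINT y|rho k. \<bar>xi y\<bar> * indicator {C<..} \<bar>xi y\<bar>) / K)"
proof -
 let ?I = "{1..K}"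
 interpret P: prob_space "PiM ?I rho" by (rule prob_space_PiM[OF M])
 define lo where "lo y = xi y * indicator {..C} (abs (xi y))" for y
 define hi where "hi y = xi y * indicator {C<..} (abs (xi y))" for y
 have lohi: "xi y = lo y + hi y" for y by (auto simp: lo_def hi_def split: split_indicator)
 have mlo[measurable]: "lo : bm (rho k)" and mhi[measurable]: "hi : bm (rho k)" if "k : ?I" for k
  using m[OF that] unfolding lo_def hi_def by measurable
 have lob: "abs (lo y) <= C" for y using C by (auto simp: lo_def split: split_indicator)
 have lo2: "(lo y)^2 <= C\<^sup>2" for y using power_mono[OF lob[of y], of 2] by simp
 have ihi: "integrable (rho k) hi" and ilo: "integrable (rho k) lo" and ilo2: "integrable (rho k) (%y. (lo y)\<^sup>2)" if k: "k : ?I" for k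
 proof -
  interpret prob_space "rho k" by (rule M[OF k])
  note [measurable] = mlo[OF k]
  show "integrable (rho k) lo" by (rule integrable_const_bound[of _ C]) (auto simp: lob)
  then show "integrable (rho k) hi" using int[OF k] lohi by (simp add: hi_def[abs_def] Bochner_Integration.integrable_diff
   flip: add_diff_cancel_left')
    (metis (no_types, lifting) Bochner_Integration.integrable_cong Bochner_Integration.integrable_diff add_diff_cancel_left' hi_def lohi)
  show "integrable (rho k) (%y. (lo y)\<^sup>2)" by (rule integrable_const_bound[of _ "C\<^sup>2"]) (auto simp: lo2)
 qed
 define A where "A x = (\<Sum>k\<in>?I. lo (x k)) - (\<Sum>k\<in>?I. LINT y|rho k. lo y)" for x
 have A2: "integrable (PiM ?I rho) (%x. (A x)\<^sup>2)" "(LINT x|PiM ?I rho. (A x)\<^sup>2) <= K * C\<^sup>2"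
 proof -
  show "integrable (PiM ?I rho) (%x. (A x)\<^sup>2)" unfolding A_def by (rule integrable_indep_sum_sq[OF _ M]) (auto intro: mlo ilo2)
  have "(LINT x|PiM ?I rho. (A x)\<^sup>2) <= (\<Sum>k\<in>?I. LINT y|rho k. (lo y)\<^sup>2)" unfolding A_def
   by (rule integral_indep_sum_sq_le[OF _ M]) (auto intro: mlo ilo2)
  also have "... <= (\<Sum>k\<in>?I. C\<^sup>2)"
  proof (rule sum_mono)
   fix k assume k: "k : ?I"
   interpret prob_space "rho k" by (rule M[OF k])
   show "(LINT y|rho k. (lo y)\<^sup>2) <= C\<^sup>2"
    using integral_mono[OF ilo2[OF k] integrable_const, of "C\<^sup>2"] lo2 by (simp add: prob_space)
  qed
  finally show "(LINT x|PiM ?I rho. (A x)\<^sup>2) <= K * C\<^sup>2" by simp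
 qed
 have mA[measurable]: "A : bm (PiM ?I rho)" unfolding A_def by measurable
 have iA: "integrable (PiM ?I rho) A" by (rule P.square_integrable_imp_integrable[OF mA A2(1)])
 \<comment> \<open>Nonnegativity of the variance of \<open>abs (A x)\<close> serves as the
   Cauchy-Schwarz inequality.\<close>
 have "(LINT x|PiM ?I rho. abs (A x))^2 <= (LINT x|PiM ?I rho. (A x)\<^sup>2)"
 proof -
  have "0 <= P.variance (%x. abs (A x))" by (rule P.variance_positive)
  also have "... = (LINT x|PiM ?I rho. \<bar>A x\<bar>\<^sup>2) - (LINT x|PiM ?I rho. abs (A x))\<^sup>2"
   using A2 iA by (intro P.variance_eq) auto
  finally show ?thesis by simp
 qed
 then have "(LINT x|PiM ?I rho. abs (A x)) <= sqrt (K * C\<^sup>2)" using A2 by (intro real_le_rsqrt) simp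
 also have "... = sqrt K * C" using C by (simp add: real_sqrt_mult)
 finally have EA: "(LINT x|PiM ?I rho. abs (A x)) <= sqrt K * C" .
 define B where "B x = (\<Sum>k\<in>?I. abs (hi (x k)))" for x
 define b where "b = (\<Sum>k\<in>?I. LINT y|rho k. abs (hi y))"
 have iB: "integrable (PiM ?I rho) B" and EB: "(LINT x|PiM ?I rho. B x) = b"
 proof -
  have c: "integrable (PiM ?I rho) (%x. abs (hi (x k)))"
   "(LINT x|PiM ?I rho. abs (hi (x k))) = (LINT y|rho k. abs (hi y))" if k: "k : ?I" for k
  proof -
   have [measurable]: "(%y. abs (hi y)) : bm (rho k)" using mhi[OF k] by measurable
   show "integrable (PiM ?I rho) (%x. abs (hi (x k)))" using ihi[OF k] k by (subst integrable_PiM_component[OF M, where f="%y. abs (hi y)"]) auto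
   show "(LINT x|PiM ?I rho. abs (hi (x k))) = (LINT y|rho k. abs (hi y))"
    using k by (subst integral_PiM_component[OF M, where f="%y. abs (hi y)"]) auto
  qed
  show "integrable (PiM ?I rho) B" unfolding B_def using c(1) by (rule Bochner_Integration.integrable_sum)
  show "(LINT x|PiM ?I rho. B x) = b" unfolding B_def b_def using c by (simp add: Bochner_Integration.integral_sum)
 qed
 \<comment> \<open>The large parts enter twice, once in the average and once in its mean, and each
   time cost at most \<open>b / K\<close> in expectation; hence the factor 2 of the
   conclusion.\<close>
 have "(LINT x|PiM ?I rho. \<bar>(\<Sum>k\<in>?I. xi (x k)) / K - (\<Sum>k\<in>?I. LINT y|rho k. xi y) / K\<bar>)
  <= (LINT x|PiM ?I rho. (\<bar>A x\<bar> + B x + b) / K)"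
 proof (rule integral_mono')
  fix x
  have "(\<Sum>k\<in>?I. LINT y|rho k. xi y) = (\<Sum>k\<in>?I. LINT y|rho k. lo y) + (\<Sum>k\<in>?I. LINT y|rho k. hi y)"
   using ihi ilo by (simp add: lohi[abs_def] flip: sum.distrib)
  moreover have "abs (\<Sum>k\<in>?I. LINT y|rho k. hi y) <= b"
   unfolding b_def by (rule order_trans[OF sum_abs]) (intro sum_mono integral_abs_bound)
  moreover have "abs (\<Sum>k\<in>?I. hi (x k)) <= B x" unfolding B_def by (rule sum_abs)
  moreover have "(\<Sum>k\<in>?I. xi (x k)) = (\<Sum>k\<in>?I. lo (x k)) + (\<Sum>k\<in>?I. hi (x k))" by (simp add: lohi flip: sum.distrib)
  ultimately have "abs ((\<Sum>k\<in>?I. xi (x k)) - (\<Sum>k\<in>?I. LINT y|rho k. xi y)) <= abs (A x) + B x + b"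
   unfolding A_def by linarith
  then show "abs ((\<Sum>k\<in>?I. xi (x k)) / K - (\<Sum>k\<in>?I. LINT y|rho k. xi y) / K) <= (abs (A x) + B x + b) / K"
   by (simp add: divide_right_mono flip: diff_divide_distrib)
  have "0 <= B x" "0 <= b" by (auto simp: B_def b_def intro!: sum_nonneg)
  then show "0 <= (abs (A x) + B x + b) / K" by simp
 qed (use iA iB in auto)
 also have "... = ((LINT x|PiM ?I rho. abs (A x)) + 2 * b) / K" using iA iB by (simp add: EB P.prob_space)
 also have "... <= (sqrt K * C + 2 * b) / K" using EA by (simp add: divide_right_mono)
 also have "... = C / sqrt K + 2 * (b / K)"
 proof -
  have "sqrt K * C * sqrt K = C * (sqrt K * sqrt K)" by (simp only: mult_ac)
  then have "sqrt K * C / K = C / sqrt K" using K by (subst frac_eq_eq) auto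
  then show ?thesis by (simp add: add_divide_distrib)
 qed
 also have "b = (\<Sum>k\<in>?I. LINT y|rho k. abs (xi y) * indicator {C<..} (abs (xi y)))" by (simp add: b_def hi_def abs_mult)
 finally show ?thesis .
qed


section \<open>Characteristic functions of sums of independent terms\<close>

lemma exp_minus_approx:
 fixes x :: real
 assumes "0 <= x"
 shows "abs (exp (- x) - (1 - x)) <= x\<^sup>2 / 2"
proof -
 define f where "f y = 1 - y + y\<^sup>2 / 2 - exp (- y)" for y :: real
 have "f 0 <= f x"
 proof (rule DERIV_nonneg_imp_nondecreasing[OF assms])
  fix y :: real assume "0 <= y" "y <= x"
  have "(f has_real_derivative (- 1 + y + exp (- y))) (at y)" unfolding f_def by (auto intro!: derivative_eq_intros)
  moreover have "0 <= - 1 + y + exp (- y)" using exp_ge_add_one_self[of "- y"] by simp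
  ultimately show "\<exists>d. (f has_real_derivative d) (at y) & 0 <= d" by blast
 qed
 moreover have "1 - x <= exp (- x)" using exp_ge_add_one_self[of "- x"] by simp
 ultimately show ?thesis by (simp add: f_def)
qed

lemma cmod_iexp [simp]: "cmod (iexp x) = 1" by simp

text \<open>Both the characteristic function of \<open>X - b\<close> and the Gaussian one are
  compared with the polynomial \<open>1 - t^2 * v / 2\<close>. The difficulty is that the tail
  \<open>L\<close> cuts at \<open>X\<close> whereas the expansion concerns the centred variable: if
  \<open>X - b\<close> exceeds \<open>4 * C\<close> in absolute value, then \<open>X\<close> exceeds
  \<open>C\<close> or \<open>b\<close> exceeds \<open>2 * C\<close>. In the Gaussian part one factor
  \<open>v\<close> is replaced by \<open>C^2 + L\<close>.\<close>

lemma char_truncated_bound: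
 fixes X :: "'b => real"
 assumes M: "prob_space M" and m[measurable]: "X : bm M" and sq: "integrable M (%x. (X x)\<^sup>2)" and C: "C > 0"
 defines "b \<equiv> \<integral>x. X x \<partial>M" and "L \<equiv> \<integral>x. (X x)\<^sup>2 * indicator {C<..} (abs (X x)) \<partial>M"
 defines "v \<equiv> (LINT x|M. (X x)\<^sup>2) - b\<^sup>2"
 shows "cmod ((CLINT x|M. iexp (t * (X x - b))) - exp (- (t\<^sup>2 * v / 2)))
   <= 10 * t\<^sup>2 * L + \<bar>t\<bar>^3 * C * v + t^4 * v * (C\<^sup>2 + L)"
  and "0 <= v" and "0 <= L"
proof -
 interpret prob_space M by fact
 define Y where "Y x = X x - b" for x
 have i1: "integrable M X" by (rule square_integrable_imp_integrable[OF m sq])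
 have Y2e: "(Y x)^2 = (X x)^2 - 2 * b * X x + b\<^sup>2" for x by (simp add: Y_def power2_eq_square algebra_simps)
 have iY: "integrable M Y" "integrable M (%x. (Y x)\<^sup>2)" "expectation Y = 0"
  unfolding Y2e unfolding Y_def[abs_def] using i1 sq by (auto simp: prob_space b_def)
 have EY2: "expectation (%x. (Y x)\<^sup>2) = v" unfolding Y2e using i1 sq by (simp add: prob_space b_def[symmetric] v_def power2_eq_square)
 show v0: "0 <= v" unfolding EY2[symmetric] by simp
 have iL: "integrable M (%x. (X x)\<^sup>2 * indicator {C<..} (abs (X x)))"
  by (rule Bochner_Integration.integrable_bound[OF sq]) (auto split: split_indicator)
 show L0: "0 <= L" unfolding L_def by (intro integral_nonneg_AE) auto
 have EX2: "expectation (%x. (X x)\<^sup>2) <= C\<^sup>2 + L"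
 proof -
  have "expectation (%x. (X x)\<^sup>2) <= expectation (%x. C\<^sup>2 + (X x)^2 * indicator {C<..} (abs (X x)))"
  proof (rule integral_mono)
   show "(X x)^2 <= C\<^sup>2 + (X x)^2 * indicator {C<..} (abs (X x))" for x using power_mono[of "abs (X x)" C 2] by (auto split: split_indicator)
  qed (use sq iL in auto)
  also have "... = C\<^sup>2 + L" using iL by (simp add: prob_space L_def)
  finally show ?thesis .
 qed
 have vC: "v <= C\<^sup>2 + L" using EX2 zero_le_power2[of b] unfolding v_def by linarith
 \<comment> \<open>If \<open>abs b > 2 * C\<close>, then \<open>C^2\<close> is at most a quarter of
   \<open>b^2\<close>, and \<open>b^2 <= C^2 + L\<close> can be solved for
   \<open>b^2\<close>.\<close>
 have b2: "b\<^sup>2 * indicator {2 * C<..} (abs b) <= 4 / 3 * L"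
 proof (cases "abs b > 2 * C")
  case True
  have "(2 * C)^2 <= \<bar>b\<bar>\<^sup>2" using True C by (intro power_mono) auto
  then have "C\<^sup>2 <= b\<^sup>2 / 4" by (simp add: power2_eq_square)
  moreover have "b\<^sup>2 <= C\<^sup>2 + L" using v0 EX2 by (simp add: v_def)
  ultimately show ?thesis using True by simp
 next
  case False then show ?thesis using L0 by simp
 qed
 define D where "D = 4 * C"
 have iL': "integrable M (%x. (Y x)\<^sup>2 * indicator {D<..} (abs (Y x)))"
  by (rule Bochner_Integration.integrable_bound[OF iY(2)]) (auto simp: Y_def split: split_indicator)
 \<comment> \<open>The two cases contribute 4 L and 4 * (4/3) L, together at most 10 L.\<close>
 have EL: "expectation (%x. (Y x)\<^sup>2 * indicator {D<..} (abs (Y x))) <= 10 * L"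
 proof -
  have "expectation (%x. (Y x)\<^sup>2 * indicator {D<..} \<bar>Y x\<bar>)
   <= expectation (%x. 4 * ((X x)^2 * indicator {C<..} \<bar>X x\<bar>) + 4 * (b\<^sup>2 * indicator {2 * C<..} \<bar>b\<bar>))"
  proof (rule integral_mono)
   fix x
   show "(Y x)^2 * indicator {D<..} \<bar>Y x\<bar>
    <= 4 * ((X x)^2 * indicator {C<..} \<bar>X x\<bar>) + 4 * (b\<^sup>2 * indicator {2 * C<..} \<bar>b\<bar>)"
   proof (cases "abs (Y x) > D")
    case True
    then have D: "abs (X x) + abs b > 4 * C" unfolding D_def Y_def by linarith
    have Yle: "abs (Y x) <= abs (X x) + abs b" unfolding Y_def by linarith
    show ?thesis
    proof (cases "abs b <= abs (X x)")
     case True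
     then have "\<bar>Y x\<bar>\<^sup>2 <= (2 * abs (X x))\<^sup>2" using Yle by (intro power_mono) auto
     moreover have "abs (X x) > C" using True D C by linarith
     ultimately show ?thesis using \<open>\<bar>Y x\<bar> > D\<close> by (simp add: add_increasing2)
    next
     case False
     then have "\<bar>Y x\<bar>\<^sup>2 <= (2 * abs b)\<^sup>2" using Yle by (intro power_mono) auto
     moreover have "abs b > 2 * C" using False D C by linarith
     ultimately show ?thesis using \<open>\<bar>Y x\<bar> > D\<close> by (simp add: add_increasing)
    qed
   qed simp
  qed (use iL iL' in auto)
  also have "... = 4 * L + 4 * (b\<^sup>2 * indicator {2 * C<..} (abs b))" using iL by (simp add: prob_space L_def)
  also have "... <= 10 * L" using b2 L0 by linarith
  finally show ?thesis .
 qed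
 have mY[measurable]: "Y : bm M" using iY by auto
 have "cmod (char (distr M borel Y) t - (1 - t^2 * v / 2)) <= (t^2 / 6) * expectation (%x. min (6 * (Y x)^2) (abs t * abs (Y x)^3))"
  by (rule char_approx3'[OF mY iY(1,2,3) _ refl]) (simp add: iY(3) EY2)
 also have "expectation (%x. min (6 * (Y x)^2) (abs t * abs (Y x)^3)) <= expectation (%x. 6 * ((Y x)^2 * indicator {D<..} (abs (Y x))) + abs t * D * (Y x)^2)"
 proof (rule integral_mono)
  show "integrable M (%x. min (6 * (Y x)^2) (abs t * abs (Y x)^3))"
   by (rule Bochner_Integration.integrable_bound[OF integrable_mult_right[OF iY(2), of 6]])
    (auto simp: Y_def)
  fix x
  show "min (6 * (Y x)^2) (abs t * abs (Y x)^3) <= 6 * ((Y x)^2 * indicator {D<..} (abs (Y x))) + abs t * D * (Y x)^2"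
  proof (cases "abs (Y x) > D")
   case True
   have "0 <= abs t * D * (Y x)^2" using C by (simp add: D_def)
   then show ?thesis using True by simp
  next
   case False
   have "abs (Y x)^3 = abs (Y x) * (Y x)^2" by (simp add: power3_eq_cube power2_eq_square flip: abs_mult)
   also have "... <= D * (Y x)^2" using False by (intro mult_right_mono) auto
   finally have "abs t * abs (Y x)^3 <= abs t * (D * (Y x)^2)" by (intro mult_left_mono) auto
   then show ?thesis using False by (simp add: mult.assoc)
  qed
 qed (use iL' iY in auto)
 also have "... = 6 * expectation (%x. (Y x)\<^sup>2 * indicator {D<..} (abs (Y x))) + abs t * D * v" using iL' iY by (simp add: EY2)
 also have "... <= 60 * L + abs t * D * v" using EL by simp
 finally have 1: "cmod (char (distr M borel Y) t - (1 - t^2 * v / 2)) <= (t\<^sup>2 / 6) * (60 * L + abs t * D * v)" by (simp add: mult_left_mono)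
 have "abs (exp (- (t\<^sup>2 * v / 2)) - (1 - t\<^sup>2 * v / 2)) <= (t\<^sup>2 * v / 2)\<^sup>2 / 2" using v0 by (intro exp_minus_approx) simp
 also have "... = t^4 * v * v / 8" by (simp add: power2_eq_square power4_eq_xxxx)
 also have "... <= t^4 * v * (C\<^sup>2 + L)"
 proof -
  have "t^4 * v * v <= t^4 * v * (C\<^sup>2 + L)" using v0 vC by (intro mult_left_mono) auto
  moreover have "0 <= t^4 * v * v" using v0 by simp
  ultimately show ?thesis by linarith
 qed
 finally have 2: "cmod (complex_of_real (exp (- (t\<^sup>2 * v / 2))) - (1 - t\<^sup>2 * v / 2)) <= t^4 * v * (C\<^sup>2 + L)"
  by (metis (no_types, lifting) norm_of_real of_real_1 of_real_diff)
 have "cmod (char (distr M borel Y) t - exp (- (t\<^sup>2 * v / 2))) \<le>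
  cmod (char (distr M borel Y) t - (1 - t^2 * v / 2)) + cmod (complex_of_real (exp (- (t\<^sup>2 * v / 2))) - (1 - t\<^sup>2 * v / 2))"
  by (rule order_trans[OF _ norm_triangle_ineq4]) simp
 also have "... <= (t\<^sup>2 / 6) * (60 * L + abs t * D * v) + t^4 * v * (C\<^sup>2 + L)" using 1 2 by linarith
 also have "(t\<^sup>2 / 6) * (60 * L + abs t * D * v) <= 10 * t\<^sup>2 * L + abs t^3 * C * v"
 proof -
  have "(t\<^sup>2 / 6) * (60 * L + abs t * D * v) = 10 * t\<^sup>2 * L + 2 / 3 * (abs t^3 * C * v)"
   by (simp add: D_def algebra_simps power3_eq_cube power2_eq_square)
  moreover have "0 <= abs t^3 * C * v" using v0 C by simp
  ultimately show ?thesis by linarith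
 qed
 finally show "cmod ((CLINT x|M. iexp (t * (X x - b))) - exp (- (t\<^sup>2 * v / 2)))
   <= 10 * t\<^sup>2 * L + \<bar>t\<bar>^3 * C * v + t^4 * v * (C\<^sup>2 + L)" by (simp add: char_def integral_distr Y_def[abs_def])
qed

text \<open>Two products of complex numbers of modulus at most 1 differ by at most the sum of the
  differences of their factors; the Gaussian is split into factors accordingly. \<open>L\<close> and
  \<open>v\<close> are averages over the particles because these are the quantities that the laws of
  large numbers control.\<close>

lemma char_indep_sum_bound:
 fixes xi :: "'b => real" and rho :: "nat => 'b measure"
 assumes K: "K >= 1" and M: "\<And>k. k : {1..K} ==> prob_space (rho k)"
  and m[measurable]: "\<And>k. k : {1..K} ==> xi : bm (rho k)"
  and sq: "\<And>k. k : {1..K} ==> integrable (rho k) (%y. (xi y)\<^sup>2)" and C: "C > 0"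
 defines "L \<equiv> (\<Sum>k=1..K. LINT y|rho k. (xi y)\<^sup>2 * indicator {C<..} (abs (xi y))) / K"
  and "v \<equiv> (\<Sum>k=1..K. (LINT y|rho k. (xi y)\<^sup>2) - (LINT y|rho k. xi y)\<^sup>2) / K"
 shows "cmod ((CLINT x|PiM {1..K} rho. iexp (s / sqrt K * ((\<Sum>k=1..K. xi (x k)) - (\<Sum>k=1..K. LINT y|rho k. xi y))))
   - exp (- (s\<^sup>2 * v / 2))) <= 10 * s\<^sup>2 * L + \<bar>s\<bar>^3 * C * v / sqrt K + s^4 * v * (C\<^sup>2 / K + L)"
proof -
 let ?I = "{1..K}" and ?t = "s / sqrt K"
 interpret P: product_prob_space "%i. if i : ?I then rho i else return (count_space UNIV) undefined" by (intro product_prob_space_extend M)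
 define b where "b k = (LINT y|rho k. xi y)" for k
 define l where "l k = (LINT y|rho k. (xi y)\<^sup>2 * indicator {C<..} (abs (xi y)))" for k
 define w where "w k = (LINT y|rho k. (xi y)\<^sup>2) - (b k)\<^sup>2" for k
 note one = char_truncated_bound[OF M m sq C, folded b_def l_def, folded w_def]
 have KL: "(\<Sum>k\<in>?I. l k) = K * L" and Kv: "(\<Sum>k\<in>?I. w k) = K * v" using K by (simp_all add: L_def v_def l_def w_def b_def)
 \<comment> \<open>A crude bound of one tail by the sum of all of them. It is used only in the
   fourth-order term, whose prefactor \<open>s^4 / K^2\<close> still leaves a multiple of
   \<open>L\<close>.\<close>
 have lL: "l k <= K * L" if "k : ?I" for k unfolding KL[symmetric] using that one(3) by (intro member_le_sum) auto
 have t2: "?t\<^sup>2 = s\<^sup>2 / K" "abs (?t)^3 = abs s^3 / (K * sqrt K)" "?t^4 = s^4 / (real K)^2"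
  using K by (simp_all add: power_divide power3_eq_cube power4_eq_xxxx power2_eq_square abs_mult)
 have "(CLINT x|PiM ?I rho. iexp (?t * ((\<Sum>k\<in>?I. xi (x k)) - (\<Sum>k\<in>?I. b k))))
  = (CLINT x|PiM ?I rho. (\<Prod>k\<in>?I. iexp (?t * (xi (x k) - b k))))"
 proof (rule Bochner_Integration.integral_cong[OF refl])
  fix x
  have "?t * ((\<Sum>k\<in>?I. xi (x k)) - (\<Sum>k\<in>?I. b k)) = (\<Sum>k\<in>?I. ?t * (xi (x k) - b k))"
   by (simp only: sum_subtractf sum_distrib_left[symmetric])
  then show "iexp (?t * ((\<Sum>k\<in>?I. xi (x k)) - (\<Sum>k\<in>?I. b k))) = (\<Prod>k\<in>?I. iexp (?t * (xi (x k) - b k)))"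
   by (simp only: of_real_sum sum_distrib_left exp_sum finite_atLeastAtMost)
 qed
 also have "... = (\<Prod>k\<in>?I. (CLINT y|(if k : ?I then rho k else return (count_space UNIV) undefined). iexp (?t * (xi y - b k))))"
  unfolding PiM_extend[of ?I rho, symmetric]
 proof (rule P.product_integral_prod)
  fix k assume k: "k : ?I"
  interpret prob_space "rho k" by (rule M[OF k])
  note [measurable] = m[OF k]
  show "integrable (if k : ?I then rho k else return (count_space UNIV) undefined) (%y. iexp (?t * (xi y - b k)))"
   using k by (auto intro!: integrable_const_bound[of _ 1])
 qed simp
 also have "... = (\<Prod>k\<in>?I. (CLINT y|rho k. iexp (?t * (xi y - b k))))" by (rule prod.cong) auto
 finally have eq1: "(CLINT x|PiM ?I rho. iexp (?t * ((\<Sum>k\<in>?I. xi (x k)) - (\<Sum>k\<in>?I. b k))))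
  = (\<Prod>k\<in>?I. (CLINT y|rho k. iexp (?t * (xi y - b k))))" .
 have "s\<^sup>2 * v / 2 = (\<Sum>k\<in>?I. ?t\<^sup>2 * w k / 2)"
  using K by (simp add: sum_distrib_left[symmetric] sum_divide_distrib[symmetric] Kv t2)
 then have eq2: "complex_of_real (exp (- (s\<^sup>2 * v / 2))) = (\<Prod>k\<in>?I. complex_of_real (exp (- (?t\<^sup>2 * w k / 2))))"
  by (simp only: sum_negf[symmetric] exp_sum finite_atLeastAtMost of_real_prod)
 have "cmod ((\<Prod>k\<in>?I. (CLINT y|rho k. iexp (?t * (xi y - b k)))) - (\<Prod>k\<in>?I. complex_of_real (exp (- (?t\<^sup>2 * w k / 2)))))
  <= (\<Sum>k\<in>?I. cmod ((CLINT y|rho k. iexp (?t * (xi y - b k))) - complex_of_real (exp (- (?t\<^sup>2 * w k / 2)))))"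
 proof (rule norm_prod_diff)
  fix k assume k: "k : ?I"
  interpret prob_space "rho k" by (rule M[OF k])
  have "cmod (CLINT y|rho k. iexp (?t * (xi y - b k))) <= (LINT y|rho k. cmod (iexp (?t * (xi y - b k))))" by (rule integral_norm_bound)
  also have "... = 1" by (simp only: cmod_iexp) (simp add: prob_space)
  finally show "cmod (CLINT y|rho k. iexp (?t * (xi y - b k))) <= 1" .
  show "cmod (complex_of_real (exp (- (?t\<^sup>2 * w k / 2)))) <= 1" using one(2)[OF k k k] by simp
 qed
 also have "... <= (\<Sum>k\<in>?I. 10 * ?t\<^sup>2 * l k + abs (?t)^3 * C * w k + ?t^4 * (C\<^sup>2 + K * L) * w k)"
 proof (rule sum_mono)
  fix k assume k: "k : ?I"
  have "?t^4 * w k * (C\<^sup>2 + l k) <= ?t^4 * w k * (C\<^sup>2 + K * L)" using one(2)[OF k k k] lL[OF k] by (intro mult_left_mono) auto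
  then show "cmod ((CLINT y|rho k. iexp (?t * (xi y - b k))) - complex_of_real (exp (- (?t\<^sup>2 * w k / 2))))
   <= 10 * ?t\<^sup>2 * l k + \<bar>?t\<bar>^3 * C * w k + ?t^4 * (C\<^sup>2 + K * L) * w k"
   using one(1)[OF k k k, of ?t] by (simp only: mult.assoc mult.left_commute mult.commute)
 qed
 also have "... = 10 * ?t\<^sup>2 * (K * L) + abs (?t)^3 * C * (K * v) + ?t^4 * (C\<^sup>2 + K * L) * (K * v)"
  by (simp only: sum.distrib sum_distrib_left[symmetric] KL Kv)
 also have "... = 10 * s\<^sup>2 * L + abs s^3 * C * v / sqrt K + s^4 * v * (C\<^sup>2 / K + L)"
  unfolding t2 using K by (simp add: field_simps power2_eq_square)
 finally show ?thesis unfolding b_def[symmetric] eq1[unfolded b_def] eq1 eq2 .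
qed


subsection \<open>One step of a particle system\<close>

text \<open>\<open>P K\<close> is the law of the past and \<open>rho K c k\<close> the law of
  particle \<open>k\<close> given the past \<open>c\<close>; given \<open>c\<close> the particles
  are independent. Both halves of a filter stage are instances: proposals have laws depending on
  \<open>k\<close>, resampled particles share one law.\<close>

locale particle_step =
 fixes P :: "nat => 'c measure" and rho :: "nat => 'c => nat => 'e measure" and E :: "'e measure"
 assumes P: "\<And>K. prob_space (P K)"
  and rho: "\<And>K k. k : {1..K} ==> (%c. rho K c k) : P K \<rightarrow>\<^sub>M prob_algebra E"
begin

abbreviation step :: "nat => (nat => 'e) measure" where
 "step K \<equiv> P K \<bind> (%c. PiM {1..K} (rho K c))"

lemma kernel: "(%c. PiM {1..K} (rho K c)) : P K \<rightarrow>\<^sub>M prob_algebra (PiM {1..K} (%_. E))"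
 by (rule measurable_PiM_kernel) (auto intro: rho)

lemma in_prob_algebra: "P K : space (prob_algebra (P K))" by (simp add: space_prob_algebra P)

lemma prob_space_step: "prob_space (step K)" by (rule prob_space_bind'[OF in_prob_algebra kernel])

lemma sets_step: "sets (step K) = sets (PiM {1..K} (%_. E))" by (rule sets_bind'[OF in_prob_algebra kernel])

lemma
 assumes "c : space (P K)" "k : {1..K}"
 shows prob_space_rho: "prob_space (rho K c k)" and sets_rho: "sets (rho K c k) = sets E"
  and measurable_rho: "f : bm E ==> f : bm (rho K c k)" using measurable_space[OF rho[OF assms(2)] assms(1)]
 by (auto simp: space_prob_algebra cong: mcs)

lemma
 assumes "c : space (P K)"
 shows prob_space_PiM_rho: "prob_space (PiM {1..K} (rho K c))"
  and sets_PiM_rho: "sets (PiM {1..K} (rho K c)) = sets (PiM {1..K} (%_. E))"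
 using measurable_space[OF kernel assms] by (auto simp: space_prob_algebra)

lemma integral_rho_measurable:
 fixes f :: "'e => real"
 assumes k: "k : {1..K}" and f: "f : bm E"
 shows "(%c. LINT y|rho K c k. f y) : bm (P K)"
proof -
 note [measurable] = measurable_prob_algebraD[OF rho[OF k]] f
 show ?thesis by measurable
qed

text \<open>Given the past, the new average is close in mean to the average of the conditional
  means, by \<open>indep_average_deviation\<close>. The level \<open>C\<close> is fixed first to
  make the tail small, and only then does \<open>K\<close> grow.\<close>

lemma lln_step:
 fixes xi :: "'e => real"
 assumes xi[measurable]: "xi : bm E"
  and int: "\<And>K. AE c in P K. \<forall>k\<in>{1..K}. integrable (rho K c k) xi"
  and mean: "tip P (%K c. (\<Sum>k=1..K. LINT y|rho K c k. xi y) / K) l"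
  and tail: "\<And>e. e > 0 ==> \<exists>C>0. whp P (%K c. (\<Sum>k=1..K. LINT y|rho K c k. abs (xi y) * indicator {C<..} (abs (xi y))) / K < e)"
 shows "tip step (%K c'. (\<Sum>k=1..K. xi (c' k)) / K) l"
proof (rule tip_bind[where N="%K. PiM {1..K} (%_. E)", OF P kernel])
 fix K :: nat
 show "(%c'. (\<Sum>k=1..K. xi (c' k)) / K) : bm (PiM {1..K} (%_. E))" by measurable
next
 show "tip P (%K c. LINT c'|PiM {1..K} (rho K c). min 1 (abs ((\<Sum>k=1..K. xi (c' k)) / real K - l))) 0" unfolding tip_def
 proof (intro allI impI)
  fix d :: real assume d: "d > 0"
  \<comment> \<open>The tail enters the bound with factor 2. So the tail, the term
    \<open>C / sqrt K\<close> and the error of the conditional means cost at most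
    \<open>d / 4\<close> each.\<close>
  then obtain C where C: "C > 0"
   and w1: "whp P (%K c. (\<Sum>k=1..K. LINT y|rho K c k. abs (xi y) * indicator {C<..} (abs (xi y))) / K < d / 8)"
   using tail[of "d / 8"] by auto
  have w2: "whp P (%K c. dist ((\<Sum>k=1..K. LINT y|rho K c k. xi y) / K) l < d / 4)" using d by (intro tipD[OF mean]) simp
  have w3: "whp P (%K c. \<forall>k\<in>{1..K}. integrable (rho K c k) xi)" using int by (intro whp_AE) auto
  have "(%K. C / sqrt (real K)) \<longlonglongrightarrow> 0" by real_asymp
  then have "\<forall>\<^sub>F K in sequentially. C / sqrt (real K) < d / 4" using d by (intro order_tendstoD) auto
  then have ev: "\<forall>\<^sub>F K in sequentially. C / sqrt (real K) < d / 4 & K >= 1" using eventually_ge_at_top[of 1] by eventually_elim auto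
  show "whp P (%K c. dist (LINT c'|PiM {1..K} (rho K c). min 1 (abs ((\<Sum>k=1..K. xi (c' k)) / real K - l))) 0 < d)"
  proof (rule whp_mono[OF whp_conj[OF P w3 whp_conj[OF P w1 w2]]])
   show "\<forall>\<^sub>F K in sequentially. \<forall>c\<in>space (P K).
    (\<forall>k\<in>{1..K}. integrable (rho K c k) xi) \<and>
    (\<Sum>k=1..K. LINT y|rho K c k. \<bar>xi y\<bar> * indicator {C<..} \<bar>xi y\<bar>) / K < d / 8 \<and>
    dist ((\<Sum>k=1..K. LINT y|rho K c k. xi y) / K) l < d / 4 -->
    dist (LINT c'|PiM {1..K} (rho K c). min 1 \<bar>(\<Sum>k=1..K. xi (c' k)) / real K - l\<bar>) 0 < d" using ev
   proof (eventually_elim, intro ballI impI, elim conjE)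
    fix K c
    assume K: "C / sqrt (real K) < d / 4" "K >= 1" and c: "c : space (P K)"
     and i: "\<forall>k\<in>{1..K}. integrable (rho K c k) xi"
     and L: "(\<Sum>k=1..K. LINT y|rho K c k. abs (xi y) * indicator {C<..} (abs (xi y))) / K < d / 8"
     and m: "dist ((\<Sum>k=1..K. LINT y|rho K c k. xi y) / K) l < d / 4"
    let ?Q = "PiM {1..K} (rho K c)"
    let ?A = "%c'. abs ((\<Sum>k=1..K. xi (c' k)) / K - (\<Sum>k=1..K. LINT y|rho K c k. xi y) / K)"
    interpret Q: prob_space ?Q by (rule prob_space_PiM_rho[OF c])
    have mk[measurable]: "xi : bm (rho K c k)" if "k : {1..K}" for k by (rule measurable_rho[OF c that xi])
    have iA: "integrable ?Q ?A"
    proof -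
     have "integrable ?Q (%x. xi (x k))" if k: "k : {1..K}" for k using i k prob_space_rho[OF c] mk by (subst integrable_PiM_component) auto
     then have "integrable ?Q (%x. \<Sum>k=1..K. xi (x k))" by auto
     then show ?thesis by auto
    qed
    have "(LINT c'|?Q. min 1 (abs ((\<Sum>k=1..K. xi (c' k)) / real K - l))) <= (LINT c'|?Q. ?A c' + d / 4)"
    proof (rule integral_mono')
     show "integrable ?Q (%c'. ?A c' + d / 4)" using iA by auto
     fix c'
     show "min 1 (abs ((\<Sum>k=1..K. xi (c' k)) / real K - l)) <= ?A c' + d / 4" using m unfolding dist_real_def by linarith
     show "0 <= ?A c' + d / 4" using d by simp
    qed
    also have "... = (LINT c'|?Q. ?A c') + d / 4" using iA by (subst Bochner_Integration.integral_add) (auto simp: Q.prob_space)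
    finally have le: "(LINT c'|?Q. min 1 (abs ((\<Sum>k=1..K. xi (c' k)) / real K - l))) <= (LINT c'|?Q. ?A c') + d / 4" .
    have "(LINT c'|?Q. ?A c') <= C / sqrt K + 2 * ((\<Sum>k=1..K. LINT y|rho K c k. abs (xi y) * indicator {C<..} (abs (xi y))) / K)"
     using i by (intro indep_average_deviation K C prob_space_rho[OF c] mk) auto
    then have "(LINT c'|?Q. min 1 (abs ((\<Sum>k=1..K. xi (c' k)) / real K - l))) < d" using le K(1) L d by linarith
    moreover have "0 <= (LINT c'|?Q. min 1 (abs ((\<Sum>k=1..K. xi (c' k)) / real K - l)))" by (intro integral_nonneg_AE) auto
    ultimately show "dist (LINT c'|?Q. min 1 (abs ((\<Sum>k=1..K. xi (c' k)) / real K - l))) 0 < d" by (simp add: dist_real_def)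
   qed
  qed
 qed
qed

text \<open>The error after the step is \<open>D\<close>, a function of the past, plus fresh noise
  that is centred given the past. The conditional characteristic function \<open>J\<close> of the
  noise tends in probability to a constant, and a factor with a constant limit can be pulled out of
  the expectation in the limit. This is how each half-stage multiplies the characteristic function
  by a Gaussian one.\<close>

lemma char_step:
 fixes xi :: "'e => real" and D :: "nat => 'c => real"
 assumes xi[measurable]: "xi : bm E" and D[measurable]: "\<And>K. D K : bm (P K)"
  and int: "\<And>K. K >= 1 ==> AE c in P K. (\<forall>k\<in>{1..K}. integrable (rho K c k) (%y. (xi y)\<^sup>2)) \<and>
    D K c = (\<Sum>k=1..K. LINT y|rho K c k. xi y) / K - a"
  and var: "tip P (%K c. (\<Sum>k=1..K. (LINT y|rho K c k. (xi y)\<^sup>2) - (LINT y|rho K c k. xi y)\<^sup>2) / K) v"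
  and tail: "\<And>e. e > 0 ==> \<exists>C>0. whp P (%K c. (\<Sum>k=1..K. LINT y|rho K c k. (xi y)\<^sup>2 * indicator {C<..} (abs (xi y))) / K < e)"
  and lim: "(%K. CLINT c|P K. iexp (s * (sqrt K * D K c))) \<longlonglongrightarrow> z"
 shows "(%K. CLINT c'|step K. iexp (s * (sqrt K * ((\<Sum>k=1..K. xi (c' k)) / K - a)))) \<longlonglongrightarrow> z * exp (- (s\<^sup>2 * v / 2))"
proof -
 \<comment> \<open>The phase stands outside the inner integral, so that measurability in
   \<open>c\<close> follows from that of the kernel; \<open>Jeq\<close> moves it inside.\<close>
 define J where "J K c = iexp (- (s * (sqrt K * D K c))) *
  (CLINT c'|PiM {1..K} (rho K c). iexp (s * (sqrt K * ((\<Sum>k=1..K. xi (c' k)) / K - a))))" for K c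
 note [measurable] = measurable_prob_algebraD[OF kernel]
 have mJ[measurable]: "J K : bm (P K)" for K unfolding J_def
  by (intro borel_measurable_times mcomp[OF measurable_prob_algebraD[OF kernel] integral_measurable_subprob_algebra])
   measurable
 have Jeq: "J K c = (CLINT c'|PiM {1..K} (rho K c). iexp (s * (sqrt K * ((\<Sum>k=1..K. xi (c' k)) / K - a - D K c))))" for K c
  unfolding J_def integral_mult_right_zero[symmetric] by (intro Bochner_Integration.integral_cong refl) (simp add: algebra_simps flip: exp_add)
 have J1: "cmod (J K c) <= 1" if c: "c : space (P K)" for K c
 proof -
  interpret prob_space "PiM {1..K} (rho K c)" by (rule prob_space_PiM_rho[OF c])
  show ?thesis unfolding Jeq by (rule order_trans[OF integral_norm_bound]) (simp only: cmod_iexp, simp add: prob_space)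
 qed
 have eq: "(CLINT c'|step K. iexp (s * (sqrt K * ((\<Sum>k=1..K. xi (c' k)) / K - a))))
   = (CLINT c|P K. iexp (s * (sqrt K * D K c)) * J K c)" for K
 proof -
  have "(CLINT c'|step K. iexp (s * (sqrt K * ((\<Sum>k=1..K. xi (c' k)) / K - a))))
   = (CLINT c|P K. CLINT c'|PiM {1..K} (rho K c). iexp (s * (sqrt K * ((\<Sum>k=1..K. xi (c' k)) / K - a))))"
  proof (rule integral_bind_complex[OF kernel P, where B=1])
   show "(%c'. iexp (s * (sqrt K * ((\<Sum>k=1..K. xi (c' k)) / K - a)))) : bm (PiM {1..K} (%_. E))" by measurable
  qed (simp only: cmod_iexp order_refl)
  also have "... = (CLINT c|P K. iexp (s * (sqrt K * D K c)) * J K c)"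
   by (intro Bochner_Integration.integral_cong refl) (simp add: J_def mult.assoc[symmetric] flip: exp_add)
  finally show ?thesis .
 qed
 let ?e = "complex_of_real (exp (- (s\<^sup>2 * v / 2)))"
 have tJ: "tip P (%K c. cmod (J K c - ?e)) 0" unfolding tip_def
 proof (intro allI impI)
  fix d :: real assume d: "d > 0"
  \<comment> \<open>The bracket dominates the coefficient of the tail in the bound of
    \<open>char_indep_sum_bound\<close> once the variance is at most \<open>abs v + 1\<close>; the
    summand 1 keeps it positive for \<open>s = 0\<close>.\<close>
  define \<delta> where "\<delta> = d / (4 * (10 * s\<^sup>2 + 2 * s^4 * (abs v + 1) + 1))"
  have den: "10 * s\<^sup>2 + 2 * s^4 * (abs v + 1) + 1 > 0" by (intro add_nonneg_pos add_nonneg_nonneg) auto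
  have \<delta>: "\<delta> > 0" using d den by (simp add: \<delta>_def)
  obtain C where C: "C > 0"
   and w1: "whp P (%K c. (\<Sum>k=1..K. LINT y|rho K c k. (xi y)\<^sup>2 * indicator {C<..} (abs (xi y))) / K < \<delta>)"
   using tail[OF \<delta>] by auto
  let ?V = "%K c. (\<Sum>k=1..K. (LINT y|rho K c k. (xi y)\<^sup>2) - (LINT y|rho K c k. xi y)\<^sup>2) / K"
  have w2: "whp P (%K c. dist (?V K c) v < 1)" by (intro tipD[OF var]) simp
  have "tip P (%K c. exp (- (s\<^sup>2 * ?V K c / 2))) (exp (- (s\<^sup>2 * v / 2)))"
   by (rule tip_continuous[OF var]) (auto intro!: continuous_intros)
  then have w3: "whp P (%K c. dist (exp (- (s\<^sup>2 * ?V K c / 2))) (exp (- (s\<^sup>2 * v / 2))) < d / 4)" using d by (intro tipD) auto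
  have w4: "whp P (%K c. (\<forall>k\<in>{1..K}. integrable (rho K c k) (%y. (xi y)\<^sup>2)) \<and>
    D K c = (\<Sum>k=1..K. LINT y|rho K c k. xi y) / K - a)" by (intro whp_AE eventually_mono[OF eventually_ge_at_top[of 1]] int)
  have "(%K. abs s^3 * C * (abs v + 1) / sqrt (real K) + s^4 * (abs v + 1) * (C\<^sup>2 / real K)) \<longlonglongrightarrow> 0" by real_asymp
  then have "\<forall>\<^sub>F K in sequentially. abs s^3 * C * (abs v + 1) / sqrt (real K) + s^4 * (abs v + 1) * (C\<^sup>2 / real K) < d / 4"
   using d by (intro order_tendstoD) auto
  then have ev: "\<forall>\<^sub>F K in sequentially. abs s^3 * C * (abs v + 1) / sqrt (real K) + s^4 * (abs v + 1) * (C\<^sup>2 / real K) < d / 4 & K >= 1"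
   using eventually_ge_at_top[of 1] by eventually_elim auto
  show "whp P (%K c. dist (cmod (J K c - ?e)) 0 < d)"
  proof (rule whp_mono[OF whp_conj[OF P w4 whp_conj[OF P w1 whp_conj[OF P w2 w3]]]])
   show "\<forall>\<^sub>F K in sequentially. \<forall>c\<in>space (P K).
    ((\<forall>k\<in>{1..K}. integrable (rho K c k) (%y. (xi y)\<^sup>2)) \<and>
     D K c = (\<Sum>k=1..K. LINT y|rho K c k. xi y) / K - a) \<and>
    (\<Sum>k=1..K. LINT y|rho K c k. (xi y)\<^sup>2 * indicator {C<..} \<bar>xi y\<bar>) / K < \<delta> \<and>
    dist (?V K c) v < 1 & dist (exp (- (s\<^sup>2 * ?V K c / 2))) (exp (- (s\<^sup>2 * v / 2))) < d / 4 -->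
    dist (cmod (J K c - ?e)) 0 < d" using ev
   proof (eventually_elim, intro ballI impI, elim conjE)
    fix K c
    let ?L = "(\<Sum>k=1..K. LINT y|rho K c k. (xi y)\<^sup>2 * indicator {C<..} (abs (xi y))) / K"
    assume K: "abs s^3 * C * (abs v + 1) / sqrt (real K) + s^4 * (abs v + 1) * (C\<^sup>2 / real K) < d / 4" "K >= 1"
     and c: "c : space (P K)" and i: "\<forall>k\<in>{1..K}. integrable (rho K c k) (%y. (xi y)\<^sup>2)"
     and Deq: "D K c = (\<Sum>k=1..K. LINT y|rho K c k. xi y) / K - a"
     and L: "?L < \<delta>" and V: "dist (?V K c) v < 1"
     and Ve: "dist (exp (- (s\<^sup>2 * ?V K c / 2))) (exp (- (s\<^sup>2 * v / 2))) < d / 4"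
    have V1: "?V K c <= abs v + 1" using V unfolding dist_real_def by linarith
    have L0: "0 <= ?L" by (intro divide_nonneg_nonneg sum_nonneg integral_nonneg_AE) auto
    have "sqrt K * ((\<Sum>k=1..K. xi (c' k)) / K - a - D K c)
     = ((\<Sum>k=1..K. xi (c' k)) - (\<Sum>k=1..K. LINT y|rho K c k. xi y)) / sqrt K" for c'
    proof -
     have r: "sqrt K / K = 1 / sqrt K" using K(2) by (subst frac_eq_eq) auto
     have "sqrt K * (x / K - a - (y / K - a)) = sqrt K / K * (x - y)" for x y by (simp add: diff_divide_distrib right_diff_distrib)
     then show ?thesis unfolding Deq r by simp
    qed
    then have Jeq': "J K c = (CLINT c'|PiM {1..K} (rho K c). iexp (s / sqrt K * ((\<Sum>k=1..K. xi (c' k)) - (\<Sum>k=1..K. LINT y|rho K c k. xi y))))"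
     unfolding Jeq by (simp add: mult.assoc)
    have "cmod (J K c - exp (- (s\<^sup>2 * ?V K c / 2))) <= 10 * s\<^sup>2 * ?L + abs s^3 * C * ?V K c / sqrt K + s^4 * ?V K c * (C\<^sup>2 / K + ?L)"
     unfolding Jeq' using i by (intro char_indep_sum_bound K C prob_space_rho[OF c] measurable_rho[OF c _ xi]) auto
    also have "... <= 10 * s\<^sup>2 * ?L + abs s^3 * C * (abs v + 1) / sqrt K + s^4 * (abs v + 1) * (C\<^sup>2 / K + ?L)"
     using V1 C L0 by (intro add_mono mult_right_mono mult_left_mono divide_right_mono) auto
    also have "... = (abs s^3 * C * (abs v + 1) / sqrt (real K) + s^4 * (abs v + 1) * (C\<^sup>2 / real K)) + (10 * s\<^sup>2 + s^4 * (abs v + 1)) * ?L"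
     by (simp only: distrib_left distrib_right)
    also have "(10 * s\<^sup>2 + s^4 * (abs v + 1)) * ?L <= (10 * s\<^sup>2 + 2 * s^4 * (abs v + 1) + 1) * \<delta>"
     using L L0 by (intro mult_mono) (auto intro!: add_nonneg_nonneg)
    also have "... = d / 4"
    proof -
     have "q * (d / (4 * q)) = d / 4" if "q > 0" for q :: real using that by simp
     then show ?thesis unfolding \<delta>_def using den by blast
    qed
    finally have 1: "cmod (J K c - exp (- (s\<^sup>2 * ?V K c / 2))) < d / 2" using K(1) by linarith
    have 2: "cmod (complex_of_real (exp (- (s\<^sup>2 * ?V K c / 2))) - ?e) < d / 4"
     using Ve unfolding dist_real_def by (simp only: of_real_diff[symmetric] norm_of_real)
    have "cmod (J K c - ?e) <= cmod (J K c - exp (- (s\<^sup>2 * ?V K c / 2))) + cmod (complex_of_real (exp (- (s\<^sup>2 * ?V K c / 2))) - ?e)"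
     by (rule order_trans[OF _ norm_triangle_ineq]) simp
    then show "dist (cmod (J K c - ?e)) 0 < d" using 1 2 d by simp
   qed
  qed
 qed
 have lJ: "(%K. LINT c|P K. cmod (J K c - ?e)) \<longlonglongrightarrow> 0"
 proof (rule tip_integral[OF P tJ])
  show "abs (cmod (J K c - ?e)) <= 1 + cmod ?e" if "c : space (P K)" for K c
   using norm_triangle_ineq4[of "J K c" ?e] J1[OF that] by (simp only: abs_norm_cancel)
 qed measurable
 have "(%K. (CLINT c|P K. iexp (s * (sqrt K * D K c)) * J K c) - (CLINT c|P K. iexp (s * (sqrt K * D K c))) * ?e) \<longlonglongrightarrow> 0"
 proof (rule Lim_null_comparison[OF always_eventually lJ], rule allI)
  fix K
  interpret prob_space "P K" by (rule P)
  have i1: "integrable (P K) (%c. iexp (s * (sqrt K * D K c)))" by (rule integrable_const_bound[of _ 1]) (simp only: cmod_iexp, simp, measurable)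
  have i2: "integrable (P K) (%c. iexp (s * (sqrt K * D K c)) * J K c)"
   by (rule integrable_const_bound[of _ 1]) (intro AE_I2, simp only: norm_mult cmod_iexp, simp add: J1, measurable)
  have "(CLINT c|P K. iexp (s * (sqrt K * D K c)) * J K c) - (CLINT c|P K. iexp (s * (sqrt K * D K c))) * ?e
   = (CLINT c|P K. iexp (s * (sqrt K * D K c)) * (J K c - ?e))" using i1 i2 by (simp add: right_diff_distrib)
  also have "cmod ... <= (LINT c|P K. cmod (iexp (s * (sqrt K * D K c)) * (J K c - ?e)))" by (rule integral_norm_bound)
  also have "... = (LINT c|P K. cmod (J K c - ?e))" by (simp only: norm_mult cmod_iexp mult_1)
  finally show "cmod ((CLINT c|P K. iexp (s * (sqrt K * D K c)) * J K c) - (CLINT c|P K. iexp (s * (sqrt K * D K c))) * ?e)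
   <= (LINT c|P K. cmod (J K c - ?e))" .
 qed
 then show ?thesis unfolding eq using tendsto_mult[OF lim tendsto_const[of ?e]] by (rule Lim_transform[rotated])
qed

text \<open>A bound for each fixed \<open>K\<close>, with no limit and no integrability assumption:
  either the conditional second moments are finite and orthogonality applies, or the truncation at 1
  makes the right-hand side large enough. For this reason the conditional mean is only required to
  be \<open>D\<close> where the second moments exist.\<close>

lemma second_moment_step:
 fixes xi :: "'e => real" and D :: "'c => real"
 assumes xi[measurable]: "xi : bm E" and D[measurable]: "D : bm (P K)" and K: "K >= 1"
  and mean: "AE c in P K. (\<forall>k\<in>{1..K}. integrable (rho K c k) (%y. (xi y)\<^sup>2)) --> D c = (\<Sum>k=1..K. LINT y|rho K c k. xi y) / K - a"
 shows "(\<integral>\<^sup>+c'. min 1 (K * ((\<Sum>k=1..K. xi (c' k)) / K - a)^2) \<partial>step K)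
  <= 2 * (\<integral>\<^sup>+c. min 1 (K * (D c)^2) \<partial>P K)
   + 2 * (\<integral>\<^sup>+c. min 1 ((\<Sum>k=1..K. \<integral>\<^sup>+y. (xi y)\<^sup>2 \<partial>rho K c k) / K) \<partial>P K)"
proof -
 note [measurable] = measurable_prob_algebraD[OF kernel]
 have [measurable]: "(%c. \<integral>\<^sup>+y. (xi y)\<^sup>2 \<partial>rho K c k) : bm (P K)" if "k : {1..K}" for k
 proof -
  note [measurable] = measurable_prob_algebraD[OF rho[OF that]]
  show ?thesis by measurable
 qed
 let ?S = "%c'. (\<Sum>k=1..K. xi (c' k)) / K"
 let ?V = "%c. (\<Sum>k=1..K. \<integral>\<^sup>+y. (xi y)\<^sup>2 \<partial>rho K c k) / K"
 have "(\<integral>\<^sup>+c'. min 1 (K * (?S c' - a)^2) \<partial>step K)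
  = (\<integral>\<^sup>+c. \<integral>\<^sup>+c'. min 1 (K * (?S c' - a)^2) \<partial>PiM {1..K} (rho K c) \<partial>P K)"
  by (rule nn_integral_bind[OF _ measurable_prob_algebraD[OF kernel]]) measurable
 also have "... <= (\<integral>\<^sup>+c. 2 * min 1 (K * (D c)^2) + 2 * min 1 (?V c) \<partial>P K)"
 proof (rule nn_integral_mono_AE)
  show "AE c in P K. (\<integral>\<^sup>+c'. min 1 (K * (?S c' - a)^2) \<partial>PiM {1..K} (rho K c))
   <= ennreal (2 * min 1 (K * (D c)^2)) + 2 * min 1 (?V c)" using mean
  proof (rule AE_mp, intro AE_I2 impI)
   fix c assume c: "c : space (P K)" and m: "(\<forall>k\<in>{1..K}. integrable (rho K c k) (%y. (xi y)\<^sup>2)) --> D c = (\<Sum>k=1..K. LINT y|rho K c k. xi y) / K - a"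
   let ?Q = "PiM {1..K} (rho K c)"
   interpret Q: prob_space ?Q by (rule prob_space_PiM_rho[OF c])
   note mk = measurable_rho[OF c _ xi]
   have le1: "(\<integral>\<^sup>+c'. min 1 (K * (?S c' - a)^2) \<partial>?Q) <= 1"
    using nn_integral_mono[of ?Q "%c'. ennreal (min 1 (K * (?S c' - a)^2))" "%_. 1"] by (simp add: Q.emeasure_space_1 ennreal_le_1)
   show "(\<integral>\<^sup>+c'. min 1 (K * (?S c' - a)^2) \<partial>?Q) <= ennreal (2 * min 1 (K * (D c)^2)) + 2 * min 1 (?V c)"
   \<comment> \<open>If one of the two truncated terms attains 1, the right-hand side is at least 2
     and the left-hand side at most 1. Otherwise \<open>?V c < 1\<close> forces every conditional
     second moment to be finite.\<close>
   proof (cases "?V c >= 1 \<or> K * (D c)^2 >= 1")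
    case True
    then have "1 <= ennreal (2 * min 1 (K * (D c)^2)) + 2 * min 1 (?V c)"
    proof
     assume "?V c >= 1"
     then have "2 * min 1 (?V c) = 2" by (simp add: min_absorb1)
     then show ?thesis by (simp add: add_increasing)
    next
     assume "K * (D c)^2 >= 1"
     then have "ennreal (2 * min 1 (K * (D c)^2)) = 2" by simp
     then show ?thesis by (simp add: add_increasing2)
    qed
    with le1 show ?thesis by (rule order_trans)
   next
    case False
    then have V: "?V c < 1" and KD: "K * (D c)^2 < 1" by auto
    have fin: "(\<integral>\<^sup>+y. (xi y)\<^sup>2 \<partial>rho K c k) < \<infinity>" if k: "k : {1..K}" for k
    proof (rule ccontr)
     assume "\<not> ?thesis"
     then have "\<top> <= (\<Sum>k=1..K. \<integral>\<^sup>+y. (xi y)\<^sup>2 \<partial>rho K c k)"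
      using k member_le_sum[of k "{1..K}" "%k. \<integral>\<^sup>+y. (xi y)\<^sup>2 \<partial>rho K c k"] by (simp add: less_top)
     then have S: "(\<Sum>k=1..K. \<integral>\<^sup>+y. (xi y)\<^sup>2 \<partial>rho K c k) = \<top>" by (rule top_unique[THEN iffD1])
     show False using V unfolding S by (simp add: ennreal_top_divide)
    qed
    then have i: "integrable (rho K c k) (%y. (xi y)\<^sup>2)" if "k : {1..K}" for k
     using that mk[OF that] by (auto simp: integrable_iff_bounded)
    then have Deq: "D c = (\<Sum>k=1..K. LINT y|rho K c k. xi y) / K - a" using m by blast
    define W where "W c' = ((\<Sum>k=1..K. xi (c' k)) - (\<Sum>k=1..K. LINT y|rho K c k. xi y))^2" for c'
    have iW: "integrable ?Q W" and EW: "(LINT c'|?Q. W c') <= (\<Sum>k=1..K. LINT y|rho K c k. (xi y)\<^sup>2)"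
     unfolding W_def using i mk prob_space_rho[OF c] by (auto intro!: integrable_indep_sum_sq integral_indep_sum_sq_le)
    have pt: "min 1 (K * (?S c' - a)^2) <= 2 * (K * (D c)^2) + 2 * (W c' / K)" for c'
    proof -
     have "?S c' - a = D c + ((\<Sum>k=1..K. xi (c' k)) - (\<Sum>k=1..K. LINT y|rho K c k. xi y)) / K" by (simp add: Deq diff_divide_distrib)
     then have "(?S c' - a)^2 <= 2 * (D c)^2 + 2 * (W c' / K\<^sup>2)"
      using sum_squares_bound[of "D c" "((\<Sum>k=1..K. xi (c' k)) - (\<Sum>k=1..K. LINT y|rho K c k. xi y)) / K"]
      by (simp add: W_def power2_sum power_divide)
     then have "K * (?S c' - a)^2 <= K * (2 * (D c)^2 + 2 * (W c' / K\<^sup>2))" by (intro mult_left_mono) auto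
     also have "... = 2 * (K * (D c)^2) + 2 * (W c' / K)" using K by (simp add: field_simps power2_eq_square)
     finally show ?thesis by simp
    qed
    have "(\<integral>\<^sup>+c'. min 1 (K * (?S c' - a)^2) \<partial>?Q) <= (\<integral>\<^sup>+c'. ennreal (2 * (K * (D c)^2) + 2 * (W c' / K)) \<partial>?Q)"
     by (intro nn_integral_mono ennreal_leI pt)
    also have "... = ennreal (LINT c'|?Q. 2 * (K * (D c)^2) + 2 * (W c' / K))"
    proof (rule nn_integral_eq_integral)
     show "integrable ?Q (%c'. 2 * (K * (D c)^2) + 2 * (W c' / K))" using iW by auto
    qed (simp add: W_def)
    also have "(LINT c'|?Q. 2 * (K * (D c)^2) + 2 * (W c' / K)) = 2 * (K * (D c)^2) + 2 * ((LINT c'|?Q. W c') / K)"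
     using iW by (subst Bochner_Integration.integral_add) (auto simp: Q.prob_space)
    also have "ennreal ... <= ennreal (2 * (K * (D c)^2) + 2 * ((\<Sum>k=1..K. LINT y|rho K c k. (xi y)\<^sup>2) / K))"
     using EW by (intro ennreal_leI add_left_mono mult_left_mono divide_right_mono) auto
    also have "... = ennreal (2 * (K * (D c)^2)) + 2 * ennreal ((\<Sum>k=1..K. LINT y|rho K c k. (xi y)\<^sup>2) / K)"
    proof -
     have *: "ennreal (x + 2 * y) = ennreal x + 2 * ennreal y" if "0 <= x" "0 <= y" for x y using that by (simp add: ennreal_plus ennreal_mult)
     show ?thesis by (rule *) (auto intro!: sum_nonneg divide_nonneg_nonneg)
    qed
    also have "ennreal ((\<Sum>k=1..K. LINT y|rho K c k. (xi y)\<^sup>2) / K) = ?V c"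
    proof -
     have "ennreal (\<Sum>k=1..K. LINT y|rho K c k. (xi y)\<^sup>2) = (\<Sum>k=1..K. ennreal (LINT y|rho K c k. (xi y)\<^sup>2))"
      by (rule sum_ennreal[symmetric]) simp
     also have "... = (\<Sum>k=1..K. \<integral>\<^sup>+y. (xi y)\<^sup>2 \<partial>rho K c k)"
      using i by (intro sum.cong refl nn_integral_eq_integral[symmetric]) auto
     finally have e: "ennreal (\<Sum>k=1..K. LINT y|rho K c k. (xi y)\<^sup>2) = (\<Sum>k=1..K. \<integral>\<^sup>+y. (xi y)\<^sup>2 \<partial>rho K c k)" .
     have "ennreal ((\<Sum>k=1..K. LINT y|rho K c k. (xi y)\<^sup>2) / K)
      = ennreal (\<Sum>k=1..K. LINT y|rho K c k. (xi y)\<^sup>2) / ennreal (real K)"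
      using K by (intro divide_ennreal[symmetric]) (auto intro!: sum_nonneg)
     then show ?thesis unfolding e by (simp only: ennreal_of_nat_eq_real_of_nat)
    qed
    finally show ?thesis using V KD by simp
   qed
  qed
 qed
 also have "... = 2 * (\<integral>\<^sup>+c. min 1 (K * (D c)^2) \<partial>P K) + 2 * (\<integral>\<^sup>+c. min 1 (?V c) \<partial>P K)"
  by (subst nn_integral_add) (auto simp: nn_integral_cmult ennreal_mult'')
 finally show ?thesis .
qed

end

subsection \<open>Path laws\<close>

lemma greaterThanLessThan_Suc_eq: "{x<..<Suc a} = {x<..a}" by auto

lemma greaterThanAtMost_Suc_eq: "c <= a ==> {c<..Suc a} = insert (Suc a) {c<..a}" by auto

lemma atLeast1AtMost_eq: "{1..t} = {0<..t::nat}" by auto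

lemma measurable_paths_restrict: "J \<subseteq> I ==> (%x. restrict x J) : paths S I \<rightarrow>\<^sub>M paths S J"
 unfolding paths_def by (rule measurable_restrict_subset)

lemma measurable_paths_upd:
 "c <= a ==> (%(z, y). z(Suc a := y)) : paths S {c<..a} \<Otimes>\<^sub>M state_measure S \<rightarrow>\<^sub>M paths S {c<..Suc a}"
 unfolding paths_def by (simp add: greaterThanAtMost_Suc_eq measurable_add_dim)

lemma measurable_paths_upd':
 "c <= a ==> z : space (paths S {c<..a}) ==> (%y. z(Suc a := y)) : state_measure S \<rightarrow>\<^sub>M paths S {c<..Suc a}"
 using mcomp[OF measurable_Pair1' measurable_paths_upd, of z S c a] by simp

lemma space_paths_restrict: "x : space (paths S I) ==> J \<subseteq> I ==> restrict x J : space (paths S J)"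
 by (auto simp: paths_def space_PiM PiE_iff)

lemma restrict_space_paths: "x : space (paths S I) ==> restrict x I = x" by (auto simp: paths_def space_PiM PiE_iff extensional_restrict)

definition mrg :: "nat => nat => (nat => 'x) => (nat => 'x) => nat => 'x" where
 "mrg a b x y = merge {0<..a} {a<..b} (x, y)"

lemma measurable_mrg:
 "a <= b ==> (%(x, y). mrg a b x y) : paths S {0<..a} \<Otimes>\<^sub>M paths S {a<..b} \<rightarrow>\<^sub>M paths S {0<..b}"
 using measurable_merge[of "{0<..a}" "{a<..b}" "%_. state_measure S"] by (simp add: mrg_def paths_def ivl_disj_un case_prod_unfold)

lemma measurable_mrg' [measurable (raw)]:
 assumes "a <= b" "f : L \<rightarrow>\<^sub>M paths S {0<..a}" "g : L \<rightarrow>\<^sub>M paths S {a<..b}"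
 shows "(%l. mrg a b (f l) (g l)) : L \<rightarrow>\<^sub>M paths S {0<..b}"
 using mcomp[OF measurable_Pair[OF assms(2,3)] measurable_mrg[OF assms(1)]] by simp

lemma mrg_upd: "a <= b ==> (mrg a b x y)(Suc b := v) = mrg a (Suc b) x (y(Suc b := v))" by (auto simp: mrg_def merge_def fun_eq_iff)

lemma mrg_restrict_right: "J \<subseteq> {a<..b} ==> restrict (mrg a b x y) J = restrict y J"
 by (auto simp: mrg_def merge_def fun_eq_iff restrict_def)

lemma mrg_restrict_left: "J \<subseteq> {0<..a} ==> restrict (mrg a b x y) J = restrict x J" by (auto simp: mrg_def merge_def fun_eq_iff restrict_def)

lemma mrg_restrict: "c <= b ==> restrict (mrg a b x y) {0<..c} = mrg a c (restrict x {0<..c}) (restrict y {a<..c})"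
 by (auto simp: mrg_def merge_def fun_eq_iff restrict_def)

lemma mrg_self: "x : space (paths S {0<..a}) ==> mrg a a x y = x"
 by (auto simp: mrg_def merge_def fun_eq_iff paths_def space_PiM PiE_iff extensional_def)

lemma space_paths_empty: "space (paths S {a<..a}) = {%_. undefined}" "space (paths S {}) = {%_. undefined}" by (simp_all add: paths_def space_PiM)

text \<open>Times are shifted: \<open>a\<close> is the last known time and the law is that of the
  state at \<open>Suc a\<close>. The restriction allows \<open>z\<close> to begin at any time not
  after the start of the block of \<open>Suc a\<close>.\<close>

definition prop_kernel :: "('x, 'y) smc => nat => (nat => 'x) => 'x measure" where
 "prop_kernel S a z = density (state_measure S)
  (%y. ennreal (prop_dens S (Suc a) (restrict z {blk_start S (blk S (Suc a))<..a}) y))"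

text \<open>\<open>c\<close> is the time after which the path is recorded: \<open>c = 0\<close>
  gives full paths and the start of a block gives the paths kept by a filter. One notion thus serves
  both.\<close>

definition path_step :: "('x, 'y) smc => nat => nat => (nat => 'x) => (nat => 'x) measure" where
 "path_step S c a z = distr (prop_kernel S a z) (paths S {c<..Suc a}) (%y. z(Suc a := y))"

primrec path_run :: "('x, 'y) smc => nat => nat => (nat => 'x) => nat => (nat => 'x) measure" where
 "path_run S c a z 0 = return (paths S {c<..a}) z"
| "path_run S c a z (Suc n) = path_run S c a z n \<bind> path_step S c (a + n)"

lemma paths_upd_restrict: "z : space (paths S {c<..a}) ==> restrict (z(Suc a := y)) {c<..a} = z"
 by (auto simp: paths_def space_PiM PiE_iff extensional_def restrict_def fun_eq_iff)

context smc_model begin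

abbreviation T :: nat where
 "T \<equiv> blk_len S"

lemma blk_start_blk_Suc: "blk_start S (blk S (Suc a)) = a div T * T" by (simp add: blk_start_def blk_def)

lemma blk_start_blk_mono: "a <= b ==> blk_start S (blk S (Suc a)) <= blk_start S (blk S (Suc b))" by (simp add: blk_start_blk_Suc div_le_mono)

lemma blk_start_blk_le: "blk_start S (blk S (Suc a)) <= a" by (simp add: blk_start_blk_Suc)

lemma prop_kernel_measurable_aux:
 assumes a: "a < horizon S"
 defines "d \<equiv> %z y. ennreal (prop_dens S (Suc a) z y)"
 shows "(%z. density (state_measure S) (d z)) : paths S {blk_start S (blk S (Suc a))<..a} \<rightarrow>\<^sub>M prob_algebra (state_measure S)"
proof (rule measurable_prob_algebraI)
 interpret N: sigma_finite_measure "state_measure S" by (rule sigma_finite_state)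
 let ?B = "paths S {blk_start S (blk S (Suc a))<..a}"
 have d[measurable]: "(%(z, y). d z y) : bm (?B \<Otimes>\<^sub>M state_measure S)"
  using prop_measurable[of "Suc a"] a by (auto simp: d_def greaterThanLessThan_Suc_eq case_prod_unfold)
 have dz[measurable]: "d z : bm (state_measure S)" if "z : space ?B" for z
  using mcomp[OF measurable_Pair1'[OF that] d] by simp
 show P: "prob_space (density (state_measure S) (d z))" if z: "z : space ?B" for z using prop_total[of "Suc a" z] a z dz[OF z]
  by (intro prob_spaceI) (auto simp: emeasure_density greaterThanLessThan_Suc_eq d_def cong: nn_integral_cong_simp)
 show "(%z. density (state_measure S) (d z)) : ?B \<rightarrow>\<^sub>M subprob_algebra (state_measure S)"
 proof (rule measurable_subprob_algebra)
  show "subprob_space (density (state_measure S) (d z))" if "z : space ?B" for z by (rule prob_space_imp_subprob_space[OF P[OF that]])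
  fix A assume A[measurable]: "A : sets (state_measure S)"
  have "(%z. \<integral>\<^sup>+y. d z y * indicator A y \<partial>state_measure S) : bm ?B"
   by (rule N.borel_measurable_nn_integral) measurable
  then show "(%z. emeasure (density (state_measure S) (d z)) A) : bm ?B"
   by (rule measurable_cong[THEN iffD1, rotated]) (simp add: emeasure_density)
 qed simp
qed

lemma prop_kernel:
 assumes "a < horizon S" "c <= blk_start S (blk S (Suc a))"
 shows "prop_kernel S a : paths S {c<..a} \<rightarrow>\<^sub>M prob_algebra (state_measure S)"
proof -
 have "{blk_start S (blk S (Suc a))<..a} \<subseteq> {c<..a}" using assms by auto
 from mcomp[OF measurable_paths_restrict[OF this] prop_kernel_measurable_aux[OF assms(1)]]
 show ?thesis unfolding prop_kernel_def[abs_def] .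
qed

lemma path_step_kernel:
 assumes "a < horizon S" "c <= blk_start S (blk S (Suc a))"
 shows "path_step S c a : paths S {c<..a} \<rightarrow>\<^sub>M prob_algebra (paths S {c<..Suc a})"
proof -
 have "c <= a" using assms(2) blk_start_blk_le le_trans by blast
 then show ?thesis unfolding path_step_def[abs_def] by (intro measurable_distr_prob_space2[OF prop_kernel[OF assms]] measurable_paths_upd)
qed

lemma nn_integral_path_step:
 assumes a: "a < horizon S" "c <= blk_start S (blk S (Suc a))" and z: "z : space (paths S {c<..a})"
  and f: "f : bm (paths S {c<..Suc a})"
 shows "(\<integral>\<^sup>+x. f x \<partial>path_step S c a z) = (\<integral>\<^sup>+y. f (z(Suc a := y)) \<partial>prop_kernel S a z)"
proof -
 have "c <= a" using a(2) blk_start_blk_le le_trans by blast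
 moreover have "sets (prop_kernel S a z) = sets (state_measure S)" by (simp add: prop_kernel_def)
 ultimately show ?thesis unfolding path_step_def using z f by (intro nn_integral_distr) (auto simp: measurable_paths_upd' cong: mcs)
qed

text \<open>Stated for values of a measurable \<open>g\<close>, because the singleton of a path need
  not be a measurable set in the path space.\<close>

lemma AE_path_step_restrict:
 assumes a: "a < horizon S" "c <= blk_start S (blk S (Suc a))" and z: "z : space (paths S {c<..a})"
  and g: "g : bm (paths S {c<..a})"
 shows "AE x in path_step S c a z. g (restrict x {c<..a}) = (g z :: 'b::{second_countable_topology, t2_space})"
proof -
 have c: "c <= a" using a(2) blk_start_blk_le le_trans by blast
 have s: "sets (prop_kernel S a z) = sets (state_measure S)" by (simp add: prop_kernel_def)
 have m: "(%y. z(Suc a := y)) : prop_kernel S a z \<rightarrow>\<^sub>M paths S {c<..Suc a}"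
  using measurable_paths_upd'[OF c z] by (simp cong: mcs add: s)
 have "(%x. restrict x {c<..a}) : paths S {c<..Suc a} \<rightarrow>\<^sub>M paths S {c<..a}" by (rule measurable_paths_restrict) auto
 from mcomp[OF this g] show ?thesis unfolding path_step_def by (subst AE_distr_iff[OF m]) (auto simp: paths_upd_restrict[OF z])
qed

lemma run_kernel:
 assumes "c <= blk_start S (blk S (Suc a))" "a + n <= horizon S"
 shows "(%z. path_run S c a z n) : paths S {c<..a} \<rightarrow>\<^sub>M prob_algebra (paths S {c<..a + n})" using assms(2)
proof (induction n)
 case 0 then show ?case by simp
next
 case (Suc n)
 have "c <= blk_start S (blk S (Suc (a + n)))" using assms(1) blk_start_blk_mono[of a "a + n"] by simp
 then have [measurable]: "path_step S c (a + n) : paths S {c<..a + n} \<rightarrow>\<^sub>M prob_algebra (paths S {c<..Suc (a + n)})"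
  using Suc.prems by (intro path_step_kernel) auto
 have [measurable]: "(%z. path_run S c a z n) : paths S {c<..a} \<rightarrow>\<^sub>M prob_algebra (paths S {c<..a + n})" using Suc by simp
 show ?case by (simp, measurable)
qed

lemma
 assumes "c <= blk_start S (blk S (Suc a))" "a + n <= horizon S" "z : space (paths S {c<..a})"
 shows prob_space_run: "prob_space (path_run S c a z n)"
  and sets_run: "sets (path_run S c a z n) = sets (paths S {c<..a + n})"
  and space_run: "space (path_run S c a z n) = space (paths S {c<..a + n})"
  and in_prob_algebra_run: "path_run S c a z n : space (prob_algebra (paths S {c<..a + n}))"
 using measurable_space[OF run_kernel[OF assms(1,2)] assms(3)] by (auto simp: space_prob_algebra dest: sets_eq_imp_space_eq)

text \<open>The Chapman-Kolmogorov equation.\<close>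

lemma run_add:
 assumes c: "c <= blk_start S (blk S (Suc a))" and n: "a + (n + k) <= horizon S" and z: "z : space (paths S {c<..a})"
 shows "path_run S c a z (n + k) = path_run S c a z n \<bind> (%z'. path_run S c (a + n) z' k)" using n
proof (induction k)
 case 0
 then have "sets (path_run S c a z n) = sets (paths S {c<..a + n})" using c z by (intro sets_run) auto
 then show ?case by (simp add: bind_return'')
next
 case (Suc k)
 have c1: "c <= blk_start S (blk S (Suc (a + n)))" and c2: "c <= blk_start S (blk S (Suc (a + n + k)))"
  using c blk_start_blk_mono[of a "a + n"] blk_start_blk_mono[of a "a + n + k"] by auto
 have "path_run S c a z (n + Suc k) = (path_run S c a z n \<bind> (%z'. path_run S c (a + n) z' k)) \<bind> path_step S c (a + n + k)"
  using Suc by (simp add: add.assoc)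
 also have "... = path_run S c a z n \<bind> (%z'. path_run S c (a + n) z' k \<bind> path_step S c (a + n + k))"
 proof (rule bind_assoc)
  show "(%z'. path_run S c (a + n) z' k) : path_run S c a z n \<rightarrow>\<^sub>M subprob_algebra (paths S {c<..a + n + k})"
   using measurable_prob_algebraD[OF run_kernel[OF c1, of k]] Suc.prems sets_run[OF c _ z, of n] by (simp cong: mcs add: add.assoc)
  show "path_step S c (a + n + k) : paths S {c<..a + n + k} \<rightarrow>\<^sub>M subprob_algebra (paths S {c<..Suc (a + n + k)})"
   using Suc.prems by (intro measurable_prob_algebraD path_step_kernel c2) auto
 qed
 finally show ?case by simp
qed

lemma run_Suc_left:
 assumes c: "c <= blk_start S (blk S (Suc a))" and n: "a + Suc n <= horizon S" and z: "z : space (paths S {c<..a})"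
 shows "path_run S c a z (Suc n) = path_step S c a z \<bind> (%z'. path_run S c (Suc a) z' n)"
proof -
 have "path_run S c a z 1 = path_step S c a z"
  using bind_return[OF measurable_prob_algebraD[OF path_step_kernel[OF _ c]] z] n by (simp add: One_nat_def)
 moreover have "path_run S c a z (1 + n) = path_run S c a z 1 \<bind> (%z'. path_run S c (a + 1) z' n)" using n by (intro run_add[OF c _ z]) simp
 ultimately show ?thesis by (simp only: plus_1_eq_Suc Suc_eq_plus1[symmetric])
qed

lemma distr_run_restrict:
 assumes c: "c <= blk_start S (blk S (Suc a))" and n: "a + n <= horizon S" and z: "z : space (paths S {c<..a})"
 shows "distr (path_run S c a z n) (paths S {c<..a}) (%x. restrict x {c<..a}) = return (paths S {c<..a}) z" using n
proof (induction n)
 case 0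
 show ?case unfolding path_run.simps
  by (subst distr_return) (simp_all only: add_0_right z restrict_space_paths[OF z] measurable_paths_restrict[OF subset_refl])
next
 case (Suc n)
 let ?R = "paths S {c<..a}"
 have cn: "c <= blk_start S (blk S (Suc (a + n)))" using c blk_start_blk_mono[of a "a + n"] by simp
 have c': "c <= a" using c blk_start_blk_le le_trans by blast
 have r: "(%x. restrict x {c<..a}) : paths S {c<..b} \<rightarrow>\<^sub>M ?R" if "a <= b" for b using that by (intro measurable_paths_restrict) auto
 note k = path_step_kernel[OF _ cn]
 have s: "sets (path_run S c a z n) = sets (paths S {c<..a + n})" "space (path_run S c a z n) = space (paths S {c<..a + n})"
  using sets_run[OF c _ z, of n] space_run[OF c _ z, of n] Suc.prems by auto
 have p: "prob_space (path_run S c a z n)" using prob_space_run[OF c _ z, of n] Suc.prems by simp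
 have "distr (path_run S c a z (Suc n)) ?R (%x. restrict x {c<..a}) = path_run S c a z n \<bind> (%x. distr (path_step S c (a + n) x) ?R (%x. restrict x {c<..a}))"
  unfolding path_run.simps
 proof (rule distr_bind)
  show "path_step S c (a + n) : path_run S c a z n \<rightarrow>\<^sub>M subprob_algebra (paths S {c<..Suc (a + n)})"
   using measurable_prob_algebraD[OF k] Suc.prems s(1) by (simp cong: mcs)
  show "space (path_run S c a z n) ~= {}" using p by (rule prob_space.not_empty)
  show "(%x. restrict x {c<..a}) : paths S {c<..Suc (a + n)} \<rightarrow>\<^sub>M ?R" by (rule r) simp
 qed
 also have "... = path_run S c a z n \<bind> (%x. return ?R (restrict x {c<..a}))"
 proof (rule bind_cong_All, rule ballI)
  fix x assume "x : space (path_run S c a z n)"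
  then have x: "x : space (paths S {c<..a + n})" using s by simp
  have can: "c <= a + n" using c' by simp
  have pk: "prob_space (prop_kernel S (a + n) x)" using measurable_space[OF prop_kernel[OF _ cn] x] Suc.prems by (auto simp: space_prob_algebra)
  have m: "(%y. x(Suc (a + n) := y)) : prop_kernel S (a + n) x \<rightarrow>\<^sub>M paths S {c<..Suc (a + n)}"
   using measurable_paths_upd'[OF can x] by (simp add: prop_kernel_def)
  have "distr (path_step S c (a + n) x) ?R (%x. restrict x {c<..a})
   = distr (prop_kernel S (a + n) x) ?R (%y. restrict (x(Suc (a + n) := y)) {c<..a})"
   unfolding path_step_def by (subst distr_distr[OF r m]) (auto simp: comp_def)
  also have "... = distr (prop_kernel S (a + n) x) ?R (%y. restrict x {c<..a})" by (intro distr_cong) (auto simp: restrict_def fun_eq_iff)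
  also have "... = return ?R (restrict x {c<..a})" using x c' by (intro prob_space.distr_const[OF pk] space_paths_restrict) auto
  finally show "distr (path_step S c (a + n) x) ?R (%x. restrict x {c<..a}) = return ?R (restrict x {c<..a})" .
 qed
 also have "... = distr (path_run S c a z n) ?R (%x. restrict x {c<..a})"
  using r[of "a + n"] s(1) by (intro bind_return_distr' prob_space.not_empty[OF p]) (auto cong: mcs)
 also have "... = return ?R z" using Suc.prems by (intro Suc.IH) simp
 finally show ?case .
qed

lemma AE_run_restrict:
 assumes c: "c <= blk_start S (blk S (Suc a))" and n: "a + n <= horizon S" and z: "z : space (paths S {c<..a})"
  and g[measurable]: "g : bm (paths S {c<..a})"
 shows "AE x in path_run S c a z n. g (restrict x {c<..a}) = (g z :: 'b::{second_countable_topology, t2_space})"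
proof -
 have m: "(%x. restrict x {c<..a}) : path_run S c a z n \<rightarrow>\<^sub>M paths S {c<..a}"
 proof -
  have "{c<..a} \<subseteq> {c<..a + n}" by auto
  from measurable_paths_restrict[OF this, of S] show ?thesis unfolding mcs[OF sets_run[OF c n z] refl] .
 qed
 have "AE x in distr (path_run S c a z n) (paths S {c<..a}) (%x. restrict x {c<..a}). g x = g z"
  unfolding distr_run_restrict[OF c n z] by (subst AE_return) (auto simp: z)
 then show ?thesis by (subst (asm) AE_distr_iff[OF m]) auto
qed

lemma prop_at_upd: "t ~= b ==> t <= b ==> prop_at S t (x(b := y)) = prop_at S t x"
 unfolding prop_at_def by (auto intro!: arg_cong2[where f="prop_dens S t"] simp: restrict_def fun_eq_iff)

lemma prop_at_measurable:
 assumes t: "t : {1..horizon S}" and I: "{blk_start S (blk S t)<..t} \<subseteq> I" and tI: "t : I"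
 shows "prop_at S t : bm (paths S I)"
proof -
 have "{blk_start S (blk S t)<..<t} \<subseteq> I" using I by auto
 from measurable_paths_restrict[OF this] have "(%x. (restrict x {blk_start S (blk S t)<..<t}, x t)) \<in>
   paths S I \<rightarrow>\<^sub>M paths S {blk_start S (blk S t)<..<t} \<Otimes>\<^sub>M state_measure S"
  using tI by (intro measurable_Pair) (auto simp: paths_def intro: measurable_component_singleton)
 from mcomp[OF this prop_measurable[OF t]] show ?thesis by (simp add: prop_at_def[abs_def])
qed

lemma prop_at_nonneg:
 assumes t: "t : {1..horizon S}" and I: "{blk_start S (blk S t)<..t} \<subseteq> I" and tI: "t : I" and x: "x : space (paths S I)"
 shows "0 <= prop_at S t x" unfolding prop_at_def
 using x tI I by (intro prop_nonneg[OF t] space_paths_restrict[OF x]) (auto simp: paths_def space_PiM)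

text \<open>Links the law given by a product density with sequential sampling; the induction step is
  Tonelli's theorem in the last coordinate. From here on conditioning on the past of a path means
  composing kernels.\<close>

lemma run_eq_density:
 assumes "n <= horizon S"
 shows "path_run S 0 0 (%_. undefined) n = density (paths S {0<..n}) (%x. ennreal (\<Prod>t=1..n. prop_at S t x))" using assms
proof (induction n)
 case 0
 have "return (PiM {} (%_. state_measure S)) (%_. undefined) = PiM {} (%_::nat. state_measure S)" unfolding PiM_empty
  by (rule measure_eqI) (auto dest!: subset_singletonD)
 then show ?case by (simp add: paths_def density_1)
next
 case (Suc n)
 interpret product_sigma_finite "%_::nat. state_measure S" by (rule product_sigma_finite.intro) (rule sigma_finite_state)
 interpret N: sigma_finite_measure "state_measure S" by (rule sigma_finite_state)
 define p where "p x = ennreal (\<Prod>t=1..n. prop_at S t x)" for x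
 have IH: "path_run S 0 0 (%_. undefined) n = density (paths S {0<..n}) p" using Suc by (simp add: p_def[abs_def])
 have pm[measurable]: "p : bm (paths S {0<..n})" unfolding p_def using Suc.prems
  by (intro mcomp[OF _ measurable_ennreal] borel_measurable_prod prop_at_measurable) auto
 have k: "path_step S 0 n : paths S {0<..n} \<rightarrow>\<^sub>M prob_algebra (paths S {0<..Suc n})" using Suc.prems by (intro path_step_kernel) auto
 have k': "path_step S 0 n : density (paths S {0<..n}) p \<rightarrow>\<^sub>M subprob_algebra (paths S {0<..Suc n})"
  using measurable_prob_algebraD[OF k] by simp
 have d0: "prop_at S (Suc n) (x(Suc n := y)) = prop_dens S (Suc n) (restrict x {blk_start S (blk S (Suc n))<..n}) y" for x y
  unfolding prop_at_def greaterThanLessThan_Suc_eq by (auto intro!: arg_cong2[where f="prop_dens S (Suc n)"] simp: restrict_def fun_eq_iff)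
 define q where "q x = ennreal (\<Prod>t=1..Suc n. prop_at S t x)" for x
 have qm[measurable]: "q : bm (paths S {0<..Suc n})" unfolding q_def using Suc.prems
  by (intro mcomp[OF _ measurable_ennreal] borel_measurable_prod prop_at_measurable) auto
 have qp: "q (x(Suc n := y)) = p x * ennreal (prop_dens S (Suc n) (restrict x {blk_start S (blk S (Suc n))<..n}) y)"
  if x: "x : space (paths S {0<..n})" for x y
 proof -
  have "(\<Prod>t=1..Suc n. prop_at S t (x(Suc n := y))) = (\<Prod>t=1..n. prop_at S t x) * prop_at S (Suc n) (x(Suc n := y))"
   by (simp add: prop_at_upd)
  moreover have "0 <= (\<Prod>t=1..n. prop_at S t x)" using Suc.prems by (intro prod_nonneg ballI prop_at_nonneg[OF _ _ _ x]) auto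
  ultimately show ?thesis unfolding q_def p_def d0 by (simp add: ennreal_mult')
 qed
 have ins: "{0<..Suc n} = insert (Suc n) {0<..n}" by auto
 have "density (paths S {0<..n}) p \<bind> path_step S 0 n = density (paths S {0<..Suc n}) q"
 proof (rule measure_eqI)
  have ne: "space (density (paths S {0<..n}) p) ~= {}"
   unfolding IH[symmetric] using Suc.prems by (intro prob_space.not_empty prob_space_run) (auto simp: space_paths_empty)
  show s: "sets (density (paths S {0<..n}) p \<bind> path_step S 0 n) = sets (density (paths S {0<..Suc n}) q)"
   using sets_bind[OF sets_kernel[OF k'] ne] by simp
  fix A assume "A : sets (density (paths S {0<..n}) p \<bind> path_step S 0 n)"
  then have A[measurable]: "A : sets (paths S {0<..Suc n})" using s by simp
  note [measurable] = measurable_prob_algebraD[OF k]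
  have "emeasure (density (paths S {0<..n}) p \<bind> path_step S 0 n) A = (\<integral>\<^sup>+x. emeasure (path_step S 0 n x) A \<partial>density (paths S {0<..n}) p)"
   by (rule emeasure_bind[OF ne k' A])
  also have "... = (\<integral>\<^sup>+x. p x * emeasure (path_step S 0 n x) A \<partial>paths S {0<..n})" by (rule nn_integral_density) measurable
  also have "... = (\<integral>\<^sup>+x. (\<integral>\<^sup>+y. q (x(Suc n := y)) * indicator A (x(Suc n := y)) \<partial>state_measure S) \<partial>paths S {0<..n})"
  proof (rule nn_integral_cong)
   fix x assume x: "x : space (paths S {0<..n})"
   have u[measurable]: "(%y. x(Suc n := y)) : state_measure S \<rightarrow>\<^sub>M paths S {0<..Suc n}" by (rule measurable_paths_upd'[OF _ x]) simp
   have xr: "restrict x {blk_start S (blk S (Suc n))<..n} : space (paths S {blk_start S (blk S (Suc n))<..n})"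
    by (rule space_paths_restrict[OF x]) auto
   have [measurable]: "(%y. ennreal (prop_dens S (Suc n) (restrict x {blk_start S (blk S (Suc n))<..n}) y)) : bm (state_measure S)"
    using mcomp[OF measurable_Pair1'[OF xr] prop_measurable[of "Suc n", unfolded greaterThanLessThan_Suc_eq]] Suc.prems by auto
   have "emeasure (path_step S 0 n x) A = (\<integral>\<^sup>+x. indicator A x \<partial>path_step S 0 n x)"
    by (rule nn_integral_indicator[symmetric]) (simp add: path_step_def)
   also have "... = (\<integral>\<^sup>+y. indicator A (x(Suc n := y)) \<partial>prop_kernel S n x)"
    using Suc.prems by (intro nn_integral_path_step x) auto
   also have "... = (\<integral>\<^sup>+y. ennreal (prop_dens S (Suc n) (restrict x {blk_start S (blk S (Suc n))<..n}) y) * indicator A (x(Suc n := y)) \<partial>state_measure S)"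
    unfolding prop_kernel_def by (rule nn_integral_density) measurable
   finally show "p x * emeasure (path_step S 0 n x) A = (\<integral>\<^sup>+y. q (x(Suc n := y)) * indicator A (x(Suc n := y)) \<partial>state_measure S)"
    by (simp add: qp[OF x] mult.assoc nn_integral_cmult)
  qed
  also have "... = (\<integral>\<^sup>+x. q x * indicator A x \<partial>paths S {0<..Suc n})" unfolding paths_def ins
   by (rule product_nn_integral_insert[symmetric]) (use qm A in \<open>auto simp: paths_def ins\<close>)
  also have "... = emeasure (density (paths S {0<..Suc n}) q) A" by (rule emeasure_density[symmetric]) measurable
  finally show "emeasure (density (paths S {0<..n}) p \<bind> path_step S 0 n) A = emeasure (density (paths S {0<..Suc n}) q) A" .
 qed
 then show ?case by (simp add: IH q_def[abs_def])
qed

lemma prop_law_eq_run: "prop_law S = path_run S 0 0 (%_. undefined) (horizon S)" by (simp add: run_eq_density prop_law_def atLeast1AtMost_eq)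

lemma path_step_mrg:
 assumes a: "a <= b" "a = blk_start S (blk S (Suc b))" "b < horizon S"
  and x: "x : space (paths S {0<..a})" and y: "y : space (paths S {a<..b})"
 shows "path_step S 0 b (mrg a b x y) = distr (path_step S a b y) (paths S {0<..Suc b}) (mrg a (Suc b) x)"
proof -
 have "prop_kernel S b (mrg a b x y) = prop_kernel S b y" unfolding prop_kernel_def a(2)[symmetric] by (simp add: mrg_restrict_right)
 moreover have "mrg a (Suc b) x : paths S {a<..Suc b} \<rightarrow>\<^sub>M paths S {0<..Suc b}" using a(1) x by (intro measurable_mrg') auto
 moreover have "(%v. y(Suc b := v)) : prop_kernel S b y \<rightarrow>\<^sub>M paths S {a<..Suc b}"
  using measurable_paths_upd'[OF a(1) y] by (simp add: prop_kernel_def)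
 ultimately show ?thesis unfolding path_step_def by (subst distr_distr) (auto intro!: distr_cong simp: comp_def mrg_upd[OF a(1)])
qed

text \<open>Up to the end of its block a proposal sees no coordinate at or before the block start
  \<open>a\<close>. Extending a joined path is therefore the same as extending its block part and
  joining afterwards. All independence between blocks comes from here.\<close>

lemma run_mrg:
 assumes a: "a = j * T" and b: "a <= b" "b + n <= a + T" "b + n <= horizon S"
  and x: "x : space (paths S {0<..a})" and y: "y : space (paths S {a<..b})"
 shows "path_run S 0 b (mrg a b x y) n = distr (path_run S a b y n) (paths S {0<..b + n}) (mrg a (b + n) x)" using b(2,3)
proof (induction n)
 case 0
 have "mrg a b x : paths S {a<..b} \<rightarrow>\<^sub>M paths S {0<..b}" using b(1) x by (intro measurable_mrg') auto
 then show ?case using y by (simp add: distr_return)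
next
 case (Suc n)
 have bn: "blk_start S (blk S (Suc (b + k))) = a" if "k <= n" for k
 proof -
  have "(b + k) div T = j" using Suc.prems b(1) a that blk_len_pos by (intro div_nat_eqI) (auto simp: algebra_simps)
  then show ?thesis by (simp add: blk_start_blk_Suc a)
 qed
 have ab: "a <= blk_start S (blk S (Suc b))" using bn[of 0] by simp
 have s: "sets (path_run S a b y n) = sets (paths S {a<..b + n})" "space (path_run S a b y n) = space (paths S {a<..b + n})"
  and p: "prob_space (path_run S a b y n)"
  using sets_run[OF ab _ y, of n] space_run[OF ab _ y, of n] prob_space_run[OF ab _ y, of n] Suc.prems by auto
 have m: "mrg a (b + k) x : paths S {a<..b + k} \<rightarrow>\<^sub>M paths S {0<..b + k}" for k using b(1) x by (intro measurable_mrg') auto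
 have "path_run S 0 b (mrg a b x y) (Suc n) = distr (path_run S a b y n) (paths S {0<..b + n}) (mrg a (b + n) x) \<bind> path_step S 0 (b + n)"
  using Suc by simp
 also have "... = path_run S a b y n \<bind> (%y'. path_step S 0 (b + n) (mrg a (b + n) x y'))"
 proof (rule bind_distr)
  show "mrg a (b + n) x : path_run S a b y n \<rightarrow>\<^sub>M paths S {0<..b + n}" using m s(1) by (simp cong: mcs)
  show "path_step S 0 (b + n) : paths S {0<..b + n} \<rightarrow>\<^sub>M subprob_algebra (paths S {0<..Suc (b + n)})"
   using Suc.prems by (intro measurable_prob_algebraD path_step_kernel) auto
  show "space (path_run S a b y n) ~= {}" using p by (rule prob_space.not_empty)
 qed
 also have "... = path_run S a b y n \<bind> (%y'. distr (path_step S a (b + n) y') (paths S {0<..Suc (b + n)}) (mrg a (Suc (b + n)) x))"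
  using b(1) bn[of n] Suc.prems x s(2) by (intro bind_cong_All ballI path_step_mrg) auto
 also have "... = distr (path_run S a b y (Suc n)) (paths S {0<..Suc (b + n)}) (mrg a (Suc (b + n)) x)" unfolding path_run.simps
 proof (rule distr_bind[symmetric])
  show "path_step S a (b + n) : path_run S a b y n \<rightarrow>\<^sub>M subprob_algebra (paths S {a<..Suc (b + n)})"
   using measurable_prob_algebraD[OF path_step_kernel[of "b + n" a]] bn[of n] Suc.prems s(1) by (simp cong: mcs)
  show "space (path_run S a b y n) ~= {}" using p by (rule prob_space.not_empty)
  show "mrg a (Suc (b + n)) x : paths S {a<..Suc (b + n)} \<rightarrow>\<^sub>M paths S {0<..Suc (b + n)}" using m[of "Suc n"] by simp
 qed
 finally show ?case by simp
qed

end

subsection \<open>Marginals and normalising constants\<close>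

context smc_model begin

definition marg :: "nat => (nat => 'x) measure" where
 "marg t = path_run S 0 0 (%_. undefined) t"

lemma
 assumes "t <= horizon S"
 shows prob_space_marg: "prob_space (marg t)"
  and sets_marg [measurable_cong]: "sets (marg t) = sets (paths S {0<..t})"
  and space_marg: "space (marg t) = space (paths S {0<..t})"
  and marg_in_prob_algebra: "marg t : space (prob_algebra (paths S {0<..t}))"
 using assms prob_space_run[of 0 0 t] sets_run[of 0 0 t] space_run[of 0 0 t] in_prob_algebra_run[of 0 0 t] by (auto simp: marg_def space_paths_empty)

lemma marg_add: "t + k <= horizon S ==> marg (t + k) = marg t \<bind> (%z. path_run S 0 t z k)"
 using run_add[of 0 0 t k "%_. undefined"] by (simp add: marg_def space_paths_empty)

lemma prop_law_eq_bind: "t <= horizon S ==> prop_law S = marg t \<bind> (%z. path_run S 0 t z (horizon S - t))"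
 using marg_add[of t "horizon S - t"] by (simp add: prop_law_eq_run marg_def)

lemma prop_law_eq_marg: "prop_law S = marg (horizon S)" by (simp add: marg_def prop_law_eq_run)

lemma run_kernel0:
 "t + k <= horizon S ==> (%z. path_run S 0 t z k) : marg t \<rightarrow>\<^sub>M prob_algebra (paths S {0<..t + k})"
 using run_kernel[of 0 t k] by (simp cong: mcs add: sets_marg)

lemma distr_marg_restrict:
 assumes "t <= horizon S"
 shows "distr (prop_law S) (paths S {0<..t}) (%x. restrict x {0<..t}) = marg t"
proof -
 have k: "(%z. path_run S 0 t z (horizon S - t)) : marg t \<rightarrow>\<^sub>M subprob_algebra (paths S {0<..horizon S})"
  using measurable_prob_algebraD[OF run_kernel0[of t "horizon S - t"]] assms by simp
 have sub: "{0<..t} \<subseteq> {0<..horizon S}" using assms by auto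
 have "distr (prop_law S) (paths S {0<..t}) (%x. restrict x {0<..t})
  = marg t \<bind> (%z. distr (path_run S 0 t z (horizon S - t)) (paths S {0<..t}) (%x. restrict x {0<..t}))" unfolding prop_law_eq_bind[OF assms]
  by (rule distr_bind[OF k prob_space.not_empty[OF prob_space_marg[OF assms]] measurable_paths_restrict[OF sub]])
 also have "... = marg t \<bind> return (paths S {0<..t})" using distr_run_restrict[of 0 t "horizon S - t"] assms
  by (intro bind_cong_All ballI) (auto simp: space_marg)
 also have "... = marg t" by (rule bind_return'') (simp add: sets_marg assms)
 finally show ?thesis .
qed

lemma measurable_prop_law_restrict:
 "I \<subseteq> {0<..horizon S} ==> (%x. restrict x I) : prop_law S \<rightarrow>\<^sub>M paths S I"
 using measurable_paths_restrict[of I "{0<..horizon S}" S] by (simp cong: mcs add: prop_law_eq_marg sets_marg)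

lemma space_prop_law: "space (prop_law S) = space (paths S {0<..horizon S})" by (simp add: prop_law_eq_marg space_marg)

lemma prob_space_prop_law: "prob_space (prop_law S)" by (simp add: prop_law_eq_marg prob_space_marg)

lemma weight_at_restrict:
 "{blk_start S (blk S u)<..u} \<subseteq> I ==> weight_at S u (restrict x I) = weight_at S u x"
 by (simp add: weight_at_def Int_absorb2 Int_absorb1 restrict_restrict)

lemma weight_at_measurable:
 assumes "u : {1..horizon S}" "{blk_start S (blk S u)<..u} \<subseteq> I"
 shows "weight_at S u : bm (paths S I)"
 using mcomp[OF measurable_paths_restrict[OF assms(2)] weight_measurable[OF assms(1)]] unfolding weight_at_def[abs_def] .

lemma weight_at_pos:
 assumes "u : {1..horizon S}" "{blk_start S (blk S u)<..u} \<subseteq> I" "x : space (paths S I)"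
 shows "0 < weight_at S u x" unfolding weight_at_def by (rule weight_pos[OF assms(1) space_paths_restrict[OF assms(3,2)]])

lemma
 assumes t: "t <= horizon S"
 shows prod_weight_measurable: "(%x. \<Prod>u=1..t. weight_at S u x) : bm (paths S {0<..t})"
  and prod_weight_pos: "x : space (paths S {0<..t}) ==> 0 < (\<Prod>u=1..t. weight_at S u x)"
 using t by (auto intro!: borel_measurable_prod prod_pos weight_at_measurable weight_at_pos[where I="{0<..t}"])

lemma prod_weight_restrict:
 "t <= b ==> (\<Prod>u=1..t. weight_at S u (restrict x {0<..b})) = (\<Prod>u=1..t. weight_at S u x)" by (intro prod.cong refl weight_at_restrict) auto

lemma nn_integral_prod_weight:
 assumes t: "t <= horizon S"
 shows "(\<integral>\<^sup>+x. (\<Prod>u=1..t. weight_at S u x) \<partial>marg t) = eta S t" and "0 < eta S t"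
proof -
 interpret marg: prob_space "marg t" by (rule prob_space_marg[OF t])
 note [measurable] = prod_weight_measurable[OF t]
 have sub: "{0<..t} \<subseteq> {0<..horizon S}" using t by auto
 note [measurable] = measurable_prop_law_restrict[OF sub]
 have i: "integrable (prop_law S) (%x. \<Prod>u=1..t. weight_at S u x)"
 proof (cases "t = 0")
  \<comment> \<open>\<open>weight_integrable\<close> begins at time 1; for \<open>t = 0\<close> the
    empty product is constant.\<close>
  case True
  then show ?thesis using prob_space_prop_law by (auto intro: finite_measure.integrable_const prob_space.finite_measure)
 next
  case False then show ?thesis using t by (intro weight_integrable) auto
 qed
 have nn: "0 <= (\<Prod>u=1..t. weight_at S u x)" if "x : space (prop_law S)" for x
 proof (intro prod_nonneg ballI)
  fix u assume u: "u : {1..t}"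
  have "{blk_start S (blk S u)<..u} \<subseteq> {0<..horizon S}" using u t by auto
  then have "0 < weight_at S u x" using that t u by (intro weight_at_pos[where I="{0<..horizon S}"]) (auto simp: space_prop_law)
  then show "0 <= weight_at S u x" by simp
 qed
 have "ennreal (eta S t) = (\<integral>\<^sup>+x. (\<Prod>u=1..t. weight_at S u x) \<partial>prop_law S)"
  unfolding eta_def using i nn by (intro nn_integral_eq_integral[symmetric]) auto
 also have "... = (\<integral>\<^sup>+x. (\<Prod>u=1..t. weight_at S u (restrict x {0<..t})) \<partial>prop_law S)"
  by (simp add: prod_weight_restrict)
 also have "... = (\<integral>\<^sup>+x. (\<Prod>u=1..t. weight_at S u x) \<partial>marg t)" unfolding distr_marg_restrict[OF t, symmetric]
  by (subst nn_integral_distr) auto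
 finally show 1: "(\<integral>\<^sup>+x. (\<Prod>u=1..t. weight_at S u x) \<partial>marg t) = eta S t" by simp
 have "eta S t ~= 0"
 proof
  assume "eta S t = 0"
  moreover have "(%x. ennreal (\<Prod>u=1..t. weight_at S u x)) : bm (marg t)"
   unfolding mcs[OF sets_marg[OF t] refl] by measurable
  ultimately have "AE x in marg t. ennreal (\<Prod>u=1..t. weight_at S u x) = 0"
   using 1 nn_integral_0_iff_AE[of "%x. ennreal (\<Prod>u=1..t. weight_at S u x)" "marg t"] by simp
  then have "AE x in marg t. False"
   by (rule AE_mp) (use t prod_weight_pos[OF t] in \<open>auto simp: space_marg intro!: AE_I2 simp: ennreal_eq_0_iff not_le\<close>)
  then show False by simp
 qed
 moreover have "0 <= eta S t" unfolding eta_def using nn by (intro integral_nonneg_AE AE_I2) auto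
 ultimately show "0 < eta S t" by simp
qed

end

subsection \<open>The laws of a single block\<close>

locale smc_block = smc_model S for S :: "('x, 'y) smc" +
 fixes m :: nat
 assumes m: "m : {1..n_blocks S}"
begin

abbreviation a :: nat where "a \<equiv> blk_start S m"

lemma a_eq: "a = (m - 1) * T" by (simp add: blk_start_def)

lemma a_T_le: "a + T <= horizon S"
proof -
 have "a + T = m * T" using m by (cases m) (auto simp: blk_start_def)
 also have "... <= horizon S" using m by (simp add: horizon_def)
 finally show ?thesis .
qed

lemma a_n_le: "n <= T ==> a + n <= horizon S" using a_T_le by simp

lemma blk_a: "n < T ==> blk S (Suc (a + n)) = m" using m by (cases m) (auto simp: blk_def blk_start_def)

lemma a_le_start: "a <= blk_start S (blk S (Suc (a + n)))"
 using blk_start_blk_mono[of a "a + n"] blk_a[of 0] blk_len_pos by (simp add: blk_start_blk_Suc a_eq)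

lemma blk_a': "u : {a<..a + T} ==> blk S u = m" using blk_a[of "u - Suc a"] by (auto simp: Suc_le_eq)

definition Q :: "nat => (nat => 'x) measure" where
 "Q n = path_run S a a (%_. undefined) n"

abbreviation B :: "nat => (nat => 'x) measure" where
 "B n \<equiv> paths S {a<..a + n}"

lemma
 assumes "n <= T"
 shows prob_space_Q: "prob_space (Q n)"
  and sets_Q [measurable_cong]: "sets (Q n) = sets (B n)"
  and space_Q: "space (Q n) = space (B n)"
  and Q_in_prob_algebra: "Q n : space (prob_algebra (B n))"
 using prob_space_run[of a a n] sets_run[of a a n] space_run[of a a n] in_prob_algebra_run[of a a n]
  a_n_le[OF assms] a_le_start[of 0] by (auto simp: Q_def space_paths_empty)

lemma Q_Suc: "Q (Suc n) = Q n \<bind> path_step S a (a + n)" by (simp add: Q_def)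

lemma run_kernel_a:
 assumes "n + k <= T"
 shows "(%z. path_run S a (a + n) z k) : B n \<rightarrow>\<^sub>M prob_algebra (B (n + k))"
 using run_kernel[OF a_le_start[of n], of k] a_n_le[OF assms] by (simp add: add.assoc)

lemma step_kernel_a: "n < T ==> path_step S a (a + n) : B n \<rightarrow>\<^sub>M prob_algebra (B (Suc n))"
 using path_step_kernel[OF _ a_le_start[of n]] a_n_le[of "Suc n"] by simp

lemma Q_add: "n + k <= T ==> Q (n + k) = Q n \<bind> (%z. path_run S a (a + n) z k)"
 unfolding Q_def using run_add[OF _ _, of a a n k "%_. undefined"] a_le_start[of 0] a_n_le[of "n + k"] by (simp add: space_paths_empty)

lemma nn_integral_Q_Suc:
 assumes n: "n < T" and f[measurable]: "f : bm (B (Suc n))"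
 shows "(\<integral>\<^sup>+x. f x \<partial>Q (Suc n)) = (\<integral>\<^sup>+z. \<integral>\<^sup>+x. f x \<partial>path_step S a (a + n) z \<partial>Q n)"
proof -
 have "path_step S a (a + n) : Q n \<rightarrow>\<^sub>M subprob_algebra (B (Suc n))"
  using measurable_prob_algebraD[OF step_kernel_a[OF n]] n by (simp cong: mcs add: sets_Q)
 then show ?thesis unfolding Q_Suc by (rule nn_integral_bind[OF f])
qed

lemma
 fixes f :: "_ => real"
 assumes n: "n < T" and f: "integrable (Q (Suc n)) f"
 shows AE_integrable_step: "AE z in Q n. integrable (path_step S a (a + n) z) f"
  and integrable_step: "integrable (Q n) (%z. LINT x|path_step S a (a + n) z. f x)"
  and integral_Q_Suc: "(LINT x|Q (Suc n). f x) = (LINT z|Q n. LINT x|path_step S a (a + n) z. f x)"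
proof -
 have k: "path_step S a (a + n) : Q n \<rightarrow>\<^sub>M prob_algebra (B (Suc n))"
  using step_kernel_a[OF n] n by (simp cong: mcs add: sets_Q)
 have ne: "space (Q n) ~= {}" using n by (intro prob_space.not_empty prob_space_Q) simp
 show "AE z in Q n. integrable (path_step S a (a + n) z) f"
  and "integrable (Q n) (%z. LINT x|path_step S a (a + n) z. f x)"
  and "(LINT x|Q (Suc n). f x) = (LINT z|Q n. LINT x|path_step S a (a + n) z. f x)"
  using AE_integrable_bind[OF k ne] integrable_integral_bind[OF k ne] integral_bind[OF k ne] f unfolding Q_Suc by blast+
qed

text \<open>The kernel depends on \<open>x\<close> only through the joining map: the block path has
  law \<open>Q n\<close> whatever the past.\<close>

lemma marg_block:
 assumes n: "n <= T"
 shows "marg (a + n) = marg a \<bind> (%x. distr (Q n) (paths S {0<..a + n}) (mrg a (a + n) x))"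
proof -
 have "path_run S 0 a x n = distr (Q n) (paths S {0<..a + n}) (mrg a (a + n) x)" if x: "x : space (marg a)" for x
 proof -
  have x: "x : space (paths S {0<..a})" using x a_T_le by (simp add: space_marg)
  then show ?thesis using run_mrg[OF a_eq, of a n x "%_. undefined"] n a_n_le[OF n] by (simp add: Q_def mrg_self space_paths_empty)
 qed
 then show ?thesis unfolding marg_add[OF a_n_le[OF n]] by (intro bind_cong_All ballI)
qed

lemma marg_block_kernel:
 assumes n: "n <= T"
 shows "(%x. distr (Q n) (paths S {0<..a + n}) (mrg a (a + n) x)) : marg a \<rightarrow>\<^sub>M prob_algebra (paths S {0<..a + n})"
proof (rule measurable_distr_prob_space2)
 show "(%x. Q n) : marg a \<rightarrow>\<^sub>M prob_algebra (B n)" using Q_in_prob_algebra[OF n] by simp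
 show "(%(x, y). mrg a (a + n) x y) : marg a \<Otimes>\<^sub>M B n \<rightarrow>\<^sub>M paths S {0<..a + n}"
  using measurable_mrg[of a "a + n" S] a_T_le by (simp cong: mcs add: sets_marg)
qed

lemma nn_integral_marg_block:
 assumes n: "n <= T" and f[measurable]: "f : bm (paths S {0<..a + n})"
 shows "(\<integral>\<^sup>+x. f x \<partial>marg (a + n)) = (\<integral>\<^sup>+x. \<integral>\<^sup>+y. f (mrg a (a + n) x y) \<partial>Q n \<partial>marg a)"
proof -
 have "(\<integral>\<^sup>+x. f x \<partial>marg (a + n)) = (\<integral>\<^sup>+x. \<integral>\<^sup>+y. f y \<partial>distr (Q n) (paths S {0<..a + n}) (mrg a (a + n) x) \<partial>marg a)"
  unfolding marg_block[OF n] by (rule nn_integral_bind[OF f measurable_prob_algebraD[OF marg_block_kernel[OF n]]])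
 also have "... = (\<integral>\<^sup>+x. \<integral>\<^sup>+y. f (mrg a (a + n) x y) \<partial>Q n \<partial>marg a)"
 proof (intro nn_integral_cong nn_integral_distr)
  fix x assume "x : space (marg a)"
  then have "mrg a (a + n) x : B n \<rightarrow>\<^sub>M paths S {0<..a + n}" using a_T_le by (intro measurable_mrg') (auto simp: space_marg)
  then show "mrg a (a + n) x : Q n \<rightarrow>\<^sub>M paths S {0<..a + n}" using n by (simp cong: mcs add: sets_Q)
 qed (simp add: f)
 finally show ?thesis .
qed

definition W :: "nat => (nat => 'x) => real" where
 "W n x = (\<Prod>u\<in>{a<..a + n}. weight_at S u x)"

abbreviation h :: "nat => (nat => 'x) => real" where
 "h n \<equiv> h_blk S m (a + n)"

abbreviation Z :: "nat => real" where
 "Z n \<equiv> eta_blk S m (a + n)"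

lemma h_eq: "h n x = Z n / W n x" by (simp add: h_blk_def W_def)

lemma weight_idx:
 assumes "u : {a<..a + n}" "n <= T"
 shows "u : {1..horizon S}" and "n <= k ==> {blk_start S (blk S u)<..u} \<subseteq> {a<..a + k}"
proof -
 have "blk S u = m" using assms by (intro blk_a') auto
 then show "u : {1..horizon S}" and "n <= k ==> {blk_start S (blk S u)<..u} \<subseteq> {a<..a + k}" using assms a_n_le[of n] by auto
qed

lemma W_measurable [measurable]: "n <= T ==> n <= k ==> W n : bm (B k)" unfolding W_def[abs_def] using weight_idx
 by (intro borel_measurable_prod weight_at_measurable) blast+

lemma W_pos: "n <= T ==> n <= k ==> x : space (B k) ==> 0 < W n x" unfolding W_def using weight_idx
 by (intro prod_pos ballI weight_at_pos[where I="{a<..a + k}"]) blast+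

lemma W_restrict: "n <= T ==> W n (restrict x {a<..a + n}) = W n x"
 unfolding W_def using weight_idx(2)[OF _ _ order_refl] by (intro prod.cong refl weight_at_restrict) blast+

lemma W_0 [simp]: "W 0 x = 1" by (simp add: W_def)

lemma W_Suc: "n < T ==> x : space (B (Suc n)) ==> W (Suc n) x = W n x * weight S (Suc (a + n)) x"
 by (simp add: W_def greaterThanAtMost_Suc_eq weight_at_def blk_a restrict_space_paths[of x S "{a<..Suc (a + n)}", unfolded greaterThanAtMost_Suc_eq[OF le_add1]])

lemma Z_pos: "n <= T ==> 0 < Z n" using nn_integral_prod_weight(2)[of "a + n"] nn_integral_prod_weight(2)[of a] a_n_le[of n]
 by (simp add: eta_blk_def)

lemma Z_0 [simp]: "eta_blk S m a = 1" using nn_integral_prod_weight(2)[of a] a_T_le by (simp add: eta_blk_def)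

lemma prod_weight_mrg:
 assumes n: "n <= T"
 shows "(\<Prod>u=1..a + n. weight_at S u (mrg a (a + n) x y)) = (\<Prod>u=1..a. weight_at S u x) * W n y"
proof -
 have "{1..a + n} = {1..a} \<union> {a<..a + n}" by auto
 then have "(\<Prod>u=1..a + n. weight_at S u (mrg a (a + n) x y))
  = (\<Prod>u=1..a. weight_at S u (mrg a (a + n) x y)) * (\<Prod>u\<in>{a<..a + n}. weight_at S u (mrg a (a + n) x y))"
  by (simp add: prod.union_disjoint ivl_disj_int)
 also have "(\<Prod>u=1..a. weight_at S u (mrg a (a + n) x y)) = (\<Prod>u=1..a. weight_at S u x)"
  unfolding weight_at_def by (intro prod.cong refl arg_cong[where f="weight S _"] mrg_restrict_left) auto
 also have "(\<Prod>u\<in>{a<..a + n}. weight_at S u (mrg a (a + n) x y)) = W n y" unfolding W_def weight_at_def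
  using weight_idx(2)[OF _ n order_refl] by (intro prod.cong refl arg_cong[where f="weight S _"] mrg_restrict_right) blast
 finally show ?thesis .
qed

text \<open>\<open>Z n\<close> is by definition a quotient of global constants. Independence of the
  block from its past makes \<open>eta S (a + n)\<close> a product, so that the quotient normalises
  the weights of the block.\<close>

lemma nn_integral_W: assumes n: "n <= T" shows "(\<integral>\<^sup>+y. W n y \<partial>Q n) = Z n"
proof -
 have an: "a + n <= horizon S" and a0: "a <= horizon S" using a_n_le[OF n] by auto
 note [measurable] = prod_weight_measurable[OF an] prod_weight_measurable[OF a0]
 have Wm[measurable]: "W n : bm (Q n)" using n by (simp cong: mcs add: sets_Q)
 have "ennreal (eta S (a + n)) = (\<integral>\<^sup>+x. (\<Prod>u=1..a + n. weight_at S u x) \<partial>marg (a + n))"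
  using nn_integral_prod_weight(1)[OF an] by simp
 also have "... = (\<integral>\<^sup>+x. \<integral>\<^sup>+y. ennreal ((\<Prod>u=1..a. weight_at S u x) * W n y) \<partial>Q n \<partial>marg a)"
  by (subst nn_integral_marg_block[OF n]) (auto simp: prod_weight_mrg[OF n])
 also have "... = (\<integral>\<^sup>+x. ennreal (\<Prod>u=1..a. weight_at S u x) * (\<integral>\<^sup>+y. W n y \<partial>Q n) \<partial>marg a)"
  using prod_weight_pos[OF a0] a0 by (intro nn_integral_cong, subst nn_integral_cmult[symmetric]) (auto simp: space_marg ennreal_mult' less_imp_le)
 also have "... = (\<integral>\<^sup>+x. ennreal (\<Prod>u=1..a. weight_at S u x) \<partial>marg a) * (\<integral>\<^sup>+y. W n y \<partial>Q n)"
  by (rule nn_integral_multc) (use a0 in \<open>simp cong: mcs add: sets_marg\<close>)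
 also have "(\<integral>\<^sup>+x. ennreal (\<Prod>u=1..a. weight_at S u x) \<partial>marg a) = eta S a" by (rule nn_integral_prod_weight(1)[OF a0])
 finally have e: "ennreal (eta S (a + n)) = ennreal (eta S a) * (\<integral>\<^sup>+y. W n y \<partial>Q n)" .
 have p: "0 < eta S a" by (rule nn_integral_prod_weight(2)[OF a0])
 have "(\<integral>\<^sup>+y. W n y \<partial>Q n) ~= \<top>"
 proof
  assume "(\<integral>\<^sup>+y. W n y \<partial>Q n) = \<top>"
  with e p show False by (simp add: ennreal_mult_top)
 qed
 then obtain r where r: "(\<integral>\<^sup>+y. W n y \<partial>Q n) = ennreal r" "0 <= r" by (cases "\<integral>\<^sup>+y. W n y \<partial>Q n") auto
 have "eta S (a + n) = eta S a * r" using e p r nn_integral_prod_weight(2)[OF an] by (simp add: ennreal_mult[symmetric] ennreal_inj)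
 then show ?thesis using p r by (simp add: eta_blk_def)
qed

lemma h_measurable [measurable]: "n <= T ==> n <= k ==> h n : bm (B k)" unfolding h_eq[abs_def] by measurable

lemma h_pos: "n <= T ==> n <= k ==> x : space (B k) ==> 0 < h n x" unfolding h_eq by (intro divide_pos_pos Z_pos W_pos)

lemma h_restrict: "n <= T ==> h n (restrict x {a<..a + n}) = h n x" by (simp add: h_eq W_restrict)

lemma h_0 [simp]: "h_blk S m a x = 1" using h_eq[of 0 x] by simp

lemma h_Suc:
 assumes n: "n < T" and x: "x : space (B (Suc n))"
 shows "h (Suc n) x * weight S (Suc (a + n)) x * Z n = h n x * Z (Suc n)"
proof -
 have "W n x > 0" "W (Suc n) x > 0" using n x by (auto intro!: W_pos[where k="Suc n"])
 then have "W n x ~= 0" "weight S (Suc (a + n)) x ~= 0" unfolding W_Suc[OF n x] by auto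
 then show ?thesis unfolding h_eq W_Suc[OF n x] by simp
qed

text \<open>\<open>1 / h n\<close> equals \<open>W n / Z n\<close>, a probability density with
  respect to \<open>Q n\<close>. It is the density of the law that the resampled particles
  approach.\<close>

lemma inverse_h_integral:
 assumes n: "n <= T"
 shows "integrable (Q n) (%x. 1 / h n x)" and "(LINT x|Q n. 1 / h n x) = 1"
proof -
 have [measurable]: "h n : bm (Q n)" "W n : bm (Q n)" using n by (simp_all cong: mcs add: sets_Q)
 have "(\<integral>\<^sup>+x. ennreal (1 / h n x) \<partial>Q n) = (\<integral>\<^sup>+x. ennreal (1 / Z n) * W n x \<partial>Q n)"
  using Z_pos[OF n] by (intro nn_integral_cong) (simp add: h_eq ennreal_mult'[symmetric])
 also have "... = ennreal (1 / Z n) * Z n" using n by (subst nn_integral_cmult) (auto simp: nn_integral_W)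
 also have "... = 1" using Z_pos[OF n] by (simp add: ennreal_mult'[symmetric])
 finally have 1: "(\<integral>\<^sup>+x. ennreal (1 / h n x) \<partial>Q n) = 1" .
 have nn: "AE x in Q n. 0 <= 1 / h n x" using h_pos[OF n order_refl] n by (intro AE_I2) (auto simp: space_Q intro: less_imp_le)
 show "integrable (Q n) (%x. 1 / h n x)" by (rule integrableI_nonneg[OF _ nn]) (auto simp: 1)
 show "(LINT x|Q n. 1 / h n x) = 1" by (subst integral_eq_nn_integral[OF _ nn]) (auto simp: 1)
qed

end

subsection \<open>The particle filter of a block\<close>

context smc_block begin

declare add_Suc_right [simp del]

abbreviation E :: "nat => ((nat => 'x) \<times> real) measure" where
 "E n \<equiv> B n \<Otimes>\<^sub>M borel"

abbreviation clouds :: "nat => nat => (nat => (nat => 'x) \<times> real) measure" where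
 "clouds K n \<equiv> PiM {1..K} (%_. E n)"

definition prop_move :: "nat => (nat => (nat => 'x) \<times> real) => nat => ((nat => 'x) \<times> real) measure" where
 "prop_move n c k = distr (path_step S a (a + n) (fst (c k))) (E (Suc n)) (%x. (x, snd (c k)))"

abbreviation nw :: "nat => nat => (nat => (nat => 'x) \<times> real) => nat => real" where
 "nw K n c \<equiv> norm_weight S K (Suc (a + n)) (%k. fst (c k))"

definition res_move :: "nat => nat => (nat => (nat => 'x) \<times> real) => ((nat => 'x) \<times> real) measure" where
 "res_move K n c = distr (point_measure {1..K} (%j. ennreal (nw K n c j))) (E (Suc n))
  (%j. (fst (c j), snd (c j) / (real K * nw K n c j)))"

definition law :: "nat => nat => (nat => (nat => 'x) \<times> real) measure" where
 "law n K = filter_law S K m n"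

text \<open>The law between the proposals and the resampling. Cutting each stage in two makes both
  halves instances of \<open>particle_step\<close>, and they produce the odd and the even terms of
  the variance.\<close>

definition plaw :: "nat => nat => (nat => (nat => 'x) \<times> real) measure" where
 "plaw n K = law n K \<bind> (%c. PiM {1..K} (prop_move n c))"

lemma cloud_component:
 assumes "c : space (clouds K n)" "k : {1..K}"
 shows "fst (c k) : space (B n)" using assms by (auto simp: space_PiM space_pair_measure PiE_iff mem_Times_iff)

lemma weight_cloud_pos:
 assumes n: "n < T" and x: "x : space (B (Suc n))"
 shows "0 < weight S (Suc (a + n)) x" using weight_pos[of "Suc (a + n)" x] x a_n_le[of "Suc n"] n by (simp add: blk_a add_Suc_right)

lemma weight_cloud_measurable [measurable]:
 assumes n: "n < T"
 shows "weight S (Suc (a + n)) : bm (B (Suc n))"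
 using weight_measurable[of "Suc (a + n)"] a_n_le[of "Suc n"] n by (simp add: blk_a add_Suc_right)

lemma nw_eq: "K >= 1 ==> nw K n c j = weight S (Suc (a + n)) (fst (c j)) / (\<Sum>k=1..K. weight S (Suc (a + n)) (fst (c k)))"
 by (simp add: norm_weight_def)

lemma
 assumes n: "n < T" and c: "c : space (clouds K (Suc n))" and K: "K >= 1"
 shows sum_weight_pos: "0 < (\<Sum>k=1..K. weight S (Suc (a + n)) (fst (c k)))"
  and nw_pos: "j : {1..K} ==> 0 < nw K n c j"
  and sum_nw: "(\<Sum>j=1..K. nw K n c j) = 1"
proof -
 have w: "0 < weight S (Suc (a + n)) (fst (c k))" if "k : {1..K}" for k using cloud_component[OF c that] by (intro weight_cloud_pos n)
 show 1: "0 < (\<Sum>k=1..K. weight S (Suc (a + n)) (fst (c k)))" using K w by (intro sum_pos) auto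
 show "0 < nw K n c j" if "j : {1..K}" using w[OF that] 1 by (simp add: nw_eq[OF K])
 show "(\<Sum>j=1..K. nw K n c j) = 1" using 1 by (simp add: nw_eq[OF K] flip: sum_divide_distrib)
qed

lemma res_move_measurable:
 "(%j. (fst (c j), snd (c j) / (real K * nw K n c j))) : {1..K} \<rightarrow> space (E (Suc n)) ==>
  (%j. (fst (c j), snd (c j) / (real K * nw K n c j))) : point_measure {1..K} f \<rightarrow>\<^sub>M E (Suc n)"
 by (simp add: measurable_point_measure_eq1)

lemma res_move_map:
 assumes c: "c : space (clouds K (Suc n))"
 shows "(%j. (fst (c j), snd (c j) / (real K * nw K n c j))) : point_measure {1..K} f \<rightarrow>\<^sub>M E (Suc n)"
 using cloud_component[OF c] by (intro res_move_measurable) (auto simp: space_pair_measure)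

lemma nn_integral_res_move:
 assumes n: "n < T" and c: "c : space (clouds K (Suc n))" and K: "K >= 1" and f: "f : bm (E (Suc n))"
 shows "(\<integral>\<^sup>+x. f x \<partial>res_move K n c) = (\<Sum>j=1..K. ennreal (nw K n c j) * f (fst (c j), snd (c j) / (real K * nw K n c j)))"
 unfolding res_move_def by (subst nn_integral_distr[OF res_move_map[OF c]])
  (simp_all add: f nn_integral_point_measure_finite mult.commute)

lemma
 fixes f :: "_ => real"
 assumes n: "n < T" and c: "c : space (clouds K (Suc n))" and K: "K >= 1" and f: "f : bm (E (Suc n))"
 shows integral_res_move: "(LINT x|res_move K n c. f x) = (\<Sum>j=1..K. nw K n c j * f (fst (c j), snd (c j) / (real K * nw K n c j)))"
  and integrable_res_move: "integrable (res_move K n c) f"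
proof -
 have nn: "0 <= nw K n c j" if "j : {1..K}" for j using nw_pos[OF n c K that] by simp
 show "(LINT x|res_move K n c. f x) = (\<Sum>j=1..K. nw K n c j * f (fst (c j), snd (c j) / (real K * nw K n c j)))" unfolding res_move_def
  by (subst integral_distr[OF res_move_map[OF c] f], subst lebesgue_integral_point_measure_finite) (auto simp: nn)
 show "integrable (res_move K n c) f" unfolding res_move_def integrable_distr_eq[OF res_move_map[OF c] f]
  by (rule integrable_point_measure_finite) auto
qed

lemma prob_space_res_point:
 assumes n: "n < T" and c: "c : space (clouds K (Suc n))" and K: "K >= 1"
 shows "prob_space (point_measure {1..K} (%j. ennreal (nw K n c j)))"
proof
 have "emeasure (point_measure {1..K} (%j. ennreal (nw K n c j))) {1..K} = (\<Sum>j=1..K. ennreal (nw K n c j))"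
  by (rule emeasure_point_measure_finite) auto
 also have "... = ennreal (\<Sum>j=1..K. nw K n c j)" using nw_pos[OF n c K] by (intro sum_ennreal) (auto intro: less_imp_le)
 finally show "emeasure (point_measure {1..K} (%j. ennreal (nw K n c j))) (space (point_measure {1..K} (%j. ennreal (nw K n c j)))) = 1"
  by (simp add: sum_nw[OF n c K] space_point_measure)
qed

lemma weight_comp_measurable:
 "n < T ==> k : {1..K} ==> (%c. weight S (Suc (a + n)) (fst (c k))) : bm (clouds K (Suc n))"
 by (rule mcomp[OF _ weight_cloud_measurable]) auto

lemma nw_measurable:
 assumes n: "n < T" and j: "j : {1..K}"
 shows "(%c. nw K n c j) : bm (clouds K (Suc n))"
proof -
 have "1 <= K" using j by simp
 then show ?thesis
  unfolding nw_eq[OF \<open>1 \<le> K\<close>] using weight_comp_measurable[OF n] j by (intro borel_measurable_divide borel_measurable_sum) auto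
qed

lemma res_move_kernel:
 assumes n: "n < T" and K: "K >= 1"
 shows "res_move K n : clouds K (Suc n) \<rightarrow>\<^sub>M prob_algebra (E (Suc n))"
proof (rule measurable_prob_algebraI)
 fix c assume c: "c : space (clouds K (Suc n))"
 show "prob_space (res_move K n c)" unfolding res_move_def by (rule prob_space.prob_space_distr[OF prob_space_res_point[OF n c K] res_move_map[OF c]])
next
 show "res_move K n : clouds K (Suc n) \<rightarrow>\<^sub>M subprob_algebra (E (Suc n))"
 proof (rule measurable_subprob_algebra)
  fix c assume c: "c : space (clouds K (Suc n))"
  show "subprob_space (res_move K n c)" unfolding res_move_def
   by (rule prob_space_imp_subprob_space[OF prob_space.prob_space_distr[OF prob_space_res_point[OF n c K] res_move_map[OF c]]])
  show "sets (res_move K n c) = sets (E (Suc n))" by (simp add: res_move_def)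
 next
  fix A assume A[measurable]: "A : sets (E (Suc n))"
  have "(%c. \<Sum>j=1..K. ennreal (nw K n c j) * indicator A (fst (c j), snd (c j) / (real K * nw K n c j))) : bm (clouds K (Suc n))"
  proof (rule borel_measurable_sum)
   fix j assume j: "j : {1..K}"
   have cj: "(%c. c j) : clouds K (Suc n) \<rightarrow>\<^sub>M E (Suc n)" by (rule measurable_component_singleton[OF j])
   note [measurable] = nw_measurable[OF n j]
   have "(%c. (fst (c j), snd (c j) / (real K * nw K n c j))) : clouds K (Suc n) \<rightarrow>\<^sub>M E (Suc n)"
    by (intro measurable_Pair mcomp[OF cj measurable_fst] borel_measurable_divide
      mcomp[OF cj measurable_snd] borel_measurable_times borel_measurable_const nw_measurable[OF n j])
   from mcomp[OF this borel_measurable_indicator[OF A, where 'b=ennreal]]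
   show "(%c. ennreal (nw K n c j) * indicator A (fst (c j), snd (c j) / (real K * nw K n c j))) : bm (clouds K (Suc n))" by measurable
  qed
  then show "(%c. emeasure (res_move K n c) A) : bm (clouds K (Suc n))"
  proof (rule measurable_cong[THEN iffD2, rotated])
   fix c assume c: "c : space (clouds K (Suc n))"
   have "emeasure (res_move K n c) A = (\<integral>\<^sup>+x. indicator A x \<partial>res_move K n c)"
    by (rule nn_integral_indicator[symmetric]) (simp add: res_move_def)
   then show "emeasure (res_move K n c) A = (\<Sum>j=1..K. ennreal (nw K n c j) * indicator A (fst (c j), snd (c j) / (real K * nw K n c j)))"
    by (simp add: nn_integral_res_move[OF n c K])
  qed
 qed
qed

lemma prop_move_map:
 assumes n: "n < T" and x: "x : space (B n)"
 shows "(%x. (x, r)) : path_step S a (a + n) x \<rightarrow>\<^sub>M E (Suc n)" using measurable_space[OF step_kernel_a[OF n] x]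
 by (simp add: space_prob_algebra cong: mcs)

lemma
 fixes f :: "_ => real"
 assumes n: "n < T" and c: "c : space (clouds K n)" and k: "k : {1..K}"
 shows nn_integral_prop_move: "g : bm (E (Suc n)) ==> (\<integral>\<^sup>+x. g x \<partial>prop_move n c k) = (\<integral>\<^sup>+x. g (x, snd (c k)) \<partial>path_step S a (a + n) (fst (c k)))"
  and integral_prop_move: "f : bm (E (Suc n)) ==> (LINT x|prop_move n c k. f x) = (LINT x|path_step S a (a + n) (fst (c k)). f (x, snd (c k)))"
  and integrable_prop_move: "f : bm (E (Suc n)) ==> integrable (prop_move n c k) f \<longleftrightarrow> integrable (path_step S a (a + n) (fst (c k))) (%x. f (x, snd (c k)))"
 using prop_move_map[OF n cloud_component[OF c k]] by (auto simp: prop_move_def nn_integral_distr integral_distr integrable_distr_eq)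

lemma prop_move_kernel:
 assumes n: "n < T" and k: "k : {1..K}"
 shows "(%c. prop_move n c k) : clouds K n \<rightarrow>\<^sub>M prob_algebra (E (Suc n))" unfolding prop_move_def
proof (rule measurable_distr_prob_space2)
 have fs: "(%c. fst (c k)) : clouds K n \<rightarrow>\<^sub>M B n" "(%c. snd (c k)) : clouds K n \<rightarrow>\<^sub>M borel"
  using measurable_component_singleton[OF k, of "%_. E n"] by measurable
 show "(%c. path_step S a (a + n) (fst (c k))) : clouds K n \<rightarrow>\<^sub>M prob_algebra (B (Suc n))"
  by (rule mcomp[OF fs(1) step_kernel_a[OF n]])
 show "(%(c, x). (x, snd (c k))) : clouds K n \<Otimes>\<^sub>M B (Suc n) \<rightarrow>\<^sub>M E (Suc n)" using fs(2) by measurable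
qed

lemma prop_kernel_clouds:
 "n < T ==> (%c. PiM {1..K} (prop_move n c)) : clouds K n \<rightarrow>\<^sub>M prob_algebra (clouds K (Suc n))"
 by (rule measurable_PiM_kernel) (auto intro: prop_move_kernel)

text \<open>No lower bound on \<open>K\<close> is required: for \<open>K = 0\<close> the product is
  over the empty index set.\<close>

lemma res_kernel_clouds:
 "n < T ==> (%c. PiM {1..K} (%_. res_move K n c)) : clouds K (Suc n) \<rightarrow>\<^sub>M prob_algebra (clouds K (Suc n))"
 by (rule measurable_PiM_kernel) (auto intro: res_move_kernel)

lemma cloud_space_eq: "cloud_space S K m (a + n) = clouds K n" by (simp add: cloud_space_def)

text \<open>The algorithm draws the vector of states, then the vector of ancestor indices, and
  assembles the cloud at the end. Pushing both product measures forward componentwise shows that the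
  particles are independent given the past, first after the proposals and again after the
  resampling.\<close>

lemma filter_step_eq:
 assumes n: "n < T" and c: "c : space (clouds K n)"
 shows "filter_step S K m (Suc (a + n)) c = PiM {1..K} (prop_move n c) \<bind> (%c'. PiM {1..K} (%_. res_move K n c'))"
proof -
 let ?I = "{1..K}" and ?t = "Suc (a + n)"
 define kp where "kp k = density (state_measure S) (%v. ennreal (prop_dens S ?t (fst (c k)) v))" for k
 have kap: "prop_kernel S (a + n) (fst (c k)) = kp k" if "k : ?I" for k
  using restrict_space_paths[OF cloud_component[OF c that]] n by (simp add: prop_kernel_def kp_def blk_a)
 have pk: "prob_space (kp k)" "sets (kp k) = sets (state_measure S)" if k: "k : ?I" for k
  using measurable_space[OF prop_kernel[OF _ a_le_start[of n]] cloud_component[OF c k]] a_n_le[of "Suc n"] n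
  by (auto simp: space_prob_algebra kap[OF k])
 have sp: "sets (PiM ?I kp) = sets (PiM ?I (%_. state_measure S))" by (intro sets_PiM_cong) (auto simp: pk)
 have upd: "(%y. (fst (c k))(?t := y)) : state_measure S \<rightarrow>\<^sub>M B (Suc n)" if "k : ?I" for k
  using measurable_paths_upd'[OF _ cloud_component[OF c that]] by (simp add: add_Suc_right)
 have m1: "(%y. ((fst (c k))(?t := y), snd (c k))) : kp k \<rightarrow>\<^sub>M E (Suc n)" if k: "k : ?I" for k
  using upd[OF k] unfolding mcs[OF pk(2)[OF k] refl] by measurable
 define z where "z y = (\<lambda>k\<in>?I. ((fst (c k))(?t := y k), snd (c k)))" for y
 have "PiM ?I (prop_move n c) = PiM ?I (%k. distr (kp k) (E (Suc n)) (%y. ((fst (c k))(?t := y), snd (c k))))"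
 proof (rule PiM_cong[OF refl])
  fix k assume k: "k : ?I"
  have "(%y. (fst (c k))(?t := y)) : kp k \<rightarrow>\<^sub>M B (Suc n)" using upd[OF k] unfolding mcs[OF pk(2)[OF k] refl] .
  then show "prop_move n c k = distr (kp k) (E (Suc n)) (%y. ((fst (c k))(?t := y), snd (c k)))"
   unfolding prop_move_def path_step_def kap[OF k] add_Suc_right[symmetric] by (subst distr_distr) (auto simp: comp_def)
 qed
 also have "... = distr (PiM ?I kp) (clouds K (Suc n)) z" unfolding z_def by (rule distr_PiM_componentwise[symmetric]) (auto intro: pk m1)
 finally have 1: "PiM ?I (prop_move n c) = distr (PiM ?I kp) (clouds K (Suc n)) z" .
 have mz: "z : PiM ?I kp \<rightarrow>\<^sub>M clouds K (Suc n)" unfolding z_def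
 proof (rule measurable_restrict)
  fix k assume k: "k : ?I"
  show "(%y. ((fst (c k))(?t := y k), snd (c k))) : PiM ?I kp \<rightarrow>\<^sub>M E (Suc n)"
   using mcomp[OF measurable_component_singleton[OF k, of kp] m1[OF k]] .
 qed
 have "PiM ?I (prop_move n c) \<bind> (%c'. PiM ?I (%_. res_move K n c'))
  = PiM ?I kp \<bind> (%y. PiM ?I (%_. res_move K n (z y)))"
  unfolding 1 by (rule bind_distr[OF mz measurable_prob_algebraD[OF res_kernel_clouds[OF n]]])
   (intro prob_space.not_empty prob_space_PiM pk)
 also have "... = PiM ?I kp \<bind> (%y. PiM ?I (%_. point_measure ?I (%j. ennreal (norm_weight S K ?t (%k. (fst (c k))(?t := y k)) j))) \<bind>
   (%b. return (cloud_space S K m ?t) (\<lambda>k\<in>?I. ((fst (c (b k)))(?t := y (b k)),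
    snd (c (b k)) / (real K * norm_weight S K ?t (%k. (fst (c k))(?t := y k)) (b k))))))"
 proof (rule bind_cong_All, rule ballI)
  fix y assume y: "y : space (PiM ?I kp)"
  have zy: "z y : space (clouds K (Suc n))" by (rule measurable_space[OF mz y])
  have w: "norm_weight S K ?t (%k. (fst (c k))(?t := y k)) j = nw K n (z y) j" if "j : ?I" for j
  proof -
   have "(\<Sum>k\<in>?I. weight S ?t ((fst (c k))(?t := y k))) = (\<Sum>k\<in>?I. weight S ?t (fst (z y k)))" by (intro sum.cong) (auto simp: z_def)
   moreover have "fst (z y j) = (fst (c j))(?t := y j)" using that by (simp add: z_def)
   ultimately show ?thesis by (simp add: norm_weight_def)
  qed
  let ?pm = "point_measure ?I (%j. ennreal (nw K n (z y) j))"
  have pm: "point_measure ?I (%j. ennreal (norm_weight S K ?t (%k. (fst (c k))(?t := y k)) j)) = ?pm"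
   unfolding point_measure_def by (rule density_cong) (auto simp: w AE_count_space)
  have pp: "prob_space ?pm" if "k : ?I" for k using that by (intro prob_space_res_point[OF n zy]) auto
  have mm: "(%b. \<lambda>k\<in>?I. (fst (z y (b k)), snd (z y (b k)) / (real K * nw K n (z y) (b k)))) : PiM ?I (%_. ?pm) \<rightarrow>\<^sub>M clouds K (Suc n)"
  proof (rule measurable_restrict)
   fix k assume k: "k : ?I"
   show "(%b. (fst (z y (b k)), snd (z y (b k)) / (real K * nw K n (z y) (b k)))) : PiM ?I (%_. ?pm) \<rightarrow>\<^sub>M E (Suc n)"
    using mcomp[OF measurable_component_singleton[OF k, of "%_. ?pm"] res_move_map[OF zy]] .
  qed
  have "PiM ?I (%_. res_move K n (z y)) = distr (PiM ?I (%_. ?pm)) (clouds K (Suc n))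
    (%b. \<lambda>k\<in>?I. (fst (z y (b k)), snd (z y (b k)) / (real K * nw K n (z y) (b k))))" unfolding res_move_def
   by (rule distr_PiM_componentwise[symmetric], simp, rule pp, assumption, rule res_move_map[OF zy])
  also have "... = PiM ?I (%_. ?pm) \<bind> (%b. return (clouds K (Suc n))
    (\<lambda>k\<in>?I. (fst (z y (b k)), snd (z y (b k)) / (real K * nw K n (z y) (b k)))))"
   by (rule bind_return_distr'[symmetric, OF _ mm]) (intro prob_space.not_empty prob_space_PiM pp)
  also have "... = PiM ?I (%_. ?pm) \<bind> (%b. return (cloud_space S K m ?t) (\<lambda>k\<in>?I. ((fst (c (b k)))(?t := y (b k)),
    snd (c (b k)) / (real K * norm_weight S K ?t (%k. (fst (c k))(?t := y k)) (b k)))))"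
  proof (rule bind_cong_All, rule ballI)
   fix b assume "b : space (PiM ?I (%_. ?pm))"
   then have b: "b k : ?I" if "k : ?I" for k using that by (auto simp: space_PiM space_point_measure)
   show "return (clouds K (Suc n)) (\<lambda>k\<in>?I. (fst (z y (b k)), snd (z y (b k)) / (real K * nw K n (z y) (b k))))
    = return (cloud_space S K m ?t) (\<lambda>k\<in>?I. ((fst (c (b k)))(?t := y (b k)),
    snd (c (b k)) / (real K * norm_weight S K ?t (%k. (fst (c k))(?t := y k)) (b k))))"
   proof (intro arg_cong2[where f=return] restrict_ext)
    show "clouds K (Suc n) = cloud_space S K m ?t" using cloud_space_eq[of K "Suc n"] by (simp add: add_Suc_right)
   qed (use b in \<open>auto simp: w z_def\<close>)
  qed
  finally show "PiM ?I (%_. res_move K n (z y)) = PiM ?I (%_. point_measure ?I (%j. ennreal (norm_weight S K ?t (%k. (fst (c k))(?t := y k)) j))) \<bind>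
   (%b. return (cloud_space S K m ?t) (\<lambda>k\<in>?I. ((fst (c (b k)))(?t := y (b k)),
    snd (c (b k)) / (real K * norm_weight S K ?t (%k. (fst (c k))(?t := y k)) (b k)))))" unfolding pm .
 qed
 finally show ?thesis unfolding filter_step_def Let_def kp_def[abs_def] by simp
qed

lemma init_cloud: "(\<lambda>k\<in>{1..K}. (%_. undefined, 1)) : space (clouds K 0)" by (auto simp: space_PiM space_pair_measure space_paths_empty)

lemma law_0: "law 0 K = return (clouds K 0) (\<lambda>k\<in>{1..K}. (%_. undefined, 1))" using cloud_space_eq[of K 0] by (simp add: law_def)

text \<open>One induction, since rewriting stage \<open>n\<close> needs \<open>law n K\<close> to be
  a probability measure on clouds, and that \<open>law (Suc n) K\<close> is one is read off from the
  rewritten stage.\<close>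

lemma
 assumes "n <= T"
 shows prob_space_law: "prob_space (law n K)" and sets_law [measurable_cong]: "sets (law n K) = sets (clouds K n)"
  and law_Suc: "n < T ==> law (Suc n) K = plaw n K \<bind> (%c. PiM {1..K} (%_. res_move K n c))"
proof -
 have *: "law n K : space (prob_algebra (clouds K n)) \<and>
  (n < T --> law (Suc n) K = plaw n K \<bind> (%c. PiM {1..K} (%_. res_move K n c)))" using assms
 proof (induction n)
  have S: "law (Suc n) K = plaw n K \<bind> (%c. PiM {1..K} (%_. res_move K n c))"
   if n: "n < T" and p: "law n K : space (prob_algebra (clouds K n))" for n
  proof -
   have s: "sets (law n K) = sets (clouds K n)" using p by (simp add: space_prob_algebra)
   have "law (Suc n) K = law n K \<bind> (%c. PiM {1..K} (prop_move n c) \<bind> (%c'. PiM {1..K} (%_. res_move K n c')))"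
   proof -
    have "law (Suc n) K = law n K \<bind> filter_step S K m (Suc (a + n))" by (simp add: law_def add_Suc_right)
    also have "... = law n K \<bind> (%c. PiM {1..K} (prop_move n c) \<bind> (%c'. PiM {1..K} (%_. res_move K n c')))"
     by (intro bind_cong_All ballI filter_step_eq[OF n]) (simp only: sets_eq_imp_space_eq[OF s])
    finally show ?thesis .
   qed
   also have "... = plaw n K \<bind> (%c. PiM {1..K} (%_. res_move K n c))" unfolding plaw_def
   proof (rule bind_assoc[symmetric])
    show "(%c. PiM {1..K} (prop_move n c)) : law n K \<rightarrow>\<^sub>M subprob_algebra (clouds K (Suc n))"
     unfolding mcs[OF s refl] by (rule measurable_prob_algebraD[OF prop_kernel_clouds[OF n]])
    show "(%c'. PiM {1..K} (%_. res_move K n c')) : clouds K (Suc n) \<rightarrow>\<^sub>M subprob_algebra (clouds K (Suc n))"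
     by (rule measurable_prob_algebraD[OF res_kernel_clouds[OF n]])
   qed
   finally show ?thesis .
  qed
  {
   case 0
   have "law 0 K : space (prob_algebra (clouds K 0))"
    unfolding law_0 space_prob_algebra by (intro CollectI conjI sets_return prob_space_return[OF init_cloud])
   then show ?case using S[of 0] by simp
  next
   case (Suc n)
   then have n: "n < T" and p: "law n K : space (prob_algebra (clouds K n))" by auto
   have "plaw n K : space (prob_algebra (clouds K (Suc n)))"
    unfolding plaw_def using prob_space_bind'[OF p prop_kernel_clouds[OF n]] sets_bind'[OF p prop_kernel_clouds[OF n]]
    by (simp add: space_prob_algebra)
   then have "law (Suc n) K : space (prob_algebra (clouds K (Suc n)))"
    unfolding S[OF n p] using prob_space_bind'[OF _ res_kernel_clouds[OF n]] sets_bind'[OF _ res_kernel_clouds[OF n]]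
    by (simp add: space_prob_algebra)
   then show ?case using S[of "Suc n"] by simp
  }
 qed
 then show "prob_space (law n K)" "sets (law n K) = sets (clouds K n)"
  "n < T ==> law (Suc n) K = plaw n K \<bind> (%c. PiM {1..K} (%_. res_move K n c))" by (auto simp: space_prob_algebra)
qed

lemma space_law: "n <= T ==> space (law n K) = space (clouds K n)" by (rule sets_eq_imp_space_eq[OF sets_law])

lemma
 assumes n: "n < T"
 shows prob_space_plaw: "prob_space (plaw n K)" and sets_plaw [measurable_cong]: "sets (plaw n K) = sets (clouds K (Suc n))"
proof -
 have p: "law n K : space (prob_algebra (clouds K n))" using n by (simp add: space_prob_algebra prob_space_law sets_law)
 show "prob_space (plaw n K)" "sets (plaw n K) = sets (clouds K (Suc n))"
  unfolding plaw_def using prob_space_bind'[OF p prop_kernel_clouds[OF n]] sets_bind'[OF p prop_kernel_clouds[OF n]] by auto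
qed

lemma space_plaw: "n < T ==> space (plaw n K) = space (clouds K (Suc n))" by (rule sets_eq_imp_space_eq[OF sets_plaw])

lemma particle_step_prop:
 assumes n: "n < T"
 shows "particle_step (law n) (%K c k. prop_move n c k) (E (Suc n))"
proof (rule particle_step.intro)
 show "prob_space (law n K)" for K using n by (intro prob_space_law) simp
 show "(%c. prop_move n c k) : law n K \<rightarrow>\<^sub>M prob_algebra (E (Suc n))" if "k : {1..K}" for K k
  unfolding mcs[OF sets_law[OF less_imp_le[OF n]] refl] by (rule prop_move_kernel[OF n that])
qed

lemma particle_step_res:
 assumes n: "n < T"
 shows "particle_step (plaw n) (%K c k. res_move K n c) (E (Suc n))"
proof (rule particle_step.intro)
 show "prob_space (plaw n K)" for K by (rule prob_space_plaw[OF n])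
 show "(%c. res_move K n c) : plaw n K \<rightarrow>\<^sub>M prob_algebra (E (Suc n))" if "k : {1..K}" for K k
  unfolding mcs[OF sets_plaw[OF n] refl] using that by (intro res_move_kernel[OF n]) simp
qed

end

context smc_block begin

lemma
 assumes "k : {1..K}"
 shows cloud_fst_measurable: "(%c. fst (c k)) : clouds K n \<rightarrow>\<^sub>M B n"
  and cloud_snd_measurable: "(%c. snd (c k)) : bm (clouds K n)"
proof -
 have c: "(%c. c k) : clouds K n \<rightarrow>\<^sub>M E n" by (rule measurable_component_singleton[OF assms])
 show "(%c. fst (c k)) : clouds K n \<rightarrow>\<^sub>M B n" by (rule mcomp[OF c measurable_fst])
 show "(%c. snd (c k)) : bm (clouds K n)" by (rule mcomp[OF c measurable_snd])
qed

subsection \<open>Unbiasedness\<close>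

text \<open>Values in \<open>ennreal\<close> free the unbiasedness identities from integrability
  conditions, so that they apply to squares and to indicators of null sets alike.\<close>

definition wsum :: "nat => ((nat => 'x) => ennreal) => (nat => (nat => 'x) \<times> real) => ennreal" where
 "wsum K f c = (\<Sum>k=1..K. ennreal (snd (c k)) * f (fst (c k)))"

lemma wsum_measurable:
 assumes f: "f : bm (B n)"
 shows "wsum K f : bm (clouds K n)" unfolding wsum_def[abs_def]
proof (rule borel_measurable_sum)
 fix k assume k: "k : {1..K}"
 note [measurable] = cloud_snd_measurable[OF k] mcomp[OF cloud_fst_measurable[OF k] f]
 show "(%c. ennreal (snd (c k)) * f (fst (c k))) : bm (clouds K n)" by measurable
qed

lemma unbiased_prop:
 assumes n: "n < T" and f[measurable]: "f : bm (B (Suc n))"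
 shows "(\<integral>\<^sup>+c. wsum K f c \<partial>plaw n K) = (\<integral>\<^sup>+c. wsum K (%z. \<integral>\<^sup>+x. f x \<partial>path_step S a (a + n) z) c \<partial>law n K)"
proof -
 interpret particle_step "law n" "%K c k. prop_move n c k" "E (Suc n)" by (rule particle_step_prop[OF n])
 have "(\<integral>\<^sup>+c. wsum K f c \<partial>plaw n K) = (\<integral>\<^sup>+c. \<integral>\<^sup>+c'. wsum K f c' \<partial>PiM {1..K} (prop_move n c) \<partial>law n K)"
  unfolding plaw_def by (rule nn_integral_bind[OF wsum_measurable[OF f] measurable_prob_algebraD[OF kernel]])
 also have "... = (\<integral>\<^sup>+c. wsum K (%z. \<integral>\<^sup>+x. f x \<partial>path_step S a (a + n) z) c \<partial>law n K)"
 proof (rule nn_integral_cong)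
  fix c assume c: "c : space (law n K)"
  then have c': "c : space (clouds K n)" using n by (simp add: space_law)
  have gm: "(%y. ennreal (snd y) * f (fst y)) : bm (E (Suc n))" by measurable
  have "(\<integral>\<^sup>+c'. wsum K f c' \<partial>PiM {1..K} (prop_move n c)) = (\<Sum>k=1..K. \<integral>\<^sup>+c'. ennreal (snd (c' k)) * f (fst (c' k)) \<partial>PiM {1..K} (prop_move n c))"
   unfolding wsum_def
  proof (rule nn_integral_sum)
   fix k assume k: "k : {1..K}"
   show "(%c'. ennreal (snd (c' k)) * f (fst (c' k))) : bm (PiM {1..K} (prop_move n c))"
    using mcomp[OF measurable_component_singleton[OF k] gm] by (simp add: mcs[OF sets_PiM_rho[OF c] refl])
  qed
  also have "... = (\<Sum>k=1..K. \<integral>\<^sup>+y. ennreal (snd y) * f (fst y) \<partial>prop_move n c k)"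
  proof (rule sum.cong[OF refl])
   fix k assume k: "k : {1..K}"
   show "(\<integral>\<^sup>+c'. ennreal (snd (c' k)) * f (fst (c' k)) \<partial>PiM {1..K} (prop_move n c)) = (\<integral>\<^sup>+y. ennreal (snd y) * f (fst y) \<partial>prop_move n c k)"
    using gm sets_rho[OF c k]
    by (intro nn_integral_PiM_component[OF prob_space_rho[OF c] k, where f="%y. ennreal (snd y) * f (fst y)"]) (auto cong: mcs)
  qed
  also have "... = wsum K (%z. \<integral>\<^sup>+x. f x \<partial>path_step S a (a + n) z) c" unfolding wsum_def
  proof (rule sum.cong[OF refl])
   fix k assume k: "k : {1..K}"
   have "sets (path_step S a (a + n) (fst (c k))) = sets (B (Suc n))"
    using measurable_space[OF step_kernel_a[OF n] cloud_component[OF c' k]] by (simp add: space_prob_algebra)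
   then have "f : bm (path_step S a (a + n) (fst (c k)))" using f by (simp cong: mcs)
   then show "(\<integral>\<^sup>+y. ennreal (snd y) * f (fst y) \<partial>prop_move n c k) = ennreal (snd (c k)) * (\<integral>\<^sup>+x. f x \<partial>path_step S a (a + n) (fst (c k)))"
    by (simp add: nn_integral_prop_move[OF n c' k gm] nn_integral_cmult)
  qed
  finally show "(\<integral>\<^sup>+c'. wsum K f c' \<partial>PiM {1..K} (prop_move n c)) = wsum K (%z. \<integral>\<^sup>+x. f x \<partial>path_step S a (a + n) z) c" .
 qed
 finally show ?thesis .
qed

text \<open>Particle \<open>j\<close> is chosen with probability \<open>nw K n c j\<close> in each
  of \<open>K\<close> draws, and its new value of \<open>H\<close> carries the reciprocal of
  \<open>K\<close> times that probability.\<close>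

lemma unbiased_res:
 assumes n: "n < T" and f[measurable]: "f : bm (B (Suc n))"
 shows "(\<integral>\<^sup>+c. wsum K f c \<partial>law (Suc n) K) = (\<integral>\<^sup>+c. wsum K f c \<partial>plaw n K)"
proof -
 interpret particle_step "plaw n" "%K c k. res_move K n c" "E (Suc n)" by (rule particle_step_res[OF n])
 have "(\<integral>\<^sup>+c. wsum K f c \<partial>law (Suc n) K) = (\<integral>\<^sup>+c. \<integral>\<^sup>+c'. wsum K f c' \<partial>PiM {1..K} (%_. res_move K n c) \<partial>plaw n K)"
  using law_Suc[of n] n by (simp add: nn_integral_bind[OF wsum_measurable[OF f] measurable_prob_algebraD[OF kernel]])
 also have "... = (\<integral>\<^sup>+c. wsum K f c \<partial>plaw n K)"
 proof (rule nn_integral_cong)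
  fix c assume c: "c : space (plaw n K)"
  then have c': "c : space (clouds K (Suc n))" using n by (simp add: space_plaw)
  have gm: "(%y. ennreal (snd y) * f (fst y)) : bm (E (Suc n))" by measurable
  have "(\<integral>\<^sup>+c'. wsum K f c' \<partial>PiM {1..K} (%_. res_move K n c)) = (\<Sum>k=1..K. \<integral>\<^sup>+c'. ennreal (snd (c' k)) * f (fst (c' k)) \<partial>PiM {1..K} (%_. res_move K n c))"
   unfolding wsum_def
  proof (rule nn_integral_sum)
   fix k assume k: "k : {1..K}"
   show "(%c'. ennreal (snd (c' k)) * f (fst (c' k))) : bm (PiM {1..K} (%_. res_move K n c))"
    using mcomp[OF measurable_component_singleton[OF k] gm] by (simp add: mcs[OF sets_PiM_rho[OF c] refl])
  qed
  also have "... = (\<Sum>k=1..K. \<integral>\<^sup>+y. ennreal (snd y) * f (fst y) \<partial>res_move K n c)"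
  proof (rule sum.cong[OF refl])
   fix k assume k: "k : {1..K}"
   show "(\<integral>\<^sup>+c'. ennreal (snd (c' k)) * f (fst (c' k)) \<partial>PiM {1..K} (%_. res_move K n c)) = (\<integral>\<^sup>+y. ennreal (snd y) * f (fst y) \<partial>res_move K n c)"
    using gm sets_rho[OF c k]
    by (intro nn_integral_PiM_component[OF prob_space_rho[OF c] k, where f="%y. ennreal (snd y) * f (fst y)"]) (auto cong: mcs)
  qed
  also have "... = wsum K f c"
  proof (cases "K >= 1")
   case True
   have "(\<Sum>k=1..K. \<integral>\<^sup>+y. ennreal (snd y) * f (fst y) \<partial>res_move K n c)
    = (\<Sum>j=1..K. of_nat K * (ennreal (nw K n c j) * (ennreal (snd (c j) / (real K * nw K n c j)) * f (fst (c j)))))"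
    by (simp add: nn_integral_res_move[OF n c' True gm] sum_distrib_left)
   also have "... = wsum K f c" unfolding wsum_def
   proof (rule sum.cong[OF refl])
    fix j assume j: "j : {1..K}"
    have p: "0 < nw K n c j" by (rule nw_pos[OF n c' True j])
    have "of_nat K * (ennreal (nw K n c j) * ennreal (snd (c j) / (real K * nw K n c j))) = ennreal (real K * (nw K n c j * (snd (c j) / (real K * nw K n c j))))"
     using p by (simp only: ennreal_of_nat_eq_real_of_nat ennreal_mult' of_nat_0_le_iff less_imp_le)
    also have "real K * (nw K n c j * (snd (c j) / (real K * nw K n c j))) = snd (c j)" using p True by simp
    finally show "of_nat K * (ennreal (nw K n c j) * (ennreal (snd (c j) / (real K * nw K n c j)) * f (fst (c j)))) = ennreal (snd (c j)) * f (fst (c j))"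
     by (simp only: mult.assoc[symmetric])
   qed
   finally show ?thesis .
  qed (simp add: wsum_def)
  finally show "(\<integral>\<^sup>+c'. wsum K f c' \<partial>PiM {1..K} (%_. res_move K n c)) = wsum K f c" .
 qed
 finally show ?thesis .
qed

lemma unbiased:
 assumes "n <= T" "f : bm (B n)"
 shows "(\<integral>\<^sup>+c. wsum K f c \<partial>law n K) = of_nat K * (\<integral>\<^sup>+x. f x \<partial>Q n)" using assms
proof (induction n arbitrary: f)
 case 0
 have "(\<integral>\<^sup>+c. wsum K f c \<partial>law 0 K) = wsum K f (\<lambda>k\<in>{1..K}. (%_. undefined, 1))"
  unfolding law_0 by (rule nn_integral_return[OF init_cloud wsum_measurable[OF 0(2)]])
 also have "... = of_nat K * f (%_. undefined)" by (simp add: wsum_def)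
 also have "f (%_. undefined) = (\<integral>\<^sup>+x. f x \<partial>Q 0)" using 0 by (simp add: Q_def nn_integral_return space_paths_empty)
 finally show ?case .
next
 case (Suc n)
 then have n: "n < T" by simp
 have km: "(%z. \<integral>\<^sup>+x. f x \<partial>path_step S a (a + n) z) : bm (B n)"
  by (rule mcomp[OF measurable_prob_algebraD[OF step_kernel_a[OF n]] nn_integral_measurable_subprob_algebra[OF Suc.prems(2)]])
 show ?case
  using Suc.IH[OF _ km] n by (simp add: unbiased_res[OF n Suc.prems(2)] unbiased_prop[OF n Suc.prems(2)] nn_integral_Q_Suc[OF n Suc.prems(2)])
qed

lemma unbiased_plaw:
 assumes "n < T" "f : bm (B (Suc n))"
 shows "(\<integral>\<^sup>+c. wsum K f c \<partial>plaw n K) = of_nat K * (\<integral>\<^sup>+x. f x \<partial>Q (Suc n))"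
 using unbiased[of "Suc n" f K] assms by (simp add: unbiased_res)

subsection \<open>The common factor of the weights\<close>

text \<open>In a cloud of the filter the quotient of \<open>H\<close> and \<open>h n\<close> almost
  surely has the same value at all particles (\<open>AE_proportional\<close>), so it can be read off
  at particle 1.\<close>

definition cc :: "nat => (nat => (nat => 'x) \<times> real) => real" where
 "cc n c = snd (c 1) / h n (fst (c 1))"

definition proportional :: "nat => nat => (nat => (nat => 'x) \<times> real) => bool" where
 "proportional n K c \<longleftrightarrow> (\<forall>k\<in>{1..K}. snd (c k) = cc n c * h n (fst (c k)) & 0 < snd (c k))"

definition avg :: "nat => ((nat => 'x) => real) => (nat => (nat => 'x) \<times> real) => real" where
 "avg K G c = (\<Sum>k=1..K. G (fst (c k))) / K"

lemma avg_measurable: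
 assumes G: "G : bm (B n)"
 shows "avg K G : bm (clouds K n)" unfolding avg_def[abs_def]
 by (rule borel_measurable_divide[OF borel_measurable_sum borel_measurable_const])
  (rule mcomp[OF cloud_fst_measurable G])

lemma cc_measurable: "n <= T ==> n <= k ==> K >= 1 ==> cc n : bm (clouds K k)" unfolding cc_def[abs_def]
 by (intro borel_measurable_divide cloud_snd_measurable mcomp[OF cloud_fst_measurable h_measurable]) auto

lemma proportional_measurable:
 assumes "n <= T" "n <= k"
 shows "Measurable.pred (clouds K k) (proportional n K)"
proof (cases "K >= 1")
 case True
 note [measurable] = cc_measurable[OF assms True]
 show ?thesis unfolding proportional_def[abs_def]
 proof (rule pred_intros_finite)
  fix i assume i: "i : {1..K}"
  have *: "Measurable.pred M (%c. u c = v c * w c & 0 < u c)"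
   if [measurable]: "u : bm M" "v : bm M" "w : bm M"
   for M :: "(nat => (nat => 'x) \<times> real) measure" and u v w :: "_ => real" unfolding Measurable.pred_def
   by (intro sets.sets_Collect_conj borel_measurable_eq borel_measurable_less borel_measurable_times that borel_measurable_const)
  show "Measurable.pred (clouds K k) (%c. snd (c i) = cc n c * h n (fst (c i)) & 0 < snd (c i))"
   by (intro * cloud_snd_measurable[OF i] cc_measurable[OF assms True]
     mcomp[OF cloud_fst_measurable[OF i] h_measurable[OF assms]])
 qed simp
qed (simp add: proportional_def[abs_def])

lemma proportional_cc_pos:
 assumes "n <= T" "n <= k" "K >= 1" "c : space (clouds K k)" "proportional n K c"
 shows "0 < cc n c"
proof -
 have 1: "1 : {1..K}" using assms(3) by simp
 then have "0 < snd (c 1)" using assms(5) unfolding proportional_def by blast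
 then show ?thesis unfolding cc_def by (intro divide_pos_pos h_pos[OF assms(1,2) cloud_component[OF assms(4) 1]])
qed

lemma proportionalI:
 assumes "n <= T" "n <= k" "K >= 1" "c : space (clouds K k)"
  and "\<And>i. i : {1..K} ==> snd (c i) = C * h n (fst (c i)) & 0 < snd (c i)"
 shows "proportional n K c & cc n c = C"
proof -
 have "cc n c = C" using assms(3,5) h_pos[OF assms(1,2) cloud_component[OF assms(4), of 1]] by (simp add: cc_def)
 then show ?thesis unfolding proportional_def using assms(5) by blast
qed

lemma AE_prop_move:
 assumes n: "n < T" and c: "c : space (clouds K n)" and k: "k : {1..K}"
  and P: "Measurable.pred (E (Suc n)) P"
 shows "(AE y in prop_move n c k. P y) \<longleftrightarrow> (AE x in path_step S a (a + n) (fst (c k)). P (x, snd (c k)))"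
 unfolding prop_move_def by (subst AE_distr_iff[OF prop_move_map[OF n cloud_component[OF c k]]]) (use P in auto)

text \<open>A proposal appends a coordinate; it changes neither \<open>H\<close> nor
  \<open>h n\<close>, which depends on the first \<open>n\<close> block coordinates only.\<close>

lemma AE_prop_cloud:
 assumes n: "n < T" and K: "K >= 1" and c: "c : space (clouds K n)" and p: "proportional n K c"
 shows "AE c' in PiM {1..K} (prop_move n c). proportional n K c' & cc n c' = cc n c"
proof -
 interpret particle_step "law n" "%K c k. prop_move n c k" "E (Suc n)" by (rule particle_step_prop[OF n])
 have cl: "c : space (law n K)" using c n by (simp add: space_law)
 have hm[measurable]: "h n : bm (B n)" "h n : bm (B (Suc n))" using n by auto
 have "AE c' in PiM {1..K} (prop_move n c). \<forall>k\<in>{1..K}. snd (c' k) = snd (c k) & h n (fst (c' k)) = h n (fst (c k))"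
 proof (rule AE_finite_allI)
  fix k assume k: "k : {1..K}"
  have "AE x in path_step S a (a + n) (fst (c k)). h n (restrict x {a<..a + n}) = h n (fst (c k))"
   using a_n_le[of "Suc n"] n by (intro AE_path_step_restrict a_le_start cloud_component[OF c k] hm) (simp add: add_Suc_right)
  then have "AE y in prop_move n c k. snd y = snd (c k) & h n (fst y) = h n (fst (c k))"
   using n by (subst AE_prop_move[OF n c k]) (measurable, simp add: h_restrict)
  from AE_PiM_component[where M="prop_move n c" and P="%y. snd y = snd (c k) & h n (fst y) = h n (fst (c k))",
    OF prob_space_rho[OF cl] k this]
  show "AE c' in PiM {1..K} (prop_move n c). snd (c' k) = snd (c k) & h n (fst (c' k)) = h n (fst (c k))" .
 qed simp
 then show ?thesis
 proof (rule AE_mp, intro AE_I2 impI)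
  fix c' assume "c' : space (PiM {1..K} (prop_move n c))"
   and e: "\<forall>k\<in>{1..K}. snd (c' k) = snd (c k) & h n (fst (c' k)) = h n (fst (c k))"
  then have "c' : space (clouds K (Suc n))" using sets_eq_imp_space_eq[OF sets_PiM_rho[OF cl]] by simp
  then show "proportional n K c' & cc n c' = cc n c"
  proof (intro proportionalI[where k="Suc n"])
   fix i assume i: "i : {1..K}"
   show "snd (c' i) = cc n c * h n (fst (c' i)) & 0 < snd (c' i)" using bspec[OF e i] bspec[OF p[unfolded proportional_def] i] by simp
  qed (use n K in auto)
 qed
qed

lemma AE_res_move:
 assumes c: "c : space (clouds K (Suc n))"
  and P: "Measurable.pred (E (Suc n)) P" and "\<And>j. j : {1..K} ==> P (fst (c j), snd (c j) / (real K * nw K n c j))"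
 shows "AE y in res_move K n c. P y" unfolding res_move_def
 by (subst AE_distr_iff[OF res_move_map[OF c]]) (use P assms(3) in \<open>auto simp: space_point_measure intro!: AE_I2\<close>)

text \<open>Resampling divides \<open>H\<close> by the weight relative to its average. By
  \<open>h_Suc\<close> the division by the weight turns \<open>h n\<close> into
  \<open>h (Suc n)\<close> up to the ratio of the constants \<open>Z\<close>, and the average weight
  is common to all particles.\<close>

lemma AE_res_cloud:
 assumes n: "n < T" and K: "K >= 1" and c: "c : space (clouds K (Suc n))" and p: "proportional n K c"
 shows "AE c' in PiM {1..K} (%_. res_move K n c). proportional (Suc n) K c' \<and>
  cc (Suc n) c' = cc n c * avg K (weight S (Suc (a + n))) c * Z n / Z (Suc n)"
proof -
 interpret particle_step "plaw n" "%K c k. res_move K n c" "E (Suc n)" by (rule particle_step_res[OF n])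
 have cl: "c : space (plaw n K)" using c n by (simp add: space_plaw)
 define C where "C = cc n c * avg K (weight S (Suc (a + n))) c * Z n / Z (Suc n)"
 have hm[measurable]: "h (Suc n) : bm (B (Suc n))" using n by auto
 have "AE c' in PiM {1..K} (%_. res_move K n c). \<forall>k\<in>{1..K}. snd (c' k) = C * h (Suc n) (fst (c' k)) & 0 < snd (c' k)"
 proof (rule AE_finite_allI)
  fix k assume k: "k : {1..K}"
  have "AE y in res_move K n c. snd y = C * h (Suc n) (fst y) & 0 < snd y"
  proof (rule AE_res_move[OF c])
   fix j assume j: "j : {1..K}"
   let ?w = "weight S (Suc (a + n))" and ?x = "fst (c j)"
   have w: "0 < ?w ?x" using cloud_component[OF c j] by (rule weight_cloud_pos[OF n])
   have nwj: "0 < nw K n c j" by (rule nw_pos[OF n c K j])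
   have Hp: "snd (c j) = cc n c * h n ?x" "0 < snd (c j)" using p j unfolding proportional_def by blast+
   have Zp: "0 < Z n" "0 < Z (Suc n)" using n by (auto intro!: Z_pos)
   have hh: "h n ?x = h (Suc n) ?x * ?w ?x * Z n / Z (Suc n)" using h_Suc[OF n cloud_component[OF c j]] Zp by (simp add: field_simps)
   have S: "0 < (\<Sum>k=1..K. ?w (fst (c k)))" by (rule sum_weight_pos[OF n c K])
   have "real K * nw K n c j = ?w ?x / avg K ?w c" using S K by (simp add: nw_eq[OF K] avg_def)
   then have "snd (c j) / (real K * nw K n c j) = C * h (Suc n) ?x" using w by (simp add: Hp(1) hh C_def)
   moreover have "0 < snd (c j) / (real K * nw K n c j)" using Hp nwj K by simp
   ultimately show "snd (?x, snd (c j) / (real K * nw K n c j)) = C * h (Suc n) (fst (?x, snd (c j) / (real K * nw K n c j)))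
    & 0 < snd (?x, snd (c j) / (real K * nw K n c j))" by simp
  qed measurable
  from AE_PiM_component[where M="%_. res_move K n c" and P="%y. snd y = C * h (Suc n) (fst y) & 0 < snd y",
    OF prob_space_rho[OF cl] k this]
  show "AE c' in PiM {1..K} (%_. res_move K n c). snd (c' k) = C * h (Suc n) (fst (c' k)) & 0 < snd (c' k)" .
 qed simp
 then show ?thesis
 proof (rule AE_mp, intro AE_I2 impI)
  fix c' assume "c' : space (PiM {1..K} (%_. res_move K n c))"
   and e: "\<forall>k\<in>{1..K}. snd (c' k) = C * h (Suc n) (fst (c' k)) & 0 < snd (c' k)"
  then have "c' : space (clouds K (Suc n))" using sets_eq_imp_space_eq[OF sets_PiM_rho[OF cl]] by simp
  then show "proportional (Suc n) K c' & cc (Suc n) c' = cc n c * avg K (weight S (Suc (a + n))) c * Z n / Z (Suc n)" unfolding C_def[symmetric]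
  proof (intro proportionalI[where k="Suc n"])
   show "\<And>i. i : {1..K} ==> snd (c' i) = C * h (Suc n) (fst (c' i)) & 0 < snd (c' i)" using e by blast
  qed (use n K in auto)
 qed
qed

lemma AE_proportional_plaw_if:
 assumes n: "n < T" and K: "K >= 1" and "AE c in law n K. proportional n K c"
 shows "AE c in plaw n K. proportional n K c"
proof -
 interpret particle_step "law n" "%K c k. prop_move n c k" "E (Suc n)" by (rule particle_step_prop[OF n])
 have "AE c in law n K. AE c' in PiM {1..K} (prop_move n c). proportional n K c'" using assms(3) AE_space
 proof eventually_elim
  case (elim c)
  then have "c : space (clouds K n)" using n by (simp add: space_law)
  from AE_prop_cloud[OF n K this elim(1)] show ?case by eventually_elim simp
 qed
 then show ?thesis unfolding plaw_def using n by (subst AE_bind[OF measurable_prob_algebraD[OF kernel] proportional_measurable]) auto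
qed

lemma AE_proportional_law_if:
 assumes n: "n < T" and K: "K >= 1" and "AE c in plaw n K. proportional n K c"
 shows "AE c in law (Suc n) K. proportional (Suc n) K c"
proof -
 interpret particle_step "plaw n" "%K c k. res_move K n c" "E (Suc n)" by (rule particle_step_res[OF n])
 have "AE c in plaw n K. AE c' in PiM {1..K} (%_. res_move K n c). proportional (Suc n) K c'" using assms(3) AE_space
 proof eventually_elim
  case (elim c)
  then have "c : space (clouds K (Suc n))" using n by (simp add: space_plaw)
  from AE_res_cloud[OF n K this elim(1)] show ?case by eventually_elim simp
 qed
 then have "AE c in plaw n K \<bind> (%c. PiM {1..K} (%_. res_move K n c)). proportional (Suc n) K c"
  using AE_bind[OF measurable_prob_algebraD[OF kernel] proportional_measurable[of "Suc n" "Suc n" K]] n by auto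
 then show ?thesis using law_Suc[of n K] n by (simp only: less_imp_le)
qed

lemma AE_proportional: "n <= T ==> K >= 1 ==> AE c in law n K. proportional n K c"
proof (induction n)
 case 0
 have "proportional 0 K (\<lambda>k\<in>{1..K}. (%_. undefined, 1))" using 0 by (auto simp: proportional_def cc_def)
 then show ?case unfolding law_0 by (subst AE_return[OF init_cloud]) (use proportional_measurable[of 0 0 K] in auto)
next
 case (Suc n)
 then show ?case by (intro AE_proportional_law_if AE_proportional_plaw_if) auto
qed

lemma AE_proportional_plaw: "n < T ==> K >= 1 ==> AE c in plaw n K. proportional n K c"
 by (intro AE_proportional_plaw_if AE_proportional) auto

text \<open>Unbiasedness for the indicator of a null set says that the weighted number of particles
  in it has mean zero. As \<open>H\<close> is positive, almost surely no particle is in it. This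
  allows the use of functions that are determined only almost everywhere.\<close>

lemma AE_particles_aux:
 assumes L: "sets L = sets (clouds K k)" and p: "AE c in L. proportional n K c" and q: "sets q = sets (B k)"
  and ub: "\<And>f. f : bm (B k) ==> (\<integral>\<^sup>+c. wsum K f c \<partial>L) = of_nat K * (\<integral>\<^sup>+x. f x \<partial>q)"
  and P: "AE x in q. P x"
 shows "AE c in L. \<forall>i\<in>{1..K}. P (fst (c i))"
proof -
 obtain N where N: "{x : space q. \<not> P x} \<subseteq> N" "emeasure q N = 0" "N : sets q" using P by (rule AE_E)
 have m: "indicator N : bm (B k)" using N(3) q by simp
 have "(\<integral>\<^sup>+c. wsum K (indicator N) c \<partial>L) = 0" using ub[OF m] N by simp
 then have "AE c in L. wsum K (indicator N) c = 0"
  using wsum_measurable[OF m, of K] L by (subst (asm) nn_integral_0_iff_AE) (auto cong: mcs)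
 with p AE_space show ?thesis
 proof eventually_elim
  case (elim c)
  have "c : space (clouds K k)" using elim(2) sets_eq_imp_space_eq[OF L] by simp
  then have X: "fst (c i) : space q" if "i : {1..K}" for i using cloud_component[OF _ that] sets_eq_imp_space_eq[OF q] by auto
  have "ennreal (snd (c i)) * indicator N (fst (c i)) = 0" if "i : {1..K}" for i using elim(3) that by (auto simp: wsum_def split: split_indicator)
  moreover have "0 < snd (c i)" if "i : {1..K}" for i using elim(1) that unfolding proportional_def by blast
  ultimately have "fst (c i) \<notin> N" if "i : {1..K}" for i using that by (metis ennreal_eq_0_iff indicator_simps(1) mult.right_neutral not_le)
  then show ?case using N(1) X by blast
 qed
qed

lemma AE_particles:
 assumes "n <= T" "AE x in Q n. P x"
 shows "AE c in law n K. \<forall>i\<in>{1..K}. P (fst (c i))"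
proof (cases "K >= 1")
 case True
 then show ?thesis using assms by (intro AE_particles_aux[OF sets_law AE_proportional sets_Q unbiased]) auto
qed simp

end

lemma tip_bind_const:
 fixes X :: "nat => 'a => real" and Y :: "nat => 'b => real"
 assumes P: "\<And>K. prob_space (P K)" and kp: "\<And>K. kp K : P K \<rightarrow>\<^sub>M prob_algebra (N K)"
  and Y: "\<And>K. K >= 1 ==> Y K : bm (N K)" and X: "tip P X l"
  and eq: "\<And>K. K >= 1 ==> AE om in P K. AE y in kp K om. Y K y = X K om"
 shows "tip (%K. P K \<bind> kp K) Y l"
proof -
 \<comment> \<open>Measurability of \<open>Y K\<close> is known for \<open>K >= 1\<close> only; at
   \<open>K = 0\<close> the constant \<open>l\<close> is put in its place.\<close>
 define Y' where "Y' K = (if K >= 1 then Y K else (%_. l))" for K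
 have PP: "P K : space (prob_algebra (P K))" for K by (simp add: space_prob_algebra P)
 have PB: "prob_space (P K \<bind> kp K)" for K by (rule prob_space_bind'[OF PP kp])
 have "tip (%K. P K \<bind> kp K) Y' l"
 proof (rule tip_bind[OF P kp])
  show "Y' K : bm (N K)" for K using Y by (simp add: Y'_def)
  have "tip P (%K om. min 1 (abs (X K om - l))) (min 1 (abs (l - l)))" by (rule tip_continuous[OF X]) (intro continuous_intros)
  then have "tip P (%K om. min 1 (abs (X K om - l))) 0" by simp
  then show "tip P (%K om. LINT y|kp K om. min 1 (abs (Y' K y - l))) 0"
  proof (rule tip_cong[OF P])
   show "whp P (%K om. (LINT y|kp K om. min 1 (abs (Y' K y - l))) = min 1 (abs (X K om - l)))"
   proof (rule whp_AE, rule eventually_mono[OF eventually_ge_at_top[of 1]])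
    fix K :: nat assume K: "1 <= K"
    show "AE om in P K. (LINT y|kp K om. min 1 (abs (Y' K y - l))) = min 1 (abs (X K om - l))" using eq[OF K] AE_space
    proof eventually_elim
     case (elim om)
     have "prob_space (kp K om)" "sets (kp K om) = sets (N K)"
      using measurable_space[OF kp elim(2)] by (auto simp: space_prob_algebra)
     then interpret prob_space "kp K om" by simp
     have [measurable]: "Y K : bm (kp K om)"
      using Y[OF K] \<open>sets (kp K om) = sets (N K)\<close> by (simp cong: mcs)
     have "(LINT y|kp K om. min 1 (abs (Y' K y - l))) = (LINT y|kp K om. min 1 (abs (X K om - l)))"
      using elim(1) K by (intro integral_cong_AE) (auto simp: Y'_def elim: eventually_mono)
     then show ?case by (simp add: prob_space)
    qed
   qed
  qed
 qed
 then show ?thesis by (rule tip_cong[OF PB]) (auto simp: Y'_def intro!: whp_all eventually_mono[OF eventually_ge_at_top[of 1]])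
qed

text \<open>Dominated convergence. The cut is made at the size of \<open>G\<close> while
  \<open>F\<close> is integrated, since in the applications \<open>F\<close> carries an extra factor
  \<open>1 / h\<close>.\<close>

lemma integral_tail_small:
 fixes F G :: "'a => real"
 assumes F: "integrable M F" and G[measurable]: "G : bm M" and e: "e > 0"
 shows "\<exists>C>0. (LINT x|M. F x * indicator {C<..} (abs (G x))) < e"
proof -
 have [measurable]: "F : bm M" using F by auto
 have "(%i. LINT x|M. F x * indicator {real (Suc i)<..} (abs (G x))) \<longlonglongrightarrow> (LINT x|M. 0)"
 proof (rule integral_dominated_convergence[where w="%x. abs (F x)"])
  show "AE x in M. (%i. F x * indicator {real (Suc i)<..} (abs (G x))) \<longlonglongrightarrow> 0"
  proof (rule AE_I2)
   fix x
   obtain i where i: "abs (G x) <= real i" using real_arch_simple by blast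
   have "\<forall>\<^sub>F j in sequentially. F x * indicator {real (Suc j)<..} (abs (G x)) = 0"
    using eventually_ge_at_top[of i] by eventually_elim (use i in auto)
   then show "(%i. F x * indicator {real (Suc i)<..} (abs (G x))) \<longlonglongrightarrow> 0" by (simp add: tendsto_eventually)
  qed
  show "integrable M (%x. abs (F x))" using F by auto
  show "AE x in M. norm (F x * indicator {real (Suc i)<..} (abs (G x))) <= abs (F x)" for i by (auto split: split_indicator)
 qed measurable
 then have "\<forall>\<^sub>F i in sequentially. (LINT x|M. F x * indicator {real (Suc i)<..} (abs (G x))) < e"
  using e by (intro order_tendstoD(2)) auto
 then obtain i where "(LINT x|M. F x * indicator {real (Suc i)<..} (abs (G x))) < e" using eventually_happens by fastforce
 then show ?thesis by (intro exI[of _ "real (Suc i)"]) auto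
qed

context smc_block begin

subsection \<open>Law of large numbers\<close>

definition kap :: "nat => ((nat => 'x) => real) => (nat => 'x) => real" where
 "kap n G z = (LINT x|path_step S a (a + n) z. G x)"

lemma kap_measurable: "n < T ==> G : bm (B (Suc n)) ==> kap n G : bm (B n)" unfolding kap_def[abs_def]
 by (rule mcomp[OF measurable_prob_algebraD[OF step_kernel_a] integral_measurable_subprob_algebra])

lemma
 assumes n: "n < T" and z: "z : space (B n)"
 shows prob_space_step_a: "prob_space (path_step S a (a + n) z)"
  and sets_step_a: "sets (path_step S a (a + n) z) = sets (B (Suc n))"
  and AE_step_h: "AE x in path_step S a (a + n) z. h n x = h n z"
proof -
 show "prob_space (path_step S a (a + n) z)" "sets (path_step S a (a + n) z) = sets (B (Suc n))"
  using measurable_space[OF step_kernel_a[OF n] z] by (auto simp: space_prob_algebra)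
 have "AE x in path_step S a (a + n) z. h n (restrict x {a<..a + n}) = h n z"
  using a_n_le[of "Suc n"] n by (intro AE_path_step_restrict a_le_start z h_measurable) (auto simp: add_Suc_right)
 then show "AE x in path_step S a (a + n) z. h n x = h n z" using n by (simp add: h_restrict)
qed

text \<open>\<open>h n\<close> is almost surely unchanged by the step and can be pulled out of the
  inner integral; what remains is the tower property for \<open>G / h n\<close>.\<close>

lemma
 assumes n: "n < T" and G: "G : bm (B (Suc n))" and i: "integrable (Q (Suc n)) (%x. G x / h n x)"
 shows AE_integrable_kap: "AE z in Q n. integrable (path_step S a (a + n) z) G"
  and integrable_kap: "integrable (Q n) (%z. kap n G z / h n z)"
  and integral_kap: "(LINT z|Q n. kap n G z / h n z) = (LINT x|Q (Suc n). G x / h n x)"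
proof -
 have hm: "h n : bm (B n)" "h n : bm (B (Suc n))" using n by auto
 have *: "integrable (path_step S a (a + n) z) (%x. G x / h n x) ==> integrable (path_step S a (a + n) z) G"
  "(LINT x|path_step S a (a + n) z. G x / h n x) = kap n G z / h n z" if z: "z : space (Q n)" for z
 proof -
  have z': "z : space (B n)" using z n by (simp add: space_Q)
  let ?P = "path_step S a (a + n) z"
  have m: "G : bm ?P" "(%x. G x / h n x) : bm ?P"
   unfolding mcs[OF sets_step_a[OF n z'] refl] using G hm by auto
  have hz: "h n z ~= 0" using h_pos[of n n z] n z' by simp
  have e: "AE x in ?P. G x / h n x = G x / h n z" using AE_step_h[OF n z'] by eventually_elim simp
  have "(LINT x|?P. G x / h n x) = (LINT x|?P. G x / h n z)" using m e by (intro integral_cong_AE) auto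
  then show "(LINT x|?P. G x / h n x) = kap n G z / h n z" by (simp add: kap_def)
  assume "integrable ?P (%x. G x / h n x)"
  then have "integrable ?P (%x. G x / h n z)" using m e by (subst integrable_cong_AE[symmetric, where f="%x. G x / h n x"]) auto
  from integrable_mult_right[OF this, of "h n z"] show "integrable ?P G" using hz by simp
 qed
 show "AE z in Q n. integrable (path_step S a (a + n) z) G" using AE_integrable_step[OF n i] AE_space by eventually_elim (rule *(1))
 show "integrable (Q n) (%z. kap n G z / h n z)"
  using integrable_step[OF n i] by (rule Bochner_Integration.integrable_cong[OF refl *(2), THEN iffD1, rotated])
 show "(LINT z|Q n. kap n G z / h n z) = (LINT x|Q (Suc n). G x / h n x)"
  unfolding integral_Q_Suc[OF n i] by (rule Bochner_Integration.integral_cong[OF refl *(2)[symmetric]])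
qed

lemma avg_prop_move:
 assumes n: "n < T" and c: "c : space (clouds K n)" and g: "g : bm (B (Suc n))"
 shows "(\<Sum>k=1..K. LINT y|prop_move n c k. g (fst y)) / K = avg K (kap n g) c" unfolding avg_def kap_def
proof (intro arg_cong2[where f="(/)"] sum.cong refl)
 fix k assume k: "k : {1..K}"
 have "(%y. g (fst y)) : bm (E (Suc n))" using g by measurable
 from integral_prop_move[OF n c k this]
 show "(LINT y|prop_move n c k. g (fst y)) = (LINT x|path_step S a (a + n) (fst (c k)). g x)" by simp
qed

lemma avg_nw:
 assumes K: "K >= 1"
 shows "(\<Sum>j=1..K. nw K n c j * g j) = ((\<Sum>j=1..K. weight S (Suc (a + n)) (fst (c j)) * g j) / K) / avg K (weight S (Suc (a + n))) c"
proof -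
 have "x / real K / (y / real K) = x / y" for x y :: real using K by simp
 then show ?thesis by (simp only: nw_eq[OF K] avg_def times_divide_eq_left sum_divide_distrib[symmetric])
qed

lemma avg_res_move:
 assumes n: "n < T" and c: "c : space (clouds K (Suc n))" and K: "K >= 1" and g: "g : bm (B (Suc n))"
 shows "(\<Sum>k=1..K. LINT y|res_move K n c. g (fst y)) / K = avg K (%x. weight S (Suc (a + n)) x * g x) c / avg K (weight S (Suc (a + n))) c"
proof -
 have "(%y. g (fst y)) : bm (E (Suc n))" using g by measurable
 from integral_res_move[OF n c K this] show ?thesis using K by (simp add: avg_nw[OF K]) (simp add: avg_def)
qed

lemma law_Suc_step: "n < T ==> law (Suc n) = (%K. plaw n K \<bind> (%c. PiM {1..K} (%_. res_move K n c)))"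
 by (rule ext, rule law_Suc) simp_all

text \<open>The unweighted average over the resampled cloud approaches the mean under
  \<open>Q n\<close> with density \<open>1 / h n\<close>. The weights \<open>H\<close> play no part
  in it.\<close>

definition lln :: "nat => bool" where
 "lln n \<longleftrightarrow> (\<forall>G\<in>bm (B n). integrable (Q n) (%x. G x / h n x) -->
  tip (law n) (%K. avg K G) (LINT x|Q n. G x / h n x))"

text \<open>The paths already have their new coordinate, hence \<open>Q (Suc n)\<close>, but the new
  weight has not acted yet, hence still \<open>h n\<close>.\<close>

definition lln_plaw :: "nat => bool" where
 "lln_plaw n \<longleftrightarrow> (\<forall>G\<in>bm (B (Suc n)). integrable (Q (Suc n)) (%x. G x / h n x) -->
  tip (plaw n) (%K. avg K G) (LINT x|Q (Suc n). G x / h n x))"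

lemma tip_avg_kap:
 assumes n: "n < T" and L: "lln n" and G: "G : bm (B (Suc n))"
  and i: "integrable (Q (Suc n)) (%x. G x / h n x)"
 shows "tip (law n) (%K. avg K (kap n G)) (LINT x|Q (Suc n). G x / h n x)"
 using L[unfolded lln_def, THEN bspec, OF kap_measurable[OF n G], THEN mp, OF integrable_kap[OF n G i]] unfolding integral_kap[OF n G i] .

text \<open>The integrand \<open>R\<close> and the cut function \<open>G\<close> are separate, so
  that the lemma serves the law of large numbers, with \<open>R\<close> the absolute value of
  \<open>G\<close>, and the central limit theorem, with \<open>R\<close> its square.\<close>

lemma prop_tail:
 fixes G R :: "_ => real"
 assumes n: "n < T" and L: "lln n" and G: "G : bm (B (Suc n))" and R: "R : bm (B (Suc n))"
  and i: "integrable (Q (Suc n)) (%x. R x / h n x)" and e: "e > 0"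
 shows "\<exists>C>0. whp (law n) (%K c. avg K (kap n (%x. R x * indicator {C<..} (abs (G x)))) c < e)"
proof -
 have hm: "h n : bm (B n)" "h n : bm (B (Suc n))" using n by auto
 have GQ: "G : bm (Q (Suc n))" using G n by (simp cong: mcs add: sets_Q)
 obtain C where C: "C > 0" "(LINT x|Q (Suc n). R x / h n x * indicator {C<..} (abs (G x))) < e" using integral_tail_small[OF i GQ e] by auto
 let ?R = "%x. R x * indicator {C<..} (abs (G x))"
 have m: "?R : bm (B (Suc n))" using R G by measurable
 have "integrable (Q (Suc n)) (%x. ?R x / h n x)"
 proof (rule Bochner_Integration.integrable_bound[OF i])
  show "(%x. ?R x / h n x) : bm (Q (Suc n))" using m hm n by (auto cong: mcs simp: sets_Q)
 qed (auto split: split_indicator)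
 then have "tip (law n) (%K. avg K (kap n ?R)) (LINT x|Q (Suc n). ?R x / h n x)" by (rule tip_avg_kap[OF n L m])
 moreover have "(LINT x|Q (Suc n). ?R x / h n x) < e" using C(2) by simp
 ultimately show ?thesis using C(1) tip_less by blast
qed

lemma lln_plaw_if_lln:
 assumes n: "n < T" and L: "lln n"
 shows "lln_plaw n" unfolding lln_plaw_def
proof (intro ballI impI)
 fix G assume G: "G : bm (B (Suc n))" and i: "integrable (Q (Suc n)) (%x. G x / h n x)"
 interpret particle_step "law n" "%K c k. prop_move n c k" "E (Suc n)" by (rule particle_step_prop[OF n])
 have hm: "h n : bm (B n)" "h n : bm (B (Suc n))" using n by auto
 have sp: "space (law n K) = space (clouds K n)" for K using n by (simp add: space_law)
 have xm: "(%y. G (fst y)) : bm (E (Suc n))" using G by measurable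
 have "tip step (%K c'. (\<Sum>k=1..K. G (fst (c' k))) / K) (LINT x|Q (Suc n). G x / h n x)"
 proof (rule lln_step[OF xm])
  show "AE c in law n K. \<forall>k\<in>{1..K}. integrable (prop_move n c k) (%y. G (fst y))" for K
   using AE_particles[OF less_imp_le[OF n] AE_integrable_kap[OF n G i], of K] AE_space
  proof eventually_elim
   case (elim c)
   then have c: "c : space (clouds K n)" by (simp add: sp)
   show ?case using elim(1) integrable_prop_move[OF n c _ xm] by simp
  qed
  have "tip (law n) (%K. avg K (kap n G)) (LINT x|Q (Suc n). G x / h n x)" by (rule tip_avg_kap[OF n L G i])
  then show "tip (law n) (%K c. (\<Sum>k=1..K. LINT y|prop_move n c k. G (fst y)) / K) (LINT x|Q (Suc n). G x / h n x)"
   by (rule tip_cong[OF P]) (auto intro!: whp_all always_eventually avg_prop_move[OF n _ G] simp: sp)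
  fix e :: real assume e: "e > 0"
  have ai: "integrable (Q (Suc n)) (%x. abs (G x) / h n x)"
  proof (rule Bochner_Integration.integrable_bound[OF i])
   show "(%x. abs (G x) / h n x) : bm (Q (Suc n))" using G hm n by (auto cong: mcs simp: sets_Q)
  qed auto
  have am: "(%x. abs (G x)) : bm (B (Suc n))" using G by measurable
  obtain C where C: "C > 0" "whp (law n) (%K c. avg K (kap n (%x. abs (G x) * indicator {C<..} (abs (G x)))) c < e)"
   using prop_tail[OF n L G am ai e] by auto
  have gm: "(%x. abs (G x) * indicator {C<..} (abs (G x))) : bm (B (Suc n))" using G by measurable
  show "\<exists>C>0. whp (law n) (%K c. (\<Sum>k=1..K. LINT y|prop_move n c k. abs (G (fst y)) * indicator {C<..} (abs (G (fst y)))) / K < e)"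
   using C avg_prop_move[OF n _ gm] by (intro exI[of _ C] conjI whp_imp[OF C(2)]) (auto simp: sp)
 qed
 then show "tip (plaw n) (%K. avg K G) (LINT x|Q (Suc n). G x / h n x)" unfolding plaw_def avg_def .
qed

lemma weight_h:
 assumes n: "n < T" and x: "x : space (B (Suc n))"
 shows "weight S (Suc (a + n)) x * g / h n x = Z (Suc n) / Z n * (g / h (Suc n) x)"
proof -
 have hp: "h n x > 0" "h (Suc n) x > 0" using n x by (auto intro!: h_pos[where k="Suc n"])
 have Zp: "Z n > 0" "Z (Suc n) > 0" using n by (auto intro!: Z_pos)
 have "weight S (Suc (a + n)) x / h n x = Z (Suc n) / (Z n * h (Suc n) x)" using h_Suc[OF n x] hp Zp by (simp add: field_simps)
 then have "weight S (Suc (a + n)) x / h n x * g = Z (Suc n) / (Z n * h (Suc n) x) * g" by simp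
 then show ?thesis by simp
qed

text \<open>Multiplication by the newest weight changes the density from \<open>1 / h n\<close> to
  \<open>1 / h (Suc n)\<close>, up to the factor \<open>Z (Suc n) / Z n\<close>. This factor cancels
  in the self-normalised quotient of \<open>tip_resampled_avg\<close>.\<close>

lemma
 assumes n: "n < T" and L: "lln_plaw n" and G: "G : bm (B (Suc n))"
  and i: "integrable (Q (Suc n)) (%x. G x / h (Suc n) x)"
 shows tip_weighted_avg: "tip (plaw n) (%K. avg K (%x. weight S (Suc (a + n)) x * G x)) (Z (Suc n) / Z n * (LINT x|Q (Suc n). G x / h (Suc n) x))"
proof -
 have wm: "weight S (Suc (a + n)) : bm (B (Suc n))" by (rule weight_cloud_measurable[OF n])
 have sp: "space (Q (Suc n)) = space (B (Suc n))" using n by (simp add: space_Q)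
 have e: "weight S (Suc (a + n)) x * G x / h n x = Z (Suc n) / Z n * (G x / h (Suc n) x)" if "x : space (Q (Suc n))" for x
  using weight_h[OF n] that by (simp add: sp)
 have 1: "integrable (Q (Suc n)) (%x. weight S (Suc (a + n)) x * G x / h n x)"
  using integrable_mult_right[OF i, of "Z (Suc n) / Z n"] by (simp add: e cong: Bochner_Integration.integrable_cong)
 have 2: "(LINT x|Q (Suc n). weight S (Suc (a + n)) x * G x / h n x) = Z (Suc n) / Z n * (LINT x|Q (Suc n). G x / h (Suc n) x)"
 proof -
  have "(LINT x|Q (Suc n). weight S (Suc (a + n)) x * G x / h n x) = (LINT x|Q (Suc n). Z (Suc n) / Z n * (G x / h (Suc n) x))"
   by (rule Bochner_Integration.integral_cong[OF refl]) (rule e)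
  then show ?thesis by (simp only: integral_mult_right_zero)
 qed
 have m: "(%x. weight S (Suc (a + n)) x * G x) : bm (B (Suc n))" using wm G by measurable
 show ?thesis using L[unfolded lln_plaw_def, THEN bspec, OF m, THEN mp, OF 1] unfolding 2 .
qed

lemma tip_avg_weight:
 assumes n: "n < T" and L: "lln_plaw n"
 shows "tip (plaw n) (%K. avg K (weight S (Suc (a + n)))) (Z (Suc n) / Z n)"
proof -
 have i: "integrable (Q (Suc n)) (%x. 1 / h (Suc n) x)" "(LINT x|Q (Suc n). 1 / h (Suc n) x) = 1" using n by (intro inverse_h_integral; simp)+
 show ?thesis using tip_weighted_avg[OF n L borel_measurable_const i(1)] unfolding i(2) mult_1_right .
qed

lemma tip_resampled_avg:
 assumes n: "n < T" and L: "lln_plaw n" and G: "G : bm (B (Suc n))"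
  and i: "integrable (Q (Suc n)) (%x. G x / h (Suc n) x)"
 shows "tip (plaw n) (%K c. avg K (%x. weight S (Suc (a + n)) x * G x) c / avg K (weight S (Suc (a + n))) c) (LINT x|Q (Suc n). G x / h (Suc n) x)"
proof -
 have Zp: "Z n > 0" "Z (Suc n) > 0" using n by (auto intro!: Z_pos)
 then show ?thesis using tip_divide[OF prob_space_plaw[OF n] tip_weighted_avg[OF assms] tip_avg_weight[OF n L]] by simp
qed

lemma res_tail:
 fixes G R :: "_ => real"
 assumes n: "n < T" and L: "lln_plaw n" and G: "G : bm (B (Suc n))" and R: "R : bm (B (Suc n))"
  and i: "integrable (Q (Suc n)) (%x. R x / h (Suc n) x)" and e: "e > 0"
 shows "\<exists>C>0. whp (plaw n) (%K c. avg K (%x. weight S (Suc (a + n)) x * (R x * indicator {C<..} (abs (G x)))) c / avg K (weight S (Suc (a + n))) c < e)"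
proof -
 have hm: "h (Suc n) : bm (B (Suc n))" using n by auto
 have GQ: "G : bm (Q (Suc n))" using G n by (simp cong: mcs add: sets_Q)
 obtain C where C: "C > 0" "(LINT x|Q (Suc n). R x / h (Suc n) x * indicator {C<..} (abs (G x))) < e" using integral_tail_small[OF i GQ e] by auto
 let ?R = "%x. R x * indicator {C<..} (abs (G x))"
 have m: "?R : bm (B (Suc n))" using R G by measurable
 have "integrable (Q (Suc n)) (%x. ?R x / h (Suc n) x)"
 proof (rule Bochner_Integration.integrable_bound[OF i])
  show "(%x. ?R x / h (Suc n) x) : bm (Q (Suc n))" using m hm n by (auto cong: mcs simp: sets_Q)
 qed (auto split: split_indicator)
 from tip_resampled_avg[OF n L m this] C show ?thesis using tip_less by (intro exI[of _ C]) auto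
qed

lemma lln_Suc_if_lln_plaw:
 assumes n: "n < T" and L: "lln_plaw n"
 shows "lln (Suc n)" unfolding lln_def
proof (intro ballI impI)
 fix G assume G: "G : bm (B (Suc n))" and i: "integrable (Q (Suc n)) (%x. G x / h (Suc n) x)"
 interpret particle_step "plaw n" "%K c k. res_move K n c" "E (Suc n)" by (rule particle_step_res[OF n])
 have hm: "h (Suc n) : bm (B (Suc n))" using n by auto
 have sp: "space (plaw n K) = space (clouds K (Suc n))" for K using n by (simp add: space_plaw)
 have xm: "(%y. G (fst y)) : bm (E (Suc n))" using G by measurable
 have eq: "whp (plaw n) (%K c. (\<Sum>k=1..K. LINT y|res_move K n c. g (fst y)) / K
   = avg K (%x. weight S (Suc (a + n)) x * g x) c / avg K (weight S (Suc (a + n))) c)"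
  if g: "g : bm (B (Suc n))" for g
  by (rule whp_all, rule eventually_mono[OF eventually_ge_at_top[of 1]], intro ballI avg_res_move[OF n _ _ g]) (simp_all add: sp)
 have "tip step (%K c'. (\<Sum>k=1..K. G (fst (c' k))) / K) (LINT x|Q (Suc n). G x / h (Suc n) x)"
 proof (rule lln_step[OF xm])
  show "AE c in plaw n K. \<forall>k\<in>{1..K}. integrable (res_move K n c) (%y. G (fst y))" for K
   by (rule AE_I2) (auto intro!: integrable_res_move[OF n _ _ xm] simp: sp)
  show "tip (plaw n) (%K c. (\<Sum>k=1..K. LINT y|res_move K n c. G (fst y)) / K) (LINT x|Q (Suc n). G x / h (Suc n) x)"
   by (rule tip_cong[OF P tip_resampled_avg[OF n L G i] eq[OF G]])
  fix e :: real assume e: "e > 0"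
  have ai: "integrable (Q (Suc n)) (%x. abs (G x) / h (Suc n) x)"
  proof (rule Bochner_Integration.integrable_bound[OF i])
   show "(%x. abs (G x) / h (Suc n) x) : bm (Q (Suc n))" using G hm n by (auto cong: mcs simp: sets_Q)
  qed auto
  have am: "(%x. abs (G x)) : bm (B (Suc n))" using G by measurable
  obtain C where C: "C > 0" "whp (plaw n) (%K c. avg K (%x. weight S (Suc (a + n)) x * (abs (G x) * indicator {C<..} (abs (G x)))) c / avg K (weight S (Suc (a + n))) c < e)"
   using res_tail[OF n L G am ai e] by auto
  have gm: "(%x. abs (G x) * indicator {C<..} (abs (G x))) : bm (B (Suc n))" using G by measurable
  show "\<exists>C>0. whp (plaw n) (%K c. (\<Sum>k=1..K. LINT y|res_move K n c. abs (G (fst y)) * indicator {C<..} (abs (G (fst y)))) / K < e)"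
   using C by (intro exI[of _ C] conjI whp_imp[OF whp_conj[OF P C(2) eq[OF gm]]]) auto
 qed
 then show "tip (law (Suc n)) (%K. avg K G) (LINT x|Q (Suc n). G x / h (Suc n) x)" unfolding law_Suc_step[OF n] avg_def .
qed

lemma lln_0: "lln 0" unfolding lln_def
proof (intro ballI impI)
 fix G assume G: "G : bm (B 0)" "integrable (Q 0) (%x. G x / h 0 x)"
 have e: "(LINT x|Q 0. G x / h 0 x) = G (%_. undefined)" using G(1) by (simp add: Q_def integral_return space_paths_empty)
 show "tip (law 0) (%K. avg K G) (LINT x|Q 0. G x / h 0 x)" unfolding e
 proof (rule tip_cong[OF _ tip_const[OF tendsto_const]])
  show "whp (law 0) (%K om. avg K G om = G (%_. undefined))"
  proof (rule whp_AE, rule eventually_mono[OF eventually_ge_at_top[of 1]])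
   fix K :: nat assume K: "1 <= K"
   have "Measurable.pred (clouds K 0) (%c. avg K G c = G (%_. undefined))"
    unfolding Measurable.pred_def by (intro borel_measurable_eq avg_measurable G borel_measurable_const)
   then show "AE c in law 0 K. avg K G c = G (%_. undefined)" unfolding law_0 using K by (subst AE_return[OF init_cloud]) (auto simp: avg_def)
  qed
 qed (simp add: prob_space_law)
qed

lemma lln: "n <= T ==> lln n"
proof (induction n)
 case 0 show ?case by (rule lln_0)
next
 case (Suc n)
 then show ?case by (intro lln_Suc_if_lln_plaw lln_plaw_if_lln) auto
qed

lemma lln_plaw: "n < T ==> lln_plaw n" by (intro lln_plaw_if_lln lln) auto

lemma tip_cc_plaw_if:
 assumes n: "n < T" and t: "tip (law n) (%K. cc n) 1"
 shows "tip (plaw n) (%K. cc n) 1"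
proof -
 interpret particle_step "law n" "%K c k. prop_move n c k" "E (Suc n)" by (rule particle_step_prop[OF n])
 show ?thesis unfolding plaw_def
 proof (rule tip_bind_const[OF P kernel _ t])
  show "cc n : bm (clouds K (Suc n))" if "1 <= K" for K using n that by (intro cc_measurable) auto
  fix K :: nat assume K: "1 <= K"
  show "AE c in law n K. AE c' in PiM {1..K} (prop_move n c). cc n c' = cc n c" using AE_proportional[OF less_imp_le[OF n] K] AE_space
  proof eventually_elim
   case (elim c)
   then have "c : space (clouds K n)" using n by (simp add: space_law)
   from AE_prop_cloud[OF n K this elim(1)] show ?case by eventually_elim simp
  qed
 qed
qed

text \<open>By the law of large numbers the average weight tends to \<open>Z (Suc n) / Z n\<close>,
  and the update of the common factor multiplies by exactly the reciprocal of this limit.\<close>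

lemma tip_cc_Suc_if:
 assumes n: "n < T" and t: "tip (plaw n) (%K. cc n) 1"
 shows "tip (law (Suc n)) (%K. cc (Suc n)) 1"
  and "tip (plaw n) (%K c. cc n c * avg K (weight S (Suc (a + n))) c * Z n / Z (Suc n)) 1"
proof -
 interpret particle_step "plaw n" "%K c k. res_move K n c" "E (Suc n)" by (rule particle_step_res[OF n])
 have Zp: "Z n > 0" "Z (Suc n) > 0" using n by (auto intro!: Z_pos)
 have "tip (plaw n) (%K c. cc n c * avg K (weight S (Suc (a + n))) c * Z n / Z (Suc n)) (1 * (Z (Suc n) / Z n) * Z n / Z (Suc n))"
  using Zp by (intro tip_divide[OF P] tip_mult[OF P] t tip_avg_weight[OF n lln_plaw[OF n]] tip_const tendsto_const) auto
 then show 1: "tip (plaw n) (%K c. cc n c * avg K (weight S (Suc (a + n))) c * Z n / Z (Suc n)) 1" using Zp by simp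
 have "tip step (%K. cc (Suc n)) 1"
 proof (rule tip_bind_const[OF P kernel _ 1])
  show "cc (Suc n) : bm (clouds K (Suc n))" if "1 <= K" for K using n that by (intro cc_measurable) auto
  fix K :: nat assume K: "1 <= K"
  show "AE c in plaw n K. AE c' in PiM {1..K} (%_. res_move K n c). cc (Suc n) c' = cc n c * avg K (weight S (Suc (a + n))) c * Z n / Z (Suc n)"
   using AE_proportional_plaw[OF n K] AE_space
  proof eventually_elim
   case (elim c)
   then have "c : space (clouds K (Suc n))" using n by (simp add: space_plaw)
   from AE_res_cloud[OF n K this elim(1)] show ?case by eventually_elim simp
  qed
 qed
 then show "tip (law (Suc n)) (%K. cc (Suc n)) 1" unfolding law_Suc_step[OF n] .
qed

lemma tip_cc: "n <= T ==> tip (law n) (%K. cc n) 1"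
proof (induction n)
 case 0
 show ?case
 proof (rule tip_cong[OF _ tip_const[OF tendsto_const]])
  show "whp (law 0) (%K om. cc 0 om = 1)"
  proof (rule whp_AE, rule eventually_mono[OF eventually_ge_at_top[of 1]])
   fix K :: nat assume K: "1 <= K"
   have "Measurable.pred (clouds K 0) (%c. cc 0 c = 1)"
    unfolding Measurable.pred_def by (intro borel_measurable_eq cc_measurable K borel_measurable_const) auto
   then show "AE c in law 0 K. cc 0 c = 1" unfolding law_0 using K by (subst AE_return[OF init_cloud]) (auto simp: cc_def)
  qed
 qed (simp add: prob_space_law)
next
 case (Suc n)
 then show ?case by (intro tip_cc_Suc_if tip_cc_plaw_if) auto
qed

lemma tip_cc_plaw: "n < T ==> tip (plaw n) (%K. cc n) 1" by (intro tip_cc_plaw_if tip_cc) auto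

end

lemma tip_measure:
 fixes X :: "nat => 'a => real"
 assumes P: "\<And>K. prob_space (P K)" and X: "tip P X l" and u: "l < u"
 shows "(%K. measure (P K) {om\<in>space (P K). u < X K om}) \<longlonglongrightarrow> 0"
proof (rule tendstoI)
 fix e :: real assume "e > 0"
 then have "\<forall>\<^sub>F K in sequentially. \<exists>B\<in>sets (P K). measure (P K) B < e & (\<forall>om\<in>space (P K) - B. X K om < u)"
  by (rule whpD[OF tip_less[OF X u]])
 then show "\<forall>\<^sub>F K in sequentially. dist (measure (P K) {om\<in>space (P K). u < X K om}) 0 < e"
 proof eventually_elim
  case (elim K)
  interpret prob_space "P K" by (rule P)
  from elim obtain B where B: "B : events" "prob B < e" "\<forall>om\<in>space (P K) - B. X K om < u" by blast
  then have "om : B" if "om : space (P K)" "u < X K om" for om using that less_asym by blast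
  then have "{om\<in>space (P K). u < X K om} \<subseteq> B" by blast
  then have "prob {om\<in>space (P K). u < X K om} <= prob B" using B(1) by (rule finite_measure_mono)
  then show ?case using B(2) by simp
 qed
qed

section \<open>Weighted averages and the size of the common factor\<close>

context smc_block begin

definition wavg :: "nat => ((nat => 'x) => real) => (nat => (nat => 'x) \<times> real) => real" where
 "wavg K G c = (\<Sum>k=1..K. snd (c k) * G (fst (c k))) / K"

lemma wavg_measurable:
 assumes G: "G : bm (B n)"
 shows "wavg K G : bm (clouds K n)" unfolding wavg_def[abs_def]
 by (rule borel_measurable_divide[OF borel_measurable_sum borel_measurable_const],
   rule borel_measurable_times[OF cloud_snd_measurable mcomp[OF cloud_fst_measurable G]])

lemma wavg_proportional:
 assumes "proportional n K c"
 shows "wavg K G c = cc n c * avg K (%x. h n x * G x) c"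
proof -
 have "(\<Sum>k=1..K. snd (c k) * G (fst (c k))) = (\<Sum>k=1..K. cc n c * (h n (fst (c k)) * G (fst (c k))))"
  using assms unfolding proportional_def by (intro sum.cong refl) (simp add: mult.assoc)
 then show ?thesis by (simp add: wavg_def avg_def sum_distrib_left)
qed

text \<open>The value that \<open>cc (Suc n)\<close> almost surely takes after the resampling. It is
  already determined by the cloud before it, so it can be used inside conditional moments.\<close>

definition cc_next :: "nat => nat => (nat => (nat => 'x) \<times> real) => real" where
 "cc_next n K c = cc n c * avg K (weight S (Suc (a + n))) c * Z n / Z (Suc n)"

lemma cc_next:
 assumes n: "n < T" and K: "K >= 1" and c: "c : space (clouds K (Suc n))" and p: "proportional n K c" and j: "j : {1..K}"
 shows "snd (c j) / (real K * nw K n c j) = cc_next n K c * h (Suc n) (fst (c j))" and "0 < cc_next n K c"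
proof -
 let ?w = "weight S (Suc (a + n))" and ?x = "fst (c j)"
 have w: "0 < ?w ?x" using cloud_component[OF c j] by (rule weight_cloud_pos[OF n])
 have Hp: "snd (c j) = cc n c * h n ?x" using p j unfolding proportional_def by blast
 have Zp: "0 < Z n" "0 < Z (Suc n)" using n by (auto intro!: Z_pos)
 have hh: "h n ?x = h (Suc n) ?x * ?w ?x * Z n / Z (Suc n)" using h_Suc[OF n cloud_component[OF c j]] Zp by (simp add: field_simps)
 have S: "0 < (\<Sum>k=1..K. ?w (fst (c k)))" by (rule sum_weight_pos[OF n c K])
 have "real K * nw K n c j = ?w ?x / avg K ?w c" using S K by (simp add: nw_eq[OF K] avg_def)
 then show "snd (c j) / (real K * nw K n c j) = cc_next n K c * h (Suc n) (fst (c j))" using w by (simp add: Hp hh cc_next_def)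
 have "0 < cc n c" using proportional_cc_pos[of n "Suc n" K c] n K c p by simp
 moreover have "0 < avg K ?w c" using S K by (simp add: avg_def)
 ultimately show "0 < cc_next n K c" using Zp by (simp add: cc_next_def)
qed

lemma tip_cc_next: "n < T ==> tip (plaw n) (cc_next n) 1" using tip_cc_Suc_if(2)[OF _ tip_cc_plaw] unfolding cc_next_def[abs_def] by blast

lemma cc_next_measurable: "n < T ==> K >= 1 ==> cc_next n K : bm (clouds K (Suc n))" unfolding cc_next_def[abs_def]
 by (intro borel_measurable_divide borel_measurable_times cc_measurable avg_measurable weight_cloud_measurable borel_measurable_const) auto

text \<open>The threshold 2 stands for any number above the limit 1 of the common factor.\<close>

definition bad :: "nat => nat => ennreal" where
 "bad n K = emeasure (law n K) {c\<in>space (law n K). 2 < cc n c}"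

definition bad_next :: "nat => nat => ennreal" where
 "bad_next n K = emeasure (plaw n K) {c\<in>space (plaw n K). 2 < cc_next n K c}"

lemma bad_tendsto: assumes n: "n <= T" shows "bad n \<longlonglongrightarrow> 0"
proof -
 have "(%K. measure (law n K) {c\<in>space (law n K). 2 < cc n c}) \<longlonglongrightarrow> 0"
  using n by (intro tip_measure[OF prob_space_law tip_cc]) auto
 from tendsto_ennrealI[OF this] show ?thesis
  unfolding bad_def using prob_space_law[OF n] by (simp add: finite_measure.emeasure_eq_measure prob_space.finite_measure)
qed

lemma bad_next_tendsto: assumes n: "n < T" shows "bad_next n \<longlonglongrightarrow> 0"
proof -
 have "(%K. measure (plaw n K) {c\<in>space (plaw n K). 2 < cc_next n K c}) \<longlonglongrightarrow> 0"
  using n by (intro tip_measure[OF prob_space_plaw tip_cc_next]) auto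
 from tendsto_ennrealI[OF this] show ?thesis
  unfolding bad_next_def using prob_space_plaw[OF n] by (simp add: finite_measure.emeasure_eq_measure prob_space.finite_measure)
qed

text \<open>The part of \<open>moment_bound\<close> that does not depend on the test function. Each
  half-stage doubles the previous bound, hence the factor 4; \<open>bad\<close> is doubled once more
  by the resampling half, \<open>bad_next\<close> is not.\<close>

primrec rem :: "nat => nat => ennreal" where
 "rem 0 K = 0"
| "rem (Suc n) K = 4 * rem n K + 4 * bad n K + 2 * bad_next n K"

lemma rem_tendsto: "n <= T ==> rem n \<longlonglongrightarrow> 0"
proof (induction n)
 case (Suc n)
 have "(%K. 4 * rem n K + 4 * bad n K + 2 * bad_next n K) \<longlonglongrightarrow> 4 * 0 + 4 * 0 + 2 * 0"
  using Suc by (intro tendsto_add ennreal_tendsto_cmult bad_tendsto bad_next_tendsto) auto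
 then show ?case by simp
next
 case 0
 have "rem 0 = (%K. 0)" by (rule ext) simp
 then show ?case by simp
qed

lemma wavg_sq_le:
 assumes n: "n <= T" and K: "K >= 1" and c: "c : space (clouds K k)" and nk: "n <= k" and p: "proportional n K c"
  and cc: "cc n c <= 2"
 shows "ennreal ((\<Sum>k=1..K. (snd (c k) * G (fst (c k)))\<^sup>2) / K) <= 2 / of_nat K * wsum K (%x. ennreal (h n x * (G x)^2)) c"
proof -
 have h0: "0 < h n (fst (c i))" if "i : {1..K}" for i using cloud_component[OF c that] by (rule h_pos[OF n nk])
 have e: "(snd (c i) * G (fst (c i)))^2 <= 2 * (snd (c i) * (h n (fst (c i)) * (G (fst (c i)))^2))" if i: "i : {1..K}" for i
 proof -
  have s: "snd (c i) = cc n c * h n (fst (c i))" "0 < snd (c i)" using p i unfolding proportional_def by blast+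
  then have "snd (c i) <= 2 * h n (fst (c i))" using mult_right_mono[OF cc less_imp_le[OF h0[OF i]]] by simp
  then have "snd (c i) * (snd (c i) * (G (fst (c i)))^2) <= snd (c i) * (2 * h n (fst (c i)) * (G (fst (c i)))^2)"
   using s(2) by (intro mult_left_mono mult_right_mono) auto
  then show ?thesis by (simp add: power2_eq_square mult_ac)
 qed
 have pos: "0 <= snd (c i) * (h n (fst (c i)) * (G (fst (c i)))^2)" if i: "i : {1..K}" for i
 proof -
  have "0 < snd (c i)" using p i unfolding proportional_def by blast
  then show ?thesis using h0[OF i] by (intro mult_nonneg_nonneg) auto
 qed
 have "(\<Sum>k=1..K. (snd (c k) * G (fst (c k)))\<^sup>2) / K <= (\<Sum>k=1..K. 2 * (snd (c k) * (h n (fst (c k)) * (G (fst (c k)))^2))) / K"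
  by (intro divide_right_mono sum_mono e) auto
 also have "... = 2 / K * (\<Sum>k=1..K. snd (c k) * (h n (fst (c k)) * (G (fst (c k)))^2))"
  by (simp only: sum_distrib_left[symmetric] times_divide_eq_left)
 finally have "ennreal ((\<Sum>k=1..K. (snd (c k) * G (fst (c k)))\<^sup>2) / K)
  <= ennreal (2 / K * (\<Sum>k=1..K. snd (c k) * (h n (fst (c k)) * (G (fst (c k)))^2)))" by (rule ennreal_leI)
 also have "... = ennreal (2 / K) * (\<Sum>k=1..K. ennreal (snd (c k) * (h n (fst (c k)) * (G (fst (c k)))^2)))"
  by (subst ennreal_mult', simp, subst sum_ennreal[OF pos], assumption, rule refl)
 also have "(\<Sum>k=1..K. ennreal (snd (c k) * (h n (fst (c k)) * (G (fst (c k)))^2))) = wsum K (%x. ennreal (h n x * (G x)^2)) c"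
  unfolding wsum_def using p unfolding proportional_def by (intro sum.cong refl ennreal_mult') (meson less_imp_le)
 also have "ennreal (2 / K) = 2 / of_nat K" using K by (simp add: divide_ennreal[symmetric] ennreal_of_nat_eq_real_of_nat)
 finally show ?thesis .
qed

text \<open>On the event that the common factor is at most \<open>2\<close>, one factor \<open>H\<close> is bounded by \<open>2 h\<close> and the
 remaining one is removed by unbiasedness.\<close>
lemma truncated_second_moment:
 assumes n: "n <= T" and K: "K >= 1" and G: "G : bm (B n)"
 shows "(\<integral>\<^sup>+c. ennreal ((wavg K G c)^2) * indicator {c. cc n c <= 2} c \<partial>law n K) <= 2 * (\<integral>\<^sup>+x. ennreal (h n x * (G x)^2) \<partial>Q n)"
proof -
 have m: "(%x. ennreal (h n x * (G x)^2)) : bm (B n)" using n G by measurable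
 have "(\<integral>\<^sup>+c. ennreal ((wavg K G c)^2) * indicator {c. cc n c <= 2} c \<partial>law n K)
  <= (\<integral>\<^sup>+c. 2 / of_nat K * wsum K (%x. ennreal (h n x * (G x)^2)) c \<partial>law n K)"
 proof (rule nn_integral_mono_AE)
  show "AE c in law n K. ennreal ((wavg K G c)^2) * indicator {c. cc n c <= 2} c <= 2 / of_nat K * wsum K (%x. ennreal (h n x * (G x)^2)) c"
   using AE_proportional[OF n K] AE_space
  proof eventually_elim
   case (elim c)
   then have c: "c : space (clouds K n)" using n by (simp add: space_law)
   have "(\<Sum>k=1..K. snd (c k) * G (fst (c k)))^2 <= (\<Sum>k=1..K. (snd (c k) * G (fst (c k)))\<^sup>2) * K"
    using sum_squared_le_sum_of_squares[where I="{1..K}" and f="%k. snd (c k) * G (fst (c k))"] K by simp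
   then have "(wavg K G c)^2 <= (\<Sum>k=1..K. (snd (c k) * G (fst (c k)))\<^sup>2) / K"
    using K by (simp add: wavg_def power_divide field_simps power2_eq_square)
   then show ?case using wavg_sq_le[OF n K c order_refl elim(1), of G] by (auto split: split_indicator intro: order_trans[OF ennreal_leI])
  qed
 qed
 also have "... = 2 / of_nat K * (of_nat K * (\<integral>\<^sup>+x. ennreal (h n x * (G x)^2) \<partial>Q n))"
  using wsum_measurable[OF m, of K] n by (subst nn_integral_cmult) (auto simp: unbiased[OF n m] cong: mcs)
 also have "... = 2 * (\<integral>\<^sup>+x. ennreal (h n x * (G x)^2) \<partial>Q n)"
 proof -
  have "2 / of_nat K * of_nat K = (2 :: ennreal)" using K
   by (simp add: ennreal_of_nat_eq_real_of_nat divide_ennreal ennreal_mult'[symmetric] flip: ennreal_numeral)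
  then show ?thesis by (simp add: mult.assoc[symmetric])
 qed
 finally show ?thesis .
qed

end

section \<open>Backward means of a test function on one block\<close>

locale smc_block_fun = smc_block S m for S :: "('x, 'y) smc" and m +
 fixes g :: "(nat => 'x) => real"
 assumes g_measurable: "g : bm (B T)"
  and g_integrable: "integrable (Q T) g"
begin

text \<open>A version, defined at every path, of the conditional mean of \<open>g\<close> given the
  first \<open>n\<close> block coordinates. Where \<open>g\<close> is not integrable along the run,
  the integral has the default value 0; by \<open>AE_integrable_run\<close> this is a null
  set.\<close>

definition gn :: "nat => (nat => 'x) => real" where
 "gn n z = (LINT x|path_run S a (a + n) z (T - n). g x)"

definition g0 :: real where "g0 = (LINT x|Q T. g x)"

lemma run_kernel_T: "n <= T ==> (%z. path_run S a (a + n) z (T - n)) : B n \<rightarrow>\<^sub>M prob_algebra (B T)"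
 using run_kernel_a[of n "T - n"] by simp

lemma gn_measurable: "n <= T ==> gn n : bm (B n)" unfolding gn_def[abs_def]
 by (rule mcomp[OF measurable_prob_algebraD[OF run_kernel_T] integral_measurable_subprob_algebra[OF g_measurable]])

lemma
 assumes n: "n <= T"
 shows integrable_gn: "integrable (Q n) (gn n)" and integral_gn: "(LINT z|Q n. gn n z) = g0"
  and AE_integrable_run: "AE z in Q n. integrable (path_run S a (a + n) z (T - n)) g"
proof -
 have e: "Q T = Q n \<bind> (%z. path_run S a (a + n) z (T - n))" using Q_add[of n "T - n"] n by simp
 have k: "(%z. path_run S a (a + n) z (T - n)) : Q n \<rightarrow>\<^sub>M prob_algebra (B T)"
  using run_kernel_T[OF n] n by (simp cong: mcs add: sets_Q)
 have ne: "space (Q n) ~= {}" using n by (intro prob_space.not_empty prob_space_Q)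
 show "integrable (Q n) (gn n)" "(LINT z|Q n. gn n z) = g0"
  "AE z in Q n. integrable (path_run S a (a + n) z (T - n)) g"
  using integrable_integral_bind[OF k ne] integral_bind[OF k ne] AE_integrable_bind[OF k ne] g_integrable
  unfolding e[symmetric] gn_def[abs_def] g0_def by auto
qed

lemma gn_T: "z : space (B T) ==> gn T z = g z" using g_measurable by (simp add: gn_def integral_return)

lemma gn_0: "gn 0 (%_. undefined) = g0" by (simp add: gn_def g0_def Q_def)

text \<open>The one-step backward recursion. It holds only almost everywhere, because the inner
  integrals may take their default value on a null set.\<close>

lemma AE_gn:
 assumes n: "n < T"
 shows "AE z in Q n. integrable (path_step S a (a + n) z) (gn (Suc n)) & gn n z = kap n (gn (Suc n)) z"
 using AE_integrable_run[OF less_imp_le[OF n]] AE_space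
proof eventually_elim
 case (elim z)
 have z: "z : space (B n)" using elim(2) n by (simp add: space_Q)
 let ?r = "T - Suc n"
 have sc: "T - n = Suc ?r" using n by simp
 have k: "(%z. path_run S a (a + Suc n) z ?r) : path_step S a (a + n) z \<rightarrow>\<^sub>M prob_algebra (B T)"
  using run_kernel_T[of "Suc n"] n by (simp cong: mcs add: sets_step_a[OF n z])
 have e: "path_run S a (a + n) z (T - n) = path_step S a (a + n) z \<bind> (%z. path_run S a (a + Suc n) z ?r)"
  unfolding sc using run_Suc_left[OF a_le_start[of n] _ z, of ?r] a_T_le n by (simp add: add_Suc_right)
 have ne: "space (path_step S a (a + n) z) ~= {}" by (intro prob_space.not_empty prob_space_step_a[OF n z])
 show ?case using integrable_integral_bind[OF k ne] integral_bind[OF k ne] elim(1) unfolding e[symmetric] by (simp add: gn_def[abs_def] kap_def)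
qed

text \<open>The proposal keeps \<open>H\<close> and averages \<open>gn (Suc n)\<close> to
  \<open>gn n\<close>. The weighted average is thus a martingale through this half-stage, and
  \<open>res_mean\<close> says the same for the other half; this is what makes the noise terms
  centred.\<close>

lemma AE_prop_mean:
 assumes n: "n < T"
 shows "AE c in law n K. wavg K (gn n) c - g0 = (\<Sum>k=1..K. LINT y|prop_move n c k. snd y * gn (Suc n) (fst y)) / K - g0"
 using AE_particles[OF less_imp_le[OF n] AE_gn[OF n], of K] AE_space
proof eventually_elim
 case (elim c)
 then have c: "c : space (clouds K n)" using n by (simp add: space_law)
 have gm: "gn (Suc n) : bm (B (Suc n))" using n by (intro gn_measurable) simp
 have xm: "(%y. snd y * gn (Suc n) (fst y)) : bm (E (Suc n))" using gm by measurable
 have "(LINT y|prop_move n c k. snd y * gn (Suc n) (fst y)) = snd (c k) * gn n (fst (c k))" if k: "k : {1..K}" for k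
  using elim(1) k by (simp add: integral_prop_move[OF n c k xm] kap_def)
 then show ?case by (simp add: wavg_def)
qed

lemma res_mean:
 assumes n: "n < T" and K: "K >= 1" and c: "c : space (clouds K (Suc n))"
 shows "(LINT y|res_move K n c. snd y * gn (Suc n) (fst y)) = wavg K (gn (Suc n)) c"
proof -
 have gm: "gn (Suc n) : bm (B (Suc n))" using n by (intro gn_measurable) simp
 have xm: "(%y. snd y * gn (Suc n) (fst y)) : bm (E (Suc n))" using gm by measurable
 have "nw K n c j * (snd (c j) / (real K * nw K n c j) * gn (Suc n) (fst (c j))) = snd (c j) * gn (Suc n) (fst (c j)) / K" if "j : {1..K}" for j
  using nw_pos[OF n c K that] by simp
 then show ?thesis by (simp add: integral_res_move[OF n c K xm] wavg_def sum_divide_distrib)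
qed

subsection \<open>A second moment bound that is uniform in the test function\<close>

abbreviation sqn :: "nat => nat => ennreal" where
 "sqn i n \<equiv> \<integral>\<^sup>+x. ennreal (h i x * (gn n x)^2) \<partial>Q n"

text \<open>\<open>second_moment_step\<close> for the variable \<open>H\<close> times
  \<open>gn (Suc n)\<close>. Where \<open>cc n\<close> is at most 2, one factor \<open>H\<close> is
  bounded by \<open>2 * h n\<close> and unbiasedness evaluates the mean of the rest; elsewhere the
  truncation at 1 leaves \<open>bad\<close>.\<close>

lemma moment_prop:
 assumes n: "n < T" and K: "K >= 1"
 shows "(\<integral>\<^sup>+c. min 1 (K * (wavg K (gn (Suc n)) c - g0)^2) \<partial>plaw n K)
  <= 2 * (\<integral>\<^sup>+c. min 1 (K * (wavg K (gn n) c - g0)^2) \<partial>law n K) + 2 * (bad n K + 2 * sqn n (Suc n))"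
proof -
 interpret particle_step "law n" "%K c k. prop_move n c k" "E (Suc n)" by (rule particle_step_prop[OF n])
 have n': "n <= T" using n by simp
 have gm: "gn (Suc n) : bm (B (Suc n))" using n by (intro gn_measurable) simp
 have g2m: "(%x. ennreal ((gn (Suc n) x)^2)) : bm (B (Suc n))" using gm by measurable
 have hm: "h n : bm (B n)" "h n : bm (B (Suc n))" using n by auto
 have xm: "(%y. snd y * gn (Suc n) (fst y)) : bm (E (Suc n))" using gm by measurable
 have Dm: "(%c. wavg K (gn n) c - g0) : bm (law n K)"
  using wavg_measurable[OF gn_measurable[OF n'], of K] by (simp cong: mcs add: sets_law[OF n'])
 define V where "V c = (\<Sum>k=1..K. \<integral>\<^sup>+y. (snd y * gn (Suc n) (fst y))\<^sup>2 \<partial>prop_move n c k) / K" for c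
 define phi where "phi z = (\<integral>\<^sup>+x. ennreal (h n x * (gn (Suc n) x)^2) \<partial>path_step S a (a + n) z)" for z
 have hgm: "(%x. ennreal (h n x * (gn (Suc n) x)^2)) : bm (B (Suc n))" using hm gm by measurable
 have phim: "phi : bm (B n)"
  unfolding phi_def by (rule mcomp[OF measurable_prob_algebraD[OF step_kernel_a[OF n]] nn_integral_measurable_subprob_algebra[OF hgm]])
 have ccm: "cc n : bm (clouds K n)" using n K by (intro cc_measurable) auto
 have "(\<integral>\<^sup>+c'. min 1 (K * ((\<Sum>k=1..K. snd (c' k) * gn (Suc n) (fst (c' k))) / K - g0)^2) \<partial>step K)
  <= 2 * (\<integral>\<^sup>+c. min 1 (K * (wavg K (gn n) c - g0)^2) \<partial>law n K) + 2 * (\<integral>\<^sup>+c. min 1 (V c) \<partial>law n K)"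
  unfolding V_def using AE_prop_mean[OF n, of K] by (intro second_moment_step[OF xm Dm K]) (auto elim: eventually_mono)
 also have "(\<integral>\<^sup>+c. min 1 (V c) \<partial>law n K) <= (\<integral>\<^sup>+c. indicator {c\<in>space (law n K). 2 < cc n c} c + 2 / of_nat K * wsum K phi c \<partial>law n K)"
 proof (rule nn_integral_mono_AE)
  show "AE c in law n K. min 1 (V c) <= indicator {c\<in>space (law n K). 2 < cc n c} c + 2 / of_nat K * wsum K phi c"
   using AE_proportional[OF n' K] AE_space
  proof eventually_elim
   case (elim c)
   have c: "c : space (clouds K n)" using elim(2) n by (simp add: space_law)
   show ?case
   proof (cases "2 < cc n c")
    case True
    then show ?thesis using elim(2) by (simp add: add_increasing2)
   next
    case False
    have "(\<integral>\<^sup>+y. (snd y * gn (Suc n) (fst y))\<^sup>2 \<partial>prop_move n c k) <= 2 * (ennreal (snd (c k)) * phi (fst (c k)))" if k: "k : {1..K}" for k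
    proof -
     let ?z = "fst (c k)"
     have z: "?z : space (B n)" by (rule cloud_component[OF c k])
     have hz: "0 < h n ?z" using n' z by (intro h_pos) auto
     have s: "snd (c k) = cc n c * h n ?z" "0 < snd (c k)" using elim(1) k unfolding proportional_def by blast+
     have sle: "snd (c k) <= 2 * h n ?z" using False hz by (simp add: s(1) mult_right_mono)
     have [measurable]: "(%x. ennreal (h n x * (gn (Suc n) x)^2)) : bm (path_step S a (a + n) ?z)"
      using hgm by (simp cong: mcs add: sets_step_a[OF n z])
     have xm2: "(%y. ennreal ((snd y * gn (Suc n) (fst y))^2)) : bm (E (Suc n))" using xm by measurable
     have "(\<integral>\<^sup>+y. (snd y * gn (Suc n) (fst y))\<^sup>2 \<partial>prop_move n c k) = (\<integral>\<^sup>+x. (snd (c k) * gn (Suc n) x)\<^sup>2 \<partial>path_step S a (a + n) ?z)"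
      by (subst nn_integral_prop_move[OF n c k xm2]) simp
     also have "... <= (\<integral>\<^sup>+x. ennreal (2 * snd (c k)) * ennreal (h n x * (gn (Suc n) x)^2) \<partial>path_step S a (a + n) ?z)"
     proof (rule nn_integral_mono_AE)
      show "AE x in path_step S a (a + n) ?z. ennreal ((snd (c k) * gn (Suc n) x)^2) <= ennreal (2 * snd (c k)) * ennreal (h n x * (gn (Suc n) x)^2)"
       using AE_step_h[OF n z]
      proof eventually_elim
       case (elim x)
       have "(snd (c k) * gn (Suc n) x)^2 = snd (c k) * (gn (Suc n) x)^2 * snd (c k)" by (simp add: power2_eq_square)
       also have "... <= snd (c k) * (gn (Suc n) x)^2 * (2 * h n ?z)" using sle s(2) by (intro mult_left_mono) auto
       finally have "(snd (c k) * gn (Suc n) x)^2 <= 2 * snd (c k) * (h n x * (gn (Suc n) x)^2)" by (simp add: elim mult_ac)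
       then show ?case using s(2) by (subst ennreal_mult'[symmetric]) (auto intro: ennreal_leI)
      qed
     qed
     also have "... = ennreal (2 * snd (c k)) * phi ?z" unfolding phi_def by (rule nn_integral_cmult) measurable
     finally show ?thesis using s(2) by (simp add: ennreal_mult' mult.assoc)
    qed
    then have "(\<Sum>k=1..K. \<integral>\<^sup>+y. (snd y * gn (Suc n) (fst y))\<^sup>2 \<partial>prop_move n c k) <= 2 * wsum K phi c"
     unfolding wsum_def sum_distrib_left by (rule sum_mono)
    then have "V c <= 2 * wsum K phi c / of_nat K" unfolding V_def by (rule divide_right_mono_ennreal)
    also have "... = 2 / of_nat K * wsum K phi c" by (simp add: ennreal_times_divide mult.commute)
    finally show ?thesis using False by (simp add: min.coboundedI2)
   qed
  qed
 qed
 also have "... = bad n K + 2 / of_nat K * (\<integral>\<^sup>+c. wsum K phi c \<partial>law n K)"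
 proof -
  have [measurable]: "wsum K phi : bm (law n K)" "cc n : bm (law n K)"
   using wsum_measurable[OF phim, of K] ccm by (simp_all cong: mcs add: sets_law[OF n'])
  show ?thesis unfolding bad_def by (subst nn_integral_add) (auto simp: nn_integral_cmult)
 qed
 also have "(\<integral>\<^sup>+c. wsum K phi c \<partial>law n K) = of_nat K * sqn n (Suc n)"
  unfolding unbiased[OF n' phim] nn_integral_Q_Suc[OF n hgm] phi_def ..
 also have "2 / of_nat K * (of_nat K * sqn n (Suc n)) = 2 * sqn n (Suc n)"
 proof -
  have "2 / of_nat K * of_nat K = (2 :: ennreal)" using K
   by (simp add: ennreal_of_nat_eq_real_of_nat divide_ennreal ennreal_mult'[symmetric] flip: ennreal_numeral)
  then show ?thesis by (simp add: mult.assoc[symmetric])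
 qed
 finally show ?thesis unfolding plaw_def wavg_def by (simp add: add_left_mono mult_left_mono)
qed

end

context smc_block_fun begin

text \<open>The argument of \<open>moment_prop\<close>, with the factor \<open>cc_next\<close> of
  the resampled \<open>H\<close>. The selection probability times one new \<open>H\<close> is the
  old \<open>H\<close> divided by \<open>K\<close>, so the other new \<open>H\<close> is the one to
  be bounded by \<open>2 * h (Suc n)\<close>.\<close>

lemma moment_res:
 assumes n: "n < T" and K: "K >= 1"
 shows "(\<integral>\<^sup>+c. min 1 (K * (wavg K (gn (Suc n)) c - g0)^2) \<partial>law (Suc n) K)
  <= 2 * (\<integral>\<^sup>+c. min 1 (K * (wavg K (gn (Suc n)) c - g0)^2) \<partial>plaw n K) + 2 * (bad_next n K + 2 * sqn (Suc n) (Suc n))"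
proof -
 interpret particle_step "plaw n" "%K c k. res_move K n c" "E (Suc n)" by (rule particle_step_res[OF n])
 have gm: "gn (Suc n) : bm (B (Suc n))" using n by (intro gn_measurable) simp
 have hm: "h (Suc n) : bm (B (Suc n))" using n by auto
 have xm: "(%y. snd y * gn (Suc n) (fst y)) : bm (E (Suc n))" using gm by measurable
 have xm2: "(%y. ennreal ((snd y * gn (Suc n) (fst y))^2)) : bm (E (Suc n))" using xm by measurable
 have Dm: "(%c. wavg K (gn (Suc n)) c - g0) : bm (plaw n K)"
  using wavg_measurable[OF gm, of K] by (simp cong: mcs add: sets_plaw[OF n])
 have sp: "space (plaw n K) = space (clouds K (Suc n))" using n by (simp add: space_plaw)
 define V where "V c = (\<Sum>k=1..K. \<integral>\<^sup>+y. (snd y * gn (Suc n) (fst y))\<^sup>2 \<partial>res_move K n c) / K" for c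
 define phi where "phi x = ennreal (h (Suc n) x * (gn (Suc n) x)^2)" for x
 have phim: "phi : bm (B (Suc n))" unfolding phi_def using hm gm by measurable
 have "(\<integral>\<^sup>+c'. min 1 (K * ((\<Sum>k=1..K. snd (c' k) * gn (Suc n) (fst (c' k))) / K - g0)^2) \<partial>step K)
  <= 2 * (\<integral>\<^sup>+c. min 1 (K * (wavg K (gn (Suc n)) c - g0)^2) \<partial>plaw n K) + 2 * (\<integral>\<^sup>+c. min 1 (V c) \<partial>plaw n K)"
  unfolding V_def using res_mean[OF n K] K by (intro second_moment_step[OF xm Dm K] AE_I2) (simp add: sp)
 also have "(\<integral>\<^sup>+c. min 1 (V c) \<partial>plaw n K) <= (\<integral>\<^sup>+c. indicator {c\<in>space (plaw n K). 2 < cc_next n K c} c + 2 / of_nat K * wsum K phi c \<partial>plaw n K)"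
 proof (rule nn_integral_mono_AE)
  show "AE c in plaw n K. min 1 (V c) <= indicator {c\<in>space (plaw n K). 2 < cc_next n K c} c + 2 / of_nat K * wsum K phi c"
   using AE_proportional_plaw[OF n K] AE_space
  proof eventually_elim
   case (elim c)
   have c: "c : space (clouds K (Suc n))" using elim(2) by (simp add: sp)
   show ?case
   proof (cases "2 < cc_next n K c")
    case True
    then show ?thesis using elim(2) by (simp add: add_increasing2)
   next
    case False
    have t: "ennreal (nw K n c j) * ennreal ((snd (c j) / (real K * nw K n c j) * gn (Suc n) (fst (c j)))^2)
     <= 2 / of_nat K * (ennreal (snd (c j)) * phi (fst (c j)))" if j: "j : {1..K}" for j
    proof -
     let ?x = "fst (c j)"
     let ?H = "snd (c j) / (real K * nw K n c j)"
     have p: "0 < nw K n c j" by (rule nw_pos[OF n c K j])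
     have hx: "0 < h (Suc n) ?x" using n cloud_component[OF c j] by (intro h_pos) auto
     have s: "0 < snd (c j)" using elim(1) j unfolding proportional_def by blast
     have "?H <= 2 * h (Suc n) ?x" unfolding cc_next(1)[OF n K c elim(1) j] using False hx by (intro mult_right_mono) auto
     moreover have "nw K n c j * (?H * gn (Suc n) ?x)^2 = snd (c j) / K * (gn (Suc n) ?x)^2 * ?H" using p by (simp add: power2_eq_square)
     ultimately have "nw K n c j * (?H * gn (Suc n) ?x)^2 <= snd (c j) / K * (gn (Suc n) ?x)^2 * (2 * h (Suc n) ?x)"
      using s by (simp only: mult_left_mono zero_le_power2 divide_nonneg_nonneg less_imp_le of_nat_0_le_iff mult_nonneg_nonneg)
     also have "... = 2 / K * (snd (c j) * (h (Suc n) ?x * (gn (Suc n) ?x)^2))" by simp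
     finally have "ennreal (nw K n c j * (?H * gn (Suc n) ?x)^2) <= ennreal (2 / K * (snd (c j) * (h (Suc n) ?x * (gn (Suc n) ?x)^2)))"
      by (rule ennreal_leI)
     also have "... = ennreal (2 / K) * (ennreal (snd (c j)) * phi ?x)"
      unfolding phi_def using s by (simp only: ennreal_mult' divide_nonneg_nonneg of_nat_0_le_iff zero_le_numeral less_imp_le)
     also have "ennreal (2 / K) = 2 / of_nat K" using K by (simp add: divide_ennreal[symmetric] ennreal_of_nat_eq_real_of_nat)
     finally show ?thesis using p by (simp only: ennreal_mult' less_imp_le)
    qed
    have "V c = (\<integral>\<^sup>+y. (snd y * gn (Suc n) (fst y))\<^sup>2 \<partial>res_move K n c)"
    proof -
     have "of_nat K * x / of_nat K = x" for x :: ennreal using K by (simp add: ennreal_mult_divide_eq mult.commute)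
     then show ?thesis unfolding V_def by simp
    qed
    also have "... = (\<Sum>j=1..K. ennreal (nw K n c j) * ennreal ((snd (c j) / (real K * nw K n c j) * gn (Suc n) (fst (c j)))^2))"
     by (subst nn_integral_res_move[OF n c K xm2]) simp
    also have "... <= (\<Sum>j=1..K. 2 / of_nat K * (ennreal (snd (c j)) * phi (fst (c j))))" by (intro sum_mono t)
    also have "... = 2 / of_nat K * wsum K phi c" unfolding wsum_def by (simp add: sum_distrib_left)
    finally show ?thesis using False by (simp add: min.coboundedI2)
   qed
  qed
 qed
 also have "... = bad_next n K + 2 / of_nat K * (\<integral>\<^sup>+c. wsum K phi c \<partial>plaw n K)"
 proof -
  have [measurable]: "wsum K phi : bm (plaw n K)" "cc_next n K : bm (plaw n K)"
   using wsum_measurable[OF phim, of K] cc_next_measurable[OF n K] by (simp_all cong: mcs add: sets_plaw[OF n])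
  show ?thesis unfolding bad_next_def by (subst nn_integral_add) (auto simp: nn_integral_cmult)
 qed
 also have "(\<integral>\<^sup>+c. wsum K phi c \<partial>plaw n K) = of_nat K * sqn (Suc n) (Suc n)"
  unfolding unbiased_plaw[OF n phim] phi_def ..
 also have "2 / of_nat K * (of_nat K * sqn (Suc n) (Suc n)) = 2 * sqn (Suc n) (Suc n)"
 proof -
  have "2 / of_nat K * of_nat K = (2 :: ennreal)" using K
   by (simp add: ennreal_of_nat_eq_real_of_nat divide_ennreal ennreal_mult'[symmetric] flip: ennreal_numeral)
  then show ?thesis by (simp add: mult.assoc[symmetric])
 qed
 finally show ?thesis unfolding law_Suc_step[OF n] wavg_def by (simp add: add_left_mono mult_left_mono)
qed

lemma AE_law_0: "K >= 1 ==> AE c in law 0 K. wavg K (gn 0) c = g0"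
proof -
 assume K: "K >= 1"
 have "Measurable.pred (clouds K 0) (%c. wavg K (gn 0) c = g0)"
  unfolding Measurable.pred_def by (intro borel_measurable_eq wavg_measurable gn_measurable borel_measurable_const) simp
 then show ?thesis unfolding law_0 using K by (subst AE_return[OF init_cloud]) (auto simp: wavg_def gn_0)
qed

text \<open>Made for test functions that change with \<open>K\<close>: the remainder
  \<open>rem\<close> does not depend on \<open>g\<close>, and if all weighted second moments of the
  backward means are small, so is the scaled error. The constant \<open>8 * 4 ^ n\<close> is crude
  and only has to be free of \<open>K\<close>.\<close>

lemma moment_bound:
 assumes "n <= T" and K: "K >= 1"
 shows "(\<integral>\<^sup>+c. min 1 (K * (wavg K (gn n) c - g0)^2) \<partial>law n K)
  <= rem n K + 8 * 4 ^ n * (\<Sum>i<n. sqn i (Suc i) + sqn (Suc i) (Suc i))" using assms(1)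
proof (induction n)
 case 0
 have "(\<integral>\<^sup>+c. min 1 (K * (wavg K (gn 0) c - g0)^2) \<partial>law 0 K) = (\<integral>\<^sup>+c. 0 \<partial>law 0 K)"
  using AE_law_0[OF K] by (intro nn_integral_cong_AE) (auto elim!: eventually_mono)
 then show ?case by simp
next
 case (Suc n)
 then have n: "n < T" by simp
 let ?N = "%n. \<integral>\<^sup>+c. min 1 (K * (wavg K (gn n) c - g0)^2) \<partial>law n K"
 let ?S = "\<Sum>i<n. sqn i (Suc i) + sqn (Suc i) (Suc i)" and ?a = "sqn n (Suc n)" and ?b = "sqn (Suc n) (Suc n)"
 have "?N (Suc n) <= 2 * (2 * ?N n + 2 * (bad n K + 2 * ?a)) + 2 * (bad_next n K + 2 * ?b)"
  using order_trans[OF moment_res[OF n K] add_right_mono[OF mult_left_mono[OF moment_prop[OF n K]]]] by simp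
 also have "... = 4 * ?N n + 4 * bad n K + 2 * bad_next n K + (8 * ?a + 4 * ?b)" by (simp add: distrib_left mult.assoc[symmetric] add.assoc)
 also have "... <= 4 * (rem n K + 8 * 4 ^ n * ?S) + 4 * bad n K + 2 * bad_next n K + (8 * 4 ^ Suc n * ?a + 8 * 4 ^ Suc n * ?b)"
 proof (intro add_mono mult_left_mono mult_right_mono Suc.IH order_refl)
  have "1 <= (4 :: ennreal) ^ Suc n" by (rule one_le_power) simp
  then show "8 <= 8 * (4 :: ennreal) ^ Suc n" "4 <= 8 * (4 :: ennreal) ^ Suc n"
   using mult_mono[of 8 8 1 "(4 :: ennreal) ^ Suc n"] mult_mono[of 4 8 1 "(4 :: ennreal) ^ Suc n"] by simp_all
 qed (use n in auto)
 also have "... = rem (Suc n) K + 8 * 4 ^ Suc n * (\<Sum>i<Suc n. sqn i (Suc i) + sqn (Suc i) (Suc i))"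
  by (simp add: distrib_left mult.assoc[symmetric] add_ac)
 finally show ?case .
qed

end

section \<open>The central limit theorem for a single filter\<close>

locale smc_block_sq = smc_block_fun S m g for S :: "('x, 'y) smc" and m and g +
 assumes sq_prev: "n < T ==> integrable (Q (Suc n)) (%x. h n x * (gn (Suc n) x)^2)"
  and sq_next: "n < T ==> integrable (Q (Suc n)) (%x. h (Suc n) x * (gn (Suc n) x)^2)"
begin

text \<open>This and \<open>var_res\<close> are the odd and the even variance terms with the squares
  expanded; \<open>sig_odd\<close> and \<open>sig_even\<close> identify them.\<close>

definition var_prop :: "nat => real" where
 "var_prop n = (LINT x|Q (Suc n). h n x * (gn (Suc n) x)^2) - (LINT x|Q n. h n x * (gn n x)^2)"

definition var_res :: "nat => real" where
 "var_res n = (LINT x|Q (Suc n). h (Suc n) x * (gn (Suc n) x)^2) - g0\<^sup>2"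

lemma sq_integrable: "n <= T ==> integrable (Q n) (%x. h n x * (gn n x)^2)"
proof (cases n)
 case 0
 interpret prob_space "Q 0" by (rule prob_space_Q) simp
 have "(%x. h 0 x * (gn 0 x)^2) : bm (Q 0)" using gn_measurable[of 0] by (simp cong: mcs add: sets_Q)
 then have "integrable (Q 0) (%x. h 0 x * (gn 0 x)^2)"
  by (intro integrable_const_bound[of _ "g0\<^sup>2"] AE_I2) (auto simp: space_Q space_paths_empty gn_0[simplified])
 then show ?thesis using 0 by simp
qed (use sq_next in auto)

lemma AE_sq:
 assumes n: "n < T"
 shows "AE z in Q n. integrable (path_step S a (a + n) z) (%x. (gn (Suc n) x)\<^sup>2) \<and>
  kap n (%x. (h n x * gn (Suc n) x)\<^sup>2) z = (h n z)^2 * (LINT x|path_step S a (a + n) z. (gn (Suc n) x)\<^sup>2)"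
  and "integrable (Q (Suc n)) (%x. (h n x * gn (Suc n) x)\<^sup>2 / h n x)"
proof -
 have n': "n <= T" using n by simp
 have gm: "gn (Suc n) : bm (B (Suc n))" using n by (intro gn_measurable) simp
 have hm: "h n : bm (B n)" "h n : bm (B (Suc n))" using n by auto
 have m: "(%x. (h n x * gn (Suc n) x)\<^sup>2) : bm (B (Suc n))" using gm hm by measurable
 have "(h n x * gn (Suc n) x)^2 / h n x = h n x * (gn (Suc n) x)^2" if "x : space (Q (Suc n))" for x
  using h_pos[of n "Suc n" x] that n by (simp add: space_Q power2_eq_square)
 then show i: "integrable (Q (Suc n)) (%x. (h n x * gn (Suc n) x)\<^sup>2 / h n x)"
  using sq_prev[OF n] by (simp cong: Bochner_Integration.integrable_cong)
 show "AE z in Q n. integrable (path_step S a (a + n) z) (%x. (gn (Suc n) x)\<^sup>2) \<and>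
  kap n (%x. (h n x * gn (Suc n) x)\<^sup>2) z = (h n z)^2 * (LINT x|path_step S a (a + n) z. (gn (Suc n) x)\<^sup>2)"
  using AE_integrable_kap[OF n m i] AE_space
 proof eventually_elim
  case (elim z)
  have z: "z : space (B n)" using elim(2) n by (simp add: space_Q)
  let ?P = "path_step S a (a + n) z"
  have hz: "0 < h n z" using n z by (intro h_pos) auto
  have mP: "(%x. (h n x * gn (Suc n) x)\<^sup>2) : bm ?P" "gn (Suc n) : bm ?P"
   using m gm by (simp_all cong: mcs add: sets_step_a[OF n z])
  have e: "AE x in ?P. (h n x * gn (Suc n) x)\<^sup>2 = (h n z)^2 * (gn (Suc n) x)^2"
   using AE_step_h[OF n z] by eventually_elim (simp add: power_mult_distrib)
  have mP2: "(%x. (h n z)\<^sup>2 * (gn (Suc n) x)^2) : bm ?P" using mP(2) by measurable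
  have i2: "integrable ?P (%x. (h n z)\<^sup>2 * (gn (Suc n) x)^2)" using elim(1) integrable_cong_AE[OF mP(1) mP2 e] by simp
  have "kap n (%x. (h n x * gn (Suc n) x)\<^sup>2) z = (LINT x|?P. (h n z)\<^sup>2 * (gn (Suc n) x)^2)"
   unfolding kap_def by (rule integral_cong_AE[OF mP(1) mP2 e])
  then show ?case using i2 hz by simp
 qed
qed

abbreviation cf :: "nat => real => nat => complex" where
 "cf n s K \<equiv> (CLINT c|law n K. iexp (s * (sqrt K * (wavg K (gn n) c - g0))))"

abbreviation cf_plaw :: "nat => real => nat => complex" where
 "cf_plaw n s K \<equiv> (CLINT c|plaw n K. iexp (s * (sqrt K * (wavg K (gn (Suc n)) c - g0))))"

text \<open>\<open>char_step\<close> with the filter before the proposals as the past. The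
  conditional variance of the noise is \<open>cc n\<close> squared times a plain average, to which
  the law of large numbers and \<open>tip_cc\<close> apply.\<close>

lemma cf_prop:
 assumes n: "n < T" and lim: "cf n s \<longlonglongrightarrow> z"
 shows "cf_plaw n s \<longlonglongrightarrow> z * exp (- (s\<^sup>2 * var_prop n / 2))"
proof -
 interpret particle_step "law n" "%K c k. prop_move n c k" "E (Suc n)" by (rule particle_step_prop[OF n])
 have n': "n <= T" using n by simp
 have gm: "gn (Suc n) : bm (B (Suc n))" "gn n : bm (B n)" using n by (auto intro!: gn_measurable)
 have hm: "h n : bm (B n)" "h n : bm (B (Suc n))" using n by auto
 let ?xi = "%y :: (nat => 'x) \<times> real. snd y * gn (Suc n) (fst y)"
 have xm: "?xi : bm (E (Suc n))" using gm by measurable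
 have xm2: "(%y. (?xi y)\<^sup>2) : bm (E (Suc n))" using xm by measurable
 have Dm: "(%c. wavg K (gn n) c - g0) : bm (law n K)" for K
  using wavg_measurable[OF gm(2), of K] by (simp cong: mcs add: sets_law[OF n'])
 let ?R = "%x. (h n x * gn (Suc n) x)\<^sup>2"
 let ?G = "%x. h n x * gn (Suc n) x"
 have Rm: "?R : bm (B (Suc n))" "?G : bm (B (Suc n))" using gm hm by measurable
 have Ri: "integrable (Q (Suc n)) (%x. ?R x / h n x)" by (rule AE_sq(2)[OF n])
 have good: "AE c in law n K. c : space (clouds K n) & proportional n K c & (\<forall>k\<in>{1..K}.
   integrable (path_step S a (a + n) (fst (c k))) (gn (Suc n)) & gn n (fst (c k)) = kap n (gn (Suc n)) (fst (c k)) \<and>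
   integrable (path_step S a (a + n) (fst (c k))) (%x. (gn (Suc n) x)\<^sup>2) \<and>
   kap n ?R (fst (c k)) = (h n (fst (c k)))^2 * (LINT x|path_step S a (a + n) (fst (c k)). (gn (Suc n) x)\<^sup>2) \<and>
   integrable (path_step S a (a + n) (fst (c k))) ?R)" if K: "K >= 1" for K
  using AE_particles[OF n' AE_gn[OF n], of K] AE_particles[OF n' AE_sq(1)[OF n], of K]
   AE_particles[OF n' AE_integrable_kap[OF n Rm(1) Ri], of K] AE_proportional[OF n' K] AE_space by eventually_elim (auto simp: space_law[OF n'])
 have "(%K. CLINT c'|step K. iexp (s * (sqrt K * ((\<Sum>k=1..K. ?xi (c' k)) / K - g0)))) \<longlonglongrightarrow> z * exp (- (s\<^sup>2 * var_prop n / 2))"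
 proof (rule char_step[OF xm Dm _ _ _ lim])
  fix K :: nat assume K: "1 <= K"
  show "AE c in law n K. (\<forall>k\<in>{1..K}. integrable (prop_move n c k) (%y. (?xi y)\<^sup>2)) \<and>
   wavg K (gn n) c - g0 = (\<Sum>k=1..K. LINT y|prop_move n c k. ?xi y) / K - g0" using good[OF K] AE_prop_mean[OF n, of K]
  proof eventually_elim
   case (elim c)
   then have c: "c : space (clouds K n)" by simp
   have "integrable (prop_move n c k) (%y. (?xi y)\<^sup>2)" if k: "k : {1..K}" for k
    using elim(1) k by (subst integrable_prop_move[OF n c k xm2]) (auto simp: power_mult_distrib)
   then show ?case using elim(2) by blast
  qed
 next
  \<comment> \<open>\<open>?v\<close> is the square of \<open>h n\<close> times the one-step
    conditional variance of \<open>gn (Suc n)\<close>. The law of large numbers divides by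
    \<open>h n\<close>, leaving the weight \<open>h n\<close> of the variance term.\<close>
  let ?v = "%z. kap n ?R z - (h n z * gn n z)\<^sup>2"
  have vm: "?v : bm (B n)" using kap_measurable[OF n Rm(1)] hm gm by measurable
  have ve: "?v z / h n z = kap n ?R z / h n z - h n z * (gn n z)^2" if "z : space (Q n)" for z
   using h_pos[of n n z] that n by (simp add: space_Q power2_eq_square diff_divide_distrib)
  have sqi: "integrable (Q n) (%z. h n z * (gn n z)^2)" by (rule sq_integrable[OF n'])
  have vi: "integrable (Q n) (%z. ?v z / h n z)" using integrable_kap[OF n Rm(1) Ri] sqi by (simp add: ve cong: Bochner_Integration.integrable_cong)
  have "(LINT z|Q n. ?v z / h n z) = (LINT z|Q n. kap n ?R z / h n z - h n z * (gn n z)^2)"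
   by (rule Bochner_Integration.integral_cong[OF refl]) (rule ve)
  also have "... = (LINT z|Q n. kap n ?R z / h n z) - (LINT z|Q n. h n z * (gn n z)^2)"
   by (rule Bochner_Integration.integral_diff[OF integrable_kap[OF n Rm(1) Ri] sqi])
  also have "(LINT z|Q n. kap n ?R z / h n z) = (LINT x|Q (Suc n). h n x * (gn (Suc n) x)^2)"
   unfolding integral_kap[OF n Rm(1) Ri] using h_pos[of n "Suc n"] n
   by (intro Bochner_Integration.integral_cong[OF refl]) (simp add: space_Q power2_eq_square)
  finally have "(LINT z|Q n. ?v z / h n z) = var_prop n" by (simp add: var_prop_def)
  then have "tip (law n) (%K. avg K ?v) (var_prop n)" using lln[OF n', unfolded lln_def, THEN bspec, OF vm, THEN mp, OF vi] by simp
  then have "tip (law n) (%K c. cc n c * cc n c * avg K ?v c) (1 * 1 * var_prop n)" by (intro tip_mult[OF P] tip_cc[OF n'])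
  then have t: "tip (law n) (%K c. cc n c * cc n c * avg K ?v c) (var_prop n)" by simp
  show "tip (law n) (%K c. (\<Sum>k=1..K. (LINT y|prop_move n c k. (?xi y)\<^sup>2) - (LINT y|prop_move n c k. ?xi y)\<^sup>2) / K) (var_prop n)"
  proof (rule tip_cong[OF P t], rule whp_AE, rule eventually_mono[OF eventually_ge_at_top[of 1]])
   fix K :: nat assume K: "1 <= K"
   show "AE c in law n K. (\<Sum>k=1..K. (LINT y|prop_move n c k. (?xi y)\<^sup>2) - (LINT y|prop_move n c k. ?xi y)\<^sup>2) / K = cc n c * cc n c * avg K ?v c"
    using good[OF K]
   proof eventually_elim
    case (elim c)
    then have c: "c : space (clouds K n)" by simp
    have "(LINT y|prop_move n c k. (?xi y)\<^sup>2) - (LINT y|prop_move n c k. ?xi y)\<^sup>2 = cc n c * cc n c * ?v (fst (c k))" if k: "k : {1..K}" for k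
    proof -
     have s: "snd (c k) = cc n c * h n (fst (c k))" using elim k unfolding proportional_def by blast
     have e1: "(LINT y|prop_move n c k. ?xi y) = snd (c k) * gn n (fst (c k))" using elim k by (simp add: integral_prop_move[OF n c k xm] kap_def)
     have e2: "(LINT y|prop_move n c k. (?xi y)\<^sup>2) = (snd (c k))^2 * (LINT x|path_step S a (a + n) (fst (c k)). (gn (Suc n) x)\<^sup>2)"
      by (subst integral_prop_move[OF n c k xm2]) (simp add: power_mult_distrib)
     show ?thesis using elim k unfolding e1 e2 s by (simp add: power2_eq_square algebra_simps)
    qed
    then show ?case by (simp add: avg_def sum_distrib_left)
   qed
  qed
 next
  fix e :: real assume e: "e > 0"
  \<comment> \<open>When \<open>cc n\<close> is below 2, \<open>H\<close> times
    \<open>gn (Suc n)\<close> is at most twice the same product with \<open>h n\<close>. So a cut at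
    \<open>2 * C\<close> implies a cut at \<open>C\<close>, and the squares cost a factor 4, hence
    \<open>e / 4\<close>.\<close>
  obtain C where C: "C > 0" and w: "whp (law n) (%K c. avg K (kap n (%x. ?R x * indicator {C<..} (abs (?G x)))) c < e / 4)"
   using prop_tail[OF n lln[OF n'] Rm(2) Rm(1) Ri, of "e / 4"] e by auto
  have wc: "whp (law n) (%K c. cc n c < 2)" by (rule tip_less[OF tip_cc[OF n']]) simp
  have wg: "whp (law n) (%K c. c : space (clouds K n) & proportional n K c & (\<forall>k\<in>{1..K}.
   integrable (path_step S a (a + n) (fst (c k))) (gn (Suc n)) & gn n (fst (c k)) = kap n (gn (Suc n)) (fst (c k)) \<and>
   integrable (path_step S a (a + n) (fst (c k))) (%x. (gn (Suc n) x)\<^sup>2) \<and>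
   kap n ?R (fst (c k)) = (h n (fst (c k)))^2 * (LINT x|path_step S a (a + n) (fst (c k)). (gn (Suc n) x)\<^sup>2) \<and>
   integrable (path_step S a (a + n) (fst (c k))) ?R))" by (rule whp_AE, rule eventually_mono[OF eventually_ge_at_top[of 1] good])
  show "\<exists>C>0. whp (law n) (%K c. (\<Sum>k=1..K. LINT y|prop_move n c k. (?xi y)\<^sup>2 * indicator {C<..} (abs (?xi y))) / K < e)"
  proof (intro exI[of _ "2 * C"] conjI whp_mono[OF whp_conj[OF P w whp_conj[OF P wc wg]]])
   show "0 < 2 * C" using C by simp
   show "\<forall>\<^sub>F K in sequentially. \<forall>c\<in>space (law n K). avg K (kap n (%x. ?R x * indicator {C<..} \<bar>?G x\<bar>)) c < e / 4 & cc n c < 2 \<and>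
    c : space (clouds K n) & proportional n K c & (\<forall>k\<in>{1..K}.
   integrable (path_step S a (a + n) (fst (c k))) (gn (Suc n)) & gn n (fst (c k)) = kap n (gn (Suc n)) (fst (c k)) \<and>
   integrable (path_step S a (a + n) (fst (c k))) (%x. (gn (Suc n) x)\<^sup>2) \<and>
   kap n ?R (fst (c k)) = (h n (fst (c k)))^2 * (LINT x|path_step S a (a + n) (fst (c k)). (gn (Suc n) x)\<^sup>2) \<and>
   integrable (path_step S a (a + n) (fst (c k))) ?R) -->
    (\<Sum>k=1..K. LINT y|prop_move n c k. (?xi y)\<^sup>2 * indicator {2 * C<..} \<bar>?xi y\<bar>) / K < e"
   proof (rule eventually_mono[OF eventually_ge_at_top[of 1]], intro ballI impI, elim conjE)
    fix K :: nat and c assume K: "1 <= K" and small: "avg K (kap n (%x. ?R x * indicator {C<..} (abs (?G x)))) c < e / 4"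
     and cc2: "cc n c < 2" and c: "c : space (clouds K n)" and p: "proportional n K c"
     and gd: "\<forall>k\<in>{1..K}.
   integrable (path_step S a (a + n) (fst (c k))) (gn (Suc n)) & gn n (fst (c k)) = kap n (gn (Suc n)) (fst (c k)) \<and>
   integrable (path_step S a (a + n) (fst (c k))) (%x. (gn (Suc n) x)\<^sup>2) \<and>
   kap n ?R (fst (c k)) = (h n (fst (c k)))^2 * (LINT x|path_step S a (a + n) (fst (c k)). (gn (Suc n) x)\<^sup>2) \<and>
   integrable (path_step S a (a + n) (fst (c k))) ?R"
    have ccp: "0 < cc n c" using proportional_cc_pos[of n n K c] n' K c p by simp
    have "(LINT y|prop_move n c k. (?xi y)\<^sup>2 * indicator {2 * C<..} (abs (?xi y))) <= 4 * kap n (%x. ?R x * indicator {C<..} (abs (?G x))) (fst (c k))" if k: "k : {1..K}" for k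
    proof -
     let ?z = "fst (c k)"
     let ?P = "path_step S a (a + n) ?z"
     have z: "?z : space (B n)" by (rule cloud_component[OF c k])
     have hz: "0 < h n ?z" using n z by (intro h_pos) auto
     have s: "snd (c k) = cc n c * h n ?z" using p k unfolding proportional_def by blast
     have fm: "(%y. (?xi y)\<^sup>2 * indicator {2 * C<..} (abs (?xi y))) : bm (E (Suc n))" using xm by measurable
     have mP: "gn (Suc n) : bm ?P" "?R : bm ?P" "?G : bm ?P"
      using gm Rm by (simp_all cong: mcs add: sets_step_a[OF n z])
     have "(LINT y|prop_move n c k. (?xi y)\<^sup>2 * indicator {2 * C<..} \<bar>?xi y\<bar>)
      = (LINT x|?P. (snd (c k) * gn (Suc n) x)\<^sup>2 * indicator {2 * C<..} \<bar>snd (c k) * gn (Suc n) x\<bar>)"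
      by (subst integral_prop_move[OF n c k fm]) simp
     also have "... <= (LINT x|?P. 4 * (?R x * indicator {C<..} (abs (?G x))))"
     proof (rule integral_mono_AE)
      have "integrable ?P (%x. (snd (c k))\<^sup>2 * (gn (Suc n) x)^2)" using gd k by auto
      then show "integrable ?P (%x. (snd (c k) * gn (Suc n) x)\<^sup>2 * indicator {2 * C<..} (abs (snd (c k) * gn (Suc n) x)))"
       by (rule Bochner_Integration.integrable_bound) (use mP in \<open>auto split: split_indicator simp: power_mult_distrib\<close>)
      have "integrable ?P (%x. 4 * ?R x)" using gd k by auto
      then show "integrable ?P (%x. 4 * (?R x * indicator {C<..} (abs (?G x))))"
       by (rule Bochner_Integration.integrable_bound) (use mP in \<open>auto split: split_indicator\<close>)
      show "AE x in ?P. (snd (c k) * gn (Suc n) x)\<^sup>2 * indicator {2 * C<..} (abs (snd (c k) * gn (Suc n) x)) <= 4 * (?R x * indicator {C<..} (abs (?G x)))"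
       using AE_step_h[OF n z]
      proof eventually_elim
       case (elim x)
       have le: "abs (snd (c k) * gn (Suc n) x) <= 2 * abs (?G x)"
       proof -
        have "abs (snd (c k) * gn (Suc n) x) = cc n c * abs (?G x)" unfolding s elim using ccp hz by (simp add: abs_mult)
        also have "... <= 2 * abs (?G x)" using cc2 by (intro mult_right_mono) auto
        finally show ?thesis .
       qed
       from power_mono[OF this, of 2] have "(snd (c k) * gn (Suc n) x)^2 <= 4 * ?R x" by (simp add: power_mult_distrib)
       then show ?case using le by (auto split: split_indicator)
      qed
     qed
     finally show ?thesis by (simp add: kap_def)
    qed
    then have "(\<Sum>k=1..K. LINT y|prop_move n c k. (?xi y)\<^sup>2 * indicator {2 * C<..} \<bar>?xi y\<bar>)
     <= (\<Sum>k=1..K. 4 * kap n (%x. ?R x * indicator {C<..} \<bar>?G x\<bar>) (fst (c k)))" by (rule sum_mono)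
    then have "(\<Sum>k=1..K. LINT y|prop_move n c k. (?xi y)\<^sup>2 * indicator {2 * C<..} \<bar>?xi y\<bar>) / K
     <= 4 * avg K (kap n (%x. ?R x * indicator {C<..} \<bar>?G x\<bar>)) c" by (simp add: avg_def sum_distrib_left divide_right_mono)
    then show "(\<Sum>k=1..K. LINT y|prop_move n c k. (?xi y)\<^sup>2 * indicator {2 * C<..} (abs (?xi y))) / K < e" using small by linarith
   qed
  qed
 qed
 then show ?thesis unfolding plaw_def wavg_def .
qed

text \<open>Given the cloud, the resampled particles are i.i.d. Their conditional second moment is a
  self-normalised average with limit given by \<open>tip_resampled_avg\<close>, and their
  conditional mean is the weighted average, which tends to \<open>g0\<close>.\<close>

lemma cf_res:
 assumes n: "n < T" and lim: "cf_plaw n s \<longlonglongrightarrow> z"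
 shows "cf (Suc n) s \<longlonglongrightarrow> z * exp (- (s\<^sup>2 * var_res n / 2))"
proof -
 interpret particle_step "plaw n" "%K c k. res_move K n c" "E (Suc n)" by (rule particle_step_res[OF n])
 have gm: "gn (Suc n) : bm (B (Suc n))" using n by (intro gn_measurable) simp
 have hm: "h (Suc n) : bm (B (Suc n))" "h n : bm (B (Suc n))" using n by auto
 let ?xi = "%y :: (nat => 'x) \<times> real. snd y * gn (Suc n) (fst y)"
 have xm: "?xi : bm (E (Suc n))" using gm by measurable
 have xm2: "(%y. (?xi y)\<^sup>2) : bm (E (Suc n))" using xm by measurable
 have sp: "space (plaw n K) = space (clouds K (Suc n))" for K using n by (simp add: space_plaw)
 have spQ: "space (Q (Suc n)) = space (B (Suc n))" using n by (simp add: space_Q)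
 have Dm: "(%c. wavg K (gn (Suc n)) c - g0) : bm (plaw n K)" for K
  using wavg_measurable[OF gm, of K] by (simp cong: mcs add: sets_plaw[OF n])
 let ?w = "weight S (Suc (a + n))"
 let ?R = "%x. (h (Suc n) x * gn (Suc n) x)\<^sup>2"
 let ?G = "%x. h (Suc n) x * gn (Suc n) x"
 have Rm: "?R : bm (B (Suc n))" "?G : bm (B (Suc n))" using gm hm by measurable
 have Re: "?R x / h (Suc n) x = h (Suc n) x * (gn (Suc n) x)^2" if "x : space (Q (Suc n))" for x
  using h_pos[of "Suc n" "Suc n" x] that n by (simp add: spQ power2_eq_square)
 have Ri: "integrable (Q (Suc n)) (%x. ?R x / h (Suc n) x)" using sq_next[OF n] by (simp add: Re cong: Bochner_Integration.integrable_cong)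
 have RI: "(LINT x|Q (Suc n). ?R x / h (Suc n) x) = (LINT x|Q (Suc n). h (Suc n) x * (gn (Suc n) x)^2)"
  by (rule Bochner_Integration.integral_cong[OF refl]) (rule Re)
 have L: "lln_plaw n" by (rule lln_plaw[OF n])
 have "(%K. CLINT c'|step K. iexp (s * (sqrt K * ((\<Sum>k=1..K. ?xi (c' k)) / K - g0)))) \<longlonglongrightarrow> z * exp (- (s\<^sup>2 * var_res n / 2))"
 proof (rule char_step[OF xm Dm _ _ _ lim])
  fix K :: nat assume K: "1 <= K"
  show "AE c in plaw n K. (\<forall>k\<in>{1..K}. integrable (res_move K n c) (%y. (?xi y)\<^sup>2)) \<and>
   wavg K (gn (Suc n)) c - g0 = (\<Sum>k=1..K. LINT y|res_move K n c. ?xi y) / K - g0"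
   using K res_mean[OF n K] integrable_res_move[OF n _ K xm2] by (intro AE_I2) (simp add: sp)
 next
  \<comment> \<open>The density before resampling is \<open>1 / h n\<close>, so the average of
    \<open>h n\<close> times \<open>gn (Suc n)\<close> tends to the plain mean of
    \<open>gn (Suc n)\<close> under \<open>Q (Suc n)\<close>.\<close>
  have gi: "integrable (Q (Suc n)) (%x. h n x * gn (Suc n) x / h n x)" "(LINT x|Q (Suc n). h n x * gn (Suc n) x / h n x) = g0"
  proof -
   have e: "h n x * gn (Suc n) x / h n x = gn (Suc n) x" if "x : space (Q (Suc n))" for x using h_pos[of n "Suc n" x] that n by (simp add: spQ)
   show "integrable (Q (Suc n)) (%x. h n x * gn (Suc n) x / h n x)"
    using integrable_gn[of "Suc n"] n by (simp add: e cong: Bochner_Integration.integrable_cong)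
   have "(LINT x|Q (Suc n). h n x * gn (Suc n) x / h n x) = (LINT x|Q (Suc n). gn (Suc n) x)"
    by (rule Bochner_Integration.integral_cong[OF refl]) (rule e)
   then show "(LINT x|Q (Suc n). h n x * gn (Suc n) x / h n x) = g0" using integral_gn[of "Suc n"] n by simp
  qed
  have m1: "(%x. h n x * gn (Suc n) x) : bm (B (Suc n))" using hm gm by measurable
  have t1: "tip (plaw n) (%K. avg K (%x. h n x * gn (Suc n) x)) g0"
   using L[unfolded lln_plaw_def, THEN bspec, OF m1, THEN mp, OF gi(1)] unfolding gi(2) .
  have t2: "tip (plaw n) (%K c. avg K (%x. ?w x * ?R x) c / avg K ?w c) (LINT x|Q (Suc n). h (Suc n) x * (gn (Suc n) x)^2)"
   using tip_resampled_avg[OF n L Rm(1) Ri] unfolding RI .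
  have "tip (plaw n) (%K c. cc_next n K c * cc_next n K c * (avg K (%x. ?w x * ?R x) c / avg K ?w c)
    - (cc n c * avg K (%x. h n x * gn (Suc n) x) c) * (cc n c * avg K (%x. h n x * gn (Suc n) x) c))
   (1 * 1 * (LINT x|Q (Suc n). h (Suc n) x * (gn (Suc n) x)^2) - (1 * g0) * (1 * g0))"
   by (intro tip_diff[OF P] tip_mult[OF P] t1 t2 tip_cc_plaw[OF n] tip_cc_next[OF n])
  then have t: "tip (plaw n) (%K c. cc_next n K c * cc_next n K c * (avg K (%x. ?w x * ?R x) c / avg K ?w c)
    - (cc n c * avg K (%x. h n x * gn (Suc n) x) c) * (cc n c * avg K (%x. h n x * gn (Suc n) x) c)) (var_res n)"
   by (simp add: var_res_def power2_eq_square)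
  show "tip (plaw n) (%K c. (\<Sum>k=1..K. (LINT y|res_move K n c. (?xi y)\<^sup>2) - (LINT y|res_move K n c. ?xi y)\<^sup>2) / K) (var_res n)"
  proof (rule tip_cong[OF P t], rule whp_AE, rule eventually_mono[OF eventually_ge_at_top[of 1]])
   fix K :: nat assume K: "1 <= K"
   show "AE c in plaw n K. (\<Sum>k=1..K. (LINT y|res_move K n c. (?xi y)\<^sup>2) - (LINT y|res_move K n c. ?xi y)\<^sup>2) / K
    = cc_next n K c * cc_next n K c * (avg K (%x. ?w x * ?R x) c / avg K ?w c)
    - (cc n c * avg K (%x. h n x * gn (Suc n) x) c) * (cc n c * avg K (%x. h n x * gn (Suc n) x) c)" using AE_proportional_plaw[OF n K] AE_space
   proof eventually_elim
    case (elim c)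
    then have c: "c : space (clouds K (Suc n))" by (simp add: sp)
    have "(LINT y|res_move K n c. (?xi y)\<^sup>2) = (\<Sum>j=1..K. nw K n c j * (cc_next n K c * cc_next n K c * ?R (fst (c j))))"
     unfolding integral_res_move[OF n c K xm2] by (intro sum.cong refl) (simp add: cc_next(1)[OF n K c elim(1)] power2_eq_square)
    also have "... = cc_next n K c * cc_next n K c * (\<Sum>j=1..K. nw K n c j * ?R (fst (c j)))"
     by (simp only: sum_distrib_left mult.left_commute mult.commute mult.assoc)
    also have "... = cc_next n K c * cc_next n K c * (avg K (%x. ?w x * ?R x) c / avg K ?w c)" unfolding avg_nw[OF K] by (simp add: avg_def)
    finally show ?case using K by (simp add: res_mean[OF n K c] wavg_proportional[OF elim(1)] power2_eq_square)
   qed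
  qed
 next
  fix e :: real assume e: "e > 0"
  obtain C where C: "C > 0" and w: "whp (plaw n) (%K c. avg K (%x. ?w x * (?R x * indicator {C<..} (abs (?G x)))) c / avg K ?w c < e / 4)"
   using res_tail[OF n L Rm(2) Rm(1) Ri, of "e / 4"] e by auto
  have wc: "whp (plaw n) (%K c. cc_next n K c < 2)" by (rule tip_less[OF tip_cc_next[OF n]]) simp
  have wg: "whp (plaw n) (%K c. proportional n K c)" by (rule whp_AE, rule eventually_mono[OF eventually_ge_at_top[of 1] AE_proportional_plaw[OF n]])
  show "\<exists>C>0. whp (plaw n) (%K c. (\<Sum>k=1..K. LINT y|res_move K n c. (?xi y)\<^sup>2 * indicator {C<..} (abs (?xi y))) / K < e)"
  proof (intro exI[of _ "2 * C"] conjI whp_mono[OF whp_conj[OF P w whp_conj[OF P wc wg]]])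
   show "0 < 2 * C" using C by simp
   show "\<forall>\<^sub>F K in sequentially. \<forall>c\<in>space (plaw n K). avg K (%x. ?w x * (?R x * indicator {C<..} \<bar>?G x\<bar>)) c / avg K ?w c < e / 4 & cc_next n K c < 2 & proportional n K c -->
    (\<Sum>k=1..K. LINT y|res_move K n c. (?xi y)\<^sup>2 * indicator {2 * C<..} \<bar>?xi y\<bar>) / K < e"
   proof (rule eventually_mono[OF eventually_ge_at_top[of 1]], intro ballI impI, elim conjE)
    fix K :: nat and c assume K: "1 <= K" and c0: "c : space (plaw n K)"
     and small: "avg K (%x. ?w x * (?R x * indicator {C<..} (abs (?G x)))) c / avg K ?w c < e / 4"
     and cc2: "cc_next n K c < 2" and p: "proportional n K c"
    have c: "c : space (clouds K (Suc n))" using c0 by (simp add: sp)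
    have fm: "(%y. (?xi y)\<^sup>2 * indicator {2 * C<..} (abs (?xi y))) : bm (E (Suc n))" using xm by measurable
    have "(\<Sum>k=1..K. LINT y|res_move K n c. (?xi y)\<^sup>2 * indicator {2 * C<..} \<bar>?xi y\<bar>) / K
     = (LINT y|res_move K n c. (?xi y)\<^sup>2 * indicator {2 * C<..} \<bar>?xi y\<bar>)" using K by simp
    also have "... <= (\<Sum>j=1..K. 4 * (nw K n c j * (?R (fst (c j)) * indicator {C<..} (abs (?G (fst (c j)))))))"
     unfolding integral_res_move[OF n c K fm]
    proof (rule sum_mono)
     fix j assume j: "j : {1..K}"
     let ?x = "fst (c j)"
     let ?H = "snd (c j) / (real K * nw K n c j)"
     have p0: "0 <= nw K n c j" using nw_pos[OF n c K j] by simp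
     have H: "?H = cc_next n K c * h (Suc n) ?x" by (rule cc_next(1)[OF n K c p j])
     have ccp: "0 < cc_next n K c" by (rule cc_next(2)[OF n K c p j])
     have le: "abs (?H * gn (Suc n) ?x) <= 2 * abs (?G ?x)"
     proof -
      have "abs (?H * gn (Suc n) ?x) = cc_next n K c * abs (?G ?x)" unfolding H using ccp by (simp add: abs_mult)
      also have "... <= 2 * abs (?G ?x)" using cc2 by (intro mult_right_mono) auto
      finally show ?thesis .
     qed
     have "(?H * gn (Suc n) ?x)^2 <= 4 * ?R ?x"
     proof -
      have four: "(2 :: real)^2 = 4" by simp
      have "\<bar>?H * gn (Suc n) ?x\<bar>\<^sup>2 <= (2 * abs (?G ?x))\<^sup>2" by (rule power_mono[OF le]) simp
      then show ?thesis unfolding power_mult_distrib[of 2] power2_abs four .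
     qed
     then have "(?H * gn (Suc n) ?x)^2 * indicator {2 * C<..} (abs (?H * gn (Suc n) ?x)) <= 4 * (?R ?x * indicator {C<..} (abs (?G ?x)))"
      using le by (auto split: split_indicator)
     from mult_left_mono[OF this p0]
     show "nw K n c j * ((snd (?x, ?H) * gn (Suc n) (fst (?x, ?H)))^2 * indicator {2 * C<..} \<bar>snd (?x, ?H) * gn (Suc n) (fst (?x, ?H))\<bar>)
      <= 4 * (nw K n c j * (?R ?x * indicator {C<..} \<bar>?G ?x\<bar>))" by (simp only: fst_conv snd_conv mult.left_commute[of 4])
    qed
    also have "... = 4 * (avg K (%x. ?w x * (?R x * indicator {C<..} (abs (?G x)))) c / avg K ?w c)"
     unfolding sum_distrib_left[symmetric] avg_nw[OF K] by (simp add: avg_def)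
    finally show "(\<Sum>k=1..K. LINT y|res_move K n c. (?xi y)\<^sup>2 * indicator {2 * C<..} (abs (?xi y))) / K < e" using small by linarith
   qed
  qed
 qed
 then show ?thesis unfolding law_Suc_step[OF n] wavg_def .
qed

lemma cf_tendsto:
 "n <= T ==> cf n s \<longlonglongrightarrow> exp (- (s\<^sup>2 * (\<Sum>i<n. var_prop i + var_res i) / 2))"
proof (induction n)
 case 0
 have "cf 0 s K = 1" if K: "K >= 1" for K
 proof -
  interpret prob_space "law 0 K" by (rule prob_space_law) simp
  have "(%c. wavg K (gn 0) c) : bm (law 0 K)"
   using wavg_measurable[OF gn_measurable[of 0], of K] sets_law[of 0 K] by (auto cong: mcs)
  then have "cf 0 s K = (CLINT c|law 0 K. 1)" using AE_law_0[OF K] by (intro integral_cong_AE) (auto elim!: eventually_mono)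
  then show ?thesis by (simp add: prob_space)
 qed
 then have "\<forall>\<^sub>F K in sequentially. cf 0 s K = 1" by (rule eventually_mono[OF eventually_ge_at_top[of 1]])
 then show ?case by (simp add: tendsto_eventually)
next
 case (Suc n)
 then have n: "n < T" by simp
 have "cf (Suc n) s \<longlonglongrightarrow> complex_of_real (exp (- (s\<^sup>2 * (\<Sum>i<n. var_prop i + var_res i) / 2))) * exp (- (s\<^sup>2 * var_prop n / 2)) * exp (- (s\<^sup>2 * var_res n / 2))"
  using Suc by (intro cf_res cf_prop n) auto
 also have "complex_of_real (exp (- (s\<^sup>2 * (\<Sum>i<n. var_prop i + var_res i) / 2))) * exp (- (s\<^sup>2 * var_prop n / 2)) * exp (- (s\<^sup>2 * var_res n / 2))
  = complex_of_real (exp (- (s\<^sup>2 * (\<Sum>i<Suc n. var_prop i + var_res i) / 2)))" unfolding of_real_mult[symmetric] exp_add[symmetric]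
  by (intro arg_cong[where f="%x. complex_of_real (exp x)"]) (simp add: distrib_left add_divide_distrib)
 finally show ?case .
qed

end

text \<open>Since \<open>1 / h\<close> is a probability density, this is the Cauchy-Schwarz
  inequality for the product of \<open>sqrt h * \<psi>\<close> and \<open>1 / sqrt h\<close>. Both
  claims come from expanding a nonnegative square divided by \<open>h\<close>.\<close>

lemma
 fixes \<psi> h :: "'a => real"
 assumes h: "\<And>x. x : space M ==> 0 < h x" and hm[measurable]: "h : bm M"
  and ih: "integrable M (%x. 1 / h x)" "(LINT x|M. 1 / h x) = 1"
  and m[measurable]: "\<psi> : bm M" and i: "integrable M (%x. h x * (\<psi> x)^2)"
 shows integrable_if_weighted_sq: "integrable M \<psi>"
  and weighted_jensen: "(LINT x|M. \<psi> x)^2 <= (LINT x|M. h x * (\<psi> x)^2)"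
proof -
 show i1: "integrable M \<psi>"
 proof (rule Bochner_Integration.integrable_bound)
  show "integrable M (%x. h x * (\<psi> x)^2 + 1 / h x)" using i ih(1) by auto
  show "AE x in M. norm (\<psi> x) <= norm (h x * (\<psi> x)^2 + 1 / h x)"
  proof (rule AE_I2)
   fix x assume "x : space M"
   then have hx: "0 < h x" by (rule h)
   have "0 <= (h x * abs (\<psi> x) - 1)\<^sup>2 / h x" using hx by simp
   also have "... = h x * (\<psi> x)^2 - 2 * abs (\<psi> x) + 1 / h x" using hx by (simp add: power2_eq_square field_simps)
   finally show "norm (\<psi> x) <= norm (h x * (\<psi> x)^2 + 1 / h x)" by simp
  qed
 qed measurable
 define b where "b = (LINT x|M. \<psi> x)"
 have "0 <= (LINT x|M. (h x * \<psi> x - b)\<^sup>2 / h x)" using h by (intro integral_nonneg_AE AE_I2 divide_nonneg_pos zero_le_power2)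
 also have "... = (LINT x|M. (h x * (\<psi> x)^2 - 2 * b * \<psi> x) + b\<^sup>2 * (1 / h x))"
 proof (rule Bochner_Integration.integral_cong[OF refl])
  fix x assume "x : space M"
  then have "0 < h x" by (rule h)
  then show "(h x * \<psi> x - b)^2 / h x = (h x * (\<psi> x)^2 - 2 * b * \<psi> x) + b\<^sup>2 * (1 / h x)"
   by (simp add: power2_eq_square field_simps)
 qed
 also have "... = (LINT x|M. h x * (\<psi> x)^2) - 2 * b * b + b\<^sup>2 * 1"
 proof -
  have "(LINT x|M. b\<^sup>2 * (1 / h x)) = b\<^sup>2 * (LINT x|M. 1 / h x)" by (rule integral_mult_right_zero)
  then show ?thesis using i i1 ih integrable_mult_right[OF ih(1), of "b\<^sup>2"]
   by (subst Bochner_Integration.integral_add) (auto simp: b_def simp del: times_divide_eq_right)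
 qed
 finally show "(LINT x|M. \<psi> x)^2 <= (LINT x|M. h x * (\<psi> x)^2)" by (simp add: b_def power2_eq_square)
qed

context smc_block begin

text \<open>Truncating \<open>h phi\<close> turns convergence in probability into convergence in mean square.\<close>
lemma wavg_mean_square:
 assumes n: "n <= T" and phi: "phi : bm (B n)" and i: "integrable (Q n) (%x. h n x * (phi x)^2)"
 shows "(%K. \<integral>\<^sup>+c. ennreal ((wavg K phi c - (LINT x|Q n. phi x))^2) * indicator {c. cc n c <= 2} c \<partial>law n K) \<longlonglongrightarrow> 0"
proof (rule tendsto_zero_ennreal)
 fix r :: real assume r: "0 < r"
 have hm: "h n : bm (B n)" using n by auto
 have QB: "f : bm (Q n) \<longleftrightarrow> f : bm (B n)" for f :: "_ => real" using n by (simp cong: mcs add: sets_Q)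
 have hpos: "0 < h n x" if "x : space (Q n)" for x using that n by (auto simp: space_Q intro: h_pos)
 \<comment> \<open>In the final estimate the large part costs \<open>6 * e\<close>, its mean
   \<open>3 * e\<close> and the bounded part \<open>r / 10\<close>; with \<open>e < r / 10\<close>
   the total is below \<open>r\<close>.\<close>
 obtain C where C: "C > 0" "(LINT x|Q n. h n x * (phi x)^2 * indicator {C<..} (abs (h n x * phi x))) < r / 10"
  using integral_tail_small[OF i, of "%x. h n x * phi x" "r / 10"] hm phi r by (auto simp: QB)
 define lo where "lo x = phi x * indicator {..C} (abs (h n x * phi x))" for x
 define hi where "hi x = phi x * indicator {C<..} (abs (h n x * phi x))" for x
 have lohi: "phi x = lo x + hi x" for x by (auto simp: lo_def hi_def split: split_indicator)
 have m: "lo : bm (B n)" "hi : bm (B n)" unfolding lo_def hi_def using phi hm by measurable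
 have hi2: "h n x * (hi x)^2 = h n x * (phi x)^2 * indicator {C<..} (abs (h n x * phi x))" for x by (auto simp: hi_def split: split_indicator)
 have "(%x. h n x * (hi x)^2) : bm (Q n)" "(%x. h n x * (lo x)^2) : bm (Q n)" unfolding QB using m hm by measurable
 then have ihi2: "integrable (Q n) (%x. h n x * (hi x)^2)" and ilo2: "integrable (Q n) (%x. h n x * (lo x)^2)"
  by (auto intro!: Bochner_Integration.integrable_bound[OF i] AE_I2 less_imp_le[OF hpos] mult_nonneg_nonneg simp: hi_def lo_def split: split_indicator)
 note inv = inverse_h_integral[OF n]
 have hQ: "h n : bm (Q n)" "lo : bm (Q n)" "hi : bm (Q n)" using hm m by (simp_all add: QB)
 have ilo: "integrable (Q n) lo" and ihi: "integrable (Q n) hi"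
  using integrable_if_weighted_sq[OF hpos hQ(1) inv hQ(2) ilo2] integrable_if_weighted_sq[OF hpos hQ(1) inv hQ(3) ihi2] by auto
 define e where "e = (LINT x|Q n. h n x * (hi x)^2)"
 have e: "0 <= e" "e < r / 10" using C(2) unfolding e_def hi2 by (auto intro!: integral_nonneg_AE AE_I2 dest!: hpos simp: less_imp_le)
 have jen: "(LINT x|Q n. hi x)^2 <= e" unfolding e_def by (rule weighted_jensen[OF hpos hQ(1) inv hQ(3) ihi2])
 have nhi: "(\<integral>\<^sup>+x. ennreal (h n x * (hi x)^2) \<partial>Q n) = ennreal e"
  unfolding e_def by (intro nn_integral_eq_integral ihi2 AE_I2 mult_nonneg_nonneg less_imp_le[OF hpos] zero_le_power2)
 \<comment> \<open>The indicator also contains \<open>proportional\<close>, which holds almost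
   surely, because \<open>tip_integral\<close> wants a bound at every point and not just almost
   everywhere.\<close>
 define X where "X K c = (wavg K lo c - (LINT x|Q n. lo x))^2 * indicator {c. proportional n K c & cc n c <= 2} c" for K c
 have tl: "tip (law n) (%K. wavg K lo) (LINT x|Q n. lo x)"
 proof -
  have e: "h n x * lo x / h n x = lo x" if "x : space (Q n)" for x using hpos[OF that] by simp
  have m1: "(%x. h n x * lo x) : bm (B n)" using hm m by measurable
  have i1: "integrable (Q n) (%x. h n x * lo x / h n x)" using ilo by (simp add: e cong: Bochner_Integration.integrable_cong)
  have I1: "(LINT x|Q n. h n x * lo x / h n x) = (LINT x|Q n. lo x)" by (rule Bochner_Integration.integral_cong[OF refl]) (rule e)
  have "tip (law n) (%K. avg K (%x. h n x * lo x)) (LINT x|Q n. lo x)"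
   using lln[OF n, unfolded lln_def, THEN bspec, OF m1, THEN mp, OF i1] unfolding I1 .
  from tip_mult[OF prob_space_law[OF n] tip_cc[OF n] this]
  have "tip (law n) (%K c. cc n c * avg K (%x. h n x * lo x) c) (LINT x|Q n. lo x)" by simp
  then show ?thesis
  proof (rule tip_cong[OF prob_space_law[OF n]])
   show "whp (law n) (%K c. wavg K lo c = cc n c * avg K (%x. h n x * lo x) c)"
    by (intro whp_AE eventually_mono[OF eventually_ge_at_top[of 1]] AE_mp[OF AE_proportional[OF n] AE_I2])
     (auto intro: wavg_proportional)
  qed
 qed
 have "tip (law n) (%K c. (wavg K lo c - (LINT x|Q n. lo x))\<^sup>2) (((LINT x|Q n. lo x) - (LINT x|Q n. lo x))^2)"
  by (rule tip_continuous[OF tl]) (intro continuous_intros)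
 then have "tip (law n) (%K c. (wavg K lo c - (LINT x|Q n. lo x))\<^sup>2) 0" by simp
 then have tX: "tip (law n) X 0" unfolding tip_def by (auto intro: whp_imp simp: X_def dist_real_def split: split_indicator)
 have Xm: "X K : bm (law n K)" for K
 proof (cases "K >= 1")
  case True
  have [measurable]: "wavg K lo : bm (law n K)" "cc n : bm (law n K)" "Measurable.pred (law n K) (proportional n K)"
   unfolding mcs[OF sets_law[OF n] refl]
   by (rule wavg_measurable[OF m(1)] cc_measurable[OF n order_refl True] proportional_measurable[OF n order_refl])+
  show ?thesis unfolding X_def by measurable
 next
  case False
  then have [simp]: "K = 0" by simp
  \<comment> \<open>For \<open>K = 0\<close> there is only one cloud, so every function on the space
    is measurable.\<close>
  have sp: "c = (%_. undefined)" if "c : space (law n 0)" for c using that by (simp add: space_law[OF n] space_PiM)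
  have "X 0 c = X 0 (%_. undefined)" if "c : space (law n 0)" for c using sp[OF that] by simp
  then have "X 0 : bm (law n 0) \<longleftrightarrow> (%_. X 0 (%_. undefined)) : bm (law n 0)" by (rule measurable_cong)
  then show ?thesis by simp
 qed
 have Xb: "abs (X K c) <= (2 * C + abs (LINT x|Q n. lo x))\<^sup>2" if c: "c : space (law n K)" for K c
 proof (cases "proportional n K c & cc n c <= 2 & K >= 1")
  case True
  have cl: "c : space (clouds K n)" using c n by (simp add: space_law)
  have p: "0 < cc n c" using proportional_cc_pos[OF n order_refl _ cl] True by simp
  have hl: "abs (h n x * lo x) <= C" for x using C(1) by (auto simp: lo_def split: split_indicator)
  have "abs (avg K (%x. h n x * lo x) c) <= (\<Sum>k=1..K. abs (h n (fst (c k)) * lo (fst (c k)))) / K"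
   unfolding avg_def using sum_abs by (simp add: divide_right_mono)
  also have "... <= (\<Sum>k=1..K. C) / K" by (intro divide_right_mono sum_mono hl) simp
  also have "... = C" using True by simp
  finally have "abs (avg K (%x. h n x * lo x) c) <= C" .
  moreover have "wavg K lo c = cc n c * avg K (%x. h n x * lo x) c" using True by (intro wavg_proportional) blast
  ultimately have "abs (wavg K lo c) <= 2 * C"
   using True p C(1) mult_mono[of "cc n c" 2 "abs (avg K (%x. h n x * lo x) c)" C] by (auto simp: abs_mult)
  then have "abs (wavg K lo c - (LINT x|Q n. lo x)) <= 2 * C + abs (LINT x|Q n. lo x)" by linarith
  from power_mono[OF this, of 2] show ?thesis using True by (simp add: X_def)
 next
  case False
  then have "X K c = 0 \<or> (K = 0 & (abs (X K c)) <= (LINT x|Q n. lo x)\<^sup>2)" by (auto simp: X_def wavg_def One_nat_def split: split_indicator)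
  moreover have "(LINT x|Q n. lo x)^2 <= (2 * C + abs (LINT x|Q n. lo x))\<^sup>2"
   using power_mono[of "abs (LINT x|Q n. lo x)" "2 * C + abs (LINT x|Q n. lo x)" 2] C(1) by simp
  ultimately show ?thesis by auto
 qed
 have "(%K. LINT c|law n K. X K c) \<longlonglongrightarrow> 0" by (rule tip_integral[OF prob_space_law[OF n] tX Xm Xb])
 then have "\<forall>\<^sub>F K in sequentially. (LINT c|law n K. X K c) < r / 30" using r by (intro order_tendstoD) auto
 then show "\<forall>\<^sub>F K in sequentially. (\<integral>\<^sup>+c. ennreal ((wavg K phi c - (LINT x|Q n. phi x))^2) * indicator {c. cc n c <= 2} c \<partial>law n K) < ennreal r"
  using eventually_ge_at_top[of 1]
 proof eventually_elim
  case (elim K)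
  interpret prob_space "law n K" by (rule prob_space_law[OF n])
  have iX: "integrable (law n K) (X K)" by (rule integrable_const_bound[where B="(2 * C + abs (LINT x|Q n. lo x))^2", OF AE_I2 Xm]) (simp add: Xb)
  have [measurable]: "wavg K hi : bm (law n K)" "cc n : bm (law n K)"
   using wavg_measurable[OF m(2)] cc_measurable[OF n order_refl elim(2)] by (simp_all cong: mcs add: sets_law[OF n])
  note [measurable] = Xm
  have nX: "(\<integral>\<^sup>+c. ennreal (X K c) \<partial>law n K) = ennreal (LINT c|law n K. X K c)"
   by (rule nn_integral_eq_integral[OF iX]) (simp add: X_def)
  have "(\<integral>\<^sup>+c. ennreal ((wavg K phi c - (LINT x|Q n. phi x))^2) * indicator {c. cc n c <= 2} c \<partial>law n K)
   <= (\<integral>\<^sup>+c. 3 * (ennreal ((wavg K hi c)^2) * indicator {c. cc n c <= 2} c) + (3 * ennreal (X K c) + ennreal (3 * e)) \<partial>law n K)"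
  proof (rule nn_integral_mono_AE)
   show "AE c in law n K. ennreal ((wavg K phi c - (LINT x|Q n. phi x))^2) * indicator {c. cc n c <= 2} c
    <= 3 * (ennreal ((wavg K hi c)^2) * indicator {c. cc n c <= 2} c) + (3 * ennreal (X K c) + ennreal (3 * e))" using AE_proportional[OF n elim(2)]
   proof eventually_elim
    case (elim c)
    show ?case
    proof (cases "cc n c <= 2")
     case True
     have s3: "(u + v - w)^2 <= 3 * u\<^sup>2 + 3 * v\<^sup>2 + 3 * w\<^sup>2" for u v w :: real
     proof -
      have "0 <= (u - v)\<^sup>2 + (u + w)^2 + (v + w)^2" by simp
      then show ?thesis by (simp add: power2_eq_square algebra_simps)
     qed
     have "wavg K phi c = wavg K lo c + wavg K hi c" by (simp add: wavg_def lohi distrib_left sum.distrib add_divide_distrib)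
     moreover have "(LINT x|Q n. phi x) = (LINT x|Q n. lo x) + (LINT x|Q n. hi x)" using ilo ihi by (simp add: lohi[abs_def])
     ultimately have "wavg K phi c - (LINT x|Q n. phi x) = wavg K hi c + (wavg K lo c - (LINT x|Q n. lo x)) - (LINT x|Q n. hi x)" by simp
     then have "(wavg K phi c - (LINT x|Q n. phi x))^2 <= 3 * (wavg K hi c)^2 + 3 * X K c + 3 * e"
      using s3[of "wavg K hi c" "wavg K lo c - (LINT x|Q n. lo x)" "LINT x|Q n. hi x"] jen elim True by (simp add: X_def)
     then have "ennreal ((wavg K phi c - (LINT x|Q n. phi x))^2) <= ennreal (3 * (wavg K hi c)^2 + 3 * X K c + 3 * e)" by (rule ennreal_leI)
     also have "... = 3 * ennreal ((wavg K hi c)^2) + (3 * ennreal (X K c) + ennreal (3 * e))"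
     proof -
      have "0 <= X K c" by (simp add: X_def)
      then show ?thesis using e(1) by (simp add: ennreal_plus ennreal_mult' add.assoc)
     qed
     finally show ?thesis using True by simp
    qed simp
   qed
  qed
  also have "... = 3 * (\<integral>\<^sup>+c. ennreal ((wavg K hi c)^2) * indicator {c. cc n c <= 2} c \<partial>law n K) + (3 * ennreal (LINT c|law n K. X K c) + ennreal (3 * e))"
  proof -
   have p1: "(%c. ennreal ((wavg K hi c)^2) * indicator {c. cc n c <= 2} c) : bm (law n K)" by measurable
   have p2: "(%c. ennreal (X K c)) : bm (law n K)" by measurable
   show ?thesis using p1 p2 by (simp add: nn_integral_add nn_integral_cmult nX emeasure_space_1)
  qed
  also have "... <= 3 * (2 * ennreal e) + (3 * ennreal (r / 30) + ennreal (3 * e))"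
   using truncated_second_moment[OF n elim(2) m(2)] elim(1) unfolding nhi by (intro add_mono mult_left_mono order_refl ennreal_leI) auto
  also have "... = ennreal (6 * e + (3 * (r / 30) + 3 * e))"
  proof -
   have p: "0 <= 6 * e" "0 <= 3 * (r / 30)" "0 <= 3 * e" "0 <= 3 * (r / 30) + 3 * e" using e(1) r by auto
   have q1: "ennreal (6 * e) = 3 * (2 * ennreal e)" by (simp add: ennreal_mult' mult.assoc[symmetric])
   have q2: "ennreal (3 * (r / 30)) = 3 * ennreal (r / 30)" using ennreal_mult'[of 3 "r / 30"] by simp
   show ?thesis unfolding ennreal_plus[OF p(1,4)] ennreal_plus[OF p(2,3)] q1 q2 ..
  qed
  also have "... < ennreal r" using e r by (intro ennreal_lessI) auto
  finally show ?case .
 qed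
qed

end

section \<open>Independence of a block from its past\<close>

context smc_block begin

lemma a_le: "a <= horizon S" using a_n_le[of 0] by simp

lemma pair_prob_space_marg_Q: "n <= T ==> pair_prob_space (marg a) (Q n)"
proof -
 assume n: "n <= T"
 interpret mg: prob_space "marg a" by (rule prob_space_marg[OF a_le])
 interpret Qn: prob_space "Q n" by (rule prob_space_Q[OF n])
 show ?thesis ..
qed

lemma mrg_pair_measurable:
 assumes "n <= T"
 shows "(%(x, y). mrg a (a + n) x y) : marg a \<Otimes>\<^sub>M Q n \<rightarrow>\<^sub>M paths S {0<..a + n}"
 using measurable_mrg[of a "a + n" S] assms by (simp cong: mcs sets_pair_measure_cong add: sets_Q sets_marg[OF a_le])

lemma marg_eq_distr:
 assumes n: "n <= T"
 shows "marg (a + n) = distr (marg a \<Otimes>\<^sub>M Q n) (paths S {0<..a + n}) (%(x, y). mrg a (a + n) x y)" (is "_ = distr _ ?N ?f")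
proof (rule measure_eqI)
 interpret pair_prob_space "marg a" "Q n" by (rule pair_prob_space_marg_Q[OF n])
 note f = mrg_pair_measurable[OF n]
 show "sets (marg (a + n)) = sets (distr (marg a \<Otimes>\<^sub>M Q n) ?N ?f)" by (simp add: sets_marg[OF a_n_le[OF n]])
 fix A assume "A : sets (marg (a + n))"
 then have A: "A : sets ?N" by (simp add: sets_marg[OF a_n_le[OF n]])
 then have iA: "indicator A : bm ?N" by measurable
 have "emeasure (marg (a + n)) A = (\<integral>\<^sup>+x. indicator A x \<partial>marg (a + n))"
  using A by (subst nn_integral_indicator) (auto simp: sets_marg[OF a_n_le[OF n]])
 also have "... = (\<integral>\<^sup>+x. \<integral>\<^sup>+y. indicator A (mrg a (a + n) x y) \<partial>Q n \<partial>marg a)"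
  by (rule nn_integral_marg_block[OF n iA])
 also have "... = (\<integral>\<^sup>+z. indicator A (?f z) \<partial>(marg a \<Otimes>\<^sub>M Q n))"
  using M2.nn_integral_fst[of "%z. indicator A (?f z)" "marg a"] mcomp[OF f iA] by (simp add: case_prod_beta')
 also have "... = emeasure (distr (marg a \<Otimes>\<^sub>M Q n) ?N ?f) A" using nn_integral_distr[OF f, of "indicator A"] A iA by simp
 finally show "emeasure (marg (a + n)) A = emeasure (distr (marg a \<Otimes>\<^sub>M Q n) ?N ?f) A" .
qed

text \<open>The quantifier over the block path \<open>y\<close> comes first, so that for a fixed
  \<open>y\<close> the property is one of the earlier coordinates alone and an induction over the
  blocks can use it.\<close>

lemma AE_mrg:
 assumes n: "n <= T" and P: "Measurable.pred (paths S {0<..a + n}) P" and ae: "AE x in marg (a + n). P x"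
 shows "AE y in Q n. AE x in marg a. P (mrg a (a + n) x y)"
proof -
 interpret pair_prob_space "marg a" "Q n" by (rule pair_prob_space_marg_Q[OF n])
 have "AE z in marg a \<Otimes>\<^sub>M Q n. P (case z of (x, y) => mrg a (a + n) x y)"
  using ae P unfolding marg_eq_distr[OF n] by (subst (asm) AE_distr_iff[OF mrg_pair_measurable[OF n]]) auto
 then have "AE x in marg a. AE y in Q n. P (mrg a (a + n) x y)" using AE_pair by fastforce
 then show ?thesis by (rule AE_commute[THEN iffD1, rotated])
   (use mcomp[OF mrg_pair_measurable[OF n] P] in \<open>simp add: pred_def case_prod_beta'\<close>)
qed

text \<open>Properties such as integrability along a run are not known to be measurable events. They
  are replaced by a stronger measurable one, namely lying outside a measurable null set, before
  orders of integration are exchanged.\<close>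

lemma AE_marg_cover:
 assumes t: "t <= horizon S" and ae: "AE x in marg t. P x"
 obtains P' where "Measurable.pred (paths S {0<..t}) P'" "AE x in marg t. P' x" "\<And>x. P' x ==> P x"
proof -
 obtain N where N: "{x : space (marg t). \<not> P x} \<subseteq> N" "emeasure (marg t) N = 0" "N : sets (marg t)" using ae by (rule AE_E)
 have N': "N : sets (paths S {0<..t})" using N(3) by (simp add: sets_marg[OF t])
 let ?P = "%x. x : space (paths S {0<..t}) & x \<notin> N"
 show ?thesis
 proof
  show "Measurable.pred (paths S {0<..t}) ?P" using N' by measurable
  have "AE x in marg t. x \<notin> N" using N by (intro AE_not_in) auto
  then show "AE x in marg t. ?P x" using AE_space by eventually_elim (simp add: space_marg[OF t])
  show "P x" if "?P x" for x using that N(1) by (auto simp: space_marg[OF t])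
 qed
qed

lemma AE_mrg_section:
 assumes n: "n <= T" and ae: "AE x in marg (a + n). P x"
 shows "AE y in Q n. AE x in marg a. P (mrg a (a + n) x y)"
proof -
 obtain P' where P': "Measurable.pred (paths S {0<..a + n}) P'" "AE x in marg (a + n). P' x" "\<And>x. P' x ==> P x"
  using AE_marg_cover[OF a_n_le[OF n] ae] by blast
 from AE_mrg[OF n P'(1,2)] show ?thesis
 proof eventually_elim
  case (elim y)
  then show ?case by eventually_elim (rule P'(3))
 qed
qed

end

section \<open>The joint law of the first filters\<close>

context smc_model begin

abbreviation st :: "nat => nat" where
 "st j \<equiv> blk_start S (Suc j)"

lemma st_Suc: "blk_start S (Suc (Suc j)) = st j + T" by (simp add: blk_start_def)

lemma st_0 [simp]: "st 0 = 0" by (simp add: blk_start_def)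

lemma st_le: "j <= n_blocks S ==> st j <= horizon S" by (simp add: blk_start_def horizon_def)

lemma block: "j < n_blocks S ==> smc_block S (Suc j)" by unfold_locales auto

abbreviation cl :: "nat => nat => (nat => (nat => 'x) \<times> real) measure" where
 "cl K i \<equiv> PiM {1..K} (%_. paths S {blk_start S i<..blk_start S i + T} \<Otimes>\<^sub>M borel)"

text \<open>The junk value outside the blocks makes this a family of probability measures.\<close>
definition fl :: "nat => nat => (nat => (nat => 'x) \<times> real) measure" where
 "fl K i = filter_law S K (if i : {1..n_blocks S} then i else 1) T"

definition Om :: "nat => nat => (nat => nat => (nat => 'x) \<times> real) measure" where
 "Om j K = PiM {1..j} (fl K)"

lemma fl_Suc:
 assumes j: "j < n_blocks S"
 shows "fl K (Suc j) = smc_block.law S (Suc j) T K" using j by (simp add: fl_def smc_block.law_def[OF block[OF j]])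

lemma prob_space_fl: "prob_space (fl K i)"
proof -
 have "smc_block S (if i : {1..n_blocks S} then i else 1)" using n_blocks_pos by unfold_locales auto
 from smc_block.prob_space_law[OF this order_refl, unfolded smc_block.law_def[OF this]] show ?thesis unfolding fl_def .
qed

lemma sets_fl: "i : {1..n_blocks S} ==> sets (fl K i) = sets (cl K i)"
proof -
 assume i: "i : {1..n_blocks S}"
 then have b: "smc_block S i" by unfold_locales
 show ?thesis using smc_block.sets_law[OF b order_refl, unfolded smc_block.law_def[OF b]] i by (simp add: fl_def)
qed

lemma product_prob_space_fl: "product_prob_space (fl K)"
proof -
 interpret prob_space "fl K i" for i by (rule prob_space_fl)
 show ?thesis by unfold_locales
qed

lemma prob_space_Om: "prob_space (Om j K)" unfolding Om_def by (rule prob_space_PiM[OF prob_space_fl])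

lemma sets_Om: "j <= n_blocks S ==> sets (Om j K) = sets (PiM {1..j} (cl K))" unfolding Om_def by (rule sets_PiM_cong[OF refl]) (rule sets_fl, auto)

lemma Om_component: "j <= n_blocks S ==> i : {1..j} ==> (%w. w i) : Om j K \<rightarrow>\<^sub>M cl K i"
 using measurable_component_singleton[of i "{1..j}" "cl K"] by (simp cong: mcs add: sets_Om)

lemma atLeastAtMost_Suc_insert: "{1..Suc j} = insert (Suc j) {1..j}" by auto

lemma nn_integral_Om_Suc:
 assumes "f : bm (Om (Suc j) K)"
 shows "(\<integral>\<^sup>+w. f w \<partial>Om (Suc j) K) = (\<integral>\<^sup>+w. \<integral>\<^sup>+c. f (w(Suc j := c)) \<partial>fl K (Suc j) \<partial>Om j K)"
proof -
 interpret product_prob_space "fl K" by (rule product_prob_space_fl)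
 show ?thesis using assms unfolding Om_def atLeastAtMost_Suc_insert by (intro product_nn_integral_insert) auto
qed

lemma integral_Om_Suc:
 fixes f :: "_ => complex"
 assumes "integrable (Om (Suc j) K) f"
 shows "(LINT w|Om (Suc j) K. f w) = (LINT w|Om j K. LINT c|fl K (Suc j). f (w(Suc j := c)))"
proof -
 interpret product_prob_space "fl K" by (rule product_prob_space_fl)
 show ?thesis using assms unfolding Om_def atLeastAtMost_Suc_insert by (intro product_integral_insert) auto
qed

lemma measurable_Om_upd: "(%(w, c). w(Suc j := c)) : Om j K \<Otimes>\<^sub>M fl K (Suc j) \<rightarrow>\<^sub>M Om (Suc j) K"
 unfolding Om_def atLeastAtMost_Suc_insert by (rule measurable_add_dim)

lemma AE_Om_Suc:
 assumes P: "Measurable.pred (Om (Suc j) K) P" and ae: "AE w in Om j K. AE c in fl K (Suc j). P (w(Suc j := c))"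
 shows "AE w in Om (Suc j) K. P w"
proof -
 have s: "{w : space (Om (Suc j) K). \<not> P w} : sets (Om (Suc j) K)" using P by measurable
 have "(\<integral>\<^sup>+w. indicator {w : space (Om (Suc j) K). \<not> P w} w \<partial>Om (Suc j) K)
  = (\<integral>\<^sup>+w. \<integral>\<^sup>+c. indicator {w : space (Om (Suc j) K). \<not> P w} (w(Suc j := c)) \<partial>fl K (Suc j) \<partial>Om j K)"
  by (rule nn_integral_Om_Suc) (use s in measurable)
 also have "... = (\<integral>\<^sup>+w. 0 \<partial>Om j K)"
 proof (rule nn_integral_cong_AE)
  show "AE w in Om j K. (\<integral>\<^sup>+c. indicator {w : space (Om (Suc j) K). \<not> P w} (w(Suc j := c)) \<partial>fl K (Suc j)) = 0" using ae
  proof eventually_elim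
   case (elim w)
   have "(\<integral>\<^sup>+c. indicator {w : space (Om (Suc j) K). \<not> P w} (w(Suc j := c)) \<partial>fl K (Suc j)) = (\<integral>\<^sup>+c. 0 \<partial>fl K (Suc j))"
    using elim by (intro nn_integral_cong_AE) (auto elim!: eventually_mono split: split_indicator)
   then show ?case by simp
  qed
 qed
 finally have "emeasure (Om (Suc j) K) {w : space (Om (Suc j) K). \<not> P w} = 0" using s by simp
 with s show ?thesis by (subst AE_iff_measurable[OF s refl])
qed

subsection \<open>Averages over joined paths\<close>

text \<open>The average over all joined paths of \<open>j\<close> blocks, nested so that the
  particle index of the last block is outermost. For fixed earlier filters it is then a weighted
  average over one filter (\<open>emp_Suc_wavg\<close>); the flat sum is recovered in
  \<open>emp_eq_sum\<close>.\<close>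

primrec emp :: "nat => nat => (nat => nat => (nat => 'x) \<times> real) => ((nat => 'x) => real) => real" where
 "emp 0 K w phi = phi (%_. undefined)"
| "emp (Suc j) K w phi =
  (\<Sum>i=1..K. snd (w (Suc j) i) * emp j K w (%x. phi (mrg (st j) (st j + T) x (fst (w (Suc j) i))))) / K"

text \<open>\<open>emp\<close> is a finite sum over joined paths and can be exchanged with an
  integral only if integrability is known at each of them.\<close>

primrec all_paths :: "nat => nat => (nat => nat => (nat => 'x) \<times> real) => ((nat => 'x) => bool) => bool" where
 "all_paths 0 K w P \<longleftrightarrow> P (%_. undefined)"
| "all_paths (Suc j) K w P \<longleftrightarrow>
  (\<forall>i\<in>{1..K}. all_paths j K w (%x. P (mrg (st j) (st j + T) x (fst (w (Suc j) i)))))"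

lemma emp_upd: "j < i ==> emp j K (w(i := c)) phi = emp j K w phi" by (induction j arbitrary: phi) auto

lemma all_paths_upd: "j < i ==> all_paths j K (w(i := c)) P = all_paths j K w P" by (induction j arbitrary: P) auto

lemma emp_cong: "all_paths j K w (%x. phi x = phi' x) ==> emp j K w phi = emp j K w phi'"
proof (induction j arbitrary: phi phi')
 case (Suc j)
 then show ?case by (auto intro!: arg_cong2[where f="(/)"] sum.cong)
qed simp

lemma all_paths_conj: "all_paths j K w P ==> all_paths j K w P' ==> all_paths j K w (%x. P x & P' x)" by (induction j arbitrary: P P') auto

lemma all_paths_mono: "all_paths j K w P ==> (\<And>x. P x ==> P' x) ==> all_paths j K w P'"
proof (induction j arbitrary: P P')
 case (Suc j)
 show ?case unfolding all_paths.simps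
 proof
  fix i assume "i : {1..K}"
  then have "all_paths j K w (%x. P (mrg (st j) (st j + T) x (fst (w (Suc j) i))))" using Suc.prems(1) by simp
  then show "all_paths j K w (%x. P' (mrg (st j) (st j + T) x (fst (w (Suc j) i))))" by (rule Suc.IH) (rule Suc.prems(2))
 qed
qed simp

lemma emp_integral:
 assumes "all_paths j K w (%x. integrable N (phi x))"
 shows "integrable N (%y. emp j K w (%x. phi x y)) & (LINT y|N. emp j K w (%x. phi x y)) = emp j K w (%x. LINT y|N. phi x y)" using assms
proof (induction j arbitrary: phi)
 case (Suc j)
 note IH = Suc.IH[OF Suc.prems[simplified, THEN bspec]]
 show ?case using IH by (auto intro!: Bochner_Integration.integrable_divide Bochner_Integration.integrable_sum simp: Bochner_Integration.integral_sum)
qed simp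

text \<open>The parameter \<open>l\<close> carries the filters together with anything else the test
  function depends on. The recursion needs this generality, because the inner test function involves
  the cloud of the last block.\<close>

lemma
 assumes "j <= n_blocks S" "\<And>i. i : {1..j} ==> (%l. f l i) : L \<rightarrow>\<^sub>M cl K i"
 shows emp_measurable: "(%(l, x). phi l x) : bm (L \<Otimes>\<^sub>M paths S {0<..st j}) ==>
   (%l. emp j K (f l) (phi l)) : bm L"
  and all_paths_measurable: "Measurable.pred (L \<Otimes>\<^sub>M paths S {0<..st j}) (%(l, x). P l x) ==>
   Measurable.pred L (%l. all_paths j K (f l) (P l))" using assms
proof (induction j arbitrary: phi P)
 case 0
 have u: "(%l. (l, (%_. undefined))) : L \<rightarrow>\<^sub>M L \<Otimes>\<^sub>M paths S {0<..st 0}"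
  by (intro measurable_Pair measurable_const) (auto simp: space_paths_empty)
 {
  case 1
  then show ?case using mcomp[OF u 1(1)] by simp
 next
  case 2
  then show ?case using mcomp[OF u 2(1)] by simp
 }
next
 case (Suc j)
 have r: "(%(l, x). (l, mrg (st j) (st j + T) x (fst (f l (Suc j) i)))) : L \<Otimes>\<^sub>M paths S {0<..st j} \<rightarrow>\<^sub>M L \<Otimes>\<^sub>M paths S {0<..blk_start S (Suc (Suc j))}"
  and r2: "(%l. snd (f l (Suc j) i)) : bm L"
  if f: "\<And>i. i : {1..Suc j} ==> (%l. f l i) : L \<rightarrow>\<^sub>M cl K i" and i: "i : {1..K}" for i
 proof -
  have c: "(%l. f l (Suc j) i) : L \<rightarrow>\<^sub>M paths S {st j<..st j + T} \<Otimes>\<^sub>M borel"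
   by (rule mcomp[OF f measurable_component_singleton[OF i]]) simp
  have s: "(%l. fst (f l (Suc j) i)) : L \<rightarrow>\<^sub>M paths S {st j<..st j + T}" by (rule mcomp[OF c measurable_fst])
  show "(%l. snd (f l (Suc j) i)) : bm L" by (rule mcomp[OF c measurable_snd])
  show "(%(l, x). (l, mrg (st j) (st j + T) x (fst (f l (Suc j) i)))) : L \<Otimes>\<^sub>M paths S {0<..st j} \<rightarrow>\<^sub>M L \<Otimes>\<^sub>M paths S {0<..blk_start S (Suc (Suc j))}"
   unfolding st_Suc case_prod_beta'
   by (intro measurable_Pair measurable_fst measurable_mrg' measurable_snd mcomp[OF measurable_fst s]) simp
 qed
 {
  case 1
  have "(%(l, x). phi l (mrg (st j) (st j + T) x (fst (f l (Suc j) i)))) : bm (L \<Otimes>\<^sub>M paths S {0<..st j})"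
   if i: "i : {1..K}" for i using mcomp[OF r[OF 1(3) i] 1(1)] by (simp add: case_prod_beta')
  then have "(%l. emp j K (f l) (%x. phi l (mrg (st j) (st j + T) x (fst (f l (Suc j) i))))) : bm L"
   if i: "i : {1..K}" for i using 1 i by (intro Suc.IH(1)) auto
  then show ?case unfolding emp.simps
   by (intro borel_measurable_divide borel_measurable_sum borel_measurable_times r2[OF 1(3)] borel_measurable_const) auto
 next
  case 2
  have "Measurable.pred (L \<Otimes>\<^sub>M paths S {0<..st j}) (%(l, x). P l (mrg (st j) (st j + T) x (fst (f l (Suc j) i))))"
   if i: "i : {1..K}" for i using mcomp[OF r[OF 2(3) i] 2(1)] by (simp add: case_prod_beta')
  then have "Measurable.pred L (%l. all_paths j K (f l) (%x. P l (mrg (st j) (st j + T) x (fst (f l (Suc j) i)))))"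
   if i: "i : {1..K}" for i using 2 i by (intro Suc.IH(2)) auto
  then show ?case unfolding all_paths.simps by (intro pred_intros_finite) auto
 }
qed

text \<open>The induction hypothesis is a premise, so that the argument serves twice: with
  \<open>n = T\<close> as the step of \<open>AE_all_paths_measurable\<close>, and for partial blocks
  in \<open>AE_all_paths_mrg\<close>.\<close>

lemma AE_all_paths_mrg_if:
 assumes j: "j < n_blocks S" and n: "n <= T" and P: "Measurable.pred (paths S {0<..st j + n}) P" and ae: "AE x in marg (st j + n). P x"
  and IH: "\<And>P. Measurable.pred (paths S {0<..st j}) P ==> AE x in marg (st j). P x ==> AE w in Om j K. all_paths j K w P"
 shows "AE w in Om j K. AE y in smc_block.Q S (Suc j) n. all_paths j K w (%x. P (mrg (st j) (st j + n) x y))"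
proof -
 interpret smc_block S "Suc j" by (rule block[OF j])
 let ?mr = "mrg (st j) (st j + n)"
 interpret Qn: prob_space "Q n" by (rule prob_space_Q[OF n])
 interpret O: prob_space "Om j K" by (rule prob_space_Om)
 interpret oq: pair_sigma_finite "Q n" "Om j K" ..
 have "AE y in Q n. AE w in Om j K. all_paths j K w (%x. P (?mr x y))" using AE_mrg[OF n P ae] AE_space
 proof eventually_elim
  case (elim y)
  have y: "y : space (B n)" using elim(2) by (simp add: space_Q[OF n])
  have "Measurable.pred (paths S {0<..st j}) (%x. P (?mr x y))"
   by (rule mcomp[OF _ P]) (intro measurable_mrg' measurable_ident_sets refl measurable_const y, simp)
  with IH elim(1) show ?case by blast
 qed
 moreover have "Measurable.pred (Q n \<Otimes>\<^sub>M Om j K) (%(y, w). all_paths j K w (%x. P (?mr x y)))"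
 proof -
  have "(%(l, x). ?mr x (fst l)) : (B n \<Otimes>\<^sub>M Om j K) \<Otimes>\<^sub>M paths S {0<..st j} \<rightarrow>\<^sub>M paths S {0<..st j + n}"
   unfolding case_prod_beta' by measurable
  from mcomp[OF this P] have "Measurable.pred (B n \<Otimes>\<^sub>M Om j K) (%l. all_paths j K (snd l) (%x. P (?mr x (fst l))))"
   using j by (intro all_paths_measurable mcomp[OF measurable_snd Om_component]) (auto simp: case_prod_beta')
  then show ?thesis unfolding mcs[OF sets_pair_measure_cong[OF sets_Q[OF n] refl] refl] case_prod_beta' .
 qed
 ultimately show ?thesis by (elim oq.AE_commute[THEN iffD1, rotated]) (simp add: pred_def case_prod_beta')
qed

text \<open>Joined paths avoid null sets. For almost every path of the last block the section in the
  earlier coordinates is null, which the induction covers; \<open>AE_particles\<close> then says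
  that the particles of the last filter are among those block paths.\<close>

lemma AE_all_paths_measurable:
 assumes "j <= n_blocks S" "Measurable.pred (paths S {0<..st j}) P" "AE x in marg (st j). P x"
 shows "AE w in Om j K. all_paths j K w P" using assms
proof (induction j arbitrary: P)
 case 0
 have "marg (st 0) = return (paths S {0<..0}) (%_. undefined)" by (simp add: marg_def)
 then have "AE x in return (paths S {0<..0}) (%_. undefined). P x" using 0(3) by metis
 then have "P (%_. undefined)" using 0(2) by (subst (asm) AE_return) (auto simp: space_paths_empty)
 then show ?case by simp
next
 case (Suc j)
 then have j: "j < n_blocks S" by simp
 interpret smc_block S "Suc j" by (rule block[OF j])
 let ?T = "T" and ?mr = "mrg (st j) (st j + T)"
 have "AE w in Om j K. AE y in Q ?T. all_paths j K w (%x. P (?mr x y))"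
  using Suc.prems Suc.IH unfolding st_Suc by (intro AE_all_paths_mrg_if[OF j order_refl]) auto
 then have "AE w in Om j K. AE c in fl K (Suc j). all_paths (Suc j) K (w(Suc j := c)) P"
 proof eventually_elim
  case (elim w)
  from AE_particles[OF order_refl elim] show ?case unfolding fl_Suc[OF j] by (simp add: all_paths_upd)
 qed
 moreover have "Measurable.pred (Om (Suc j) K) (%w. all_paths (Suc j) K w P)"
  using Suc.prems by (intro all_paths_measurable Om_component) (auto intro!: mcomp[OF measurable_snd] simp: case_prod_beta')
 ultimately show ?case by (rule AE_Om_Suc[rotated])
qed

lemma AE_all_paths_mrg:
 assumes j: "j < n_blocks S" and n: "n <= T" and ae: "AE x in marg (st j + n). P x"
 shows "AE w in Om j K. AE y in smc_block.Q S (Suc j) n. all_paths j K w (%x. P (mrg (st j) (st j + n) x y))"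
proof -
 interpret smc_block S "Suc j" by (rule block[OF j])
 have t: "st j + n <= horizon S" by (rule a_n_le[OF n])
 obtain P' where P': "Measurable.pred (paths S {0<..st j + n}) P'" "AE x in marg (st j + n). P' x" "\<And>x. P' x ==> P x"
  using AE_marg_cover[OF t ae] by blast
 have "AE w in Om j K. AE y in Q n. all_paths j K w (%x. P' (mrg (st j) (st j + n) x y))"
  using j by (intro AE_all_paths_mrg_if[OF j n P'(1,2)] AE_all_paths_measurable) auto
 then show ?thesis
 proof eventually_elim
  case (elim w)
  then show ?case by eventually_elim (erule all_paths_mono, rule P'(3))
 qed
qed

end

section \<open>Weighted second moments over several blocks\<close>

lemma square_diff_le: "(x - y)^2 <= 2 * x\<^sup>2 + 2 * y\<^sup>2" for x y :: real
 using zero_le_power2[of "x + y"] by (simp add: power2_eq_square algebra_simps)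

lemma square_sum_le: "(x + y)^2 <= 2 * x\<^sup>2 + 2 * y\<^sup>2" for x y :: real using square_diff_le[of x "- y"] by simp

context smc_model begin

lemma eta_0: "eta S 0 = 1" using prob_space_prop_law by (simp add: eta_def prob_space.prob_space)

lemma h_fun_0 [simp]: "h_fun S 0 x = 1" by (simp add: h_fun_def eta_0)

lemma
 assumes t: "t <= horizon S"
 shows h_fun_measurable: "h_fun S t : bm (paths S {0<..t})"
  and h_fun_pos: "x : space (paths S {0<..t}) ==> 0 < h_fun S t x"
  and inverse_h_fun_integral: "integrable (marg t) (%x. 1 / h_fun S t x)" "(LINT x|marg t. 1 / h_fun S t x) = 1"
proof -
 note [measurable] = prod_weight_measurable[OF t]
 have e: "0 < eta S t" by (rule nn_integral_prod_weight(2)[OF t])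
 show m[measurable]: "h_fun S t : bm (paths S {0<..t})" unfolding h_fun_def[abs_def] by measurable
 show p: "0 < h_fun S t x" if "x : space (paths S {0<..t})" for x using prod_weight_pos[OF t that] e by (simp add: h_fun_def)
 have mm: "(%x. 1 / h_fun S t x) : bm (marg t)" "(%x. \<Prod>u=1..t. weight_at S u x) : bm (marg t)"
  unfolding mcs[OF sets_marg[OF t] refl] by measurable
 have "(\<integral>\<^sup>+x. ennreal (1 / h_fun S t x) \<partial>marg t) = (\<integral>\<^sup>+x. ennreal (1 / eta S t) * ennreal (\<Prod>u=1..t. weight_at S u x) \<partial>marg t)"
  using e by (intro nn_integral_cong) (simp add: h_fun_def ennreal_mult'[symmetric])
 also have "... = ennreal (1 / eta S t) * eta S t" using mm(2) by (subst nn_integral_cmult) (auto simp: nn_integral_prod_weight(1)[OF t])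
 also have "... = 1" using e by (simp add: ennreal_mult'[symmetric])
 finally have n1: "(\<integral>\<^sup>+x. ennreal (1 / h_fun S t x) \<partial>marg t) = 1" .
 have nn: "AE x in marg t. 0 <= 1 / h_fun S t x" using p by (intro AE_I2) (simp add: space_marg[OF t] less_imp_le)
 show "integrable (marg t) (%x. 1 / h_fun S t x)" using mm(1) nn n1 by (intro integrableI_nonneg) auto
 show "(LINT x|marg t. 1 / h_fun S t x) = 1" using mm(1) nn n1 by (subst integral_eq_nn_integral) auto
qed

lemma weighted_square:
 assumes t: "t <= horizon S" and phi: "phi : bm (paths S {0<..t})"
  and fin: "(\<integral>\<^sup>+x. ennreal (h_fun S t x * (phi x)^2) \<partial>marg t) < \<infinity>"
 shows "integrable (marg t) phi" and "ennreal ((LINT x|marg t. phi x)^2) <= (\<integral>\<^sup>+x. ennreal (h_fun S t x * (phi x)^2) \<partial>marg t)"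
proof -
 have p: "0 < h_fun S t x" if "x : space (marg t)" for x using that by (intro h_fun_pos[OF t]) (simp add: space_marg[OF t])
 have m: "h_fun S t : bm (marg t)" "phi : bm (marg t)"
  unfolding mcs[OF sets_marg[OF t] refl] by (rule h_fun_measurable[OF t] phi)+
 have nn: "AE x in marg t. 0 <= h_fun S t x * (phi x)^2" by (intro AE_I2 mult_nonneg_nonneg less_imp_le[OF p] zero_le_power2)
 have i: "integrable (marg t) (%x. h_fun S t x * (phi x)^2)" using m nn fin by (intro integrableI_nonneg) auto
 show "integrable (marg t) phi" by (rule integrable_if_weighted_sq[OF p m(1) inverse_h_fun_integral[OF t] m(2) i])
 show "ennreal ((LINT x|marg t. phi x)^2) <= (\<integral>\<^sup>+x. ennreal (h_fun S t x * (phi x)^2) \<partial>marg t)"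
  unfolding nn_integral_eq_integral[OF i nn] by (rule ennreal_leI[OF weighted_jensen[OF p m(1) inverse_h_fun_integral[OF t] m(2) i]])
qed

lemma h_fun_mrg:
 assumes j: "j < n_blocks S" and n: "n <= T"
 shows "h_fun S (st j + n) (mrg (st j) (st j + n) x y) = h_fun S (st j) x * h_blk S (Suc j) (st j + n) y"
proof -
 interpret smc_block S "Suc j" by (rule block[OF j])
 have "0 < eta S (st j)" using a_n_le[of 0] by (intro nn_integral_prod_weight(2)) simp
 then show ?thesis by (simp add: h_fun_def prod_weight_mrg[OF n] h_eq eta_blk_def)
qed

text \<open>The event on which the truncated second moment bounds can be applied to one filter after
  another. As a weight it factors over the filters (\<open>okw_Suc\<close>), and by
  \<open>ok_prob\<close> its complement becomes negligible.\<close>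

definition ok :: "nat => (nat => nat => (nat => 'x) \<times> real) => bool" where
 "ok j w \<longleftrightarrow> (\<forall>i\<in>{1..j}. smc_block.cc S i T (w i) <= 2)"

abbreviation okw :: "nat => (nat => nat => (nat => 'x) \<times> real) => ennreal" where
 "okw j \<equiv> indicator {w. ok j w}"

lemma ok_Suc: "ok (Suc j) (w(Suc j := c)) \<longleftrightarrow> ok j w & smc_block.cc S (Suc j) T c <= 2" by (auto simp: ok_def atLeastAtMost_Suc_insert)

lemma okw_Suc: "okw (Suc j) (w(Suc j := c)) = okw j w * indicator {c. smc_block.cc S (Suc j) T c <= 2} c"
 by (simp add: ok_Suc split: split_indicator)

lemma ok_measurable [measurable]:
 assumes "j <= n_blocks S" "K >= 1"
 shows "Measurable.pred (Om j K) (ok j)"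
proof -
 have "(%w. smc_block.cc S i T (w i)) : bm (Om j K)" if i: "i : {1..j}" for i
 proof -
  interpret smc_block S i using i assms(1) by unfold_locales auto
  show ?thesis by (rule mcomp[OF Om_component[OF assms(1) i] cc_measurable]) (use assms(2) in auto)
 qed
 then show ?thesis unfolding ok_def[abs_def] by (intro pred_intros_finite) (auto intro!: borel_measurable_le simp: pred_def)
qed

lemma emp_param_measurable:
 assumes "j <= n_blocks S" "(%(x, y). \<psi> x y) : bm (paths S {0<..st j} \<Otimes>\<^sub>M R)"
 shows "(%(w, y). emp j K w (%x. \<psi> x y)) : bm (Om j K \<Otimes>\<^sub>M R)"
proof -
 have "(%l. emp j K (fst l) (%x. \<psi> x (snd l))) : bm (Om j K \<Otimes>\<^sub>M R)"
 proof (rule emp_measurable[OF assms(1)])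
  show "(%l. fst l i) : Om j K \<Otimes>\<^sub>M R \<rightarrow>\<^sub>M cl K i" if "i : {1..j}" for i
   by (rule mcomp[OF measurable_fst Om_component[OF assms(1) that]])
  have "(%l. (snd l, snd (fst l))) : (Om j K \<Otimes>\<^sub>M R) \<Otimes>\<^sub>M paths S {0<..st j} \<rightarrow>\<^sub>M paths S {0<..st j} \<Otimes>\<^sub>M R"
   by measurable
  from mcomp[OF this assms(2)]
  show "(%(l, x). \<psi> x (snd l)) : bm ((Om j K \<Otimes>\<^sub>M R) \<Otimes>\<^sub>M paths S {0<..st j})"
   by (simp add: case_prod_beta')
 qed
 then show ?thesis by (simp add: case_prod_beta')
qed

lemma emp_measurable_Om:
 assumes "j <= n_blocks S" "phi : bm (paths S {0<..st j})"
 shows "(%w. emp j K w phi) : bm (Om j K)" using assms by (intro emp_measurable Om_component) (auto simp: case_prod_beta')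

lemma emp_Suc_wavg:
 "emp (Suc j) K (w(Suc j := c)) phi = smc_block.wavg K (%y. emp j K w (%x. phi (mrg (st j) (st j + T) x y))) c"
 if "j < n_blocks S" using that by (simp add: smc_block.wavg_def[OF block] emp_upd)

text \<open>\<open>D w\<close> is a test function that depends on the earlier filters. After the
  exchange the inner integral is a second moment under the earlier filters for a fixed block path.
  The index \<open>k\<close> is separate from \<open>n\<close> because the hypothesis involves both
  h_t and h_{t-1}.\<close>

lemma okw_swap:
 assumes j: "j < n_blocks S" and K: "K >= 1" and n: "n <= T" and k: "k <= n"
  and D: "(%(w, y). D w y) : bm (Om j K \<Otimes>\<^sub>M paths S {st j<..st j + n})"
 shows "(\<integral>\<^sup>+w. (\<integral>\<^sup>+y. ennreal (h_blk S (Suc j) (st j + k) y * (D w y)^2) \<partial>smc_block.Q S (Suc j) n) * okw j w \<partial>Om j K)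
  = (\<integral>\<^sup>+y. ennreal (h_blk S (Suc j) (st j + k) y) * (\<integral>\<^sup>+w. ennreal ((D w y)^2) * okw j w \<partial>Om j K) \<partial>smc_block.Q S (Suc j) n)"
  and "(%w. \<integral>\<^sup>+y. ennreal (h_blk S (Suc j) (st j + k) y * (D w y)^2) \<partial>smc_block.Q S (Suc j) n) : bm (Om j K)"
proof -
 interpret smc_block S "Suc j" by (rule block[OF j])
 interpret Qn: prob_space "Q n" by (rule prob_space_Q[OF n])
 interpret O: prob_space "Om j K" by (rule prob_space_Om)
 interpret pair_sigma_finite "Q n" "Om j K" ..
 have k': "k <= T" using k n by simp
 have [measurable]: "Measurable.pred (Om j K) (ok j)" by (rule ok_measurable) (use j K in auto)
 have hm[measurable]: "h k : bm (Q n)" unfolding mcs[OF sets_Q[OF n] refl] by (rule h_measurable[OF k' k])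
 have "(%z. (snd z, fst z)) : Q n \<Otimes>\<^sub>M Om j K \<rightarrow>\<^sub>M Om j K \<Otimes>\<^sub>M B n"
  unfolding mcs[OF refl sets_pair_measure_cong[OF refl sets_Q[OF n, symmetric]]] by measurable
 from mcomp[OF this D] have D3[measurable]: "(%z. D (snd z) (fst z)) : bm (Q n \<Otimes>\<^sub>M Om j K)" by simp
 have D4: "(%w. D w y) : bm (Om j K)" if "y : space (Q n)" for y using mcomp[OF measurable_Pair1'[OF that] D3] by simp
 have D2: "D w : bm (Q n)" if "w : space (Om j K)" for w using mcomp[OF measurable_Pair2'[OF that] D3] by simp
 show "(%w. \<integral>\<^sup>+y. ennreal (h k y * (D w y)^2) \<partial>Q n) : bm (Om j K)"
 proof (rule Qn.borel_measurable_nn_integral)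
  have "(%z. D (fst z) (snd z)) : bm (Om j K \<Otimes>\<^sub>M Q n)"
   using D unfolding mcs[OF sets_pair_measure_cong[OF refl sets_Q[OF n, symmetric]] refl] by (simp add: case_prod_beta')
  then show "(%(w, y). ennreal (h k y * (D w y)^2)) : bm (Om j K \<Otimes>\<^sub>M Q n)" unfolding case_prod_beta'
   by (intro mcomp[OF _ measurable_ennreal] borel_measurable_times borel_measurable_power mcomp[OF measurable_snd hm])
 qed
 have h0: "0 < h k y" if "y : space (Q n)" for y using that by (intro h_pos[OF k' k]) (simp add: space_Q[OF n])
 have "(\<integral>\<^sup>+w. (\<integral>\<^sup>+y. ennreal (h k y * (D w y)^2) \<partial>Q n) * okw j w \<partial>Om j K)
  = (\<integral>\<^sup>+w. \<integral>\<^sup>+y. ennreal (h k y) * (ennreal ((D w y)^2) * okw j w) \<partial>Q n \<partial>Om j K)"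
 proof (intro nn_integral_cong)
  fix w assume w: "w : space (Om j K)"
  note [measurable] = D2[OF w]
  have "(\<integral>\<^sup>+y. ennreal (h k y) * (ennreal ((D w y)^2) * okw j w) \<partial>Q n) = (\<integral>\<^sup>+y. ennreal (h k y * (D w y)^2) * okw j w \<partial>Q n)"
   using h0 by (intro nn_integral_cong) (simp add: ennreal_mult' mult_ac less_imp_le)
  also have "... = (\<integral>\<^sup>+y. ennreal (h k y * (D w y)^2) \<partial>Q n) * okw j w" by (rule nn_integral_multc) measurable
  finally show "(\<integral>\<^sup>+y. ennreal (h k y * (D w y)^2) \<partial>Q n) * okw j w = (\<integral>\<^sup>+y. ennreal (h k y) * (ennreal ((D w y)^2) * okw j w) \<partial>Q n)" ..
 qed
 also have "... = (\<integral>\<^sup>+y. \<integral>\<^sup>+w. ennreal (h k y) * (ennreal ((D w y)^2) * okw j w) \<partial>Om j K \<partial>Q n)"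
  by (rule Fubini') (simp add: case_prod_beta')
 also have "... = (\<integral>\<^sup>+y. ennreal (h k y) * (\<integral>\<^sup>+w. ennreal ((D w y)^2) * okw j w \<partial>Om j K) \<partial>Q n)"
 proof (intro nn_integral_cong)
  fix y assume y: "y : space (Q n)"
  note [measurable] = D4[OF y]
  show "(\<integral>\<^sup>+w. ennreal (h k y) * (ennreal ((D w y)^2) * okw j w) \<partial>Om j K) = ennreal (h k y) * (\<integral>\<^sup>+w. ennreal ((D w y)^2) * okw j w \<partial>Om j K)"
   by (rule nn_integral_cmult) measurable
 qed
 finally show "(\<integral>\<^sup>+w. (\<integral>\<^sup>+y. ennreal (h k y * (D w y)^2) \<partial>Q n) * okw j w \<partial>Om j K)
  = (\<integral>\<^sup>+y. ennreal (h k y) * (\<integral>\<^sup>+w. ennreal ((D w y)^2) * okw j w \<partial>Om j K) \<partial>Q n)" .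
qed

text \<open>\<open>truncated_second_moment\<close> for the last filter, applied conditionally on the
  earlier ones, followed by \<open>okw_swap\<close>.\<close>

lemma step_bound:
 assumes j: "j < n_blocks S" and K: "K >= 1"
  and D: "(%(w, y). D w y) : bm (Om j K \<Otimes>\<^sub>M paths S {st j<..st j + T})"
 shows "(\<integral>\<^sup>+w. (\<integral>\<^sup>+c. ennreal ((smc_block.wavg K (D w) c)^2) * indicator {c. smc_block.cc S (Suc j) T c <= 2} c \<partial>fl K (Suc j)) * okw j w \<partial>Om j K)
  <= 2 * (\<integral>\<^sup>+y. ennreal (h_blk S (Suc j) (st j + T) y) * (\<integral>\<^sup>+w. ennreal ((D w y)^2) * okw j w \<partial>Om j K) \<partial>smc_block.Q S (Suc j) T)"
proof -
 interpret smc_block S "Suc j" by (rule block[OF j])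
 let ?T = "T"
 have [measurable]: "Measurable.pred (Om j K) (ok j)" by (rule ok_measurable) (use j K in auto)
 note [measurable] = okw_swap(2)[OF j K order_refl order_refl D]
 have D1: "D w : bm (B ?T)" if "w : space (Om j K)" for w using mcomp[OF measurable_Pair1'[OF that] D] by simp
 have "(\<integral>\<^sup>+w. (\<integral>\<^sup>+c. ennreal ((wavg K (D w) c)^2) * indicator {c. cc ?T c <= 2} c \<partial>fl K (Suc j)) * okw j w \<partial>Om j K)
  <= (\<integral>\<^sup>+w. 2 * ((\<integral>\<^sup>+x. ennreal (h ?T x * (D w x)^2) \<partial>Q ?T) * okw j w) \<partial>Om j K)"
  unfolding fl_Suc[OF j] mult.assoc[symmetric] by (intro nn_integral_mono mult_right_mono truncated_second_moment order_refl K D1) simp_all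
 also have "... = 2 * (\<integral>\<^sup>+w. (\<integral>\<^sup>+x. ennreal (h ?T x * (D w x)^2) \<partial>Q ?T) * okw j w \<partial>Om j K)"
  by (rule nn_integral_cmult) measurable
 finally show ?thesis unfolding okw_swap(1)[OF j K order_refl order_refl D] .
qed

text \<open>Integrating the block variable last lets the bounds for the first \<open>j\<close> blocks be used pointwise.\<close>
lemma nn_integral_marg_swap:
 assumes j: "j < n_blocks S" and n: "n <= T" and k: "k <= n" and phi: "phi : bm (paths S {0<..st j + n})"
 shows "(\<integral>\<^sup>+y. ennreal (h_blk S (Suc j) (st j + k) y) * (\<integral>\<^sup>+x. ennreal (h_fun S (st j) x * (phi (mrg (st j) (st j + n) x y))^2) \<partial>marg (st j)) \<partial>smc_block.Q S (Suc j) n)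
  = (\<integral>\<^sup>+x. ennreal (h_fun S (st j + k) x * (phi x)^2) \<partial>marg (st j + n))"
proof -
 interpret smc_block S "Suc j" by (rule block[OF j])
 have an: "a + n <= horizon S" "a + k <= horizon S" "a <= horizon S" and k': "k <= T" using n k a_n_le[of n] by auto
 interpret Qn: prob_space "Q n" by (rule prob_space_Q[OF n])
 interpret mg: prob_space "marg a" by (rule prob_space_marg[OF an(3)])
 interpret pair_sigma_finite "marg a" "Q n" ..
 have hm[measurable]: "h k : bm (Q n)" using n k by (simp cong: mcs add: sets_Q)
 have Hm[measurable]: "h_fun S a : bm (marg a)" using h_fun_measurable[OF an(3)] by (simp cong: mcs add: sets_marg[OF an(3)])
 have "(%z. mrg a (a + n) (fst z) (snd z)) : marg a \<Otimes>\<^sub>M Q n \<rightarrow>\<^sub>M paths S {0<..a + n}"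
  using measurable_mrg[of a "a + n" S] n by (simp cong: mcs sets_pair_measure_cong add: sets_Q sets_marg[OF an(3)] case_prod_beta')
 from mcomp[OF this phi] have phi2[measurable]: "(%z. phi (mrg a (a + n) (fst z) (snd z))) : bm (marg a \<Otimes>\<^sub>M Q n)" .
 have phi3: "(%x. phi (mrg a (a + n) x y)) : bm (marg a)" if "y : space (Q n)" for y
  using mcomp[OF measurable_Pair2'[OF that] phi2] by simp
 have Hm2: "h_fun S (a + k) : bm (paths S {0<..a + n})"
 proof -
  have "h_fun S (a + k) x = h_fun S (a + k) (restrict x {0<..a + k})" for x by (simp add: h_fun_def prod_weight_restrict)
  moreover have "(%x. h_fun S (a + k) (restrict x {0<..a + k})) : bm (paths S {0<..a + n})"
   by (rule mcomp[OF measurable_paths_restrict h_fun_measurable[OF an(2)]]) (use k in auto)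
  ultimately show ?thesis by simp
 qed
 have "(\<integral>\<^sup>+x. ennreal (h_fun S (a + k) x * (phi x)^2) \<partial>marg (a + n))
  = (\<integral>\<^sup>+x. \<integral>\<^sup>+y. ennreal (h_fun S (a + k) (mrg a (a + n) x y) * (phi (mrg a (a + n) x y))^2) \<partial>Q n \<partial>marg a)"
  by (rule nn_integral_marg_block[OF n]) (intro mcomp[OF _ measurable_ennreal] borel_measurable_times borel_measurable_power phi Hm2)
 also have "... = (\<integral>\<^sup>+x. \<integral>\<^sup>+y. ennreal (h k y) * ennreal (h_fun S a x * (phi (mrg a (a + n) x y))^2) \<partial>Q n \<partial>marg a)"
 proof (intro nn_integral_cong)
  fix x y assume x: "x : space (marg a)" and y: "y : space (Q n)"
  have "h_fun S (a + k) (mrg a (a + n) x y) = h_fun S (a + k) (restrict (mrg a (a + n) x y) {0<..a + k})"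
   by (simp add: h_fun_def prod_weight_restrict)
  also have "restrict (mrg a (a + n) x y) {0<..a + k} = mrg a (a + k) (restrict x {0<..a + k}) (restrict y {a<..a + k})"
   by (rule mrg_restrict) (use k in simp)
  also have "h_fun S (a + k) ... = h_fun S a (restrict x {0<..a + k}) * h k (restrict y {a<..a + k})" by (rule h_fun_mrg[OF j k'])
  also have "... = h_fun S a x * h k y" by (simp add: h_restrict[OF k'] h_fun_def prod_weight_restrict)
  finally have e: "h_fun S (a + k) (mrg a (a + n) x y) = h_fun S a x * h k y" .
  have "0 < h k y" using y n k by (intro h_pos[OF k' k]) (simp add: space_Q)
  then show "ennreal (h_fun S (a + k) (mrg a (a + n) x y) * (phi (mrg a (a + n) x y))^2) = ennreal (h k y) * ennreal (h_fun S a x * (phi (mrg a (a + n) x y))^2)"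
   unfolding e by (simp add: ennreal_mult'[symmetric] mult_ac)
 qed
 also have "... = (\<integral>\<^sup>+y. \<integral>\<^sup>+x. ennreal (h k y) * ennreal (h_fun S a x * (phi (mrg a (a + n) x y))^2) \<partial>marg a \<partial>Q n)"
  by (rule Fubini'[symmetric]) (simp add: case_prod_beta')
 also have "... = (\<integral>\<^sup>+y. ennreal (h k y) * (\<integral>\<^sup>+x. ennreal (h_fun S a x * (phi (mrg a (a + n) x y))^2) \<partial>marg a) \<partial>Q n)"
 proof (intro nn_integral_cong)
  fix y assume "y : space (Q n)"
  note [measurable] = phi3[OF this]
  show "(\<integral>\<^sup>+x. ennreal (h k y) * ennreal (h_fun S a x * (phi (mrg a (a + n) x y))^2) \<partial>marg a) = ennreal (h k y) * (\<integral>\<^sup>+x. ennreal (h_fun S a x * (phi (mrg a (a + n) x y))^2) \<partial>marg a)"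
   by (rule nn_integral_cmult) measurable
 qed
 finally show ?thesis ..
qed

end

section \<open>Mean-square consistency of averages over joined paths\<close>

lemma not_less_top: "\<not> x < \<infinity> ==> x = \<top>" for x :: ennreal by (cases x) auto

context smc_model begin

text \<open>Each filter contributes one factor 2 from \<open>step_bound\<close>, and h factors over
  the blocks, so that \<open>nn_integral_marg_swap\<close> reassembles the weighted second moment.
  With values in \<open>ennreal\<close> the bound also makes sense when the right-hand side is
  infinite.\<close>

lemma emp_second_moment:
 assumes "j <= n_blocks S" and K: "K >= 1" and "phi : bm (paths S {0<..st j})"
 shows "(\<integral>\<^sup>+w. ennreal ((emp j K w phi)^2) * okw j w \<partial>Om j K) <= 2 ^ j * (\<integral>\<^sup>+x. ennreal (h_fun S (st j) x * (phi x)^2) \<partial>marg (st j))"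
 using assms(1,3)
proof (induction j arbitrary: phi)
 case 0
 interpret prob_space "Om 0 K" by (rule prob_space_Om)
 have "marg (st 0) = return (paths S {0<..0}) (%_. undefined)" by (simp add: marg_def)
 moreover have "(\<integral>\<^sup>+x. ennreal (h_fun S (st 0) x * (phi x)^2) \<partial>return (paths S {0<..0}) (%_. undefined)) = ennreal ((phi (%_. undefined))^2)"
  using 0 by (subst nn_integral_return) (auto simp: space_paths_empty)
 ultimately show ?case by (simp add: ok_def emeasure_space_1)
next
 case (Suc j)
 then have j: "j < n_blocks S" and j': "j <= n_blocks S" by auto
 interpret smc_block S "Suc j" by (rule block[OF j])
 let ?T = "T" and ?mr = "mrg (st j) (st j + T)"
 let ?D = "%w y. emp j K w (%x. phi (?mr x y))"
 have phi: "phi : bm (paths S {0<..a + ?T})" using Suc.prems(2) by (simp add: st_Suc)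
 have Dm: "(%(w, y). ?D w y) : bm (Om j K \<Otimes>\<^sub>M B ?T)"
  using mcomp[OF measurable_mrg[of a "a + ?T" S] phi] by (intro emp_param_measurable[OF j']) (simp add: case_prod_beta')
 have m: "(%w. ennreal ((emp (Suc j) K w phi)^2) * okw (Suc j) w) : bm (Om (Suc j) K)"
 proof -
  note [measurable] = emp_measurable_Om[OF Suc.prems] ok_measurable[OF Suc.prems(1) K]
  show ?thesis by measurable
 qed
 have "(\<integral>\<^sup>+w. ennreal ((emp (Suc j) K w phi)^2) * okw (Suc j) w \<partial>Om (Suc j) K)
  = (\<integral>\<^sup>+w. (\<integral>\<^sup>+c. ennreal ((wavg K (?D w) c)^2) * indicator {c. cc ?T c <= 2} c \<partial>fl K (Suc j)) * okw j w \<partial>Om j K)"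
  unfolding nn_integral_Om_Suc[OF m] okw_Suc emp_Suc_wavg[OF j] by (intro nn_integral_cong) (auto split: split_indicator)
 also have "... <= 2 * (\<integral>\<^sup>+y. ennreal (h ?T y) * (\<integral>\<^sup>+w. ennreal ((?D w y)^2) * okw j w \<partial>Om j K) \<partial>Q ?T)"
  by (rule step_bound[OF j K Dm])
 also have "... <= 2 * (\<integral>\<^sup>+y. 2 ^ j * (ennreal (h ?T y) * (\<integral>\<^sup>+x. ennreal (h_fun S a x * (phi (?mr x y))^2) \<partial>marg a)) \<partial>Q ?T)"
 proof (intro mult_left_mono nn_integral_mono)
  fix y assume y: "y : space (Q ?T)"
  have "(%x. phi (?mr x y)) : bm (paths S {0<..a})"
   by (rule mcomp[OF _ phi]) (intro measurable_mrg' measurable_ident_sets refl measurable_const, use y in \<open>auto simp: space_Q\<close>)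
  from mult_left_mono[OF Suc.IH[OF j' this], of "ennreal (h ?T y)"]
  show "ennreal (h ?T y) * (\<integral>\<^sup>+w. ennreal ((?D w y)^2) * okw j w \<partial>Om j K) <= 2 ^ j * (ennreal (h ?T y) * (\<integral>\<^sup>+x. ennreal (h_fun S a x * (phi (?mr x y))^2) \<partial>marg a))"
   by (simp add: mult_ac)
 qed simp
 also have "... = 2 ^ Suc j * (\<integral>\<^sup>+x. ennreal (h_fun S (a + ?T) x * (phi x)^2) \<partial>marg (a + ?T))"
 proof -
  have mm: "(%y. ennreal (h ?T y) * (\<integral>\<^sup>+x. ennreal (h_fun S a x * (phi (?mr x y))^2) \<partial>marg a)) : bm (Q ?T)"
  proof -
   have a0: "a <= horizon S" using a_n_le[of 0] by simp
   interpret mg: prob_space "marg a" by (rule prob_space_marg[OF a0])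
   have [measurable]: "h ?T : bm (Q ?T)" by (simp cong: mcs add: sets_Q)
   have [measurable]: "h_fun S a : bm (marg a)" using h_fun_measurable[OF a0] by (simp cong: mcs add: sets_marg[OF a0])
   have "(%z. ?mr (snd z) (fst z)) : Q ?T \<Otimes>\<^sub>M marg a \<rightarrow>\<^sub>M paths S {0<..a + ?T}"
    by (simp cong: mcs sets_pair_measure_cong add: sets_Q sets_marg[OF a0] measurable_mrg')
   from mcomp[OF this phi] have [measurable]: "(%z. phi (?mr (snd z) (fst z))) : bm (Q ?T \<Otimes>\<^sub>M marg a)" .
   show ?thesis by measurable
  qed
  show ?thesis using nn_integral_marg_swap[OF j order_refl order_refl phi] by (simp add: nn_integral_cmult[OF mm] mult_ac)
 qed
 finally show ?case by (simp add: st_Suc)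
qed

text \<open>Weighted Jensen inequality in the past variable for each fixed block path. Where the
  inner integral is infinite there is nothing to prove, because \<open>h\<close> is
  positive.\<close>

lemma weighted_section:
 assumes j: "j < n_blocks S" and n: "n <= T" and k: "k <= n" and phi: "phi : bm (paths S {0<..st j + n})"
 shows "(\<integral>\<^sup>+y. ennreal (h_blk S (Suc j) (st j + k) y * (LINT x|marg (st j). phi (mrg (st j) (st j + n) x y))^2) \<partial>smc_block.Q S (Suc j) n)
  <= (\<integral>\<^sup>+x. ennreal (h_fun S (st j + k) x * (phi x)^2) \<partial>marg (st j + n))"
 unfolding nn_integral_marg_swap[OF assms, symmetric]
proof (rule nn_integral_mono)
 interpret smc_block S "Suc j" by (rule block[OF j])
 fix y assume "y : space (Q n)"
 then have y: "y : space (B n)" by (simp add: space_Q[OF n])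
 have hp: "0 < h k y" using n k y by (intro h_pos[of _ n]) auto
 let ?N = "\<integral>\<^sup>+x. ennreal (h_fun S a x * (phi (mrg a (a + n) x y))^2) \<partial>marg a"
 show "ennreal (h k y * (LINT x|marg a. phi (mrg a (a + n) x y))^2) <= ennreal (h k y) * ?N"
 proof (cases "?N < \<infinity>")
  case True
  have m: "(%x. phi (mrg a (a + n) x y)) : bm (paths S {0<..a})"
   by (rule mcomp[OF _ phi]) (intro measurable_mrg' measurable_ident_sets refl measurable_const y, simp)
  from mult_left_mono[OF weighted_square(2)[OF a_le m True], of "ennreal (h k y)"]
  show ?thesis using hp by (simp add: ennreal_mult' less_imp_le)
 next
  case False
  then have e: "?N = \<top>" by (rule not_less_top)
  show ?thesis using hp unfolding e by (simp add: ennreal_mult_top)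
 qed
qed

text \<open>Mean-square convergence on the event \<open>ok\<close>. Writing \<open>Suc K\<close>
  keeps the number of particles positive, as required by \<open>cc\<close>, which reads particle
  1.\<close>

definition consistent :: "nat => bool" where
 "consistent j \<longleftrightarrow> (\<forall>phi. phi : bm (paths S {0<..st j}) -->
  (\<integral>\<^sup>+x. ennreal (h_fun S (st j) x * (phi x)^2) \<partial>marg (st j)) < \<infinity> -->
  (%K. \<integral>\<^sup>+w. ennreal ((emp j (Suc K) w phi - (LINT x|marg (st j). phi x))^2) * okw j w \<partial>Om j (Suc K)) \<longlonglongrightarrow> 0)"

text \<open>For each \<open>y\<close> with finite weighted second moment, \<open>consistent\<close>
  gives convergence. \<open>emp_second_moment\<close> and the weighted Jensen inequality bound the
  error by \<open>2 * 2 ^ j + 2\<close> times that moment, which is the dominating function for the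
  integral over \<open>y\<close>.\<close>

lemma consistent_param:
 assumes j: "j <= n_blocks S" and cons: "consistent j" and R: "prob_space R"
  and \<psi>: "(%(x, y). \<psi> x y) : bm (paths S {0<..st j} \<Otimes>\<^sub>M R)"
  and hh[measurable]: "hh : bm R"
  and fin: "(\<integral>\<^sup>+y. ennreal (hh y) * (\<integral>\<^sup>+x. ennreal (h_fun S (st j) x * (\<psi> x y)^2) \<partial>marg (st j)) \<partial>R) < \<infinity>"
 shows "(%K. \<integral>\<^sup>+y. ennreal (hh y) * (\<integral>\<^sup>+w. ennreal ((emp j (Suc K) w (%x. \<psi> x y) - (LINT x|marg (st j). \<psi> x y))^2) * okw j w \<partial>Om j (Suc K)) \<partial>R) \<longlonglongrightarrow> 0"
proof -
 interpret R: prob_space R by (rule R)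
 have t: "st j <= horizon S" by (rule st_le[OF j])
 interpret mg: prob_space "marg (st j)" by (rule prob_space_marg[OF t])
 define N where "N y = (\<integral>\<^sup>+x. ennreal (h_fun S (st j) x * (\<psi> x y)^2) \<partial>marg (st j))" for y
 define b where "b y = (LINT x|marg (st j). \<psi> x y)" for y
 define e where "e K y = (\<integral>\<^sup>+w. ennreal ((emp j (Suc K) w (%x. \<psi> x y) - b y)^2) * okw j w \<partial>Om j (Suc K))" for K y
 have Hm[measurable]: "h_fun S (st j) : bm (marg (st j))"
  using h_fun_measurable[OF t] by (simp cong: mcs add: sets_marg[OF t])
 have "(%z. (snd z, fst z)) : R \<Otimes>\<^sub>M marg (st j) \<rightarrow>\<^sub>M paths S {0<..st j} \<Otimes>\<^sub>M R"
  by (simp cong: mcs sets_pair_measure_cong add: sets_marg[OF t])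
 from mcomp[OF this \<psi>] have \<psi>2[measurable]: "(%z. \<psi> (snd z) (fst z)) : bm (R \<Otimes>\<^sub>M marg (st j))" by simp
 have \<psi>y: "(%x. \<psi> x y) : bm (paths S {0<..st j})" if "y : space R" for y
  using mcomp[OF measurable_Pair2'[OF that] \<psi>] by simp
 have Nm[measurable]: "N : bm R" unfolding N_def by measurable
 have bm[measurable]: "b : bm R" unfolding b_def by measurable
 have em[measurable]: "e K : bm R" for K
 proof -
  interpret O: prob_space "Om j (Suc K)" by (rule prob_space_Om)
  note [measurable] = ok_measurable[OF j, of "Suc K", simplified]
  have "(%z. (snd z, fst z)) : R \<Otimes>\<^sub>M Om j (Suc K) \<rightarrow>\<^sub>M Om j (Suc K) \<Otimes>\<^sub>M R" by measurable
  from mcomp[OF this emp_param_measurable[OF j \<psi>]]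
  have [measurable]: "(%z. emp j (Suc K) (snd z) (%x. \<psi> x (fst z))) : bm (R \<Otimes>\<^sub>M Om j (Suc K))" by simp
  have [measurable]: "Measurable.pred (Om j (Suc K)) (ok j)" by (rule ok_measurable[OF j]) simp
  show ?thesis unfolding e_def by measurable
 qed
 have le: "e K y <= ennreal (2 * 2 ^ j + 2) * N y" if y: "y : space R" for K y
 proof (cases "N y < \<infinity>")
  case True
  interpret O: prob_space "Om j (Suc K)" by (rule prob_space_Om)
  have [measurable]: "Measurable.pred (Om j (Suc K)) (ok j)" by (rule ok_measurable[OF j]) simp
  note [measurable] = emp_measurable_Om[OF j \<psi>y[OF y], of "Suc K"]
  have "e K y <= (\<integral>\<^sup>+w. 2 * (ennreal ((emp j (Suc K) w (%x. \<psi> x y))^2) * okw j w) + ennreal (2 * (b y)^2) \<partial>Om j (Suc K))"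
   unfolding e_def
  proof (rule nn_integral_mono)
   fix w
   have "ennreal ((emp j (Suc K) w (%x. \<psi> x y) - b y)^2) <= ennreal (2 * (emp j (Suc K) w (%x. \<psi> x y))^2 + 2 * (b y)^2)"
    by (rule ennreal_leI[OF square_diff_le])
   then show "ennreal ((emp j (Suc K) w (%x. \<psi> x y) - b y)^2) * okw j w <= 2 * (ennreal ((emp j (Suc K) w (%x. \<psi> x y))^2) * okw j w) + ennreal (2 * (b y)^2)"
    by (auto simp: ennreal_mult' split: split_indicator)
  qed
  also have "... = 2 * (\<integral>\<^sup>+w. ennreal ((emp j (Suc K) w (%x. \<psi> x y))^2) * okw j w \<partial>Om j (Suc K)) + 2 * ennreal ((b y)^2)"
   by (simp add: nn_integral_add nn_integral_cmult O.emeasure_space_1 ennreal_mult')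
  also have "... <= 2 * (2 ^ j * N y) + 2 * N y"
  proof (intro add_mono mult_left_mono)
   show "(\<integral>\<^sup>+w. ennreal ((emp j (Suc K) w (%x. \<psi> x y))^2) * okw j w \<partial>Om j (Suc K)) <= 2 ^ j * N y"
    unfolding N_def by (rule emp_second_moment[OF j _ \<psi>y[OF y]]) simp
   show "ennreal ((b y)^2) <= N y" unfolding N_def b_def by (rule weighted_square(2)[OF t \<psi>y[OF y]]) (use True in \<open>simp add: N_def\<close>)
  qed simp_all
  also have "... = ennreal (2 * 2 ^ j + 2) * N y" by (simp add: distrib_right ennreal_mult' mult.assoc ennreal_power[symmetric])
  finally show ?thesis .
 next
  case False
  then have "N y = \<top>" by (rule not_less_top)
  then show ?thesis by (simp add: ennreal_mult_top add_pos_nonneg)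
 qed
 have "(%K. \<integral>\<^sup>+y. ennreal (hh y) * e K y \<partial>R) \<longlonglongrightarrow> (\<integral>\<^sup>+y. 0 \<partial>R)"
 proof (rule nn_integral_dominated_convergence)
  show "AE y in R. ennreal (hh y) * e K y <= ennreal (2 * 2 ^ j + 2) * (ennreal (hh y) * N y)" for K
   by (rule AE_I2, subst mult.left_commute, rule mult_left_mono[OF le]) auto
  have "(\<integral>\<^sup>+y. ennreal (2 * 2 ^ j + 2) * (ennreal (hh y) * N y) \<partial>R) = ennreal (2 * 2 ^ j + 2) * (\<integral>\<^sup>+y. ennreal (hh y) * N y \<partial>R)"
   by (rule nn_integral_cmult) measurable
  then show "(\<integral>\<^sup>+y. ennreal (2 * 2 ^ j + 2) * (ennreal (hh y) * N y) \<partial>R) < \<infinity>"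
   using fin by (simp add: N_def ennreal_mult_less_top)
  have "AE y in R. ennreal (hh y) * N y ~= \<infinity>" using fin by (intro nn_integral_noteq_infinite) (auto simp: N_def)
  then show "AE y in R. (%K. ennreal (hh y) * e K y) \<longlonglongrightarrow> 0" using AE_space
  proof eventually_elim
   case (elim y)
   show ?case
   proof (cases "ennreal (hh y) = 0")
    case False
    then have "N y < \<infinity>" using elim(1) by (auto simp: ennreal_mult_eq_top_iff less_top)
    then have "(%K. e K y) \<longlonglongrightarrow> 0"
     using cons[unfolded consistent_def, rule_format, OF \<psi>y[OF elim(2)]] by (simp add: e_def b_def N_def)
    from ennreal_tendsto_cmult[OF _ this, of "ennreal (hh y)"] show ?thesis by simp
   qed simp
  qed
 qed measurable
 then show ?thesis by (simp add: e_def b_def)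
qed

text \<open>For fixed earlier filters the error is the weighted average over the new filter of two
  functions of the block path: \<open>D\<close>, the error of the earlier filters with the block
  path as parameter, and the centred function \<open>b\<close> averaged over the past. The first is
  handled by \<open>step_bound\<close> and \<open>consistent_param\<close>, the second by
  \<open>wavg_mean_square\<close>.\<close>

lemma consistent: "j <= n_blocks S ==> consistent j"
proof (induction j)
 case 0
 have "marg (st 0) = return (paths S {0<..0}) (%_. undefined)" by (simp add: marg_def)
 moreover have "(LINT x|return (paths S {0<..0}) (%_. undefined). phi x) = phi (%_. undefined)"
  if "phi : bm (paths S {0<..st 0})" for phi :: "_ => real" using that by (subst integral_return) (auto simp: space_paths_empty)
 ultimately show ?case by (simp add: consistent_def)
next
 case (Suc j)
 then have j: "j < n_blocks S" and j': "j <= n_blocks S" and IH: "consistent j" by auto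
 interpret smc_block S "Suc j" by (rule block[OF j])
 let ?T = "T" and ?mr = "mrg (st j) (st j + T)"
 have a0: "a <= horizon S" using a_n_le[of 0] by simp
 have aT: "a + ?T <= horizon S" by (rule a_T_le)
 interpret mg: prob_space "marg a" by (rule prob_space_marg[OF a0])
 interpret QT: prob_space "Q ?T" by (rule prob_space_Q) simp
 interpret pq: pair_prob_space "marg a" "Q ?T" ..
 show ?case unfolding consistent_def
 proof (intro allI impI)
  fix phi :: "(nat => 'x) => real"
  assume "phi : bm (paths S {0<..st (Suc j)})"
   and "(\<integral>\<^sup>+x. ennreal (h_fun S (st (Suc j)) x * (phi x)^2) \<partial>marg (st (Suc j))) < \<infinity>"
  then have phi: "phi : bm (paths S {0<..a + ?T})"
   and fin: "(\<integral>\<^sup>+x. ennreal (h_fun S (a + ?T) x * (phi x)^2) \<partial>marg (a + ?T)) < \<infinity>" by (simp_all add: st_Suc)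
  have \<psi>: "(%(x, y). phi (?mr x y)) : bm (paths S {0<..st j} \<Otimes>\<^sub>M B ?T)"
   using mcomp[OF measurable_mrg[of a "a + ?T" S] phi] by (simp add: case_prod_beta')
  then have \<psi>Q: "(%(x, y). phi (?mr x y)) : bm (paths S {0<..st j} \<Otimes>\<^sub>M Q ?T)"
   by (simp cong: mcs sets_pair_measure_cong add: sets_Q)
  have \<psi>y: "(%x. phi (?mr x y)) : bm (paths S {0<..a})" if "y : space (Q ?T)" for y
   using mcomp[OF measurable_Pair2'[OF that] \<psi>Q] by simp
  define b where "b y = (LINT x|marg a. phi (?mr x y))" for y
  have hQ[measurable]: "h ?T : bm (Q ?T)" by (simp cong: mcs add: sets_Q)
  have fin2: "(\<integral>\<^sup>+y. ennreal (h ?T y) * (\<integral>\<^sup>+x. ennreal (h_fun S a x * (phi (?mr x y))^2) \<partial>marg a) \<partial>Q ?T) < \<infinity>"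
   using fin unfolding nn_integral_marg_swap[OF j order_refl order_refl phi] .
  have bm: "b : bm (B ?T)"
  proof -
   have "(%z. ?mr (snd z) (fst z)) : B ?T \<Otimes>\<^sub>M marg a \<rightarrow>\<^sub>M paths S {0<..a + ?T}"
    by (simp cong: mcs sets_pair_measure_cong add: sets_marg[OF a0] measurable_mrg')
   from mcomp[OF this phi] have [measurable]: "(%z. phi (?mr (snd z) (fst z))) : bm (B ?T \<Otimes>\<^sub>M marg a)" .
   show ?thesis unfolding b_def by measurable
  qed
  then have bQ[measurable]: "b : bm (Q ?T)" by (simp cong: mcs add: sets_Q)
  have bsq: "integrable (Q ?T) (%y. h ?T y * (b y)^2)"
  proof (rule integrableI_nonneg)
   have hp: "0 < h ?T y" if "y : space (Q ?T)" for y using that by (intro h_pos[of _ ?T]) (auto simp: space_Q)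
   show "AE y in Q ?T. 0 <= h ?T y * (b y)^2" by (intro AE_I2 mult_nonneg_nonneg less_imp_le[OF hp] zero_le_power2)
   show "(\<integral>\<^sup>+y. ennreal (h ?T y * (b y)^2) \<partial>Q ?T) < \<infinity>"
    unfolding b_def by (rule order.strict_trans1[OF weighted_section[OF j order_refl order_refl phi] fin])
  qed measurable
  have Qb: "(LINT y|Q ?T. b y) = (LINT x|marg (a + ?T). phi x)"
  proof -
   have i: "integrable (marg (a + ?T)) phi" by (rule weighted_square(1)[OF aT phi fin])
   note f = mrg_pair_measurable[OF order_refl] and d = marg_eq_distr[OF order_refl]
   have i2: "integrable (marg a \<Otimes>\<^sub>M Q ?T) (%(x, y). phi (?mr x y))"
    using i unfolding d by (subst (asm) integrable_distr_eq[OF f phi]) (simp add: case_prod_beta')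
   have "(LINT y|Q ?T. b y) = (LINT z|(marg a \<Otimes>\<^sub>M Q ?T). (case z of (x, y) => phi (?mr x y)))"
    unfolding b_def using pq.integral_snd[of "%x y. phi (?mr x y)"] i2 by simp
   also have "... = (LINT x|marg (a + ?T). phi x)" unfolding d by (subst integral_distr[OF f phi]) (simp add: case_prod_beta')
   finally show ?thesis .
  qed
  define c0 where "c0 = (LINT x|marg (a + ?T). phi x)"
  define D where "D K w y = emp j (Suc K) w (%x. phi (?mr x y)) - b y" for K w y
  define r1 where "r1 K = (\<integral>\<^sup>+y. ennreal (h ?T y) * (\<integral>\<^sup>+w. ennreal ((D K w y)^2) * okw j w \<partial>Om j (Suc K)) \<partial>Q ?T)" for K
  define r2 where "r2 K = (\<integral>\<^sup>+c. ennreal ((wavg (Suc K) b c - c0)^2) * indicator {c. cc ?T c <= 2} c \<partial>law ?T (Suc K))" for K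
  have r1: "r1 \<longlonglongrightarrow> 0" unfolding r1_def D_def b_def by (rule consistent_param[OF j' IH QT.prob_space_axioms \<psi>Q hQ fin2])
  have r2: "r2 \<longlonglongrightarrow> 0" unfolding r2_def c0_def Qb[symmetric] using LIMSEQ_Suc[OF wavg_mean_square[OF order_refl bm bsq]] .
  have le: "(\<integral>\<^sup>+w. ennreal ((emp (Suc j) (Suc K) w phi - c0)^2) * okw (Suc j) w \<partial>Om (Suc j) (Suc K)) <= 2 * (2 * r1 K) + 2 * r2 K" for K
  proof -
   interpret O: prob_space "Om j (Suc K)" by (rule prob_space_Om)
   have Dm: "(%(w, y). D K w y) : bm (Om j (Suc K) \<Otimes>\<^sub>M B ?T)"
    unfolding D_def case_prod_beta' using emp_param_measurable[OF j' \<psi>, of "Suc K"] bm by (simp add: case_prod_beta')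
   have D1: "D K w : bm (B ?T)" if "w : space (Om j (Suc K))" for w using mcomp[OF measurable_Pair1'[OF that] Dm] by simp
   have m: "(%w. ennreal ((emp (Suc j) (Suc K) w phi - c0)^2) * okw (Suc j) w) : bm (Om (Suc j) (Suc K))"
   proof -
    have [measurable]: "(%w. emp (Suc j) (Suc K) w phi) : bm (Om (Suc j) (Suc K))"
     by (rule emp_measurable_Om[OF Suc.prems]) (use phi in \<open>simp add: st_Suc\<close>)
    have [measurable]: "Measurable.pred (Om (Suc j) (Suc K)) (ok (Suc j))" by (rule ok_measurable[OF Suc.prems]) simp
    show ?thesis by measurable
   qed
   have okm[measurable]: "Measurable.pred (Om j (Suc K)) (ok j)" by (rule ok_measurable[OF j']) simp
   have ccm: "cc ?T : bm (law ?T (Suc K))" using cc_measurable[of ?T ?T "Suc K"] by (simp cong: mcs add: sets_law)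
   have "(\<integral>\<^sup>+w. ennreal ((emp (Suc j) (Suc K) w phi - c0)^2) * okw (Suc j) w \<partial>Om (Suc j) (Suc K))
    = (\<integral>\<^sup>+w. \<integral>\<^sup>+c. ennreal ((emp (Suc j) (Suc K) (w(Suc j := c)) phi - c0)^2) * (okw j w * indicator {c. cc ?T c <= 2} c) \<partial>law ?T (Suc K) \<partial>Om j (Suc K))"
    unfolding nn_integral_Om_Suc[OF m] okw_Suc fl_Suc[OF j] ..
   also have "... <= (\<integral>\<^sup>+w. 2 * ((\<integral>\<^sup>+c. ennreal ((wavg (Suc K) (D K w) c)^2) * indicator {c. cc ?T c <= 2} c \<partial>fl (Suc K) (Suc j)) * okw j w) + 2 * r2 K \<partial>Om j (Suc K))"
   proof (rule nn_integral_mono)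
    fix w assume w: "w : space (Om j (Suc K))"
    have wm[measurable]: "wavg (Suc K) (D K w) : bm (law ?T (Suc K))" "wavg (Suc K) b : bm (law ?T (Suc K))"
     using wavg_measurable[OF D1[OF w]] wavg_measurable[OF bm] by (simp_all cong: mcs add: sets_law)
    note [measurable] = ccm
    have "(\<integral>\<^sup>+c. ennreal ((emp (Suc j) (Suc K) (w(Suc j := c)) phi - c0)^2) * (okw j w * indicator {c. cc ?T c <= 2} c) \<partial>law ?T (Suc K))
     <= (\<integral>\<^sup>+c. 2 * (okw j w * (ennreal ((wavg (Suc K) (D K w) c)^2) * indicator {c. cc ?T c <= 2} c)) + 2 * (ennreal ((wavg (Suc K) b c - c0)^2) * indicator {c. cc ?T c <= 2} c) \<partial>law ?T (Suc K))"
    proof (rule nn_integral_mono)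
     fix c
     have "emp (Suc j) (Suc K) (w(Suc j := c)) phi - c0 = wavg (Suc K) (D K w) c + (wavg (Suc K) b c - c0)"
      unfolding emp_Suc_wavg[OF j] by (simp add: wavg_def D_def right_diff_distrib sum_subtractf diff_divide_distrib)
     then have "ennreal ((emp (Suc j) (Suc K) (w(Suc j := c)) phi - c0)^2) <= ennreal (2 * (wavg (Suc K) (D K w) c)^2 + 2 * (wavg (Suc K) b c - c0)^2)"
      by (simp only: ennreal_leI[OF square_sum_le])
     also have "... = 2 * ennreal ((wavg (Suc K) (D K w) c)^2) + 2 * ennreal ((wavg (Suc K) b c - c0)^2)" by (simp add: ennreal_mult')
     finally show "ennreal ((emp (Suc j) (Suc K) (w(Suc j := c)) phi - c0)^2) * (okw j w * indicator {c. cc ?T c <= 2} c)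
      <= 2 * (okw j w * (ennreal ((wavg (Suc K) (D K w) c)^2) * indicator {c. cc ?T c <= 2} c)) + 2 * (ennreal ((wavg (Suc K) b c - c0)^2) * indicator {c. cc ?T c <= 2} c)"
      by (auto split: split_indicator)
    qed
    also have "... = 2 * ((\<integral>\<^sup>+c. ennreal ((wavg (Suc K) (D K w) c)^2) * indicator {c. cc ?T c <= 2} c \<partial>law ?T (Suc K)) * okw j w) + 2 * r2 K"
    proof -
     have p1: "(%c. ennreal ((wavg (Suc K) (D K w) c)^2) * indicator {c. cc ?T c <= 2} c) : bm (law ?T (Suc K))" by measurable
     have p2: "(%c. ennreal ((wavg (Suc K) b c - c0)^2) * indicator {c. cc ?T c <= 2} c) : bm (law ?T (Suc K))" by measurable
     show ?thesis using p1 p2 by (simp add: nn_integral_add nn_integral_cmult r2_def mult_ac)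
    qed
    finally show "(\<integral>\<^sup>+c. ennreal ((emp (Suc j) (Suc K) (w(Suc j := c)) phi - c0)^2) * (okw j w * indicator {c. cc ?T c <= 2} c) \<partial>law ?T (Suc K))
     <= 2 * ((\<integral>\<^sup>+c. ennreal ((wavg (Suc K) (D K w) c)^2) * indicator {c. cc ?T c <= 2} c \<partial>fl (Suc K) (Suc j)) * okw j w) + 2 * r2 K"
     unfolding fl_Suc[OF j] .
   qed
   also have "... = 2 * (\<integral>\<^sup>+w. (\<integral>\<^sup>+c. ennreal ((wavg (Suc K) (D K w) c)^2) * indicator {c. cc ?T c <= 2} c \<partial>fl (Suc K) (Suc j)) * okw j w \<partial>Om j (Suc K)) + 2 * r2 K"
   proof -
    interpret L: prob_space "fl (Suc K) (Suc j)" by (rule prob_space_fl)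
    have "(%(w, c). wavg (Suc K) (D K w) c) : bm (Om j (Suc K) \<Otimes>\<^sub>M fl (Suc K) (Suc j))"
    proof -
     have "(%z. emp (Suc j) (Suc K) ((fst z)(Suc j := snd z)) phi) : bm (Om j (Suc K) \<Otimes>\<^sub>M fl (Suc K) (Suc j))"
     proof (rule mcomp[OF _ emp_measurable_Om[OF Suc.prems, of phi "Suc K"], of "%z. (fst z)(Suc j := snd z)"])
      show "phi : bm (paths S {0<..st (Suc j)})" using phi by (simp add: st_Suc)
     qed (use measurable_Om_upd[of j "Suc K"] in \<open>simp add: case_prod_beta'\<close>)
     moreover have "(%z. wavg (Suc K) b (snd z)) : bm (Om j (Suc K) \<Otimes>\<^sub>M fl (Suc K) (Suc j))"
      using wavg_measurable[OF bm, of "Suc K"]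
      by (intro mcomp[OF measurable_snd]) (simp cong: mcs add: fl_Suc[OF j] sets_law)
     moreover have "wavg (Suc K) (D K w) c = emp (Suc j) (Suc K) (w(Suc j := c)) phi - wavg (Suc K) b c" for w c
      unfolding emp_Suc_wavg[OF j] by (simp add: wavg_def D_def right_diff_distrib sum_subtractf diff_divide_distrib)
     ultimately show ?thesis by (simp add: case_prod_beta' borel_measurable_diff)
    qed
    then have [measurable]: "(%z. wavg (Suc K) (D K (fst z)) (snd z)) : bm (Om j (Suc K) \<Otimes>\<^sub>M fl (Suc K) (Suc j))" by (simp add: case_prod_beta')
    have [measurable]: "cc ?T : bm (fl (Suc K) (Suc j))" unfolding fl_Suc[OF j] by (rule ccm)
    have p1: "(%w. (\<integral>\<^sup>+c. ennreal ((wavg (Suc K) (D K w) c)^2) * indicator {c. cc ?T c <= 2} c \<partial>fl (Suc K) (Suc j)) * okw j w) : bm (Om j (Suc K))"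
     by measurable
    show ?thesis using p1 by (simp add: nn_integral_add nn_integral_cmult O.emeasure_space_1)
   qed
   also have "... <= 2 * (2 * r1 K) + 2 * r2 K" unfolding r1_def by (intro add_mono mult_left_mono step_bound[OF j _ Dm] order_refl) simp_all
   finally show ?thesis .
  qed
  have "(%K. 2 * (2 * r1 K) + 2 * r2 K) \<longlonglongrightarrow> 2 * (2 * 0) + 2 * 0" by (intro tendsto_add ennreal_tendsto_cmult r1 r2) simp_all
  then have l0: "(%K. 2 * (2 * r1 K) + 2 * r2 K) \<longlonglongrightarrow> 0" by simp
  have "(%K. \<integral>\<^sup>+w. ennreal ((emp (Suc j) (Suc K) w phi - c0)^2) * okw (Suc j) w \<partial>Om (Suc j) (Suc K)) \<longlonglongrightarrow> 0"
   by (rule tendsto_sandwich[OF _ _ tendsto_const l0]; rule always_eventually; rule allI) (rule zero_le, rule le)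
  then show "(%K. \<integral>\<^sup>+w. ennreal ((emp (Suc j) (Suc K) w phi - (LINT x|marg (st (Suc j)). phi x))^2) * okw (Suc j) w \<partial>Om (Suc j) (Suc K)) \<longlonglongrightarrow> 0"
   unfolding c0_def st_Suc .
 qed
qed

lemma ok_prob:
 "j <= n_blocks S ==> (%K. emeasure (Om j (Suc K)) {w : space (Om j (Suc K)). \<not> ok j w}) \<longlonglongrightarrow> 0"
proof (induction j)
 case (Suc j)
 then have j: "j < n_blocks S" and j': "j <= n_blocks S" by auto
 interpret smc_block S "Suc j" by (rule block[OF j])
 let ?T = "T" and ?p = "%j K. emeasure (Om j (Suc K)) {w : space (Om j (Suc K)). \<not> ok j w}"
 have "?p (Suc j) K <= ?p j K + bad ?T (Suc K)" for K
 proof -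
  interpret O: prob_space "Om j (Suc K)" by (rule prob_space_Om)
  interpret L: prob_space "law ?T (Suc K)" by (rule prob_space_law) simp
  have okj[measurable]: "Measurable.pred (Om j (Suc K)) (ok j)" by (rule ok_measurable[OF j']) simp
  have okS: "Measurable.pred (Om (Suc j) (Suc K)) (ok (Suc j))" by (rule ok_measurable[OF Suc.prems]) simp
  have [measurable]: "cc ?T : bm (law ?T (Suc K))" using cc_measurable[of ?T ?T "Suc K"] by (simp cong: mcs add: sets_law)
  have m: "(%w. indicator {w. \<not> ok (Suc j) w} w :: ennreal) : bm (Om (Suc j) (Suc K))" using okS by measurable
  have e: "?p j K = (\<integral>\<^sup>+w. indicator {w. \<not> ok j w} w \<partial>Om j (Suc K))"
   if [measurable]: "Measurable.pred (Om j (Suc K)) (ok j)" for j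
  proof -
   have "(\<integral>\<^sup>+w. indicator {w. \<not> ok j w} w \<partial>Om j (Suc K)) = (\<integral>\<^sup>+w. indicator {w : space (Om j (Suc K)). \<not> ok j w} w \<partial>Om j (Suc K))"
    by (intro nn_integral_cong) (auto split: split_indicator)
   then show ?thesis by simp
  qed
  have "?p (Suc j) K = (\<integral>\<^sup>+w. \<integral>\<^sup>+c. indicator {w. \<not> ok (Suc j) w} (w(Suc j := c)) \<partial>law ?T (Suc K) \<partial>Om j (Suc K))"
   unfolding e[OF okS] nn_integral_Om_Suc[OF m] fl_Suc[OF j] ..
  also have "... <= (\<integral>\<^sup>+w. \<integral>\<^sup>+c. indicator {w. \<not> ok j w} w + indicator {c : space (law ?T (Suc K)). 2 < cc ?T c} c \<partial>law ?T (Suc K) \<partial>Om j (Suc K))"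
  proof (intro nn_integral_mono)
   fix w c assume c: "c : space (law ?T (Suc K))"
   show "indicator {w. \<not> ok (Suc j) w} (w(Suc j := c)) <= indicator {w. \<not> ok j w} w + (indicator {c : space (law ?T (Suc K)). 2 < cc ?T c} c :: ennreal)"
    using c by (cases "ok j w"; cases "cc ?T c <= 2") (simp_all add: ok_Suc)
  qed
  also have "... = ?p j K + bad ?T (Suc K)" unfolding e[OF okj] bad_def by (simp add: nn_integral_add O.emeasure_space_1 L.emeasure_space_1)
  finally show ?thesis .
 qed
 note le = this
 have "(%K. ?p j K + bad ?T (Suc K)) \<longlonglongrightarrow> 0 + 0"
  by (rule tendsto_add[OF Suc.IH[OF j'] LIMSEQ_Suc[OF bad_tendsto[OF order_refl]]])
 then have l0: "(%K. ?p j K + bad ?T (Suc K)) \<longlonglongrightarrow> 0" by simp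
 show ?case by (rule tendsto_sandwich[OF _ _ tendsto_const l0]; rule always_eventually; rule allI) (rule zero_le, rule le)
qed (simp add: ok_def)

end

section \<open>Conditional means on full paths and on blocks\<close>

locale smc_clt = smc_model S for S :: "('x, 'y) smc" +
 fixes F :: "(nat => 'x) => real"
 assumes F_measurable: "F : bm (paths S {0<..horizon S})"
  and F_integrable: "integrable (marg (horizon S)) F"
begin

text \<open>A version of \<open>f_fun\<close> defined at every path (\<open>f_fun_AE\<close>).
  Conditional expectations as such are equivalence classes and could not be evaluated at joined
  paths.\<close>

definition fh :: "nat => (nat => 'x) => real" where
 "fh t z = (LINT x|path_run S 0 t z (horizon S - t). F x)"

definition psi :: real where
 "psi = (LINT x|marg (horizon S). F x)"

lemma run_kernel_U:
 "t <= horizon S ==> (%z. path_run S 0 t z (horizon S - t)) : paths S {0<..t} \<rightarrow>\<^sub>M prob_algebra (paths S {0<..horizon S})"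
 using run_kernel[of 0 t "horizon S - t"] by simp

lemma fh_measurable: "t <= horizon S ==> fh t : bm (paths S {0<..t})" unfolding fh_def[abs_def]
 by (rule mcomp[OF measurable_prob_algebraD[OF run_kernel_U] integral_measurable_subprob_algebra[OF F_measurable]])

lemma
 assumes t: "t <= horizon S"
 shows integrable_fh: "integrable (marg t) (fh t)" and integral_fh: "(LINT z|marg t. fh t z) = psi"
  and AE_integrable_F: "AE z in marg t. integrable (path_run S 0 t z (horizon S - t)) F"
proof -
 have e: "marg (horizon S) = marg t \<bind> (%z. path_run S 0 t z (horizon S - t))" using marg_add[of t "horizon S - t"] t by simp
 have k: "(%z. path_run S 0 t z (horizon S - t)) : marg t \<rightarrow>\<^sub>M prob_algebra (paths S {0<..horizon S})"
  using run_kernel0[of t "horizon S - t"] t by simp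
 have ne: "space (marg t) ~= {}" by (intro prob_space.not_empty prob_space_marg t)
 show "integrable (marg t) (fh t)" "(LINT z|marg t. fh t z) = psi"
  "AE z in marg t. integrable (path_run S 0 t z (horizon S - t)) F"
  using integrable_integral_bind[OF k ne] integral_bind[OF k ne] AE_integrable_bind[OF k ne] F_integrable
  unfolding e[symmetric] fh_def[abs_def] psi_def by auto
qed

lemma fh_horizon: "z : space (paths S {0<..horizon S}) ==> fh (horizon S) z = F z" using F_measurable by (simp add: fh_def integral_return)

lemma fh_0: "fh 0 (%_. undefined) = psi" by (simp add: fh_def psi_def marg_def)

lemma AE_fh:
 assumes t: "t + k <= horizon S"
 shows "AE z in marg t. integrable (path_run S 0 t z k) (fh (t + k)) & (LINT x|path_run S 0 t z k. fh (t + k) x) = fh t z"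
proof -
 have t': "t <= horizon S" using t by simp
 show ?thesis using AE_integrable_F[OF t'] AE_space
 proof eventually_elim
  case (elim z)
  have z: "z : space (paths S {0<..t})" using elim(2) by (simp add: space_marg[OF t'])
  let ?r = "horizon S - (t + k)"
  have sc: "horizon S - t = k + ?r" using t by simp
  interpret pk: prob_space "path_run S 0 t z k" using t z by (intro prob_space_run) auto
  have k: "(%z. path_run S 0 (t + k) z ?r) : path_run S 0 t z k \<rightarrow>\<^sub>M prob_algebra (paths S {0<..horizon S})"
   using run_kernel_U[OF t] sets_run[of 0 t k z] t z by (simp cong: mcs)
  have e: "path_run S 0 t z (horizon S - t) = path_run S 0 t z k \<bind> (%z. path_run S 0 (t + k) z ?r)"
   unfolding sc using t z by (intro run_add) auto
  show ?case using integrable_integral_bind[OF k pk.not_empty] integral_bind[OF k pk.not_empty] elim(1) unfolding e[symmetric] fh_def[abs_def] by auto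
 qed
qed

text \<open>With the past \<open>x\<close> fixed, \<open>run_mrg\<close> turns the tower property of
  \<open>fh\<close> along full paths into one along block paths.\<close>

lemma path_section:
 assumes j: "j < n_blocks S" and n: "n <= T" and x: "x : space (paths S {0<..st j})" and y: "y : space (paths S {st j<..st j + n})"
  and P: "integrable (path_run S 0 (st j + n) (mrg (st j) (st j + n) x y) (T - n)) (fh (st j + T)) \<and>
   (LINT z|path_run S 0 (st j + n) (mrg (st j) (st j + n) x y) (T - n). fh (st j + T) z) = fh (st j + n) (mrg (st j) (st j + n) x y)"
 shows "integrable (path_run S (st j) (st j + n) y (T - n)) (%y'. fh (st j + T) (mrg (st j) (st j + T) x y'))"
  and "(LINT y'|path_run S (st j) (st j + n) y (T - n). fh (st j + T) (mrg (st j) (st j + T) x y')) = fh (st j + n) (mrg (st j) (st j + n) x y)"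
proof -
 interpret smc_block S "Suc j" by (rule block[OF j])
 let ?T = "T" and ?R = "path_run S a (a + n) y (T - n)"
 have s: "sets ?R = sets (B ?T)" using sets_run[of a "a + n" "?T - n" y] a_le_start[of n] a_T_le y n by simp
 have f: "mrg a (a + ?T) x : ?R \<rightarrow>\<^sub>M paths S {0<..a + ?T}"
  unfolding mcs[OF s refl] by (intro measurable_mrg' measurable_const x measurable_ident_sets) simp_all
 have e: "path_run S 0 (a + n) (mrg a (a + n) x y) (?T - n) = distr ?R (paths S {0<..a + ?T}) (mrg a (a + ?T) x)"
  using run_mrg[OF a_eq _ _ _ x y, of "?T - n"] n a_T_le by simp
 note fm = fh_measurable[OF a_T_le]
 show "integrable ?R (%y'. fh (a + ?T) (mrg a (a + ?T) x y'))" using P unfolding e integrable_distr_eq[OF f fm] ..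
 show "(LINT y'|?R. fh (a + ?T) (mrg a (a + ?T) x y')) = fh (a + n) (mrg a (a + n) x y)" using P unfolding e integral_distr[OF f fm] ..
qed

text \<open>The corresponding version of \<open>f_blk\<close>: the coordinates before the block are
  averaged under their own law, which is legitimate because the block is independent of
  them.\<close>

definition gs :: "nat => nat => (nat => 'x) => real" where
 "gs j n y = (LINT x|marg (st j). fh (st j + n) (mrg (st j) (st j + n) x y))"

lemma
 assumes j: "j < n_blocks S" and n: "n <= T"
 shows gs_measurable: "gs j n : bm (paths S {st j<..st j + n})"
  and gs_integrable: "integrable (smc_block.Q S (Suc j) n) (gs j n)"
  and gs_integral: "(LINT y|smc_block.Q S (Suc j) n. gs j n y) = psi"
proof -
 interpret smc_block S "Suc j" by (rule block[OF j])
 interpret pair_prob_space "marg a" "Q n" by (rule pair_prob_space_marg_Q[OF n])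
 note fm = fh_measurable[OF a_n_le[OF n]]
 have "(%z. mrg a (a + n) (snd z) (fst z)) : B n \<Otimes>\<^sub>M marg a \<rightarrow>\<^sub>M paths S {0<..a + n}"
  by (simp cong: mcs sets_pair_measure_cong add: sets_marg[OF a_le] measurable_mrg')
 from mcomp[OF this fm] have [measurable]: "(%z. fh (a + n) (mrg a (a + n) (snd z) (fst z))) : bm (B n \<Otimes>\<^sub>M marg a)" .
 show "gs j n : bm (B n)" unfolding gs_def[abs_def] by measurable
 have i: "integrable (marg a \<Otimes>\<^sub>M Q n) (%(x, y). fh (a + n) (mrg a (a + n) x y))"
  using integrable_fh[OF a_n_le[OF n]] unfolding marg_eq_distr[OF n]
  by (subst (asm) integrable_distr_eq[OF mrg_pair_measurable[OF n] fm]) (simp add: case_prod_beta')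
 show "integrable (Q n) (gs j n)" unfolding gs_def[abs_def] using integrable_snd[OF i] .
 have "(LINT y|Q n. gs j n y) = (LINT z|(marg a \<Otimes>\<^sub>M Q n). (case z of (x, y) => fh (a + n) (mrg a (a + n) x y)))"
  unfolding gs_def using integral_snd[OF i] .
 also have "... = (LINT x|marg (a + n). fh (a + n) x)"
  unfolding marg_eq_distr[OF n] by (subst integral_distr[OF mrg_pair_measurable[OF n] fm]) (simp add: case_prod_beta')
 finally show "(LINT y|Q n. gs j n y) = psi" by (simp add: integral_fh[OF a_n_le[OF n]])
qed

text \<open>Averaging over the past commutes with averaging over the future within the block. Hence
  the backward means \<open>gn\<close> of the block function \<open>gs j T\<close> are, almost
  everywhere, the functions \<open>gs j n\<close> of the variance formula.\<close>

lemma AE_gs: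
 assumes j: "j < n_blocks S" and n: "n <= T"
 shows "AE y in smc_block.Q S (Suc j) n. (LINT y'|path_run S (st j) (st j + n) y (T - n). gs j T y') = gs j n y"
proof -
 interpret smc_block S "Suc j" by (rule block[OF j])
 let ?T = "T" and ?R = "%y. path_run S a (a + n) y (T - n)"
 interpret pT: pair_prob_space "marg a" "Q ?T" by (rule pair_prob_space_marg_Q) simp
 note fm = fh_measurable[OF a_T_le]
 \<comment> \<open>Finiteness of the mean of \<open>J\<close> along the run, true for almost every
   \<open>y\<close>, is the joint integrability that Fubini's theorem needs below.\<close>
 define J where "J y = (\<integral>\<^sup>+x. norm (fh (a + ?T) (mrg a (a + ?T) x y)) \<partial>marg a)" for y
 have "(%z. mrg a (a + ?T) (snd z) (fst z)) : B ?T \<Otimes>\<^sub>M marg a \<rightarrow>\<^sub>M paths S {0<..a + ?T}"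
  by (simp cong: mcs sets_pair_measure_cong add: sets_marg[OF a_le] measurable_mrg')
 from mcomp[OF this fm] have [measurable]: "(%z. fh (a + ?T) (mrg a (a + ?T) (snd z) (fst z))) : bm (B ?T \<Otimes>\<^sub>M marg a)" .
 have Jm: "J : bm (B ?T)" unfolding J_def by measurable
 have k: "?R : Q n \<rightarrow>\<^sub>M subprob_algebra (B ?T)"
  using measurable_prob_algebraD[OF run_kernel_a[of n "?T - n"]] n by (simp cong: mcs add: sets_Q)
 have "(\<integral>\<^sup>+y. \<integral>\<^sup>+y'. J y' \<partial>?R y \<partial>Q n) = (\<integral>\<^sup>+y. J y \<partial>Q ?T)"
  using nn_integral_bind[OF Jm k] Q_add[of n "?T - n"] n by simp
 also have "... = (\<integral>\<^sup>+z. norm (fh (a + ?T) z) \<partial>marg (a + ?T))"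
 proof -
  have m: "(%z. ennreal (norm (fh (a + ?T) z))) : bm (paths S {0<..a + ?T})" using fm by measurable
  have m2: "(%(x, y). ennreal (norm (fh (a + ?T) (mrg a (a + ?T) x y)))) : bm (marg a \<Otimes>\<^sub>M Q ?T)"
   using mcomp[OF mrg_pair_measurable[OF order_refl] m] by (simp add: case_prod_beta')
  show ?thesis unfolding marg_eq_distr[OF order_refl] J_def using pT.nn_integral_snd[OF m2] m
   by (subst nn_integral_distr[OF mrg_pair_measurable[OF order_refl]]) (simp_all add: case_prod_beta')
 qed
 also have "... < \<infinity>" using integrable_fh[OF a_T_le] by (simp add: integrable_iff_bounded)
 finally have "(\<integral>\<^sup>+y. \<integral>\<^sup>+y'. J y' \<partial>?R y \<partial>Q n) < \<infinity>" .
 then have fin: "AE y in Q n. (\<integral>\<^sup>+y'. J y' \<partial>?R y) ~= \<infinity>"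
  by (intro nn_integral_noteq_infinite mcomp[OF k nn_integral_measurable_subprob_algebra[OF Jm]]) auto
 have "a + n + (?T - n) = a + ?T" using n by simp
 from AE_fh[of "a + n" "?T - n", unfolded this, OF a_T_le]
 have "AE y in Q n. AE x in marg a. integrable (path_run S 0 (a + n) (mrg a (a + n) x y) (?T - n)) (fh (a + ?T)) \<and>
   (LINT z|path_run S 0 (a + n) (mrg a (a + n) x y) (?T - n). fh (a + ?T) z) = fh (a + n) (mrg a (a + n) x y)" by (rule AE_mrg_section[OF n])
 then show ?thesis using fin AE_space
 proof eventually_elim
  case (elim y)
  have y: "y : space (B n)" using elim(3) by (simp add: space_Q[OF n])
  have s: "sets (?R y) = sets (B ?T)" using sets_run[of a "a + n" "?T - n" y] a_le_start[of n] a_T_le y n by simp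
  interpret R: prob_space "?R y" using a_le_start[of n] a_T_le y n by (intro prob_space_run) auto
  interpret p: pair_prob_space "marg a" "?R y" ..
  have "(%(x, y). mrg a (a + ?T) x y) : marg a \<Otimes>\<^sub>M ?R y \<rightarrow>\<^sub>M paths S {0<..a + ?T}"
   using measurable_mrg[of a "a + ?T" S] unfolding mcs[OF sets_pair_measure_cong[OF sets_marg[OF a_le] s] refl] by simp
  from mcomp[OF this fm] have m: "(%(x, y). fh (a + ?T) (mrg a (a + ?T) x y)) : bm (marg a \<Otimes>\<^sub>M ?R y)"
   by (simp add: case_prod_beta')
  have i: "integrable (marg a \<Otimes>\<^sub>M ?R y) (%(x, y). fh (a + ?T) (mrg a (a + ?T) x y))"
  proof (rule integrableI_bounded[OF m])
   have "(%(x, y). ennreal (norm (fh (a + ?T) (mrg a (a + ?T) x y)))) : bm (marg a \<Otimes>\<^sub>M ?R y)"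
    using m by (simp add: case_prod_beta')
   from p.nn_integral_snd[OF this]
   have "(\<integral>\<^sup>+z. ennreal (norm (fh (a + ?T) (mrg a (a + ?T) (fst z) (snd z)))) \<partial>(marg a \<Otimes>\<^sub>M ?R y)) = (\<integral>\<^sup>+y'. J y' \<partial>?R y)"
    by (simp add: J_def case_prod_beta')
   then show "(\<integral>\<^sup>+z. ennreal (norm (case z of (x, y) => fh (a + ?T) (mrg a (a + ?T) x y))) \<partial>(marg a \<Otimes>\<^sub>M ?R y)) < \<infinity>"
    using elim(2) by (simp add: case_prod_beta' top.not_eq_extremum)
  qed
  have "(LINT y'|?R y. gs j ?T y') = (LINT x|marg a. LINT y'|?R y. fh (a + ?T) (mrg a (a + ?T) x y'))"
   unfolding gs_def by (rule p.Fubini_integral[OF i])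
  also have "... = gs j n y" unfolding gs_def
  proof (rule integral_cong_AE)
   show "(%x. LINT y'|?R y. fh (a + ?T) (mrg a (a + ?T) x y')) : bm (marg a)"
    using p.integrable_fst[OF i] by (rule borel_measurable_integrable)
   have "(%x. fh (a + n) (mrg a (a + n) x y)) : bm (paths S {0<..a})"
    by (rule mcomp[OF _ fh_measurable[OF a_n_le[OF n]]]) (intro measurable_mrg' measurable_ident_sets refl measurable_const y, simp)
   then show "(%x. fh (a + n) (mrg a (a + n) x y)) : bm (marg a)" unfolding mcs[OF sets_marg[OF a_le] refl] .
   show "AE x in marg a. (LINT y'|?R y. fh (a + ?T) (mrg a (a + ?T) x y')) = fh (a + n) (mrg a (a + n) x y)" using elim(1) AE_space
   proof eventually_elim
    case (elim x)
    then have x: "x : space (paths S {0<..a})" by (simp add: space_marg[OF a_le])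
    show ?case by (rule path_section(2)[OF j n x y elim(1)])
   qed
  qed
  finally show ?case .
 qed
qed

lemma block_fun: "j < n_blocks S ==> smc_block_fun S (Suc j) (gs j T)"
 using gs_measurable[of j "T"] gs_integrable[of j "T"] block[of j] by (simp add: smc_block_fun_def smc_block_fun_axioms_def)

end

locale smc_clt_sq = smc_clt S F for S :: "('x, 'y) smc" and F +
 assumes fh_sq_next: "t : {1..horizon S} ==> (\<integral>\<^sup>+x. ennreal (h_fun S t x * (fh t x)^2) \<partial>marg t) < \<infinity>"
  and fh_sq_prev: "t < horizon S ==> (\<integral>\<^sup>+x. ennreal (h_fun S t x * (fh (Suc t) x)^2) \<partial>marg (Suc t)) < \<infinity>"
begin

lemma fh_sq:
 assumes j: "j < n_blocks S" and n: "n < T" and k: "k : {n, Suc n}"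
 shows "(\<integral>\<^sup>+x. ennreal (h_fun S (st j + k) x * (fh (st j + Suc n) x)^2) \<partial>marg (st j + Suc n)) < \<infinity>"
proof -
 interpret smc_block S "Suc j" by (rule block[OF j])
 have "a + Suc n <= horizon S" using n by (intro a_n_le) simp
 then show ?thesis using fh_sq_next[of "a + Suc n"] fh_sq_prev[of "a + n"] k by (auto simp: add_Suc_right)
qed

text \<open>Averaging over the past does not increase the weighted second moment
  (\<open>weighted_section\<close>), so the two square-integrability conditions pass from full paths
  to the block functions.\<close>

lemma block_sq: assumes j: "j < n_blocks S" shows "smc_block_sq S (Suc j) (gs j T)"
proof -
 interpret smc_block_fun S "Suc j" "gs j T" by (rule block_fun[OF j])
 have i: "integrable (Q (Suc n)) (%x. h k x * (gn (Suc n) x)^2)" if n: "n < T" and k: "k : {n, Suc n}" for n k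
 proof (rule integrableI_nonneg)
  have n': "Suc n <= T" and k': "k <= Suc n" "k <= T" using n k by auto
  have hp: "0 < h k x" if "x : space (Q (Suc n))" for x using that k' by (intro h_pos[of _ "Suc n"]) (auto simp: space_Q[OF n'])
  show "AE x in Q (Suc n). 0 <= h k x * (gn (Suc n) x)^2" by (intro AE_I2 mult_nonneg_nonneg less_imp_le[OF hp] zero_le_power2)
  have [measurable]: "gn (Suc n) : bm (B (Suc n))" "h k : bm (B (Suc n))"
   using gn_measurable[OF n'] h_measurable[OF k'(2,1)] by auto
  show "(%x. h k x * (gn (Suc n) x)^2) : bm (Q (Suc n))" unfolding mcs[OF sets_Q[OF n'] refl] by measurable
  have "AE y in Q (Suc n). gn (Suc n) y = gs j (Suc n) y" using AE_gs[OF j n'] by (simp add: gn_def)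
  then have "(\<integral>\<^sup>+x. ennreal (h k x * (gn (Suc n) x)^2) \<partial>Q (Suc n)) = (\<integral>\<^sup>+x. ennreal (h k x * (gs j (Suc n) x)^2) \<partial>Q (Suc n))"
   by (intro nn_integral_cong_AE) (auto elim!: eventually_mono)
  also have "... <= (\<integral>\<^sup>+x. ennreal (h_fun S (a + k) x * (fh (a + Suc n) x)^2) \<partial>marg (a + Suc n))"
   unfolding gs_def by (rule weighted_section[OF j n' k'(1) fh_measurable[OF a_n_le[OF n']]])
  also have "... < \<infinity>" by (rule fh_sq[OF j n k])
  finally show "(\<integral>\<^sup>+x. ennreal (h k x * (gn (Suc n) x)^2) \<partial>Q (Suc n)) < \<infinity>" .
 qed
 show ?thesis by unfold_locales (use i in auto)
qed

end

section \<open>The remainder and the passage from one block to the next\<close>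

lemma cmod_iexp_diff_le:
 fixes s r d :: real
 assumes d: "0 < d"
 shows "cmod (iexp (s * r) - 1) <= d + (4 + s\<^sup>2) / d * min 1 (r\<^sup>2)"
proof -
 let ?v = "cmod (iexp (s * r) - 1)"
 have v1: "?v <= abs (s * r)" using iexp_approx1[of "s * r" 0] by simp
 have v2: "?v <= 2" using norm_triangle_ineq4[of "iexp (s * r)" 1] by simp
 have "?v\<^sup>2 <= (s * r)\<^sup>2" "?v\<^sup>2 <= 4" using power_mono[OF v1, of 2] power_mono[OF v2, of 2] by simp_all
 then have "?v\<^sup>2 <= (4 + s\<^sup>2) * min 1 (r\<^sup>2)"
  by (cases "r\<^sup>2 <= 1") (auto simp: min_def power_mult_distrib algebra_simps intro: order_trans)
 then have "?v\<^sup>2 / d <= (4 + s\<^sup>2) / d * min 1 (r\<^sup>2)" using d by (simp add: divide_right_mono)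
 \<comment> \<open>This elementary inequality converts a bound on squares into one on first powers:
   \<open>d\<close> is chosen small first, and then the truncated mean square tends to 0.\<close>
 moreover have "?v <= d + ?v\<^sup>2 / d"
 proof -
  have "0 <= (?v - d / 2)\<^sup>2 + 3 / 4 * d\<^sup>2" by simp
  then have "?v * d <= d * d + ?v\<^sup>2" by (simp add: power2_eq_square algebra_simps)
  then show ?thesis using d by (simp add: field_simps)
 qed
 ultimately show ?thesis by linarith
qed

context smc_clt begin

text \<open>The error made by replacing the law of the past with the joined paths of the earlier
  filters, as a function of the block path. It is the test function behind the remainder and is
  random through \<open>w\<close>.\<close>

definition dev :: "nat => nat => nat => (nat => nat => (nat => 'x) \<times> real) => (nat => 'x) => real" where
 "dev j K n w y = emp j K w (%x. fh (st j + n) (mrg (st j) (st j + n) x y)) - gs j n y"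

lemma dev_measurable:
 assumes j: "j < n_blocks S" and n: "n <= T"
 shows "(%(w, y). dev j K n w y) : bm (Om j K \<Otimes>\<^sub>M paths S {st j<..st j + n})"
proof -
 interpret smc_block S "Suc j" by (rule block[OF j])
 have "(%(x, y). fh (a + n) (mrg a (a + n) x y)) : bm (paths S {0<..st j} \<Otimes>\<^sub>M B n)"
  using mcomp[OF measurable_mrg[of a "a + n" S] fh_measurable[OF a_n_le[OF n]]] by (simp add: case_prod_beta')
 from emp_param_measurable[OF less_imp_le[OF j] this, of K] show ?thesis unfolding dev_def case_prod_beta'
  by (intro borel_measurable_diff mcomp[OF measurable_snd gs_measurable[OF j n]])
qed

text \<open>The backward means of the random test function \<open>dev j K T w\<close> are the
  functions \<open>dev j K n w\<close>. Their weighted second moments can therefore be estimated by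
  \<open>consistent_param\<close> at every \<open>n\<close>, as \<open>moment_bound\<close>
  demands.\<close>

lemma AE_dev_run:
 assumes j: "j < n_blocks S" and n: "n <= T"
 shows "AE w in Om j K. AE y in smc_block.Q S (Suc j) n. integrable (path_run S (st j) (st j + n) y (T - n)) (dev j K T w)
  & (LINT y'|path_run S (st j) (st j + n) y (T - n). dev j K T w y') = dev j K n w y"
proof -
 interpret smc_block_fun S "Suc j" "gs j T" by (rule block_fun[OF j])
 let ?T = "T" and ?R = "%y. path_run S a (a + n) y (T - n)"
 have e: "a + n + (?T - n) = a + ?T" using n by simp
 let ?P = "%z. integrable (path_run S 0 (a + n) z (?T - n)) (fh (a + ?T)) \<and>
  (LINT x|path_run S 0 (a + n) z (?T - n). fh (a + ?T) x) = fh (a + n) z"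
 have P: "AE z in marg (a + n). ?P z" using AE_fh[of "a + n" "?T - n", unfolded e, OF a_T_le] .
 have sp: "AE w in Om j K. all_paths j K w (%x. x : space (paths S {0<..a}))"
  using AE_space by (intro AE_all_paths_measurable) (use j in \<open>auto simp: space_marg[OF a_le] elim!: eventually_mono\<close>)
 from AE_all_paths_mrg[OF j n P, of K] sp show ?thesis
 proof eventually_elim
  case (elim w)
  note al = elim(2)
  from elim(1) AE_gs[OF j n] AE_integrable_run[OF n] AE_space show ?case
  proof eventually_elim
   case (elim y)
   have y: "y : space (B n)" using elim(4) by (simp add: space_Q[OF n])
   let ?f = "%x y'. fh (a + ?T) (mrg a (a + ?T) x y')"
   from all_paths_conj[OF elim(1) al]
   have all: "all_paths j K w (%x. integrable (?R y) (?f x) & (LINT y'|?R y. ?f x y') = fh (a + n) (mrg a (a + n) x y))"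
    by (rule all_paths_mono) (use path_section[OF j n _ y] in blast)
   have em: "integrable (?R y) (%y'. emp j K w (%x. ?f x y'))"
     "(LINT y'|?R y. emp j K w (%x. ?f x y')) = emp j K w (%x. LINT y'|?R y. ?f x y')"
    using emp_integral[of j K w "?R y" ?f, OF all_paths_mono[OF all]] by simp_all
   have "emp j K w (%x. LINT y'|?R y. ?f x y') = emp j K w (%x. fh (a + n) (mrg a (a + n) x y))"
    by (rule emp_cong) (rule all_paths_mono[OF all], erule conjunct2)
   with em elim(2,3) show ?case by (simp add: dev_def[abs_def])
  qed
 qed
qed

text \<open>The case \<open>n = 0\<close> of \<open>AE_dev_run\<close>: the block path is empty,
  \<open>Q 0\<close> is a point mass, and \<open>dev\<close> reduces to the error after
  \<open>j\<close> blocks. So this error is the exact mean of the test function behind the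
  remainder.\<close>

lemma AE_dev:
 assumes j: "j < n_blocks S"
 shows "AE w in Om j K. smc_block_fun S (Suc j) (dev j K T w) \<and>
  (LINT y|smc_block.Q S (Suc j) T. dev j K T w y) = emp j K w (fh (st j)) - psi"
proof -
 interpret smc_block S "Suc j" by (rule block[OF j])
 have sp: "AE w in Om j K. all_paths j K w (%x. x : space (paths S {0<..a}))"
  using AE_space by (intro AE_all_paths_measurable) (use j in \<open>auto simp: space_marg[OF a_le] elim!: eventually_mono\<close>)
 from AE_dev_run[OF j le0, of K] sp AE_space show ?thesis
 proof eventually_elim
  case (elim w)
  let ?u = "%_. undefined :: 'x"
  interpret Q0: prob_space "Q 0" by (rule prob_space_Q) simp
  have u: "integrable (Q T) (dev j K T w) & (LINT y'|Q T. dev j K T w y') = dev j K 0 w ?u"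
  proof -
   from elim(1) AE_space
   have "AE y in Q 0. integrable (Q T) (dev j K T w) & (LINT y'|Q T. dev j K T w y') = dev j K 0 w ?u"
    by eventually_elim (auto simp: space_Q space_paths_empty Q_def)
   then show ?thesis by (simp add: Q0.AE_const)
  qed
  have "emp j K w (%x. fh a (mrg a a x ?u)) = emp j K w (fh a)" by (rule emp_cong[OF all_paths_mono[OF elim(2)]]) (simp add: mrg_self)
  moreover have "gs j 0 ?u = psi"
  proof -
   have "(LINT x|marg a. fh a (mrg a a x ?u)) = (LINT x|marg a. fh a x)"
    by (rule Bochner_Integration.integral_cong[OF refl]) (simp add: space_marg[OF a_le] mrg_self)
   then show ?thesis by (simp add: gs_def integral_fh[OF a_le])
  qed
  ultimately have d0: "dev j K 0 w ?u = emp j K w (fh a) - psi" by (simp add: dev_def)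
  have "dev j K T w : bm (B T)"
   using mcomp[OF measurable_Pair1'[OF elim(3)] dev_measurable[OF j order_refl]] by simp
  then have "smc_block_fun S (Suc j) (dev j K T w)" using u by unfold_locales auto
  with u d0 show ?case by simp
 qed
qed

end

context smc_clt_sq begin

lemma dev_sq_tendsto:
 assumes j: "j < n_blocks S" and n: "n < T" and k: "k : {n, Suc n}"
 shows "(%K. \<integral>\<^sup>+w. (\<integral>\<^sup>+y. ennreal (h_blk S (Suc j) (st j + k) y * (dev j (Suc K) (Suc n) w y)^2) \<partial>smc_block.Q S (Suc j) (Suc n)) * okw j w \<partial>Om j (Suc K)) \<longlonglongrightarrow> 0"
proof -
 interpret smc_block S "Suc j" by (rule block[OF j])
 have n': "Suc n <= T" and k': "k <= Suc n" "k <= T" and j': "j <= n_blocks S" using n k j by auto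
 have K1: "Suc K >= 1" for K by simp
 note fm = fh_measurable[OF a_n_le[OF n']]
 have m: "(%(x, y). fh (a + Suc n) (mrg a (a + Suc n) x y)) : bm (paths S {0<..st j} \<Otimes>\<^sub>M Q (Suc n))"
  unfolding mcs[OF sets_pair_measure_cong[OF refl sets_Q[OF n']] refl]
  using mcomp[OF measurable_mrg[of a "a + Suc n" S] fm] by (simp add: case_prod_beta')
 have hm: "h k : bm (Q (Suc n))" unfolding mcs[OF sets_Q[OF n'] refl] by (rule h_measurable[OF k'(2,1)])
 show ?thesis unfolding okw_swap(1)[OF j K1 n' k'(1) dev_measurable[OF j n']] unfolding dev_def gs_def
 proof (rule consistent_param[OF j' consistent[OF j'] prob_space_Q[OF n'] m hm])
  show "(\<integral>\<^sup>+y. ennreal (h k y) * (\<integral>\<^sup>+x. ennreal (h_fun S (st j) x * (fh (a + Suc n) (mrg a (a + Suc n) x y))^2) \<partial>marg (st j)) \<partial>Q (Suc n)) < \<infinity>"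
   unfolding nn_integral_marg_swap[OF j n' k'(1) fm] by (rule fh_sq[OF j n k])
 qed
qed

text \<open>The scaled error of filter \<open>j + 1\<close> for the test function
  \<open>dev j K T w\<close>, centred at the mean found in \<open>AE_dev\<close>.\<close>

definition rmd :: "nat => nat => (nat => nat => (nat => 'x) \<times> real) => (nat => (nat => 'x) \<times> real) => real" where
 "rmd j K w c = sqrt K * (smc_block.wavg K (dev j K T w) c - (emp j K w (fh (st j)) - psi))"

text \<open>With the earlier filters fixed, \<open>moment_bound\<close> applies to the random test
  function. Integrated over the event \<open>ok\<close>, its weighted second moments vanish by
  \<open>dev_sq_tendsto\<close>; off that event the truncation leaves a probability that vanishes by
  \<open>ok_prob\<close>.\<close>

lemma rmd_tendsto:
 assumes j: "j < n_blocks S"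
 shows "(%K. \<integral>\<^sup>+w. \<integral>\<^sup>+c. ennreal (min 1 ((rmd j (Suc K) w c)^2)) \<partial>fl (Suc K) (Suc j) \<partial>Om j (Suc K)) \<longlonglongrightarrow> 0"
proof -
 interpret smc_block S "Suc j" by (rule block[OF j])
 let ?T = "T"
 define A where "A k n K w = (\<integral>\<^sup>+y. ennreal (h k y * (dev j (Suc K) (Suc n) w y)^2) \<partial>Q (Suc n))" for k n K w
 define u where "u K = (rem ?T (Suc K) + 8 * 4 ^ ?T * (\<Sum>i<?T. (\<integral>\<^sup>+w. A i i K w * okw j w \<partial>Om j (Suc K)) + (\<integral>\<^sup>+w. A (Suc i) i K w * okw j w \<partial>Om j (Suc K))))
  + emeasure (Om j (Suc K)) {w : space (Om j (Suc K)). \<not> ok j w}" for K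
 have le: "(\<integral>\<^sup>+w. \<integral>\<^sup>+c. ennreal (min 1 ((rmd j (Suc K) w c)^2)) \<partial>fl (Suc K) (Suc j) \<partial>Om j (Suc K)) <= u K" for K
 proof -
  interpret O: prob_space "Om j (Suc K)" by (rule prob_space_Om)
  have K1: "Suc K >= 1" by simp
  have j': "j <= n_blocks S" using j by simp
  have [measurable]: "Measurable.pred (Om j (Suc K)) (ok j)" by (rule ok_measurable[OF j' K1])
  have [measurable]: "A k n K : bm (Om j (Suc K))" if "n < ?T" "k <= Suc n" for k n
   unfolding A_def using that by (intro okw_swap(2)[OF j K1] dev_measurable[OF j]) auto
  let ?c = "8 * 4 ^ ?T :: ennreal"
  have run: "AE w in Om j (Suc K). \<forall>n\<in>{..?T}. AE y in Q n. integrable (path_run S a (a + n) y (?T - n)) (dev j (Suc K) ?T w)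
   & (LINT y'|path_run S a (a + n) y (?T - n). dev j (Suc K) ?T w y') = dev j (Suc K) n w y"
   using AE_dev_run[OF j, of _ "Suc K"] by (intro AE_finite_allI) auto
  have "(\<integral>\<^sup>+w. \<integral>\<^sup>+c. ennreal (min 1 ((rmd j (Suc K) w c)^2)) \<partial>fl (Suc K) (Suc j) \<partial>Om j (Suc K))
   <= (\<integral>\<^sup>+w. (rem ?T (Suc K) + ?c * (\<Sum>i<?T. A i i K w * okw j w + A (Suc i) i K w * okw j w)) + indicator {w : space (Om j (Suc K)). \<not> ok j w} w \<partial>Om j (Suc K))"
  proof (rule nn_integral_mono_AE)
   show "AE w in Om j (Suc K). (\<integral>\<^sup>+c. ennreal (min 1 ((rmd j (Suc K) w c)^2)) \<partial>fl (Suc K) (Suc j))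
    <= (rem ?T (Suc K) + ?c * (\<Sum>i<?T. A i i K w * okw j w + A (Suc i) i K w * okw j w)) + indicator {w : space (Om j (Suc K)). \<not> ok j w} w"
    using AE_dev[OF j, of "Suc K"] run AE_space
   proof eventually_elim
    case (elim w)
    show ?case
    proof (cases "ok j w")
     case False
     interpret L: prob_space "fl (Suc K) (Suc j)" by (rule prob_space_fl)
     have "(\<integral>\<^sup>+c. ennreal (min 1 ((rmd j (Suc K) w c)^2)) \<partial>fl (Suc K) (Suc j)) <= (\<integral>\<^sup>+c. 1 \<partial>fl (Suc K) (Suc j))"
      by (intro nn_integral_mono) simp
     also have "... = 1" by (simp add: L.emeasure_space_1)
     finally show ?thesis using False elim(3) by (simp add: add_increasing)
    next
     case True
     interpret e: smc_block_fun S "Suc j" "dev j (Suc K) ?T w" using elim(1) by simp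
     have g0: "e.g0 = emp j (Suc K) w (fh a) - psi" unfolding e.g0_def using elim(1) by simp
     have gn: "AE y in Q n. e.gn n y = dev j (Suc K) n w y" if "n <= ?T" for n
     proof -
      have "AE y in Q n. integrable (path_run S a (a + n) y (?T - n)) (dev j (Suc K) ?T w)
       & (LINT y'|path_run S a (a + n) y (?T - n). dev j (Suc K) ?T w y') = dev j (Suc K) n w y" using elim(2) that by (elim ballE[where x=n]) auto
      then show ?thesis by eventually_elim (simp add: e.gn_def)
     qed
     have sq: "(\<integral>\<^sup>+x. ennreal (h k x * (e.gn (Suc n) x)^2) \<partial>Q (Suc n)) = A k n K w" if "n < ?T" for k n
      unfolding A_def using gn[of "Suc n"] that by (intro nn_integral_cong_AE) (auto elim!: eventually_mono)
     have "(\<integral>\<^sup>+c. ennreal (min 1 ((rmd j (Suc K) w c)^2)) \<partial>fl (Suc K) (Suc j))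
      = (\<integral>\<^sup>+c. ennreal (min 1 (real (Suc K) * (wavg (Suc K) (e.gn ?T) c - e.g0)^2)) \<partial>law ?T (Suc K))" unfolding fl_Suc[OF j]
     proof (intro nn_integral_cong)
      fix c assume c: "c : space (law ?T (Suc K))"
      have "wavg (Suc K) (e.gn ?T) c = wavg (Suc K) (dev j (Suc K) ?T w) c"
       unfolding wavg_def using c by (intro arg_cong2[where f="(/)"] sum.cong refl) (simp add: e.gn_T cloud_component space_law)
      then show "ennreal (min 1 ((rmd j (Suc K) w c)^2)) = ennreal (min 1 (real (Suc K) * (wavg (Suc K) (e.gn ?T) c - e.g0)^2))"
       by (simp only: rmd_def g0 power_mult_distrib real_sqrt_pow2 of_nat_0_le_iff)
     qed
     also have "... <= rem ?T (Suc K) + ?c * (\<Sum>i<?T. A i i K w + A (Suc i) i K w)" using e.moment_bound[OF order_refl K1] by (simp add: sq)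
     finally show ?thesis using True by simp
    qed
   qed
  qed
  also have "... = u K"
  proof -
   have [measurable]: "(%w. A k n K w * okw j w) : bm (Om j (Suc K))" if "n < ?T" "k <= Suc n" for k n using that by measurable
   have m: "(%w. \<Sum>i<?T. A i i K w * okw j w + A (Suc i) i K w * okw j w) : bm (Om j (Suc K))"
    by (intro borel_measurable_sum borel_measurable_add) simp_all
   have "(\<integral>\<^sup>+w. (\<Sum>i<?T. A i i K w * okw j w + A (Suc i) i K w * okw j w) \<partial>Om j (Suc K))
    = (\<Sum>i<?T. (\<integral>\<^sup>+w. A i i K w * okw j w \<partial>Om j (Suc K)) + (\<integral>\<^sup>+w. A (Suc i) i K w * okw j w \<partial>Om j (Suc K)))"
    by (subst nn_integral_sum) (auto intro!: sum.cong nn_integral_add)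
   then show ?thesis unfolding u_def using m by (simp add: nn_integral_add nn_integral_cmult O.emeasure_space_1)
  qed
  finally show ?thesis .
 qed
 have "u \<longlonglongrightarrow> (0 + 8 * 4 ^ ?T * (\<Sum>i<?T. 0 + 0)) + 0" unfolding u_def
 proof (intro tendsto_add ennreal_tendsto_cmult tendsto_sum ok_prob)
  show "(%K. rem ?T (Suc K)) \<longlonglongrightarrow> 0" by (rule LIMSEQ_Suc[OF rem_tendsto]) simp
  show "(%K. \<integral>\<^sup>+w. A i i K w * okw j w \<partial>Om j (Suc K)) \<longlonglongrightarrow> 0" if "i : {..<?T}" for i
   unfolding A_def using that by (intro dev_sq_tendsto j) auto
  show "(%K. \<integral>\<^sup>+w. A (Suc i) i K w * okw j w \<partial>Om j (Suc K)) \<longlonglongrightarrow> 0" if "i : {..<?T}" for i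
   unfolding A_def using that by (intro dev_sq_tendsto j) auto
 qed (use j in \<open>auto simp: ennreal_mult_less_top power_less_top_ennreal\<close>)
 then have u: "u \<longlonglongrightarrow> 0" by simp
 show ?thesis by (rule tendsto_sandwich[OF _ _ tendsto_const u]; rule always_eventually; rule allI) (rule zero_le, rule le)
qed

definition block_var :: "nat => real" where
 "block_var j = (\<Sum>n<T. smc_block_sq.var_prop S (Suc j) (gs j T) n + smc_block_sq.var_res S (Suc j) (gs j T) n)"

definition cfe :: "nat => real => nat => complex" where
 "cfe j s K = (CLINT w|Om j (Suc K). iexp (s * (sqrt (Suc K) * (emp j (Suc K) w (fh (st j)) - psi))))"

text \<open>The scaled error is the sum of \<open>Y\<close>, which depends only on the new filter,
  of the previous error \<open>X j\<close>, which depends only on the earlier ones, and of the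
  remainder. Independence makes the characteristic function of the first two a product, and
  \<open>cmod_iexp_diff_le\<close> removes the remainder.\<close>

lemma cfe_Suc:
 assumes j: "j < n_blocks S" and lim: "cfe j s \<longlonglongrightarrow> z"
 shows "cfe (Suc j) s \<longlonglongrightarrow> z * exp (- (s\<^sup>2 * block_var j / 2))"
proof -
 interpret smc_block_sq S "Suc j" "gs j T" by (rule block_sq[OF j])
 let ?T = "T"
 have j': "j <= n_blocks S" and Sj: "Suc j <= n_blocks S" using j by auto
 have g0: "g0 = psi" unfolding g0_def by (rule gs_integral[OF j order_refl])
 define Y where "Y K c = sqrt (Suc K) * (wavg (Suc K) (gn ?T) c - g0)" for K c
 define X where "X j K w = sqrt (Suc K) * (emp j (Suc K) w (fh (st j)) - psi)" for j K w
 define b where "b K = (CLINT c|law ?T (Suc K). iexp (s * Y K c))" for K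
 define l where "l K = (\<integral>\<^sup>+w. \<integral>\<^sup>+c. ennreal (min 1 ((rmd j (Suc K) w c)^2)) \<partial>fl (Suc K) (Suc j) \<partial>Om j (Suc K))" for K
 have l: "l \<longlonglongrightarrow> 0" unfolding l_def by (rule rmd_tendsto[OF j])
 have b: "b \<longlonglongrightarrow> exp (- (s\<^sup>2 * block_var j / 2))"
  unfolding b_def Y_def block_var_def using LIMSEQ_Suc[OF cf_tendsto[OF order_refl]] .
 have bound: "ennreal (cmod (cfe (Suc j) s K - cfe j s K * b K)) <= ennreal d + ennreal ((4 + s\<^sup>2) / d) * l K" if d: "0 < d" for d K
 proof -
  interpret O: prob_space "Om (Suc j) (Suc K)" by (rule prob_space_Om)
  have XS[measurable]: "X (Suc j) K : bm (Om (Suc j) (Suc K))"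
   unfolding X_def by (intro borel_measurable_times borel_measurable_diff borel_measurable_const emp_measurable_Om Sj fh_measurable st_le)
  have Xm[measurable]: "X j K : bm (Om (Suc j) (Suc K))" unfolding X_def
  proof (intro borel_measurable_times borel_measurable_diff borel_measurable_const emp_measurable[OF j'])
   show "(%w. w i) : Om (Suc j) (Suc K) \<rightarrow>\<^sub>M cl (Suc K) i" if "i : {1..j}" for i using that by (intro Om_component Sj) auto
   show "(%(l, x). fh (st j) x) : bm (Om (Suc j) (Suc K) \<Otimes>\<^sub>M paths S {0<..st j})"
    unfolding case_prod_beta' by (rule mcomp[OF measurable_snd fh_measurable[OF st_le[OF j']]])
  qed
  have Yc: "Y K : bm (cl (Suc K) (Suc j))"
   unfolding Y_def using wavg_measurable[OF gn_measurable[OF order_refl], of "Suc K"] by measurable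
  have [measurable]: "(%w. Y K (w (Suc j))) : bm (Om (Suc j) (Suc K))" by (rule mcomp[OF Om_component[OF Sj] Yc]) simp
  \<comment> \<open>A function of all filters at once, so that its measurability is inherited from
    \<open>X\<close> and \<open>Y\<close>; \<open>Rr\<close> identifies it with the
    remainder.\<close>
  define R where "R w = X (Suc j) K w - (Y K (w (Suc j)) + X j K w)" for w
  have [measurable]: "R : bm (Om (Suc j) (Suc K))" unfolding R_def by measurable
  have Rr: "R (w(Suc j := c)) = rmd j (Suc K) w c" if c: "c : space (fl (Suc K) (Suc j))" for w c
  proof -
   have "wavg (Suc K) (gn ?T) c = wavg (Suc K) (gs j ?T) c" unfolding wavg_def using c[unfolded fl_Suc[OF j]]
    by (intro arg_cong2[where f="(/)"] sum.cong refl) (simp add: gn_T cloud_component space_law)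
   then have "R (w(Suc j := c)) = sqrt (Suc K) * (wavg (Suc K) (%y. emp j (Suc K) w (%x. fh (st j + ?T) (mrg (st j) (st j + ?T) x y))) c
     - wavg (Suc K) (gs j ?T) c - (emp j (Suc K) w (fh (st j)) - psi))"
    unfolding R_def X_def Y_def g0 emp_Suc_wavg[OF j] st_Suc emp_upd[OF lessI] by (simp add: algebra_simps del: of_nat_Suc)
   also have "wavg (Suc K) (%y. emp j (Suc K) w (%x. fh (st j + ?T) (mrg (st j) (st j + ?T) x y))) c - wavg (Suc K) (gs j ?T) c
    = wavg (Suc K) (dev j (Suc K) ?T w) c" unfolding wavg_def dev_def by (simp add: right_diff_distrib sum_subtractf diff_divide_distrib)
   finally show ?thesis by (simp only: rmd_def)
  qed
  let ?f = "%w. iexp (s * X (Suc j) K w)" and ?g = "%w. iexp (s * (Y K (w (Suc j)) + X j K w))"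
  have fi: "integrable (Om (Suc j) (Suc K)) ?f" and gi: "integrable (Om (Suc j) (Suc K)) ?g" by (rule O.integrable_const_bound[where B=1]; simp)+
  have "(CLINT w|Om (Suc j) (Suc K). ?g w) = (CLINT w|Om j (Suc K). CLINT c|fl (Suc K) (Suc j). iexp (s * Y K c) * iexp (s * X j K w))"
   unfolding integral_Om_Suc[OF gi] unfolding X_def by (simp add: emp_upd distrib_left exp_add[symmetric] algebra_simps)
  also have "... = cfe j s K * b K" unfolding fl_Suc[OF j] b_def cfe_def X_def by (simp add: mult.commute del: of_nat_Suc)
  finally have gint: "(CLINT w|Om (Suc j) (Suc K). ?g w) = cfe j s K * b K" .
  have "cfe (Suc j) s K - cfe j s K * b K = (CLINT w|Om (Suc j) (Suc K). ?f w - ?g w)"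
   unfolding gint[symmetric] using fi gi by (simp add: cfe_def X_def)
  then have "ennreal (cmod (cfe (Suc j) s K - cfe j s K * b K)) <= (\<integral>\<^sup>+w. ennreal (cmod (?f w - ?g w)) \<partial>Om (Suc j) (Suc K))"
   using integral_norm_bound_ennreal[of "Om (Suc j) (Suc K)" "%w. ?f w - ?g w"] fi gi by simp
  also have "... <= (\<integral>\<^sup>+w. ennreal d + ennreal ((4 + s\<^sup>2) / d) * ennreal (min 1 ((R w)^2)) \<partial>Om (Suc j) (Suc K))"
  proof (rule nn_integral_mono)
   fix w
   have "?f w - ?g w = ?g w * (iexp (s * R w) - 1)" by (simp add: R_def algebra_simps exp_add[symmetric])
   then have "cmod (?f w - ?g w) = cmod (iexp (s * R w) - 1)" by (simp only: norm_mult cmod_iexp mult_1)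
   also have "... <= d + (4 + s\<^sup>2) / d * min 1 ((R w)^2)" by (rule cmod_iexp_diff_le[OF d])
   finally have "ennreal (cmod (?f w - ?g w)) <= ennreal (d + (4 + s\<^sup>2) / d * min 1 ((R w)^2))" by (rule ennreal_leI)
   then show "ennreal (cmod (?f w - ?g w)) <= ennreal d + ennreal ((4 + s\<^sup>2) / d) * ennreal (min 1 ((R w)^2))"
    using d by (subst ennreal_mult'[symmetric], simp, subst ennreal_plus[symmetric]) (simp_all add: min_def)
  qed
  also have "... = ennreal d + ennreal ((4 + s\<^sup>2) / d) * (\<integral>\<^sup>+w. ennreal (min 1 ((R w)^2)) \<partial>Om (Suc j) (Suc K))"
   by (simp add: nn_integral_add nn_integral_cmult O.emeasure_space_1)
  also have "(\<integral>\<^sup>+w. ennreal (min 1 ((R w)^2)) \<partial>Om (Suc j) (Suc K)) = l K"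
   unfolding l_def by (subst nn_integral_Om_Suc, measurable) (intro nn_integral_cong, simp add: Rr)
  finally show ?thesis .
 qed
 have "(%K. cfe (Suc j) s K - cfe j s K * b K) \<longlonglongrightarrow> 0"
 proof (rule tendstoI)
  fix e :: real assume e: "0 < e"
  let ?C = "ennreal ((4 + s\<^sup>2) / (e / 2))"
  have "(%K. ennreal (e / 2) + ?C * l K) \<longlonglongrightarrow> ennreal (e / 2) + ?C * 0"
   by (intro tendsto_add tendsto_const ennreal_tendsto_cmult l) simp
  then have "(%K. ennreal (e / 2) + ?C * l K) \<longlonglongrightarrow> ennreal (e / 2)" by simp
  then have "\<forall>\<^sub>F K in sequentially. ennreal (e / 2) + ?C * l K < ennreal e"
   using e by (intro order_tendstoD(2)) (auto intro: ennreal_lessI)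
  then show "\<forall>\<^sub>F K in sequentially. dist (cfe (Suc j) s K - cfe j s K * b K) 0 < e"
  proof eventually_elim
   case (elim K)
   from order.strict_trans1[OF bound[of "e / 2" K] elim] e show ?case by (simp add: ennreal_less_iff)
  qed
 qed
 from tendsto_add[OF this tendsto_mult[OF lim b]] show ?thesis by simp
qed

lemma cfe_tendsto: "j <= n_blocks S ==> cfe j s \<longlonglongrightarrow> exp (- (s\<^sup>2 * (\<Sum>i<j. block_var i) / 2))"
proof (induction j)
 case 0
 have "cfe 0 s = (%K. 1)" using prob_space.prob_space[OF prob_space_Om] by (simp add: fun_eq_iff cfe_def fh_0)
 then show ?case by simp
next
 case (Suc j)
 have "complex_of_real (exp (- (s\<^sup>2 * (\<Sum>i<Suc j. block_var i) / 2))) = exp (- (s\<^sup>2 * (\<Sum>i<j. block_var i) / 2)) * exp (- (s\<^sup>2 * block_var j / 2))"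
  by (simp add: of_real_mult[symmetric] exp_add[symmetric] algebra_simps add_divide_distrib del: of_real_mult)
 with cfe_Suc[of j s, OF _ Suc.IH] Suc.prems show ?case by simp
qed

end

section \<open>The importance ratio and the target function\<close>

context smc_model begin

abbreviation target :: "(nat => 'x) => real" where
 "target x \<equiv> test_fun S x * lik_ratio S x"

lemma prod_prop_at:
 shows prod_prop_at_measurable: "(%x. \<Prod>t=1..horizon S. prop_at S t x) : bm (paths S {0<..horizon S})"
  and prod_prop_at_nonneg: "x : space (paths S {0<..horizon S}) ==> 0 <= (\<Prod>t=1..horizon S. prop_at S t x)"
 by (intro borel_measurable_prod prop_at_measurable, auto)
  (intro prod_nonneg ballI prop_at_nonneg[where I="{0<..horizon S}"], auto)

text \<open>The point is a vanishing denominator, where the quotient is 0 by convention. If some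
  proposal density is zero, then by \<open>prop_pos\<close> the transition density is zero at the
  same time, and so is the posterior density.\<close>

lemma lik_ratio_mult:
 assumes x: "x : space (paths S {0<..horizon S})"
 shows "(\<Prod>t=1..horizon S. prop_at S t x) * lik_ratio S x = post_dens S x"
proof (cases "(\<Prod>t=1..horizon S. prop_at S t x) = 0")
 case True
 then obtain t where t: "t : {1..horizon S}" "prop_at S t x = 0" by (auto simp: prod_zero_iff)
 have xs: "x s : space (state_measure S)" if "s : {1..horizon S}" for s using x that by (auto simp: paths_def space_PiM PiE_iff)
 have sub: "{1..t} \<subseteq> {0<..horizon S}" using t(1) by auto
 have "prop_at S t (restrict x {1..t}) = prop_at S t x"
  using t(1) unfolding prop_at_def by (auto intro!: arg_cong2[where f="prop_dens S t"] simp: restrict_def fun_eq_iff)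
 moreover have "trans_at S t (restrict x {1..t}) = trans_at S t x" using t(1) by (auto simp: trans_at_def)
 ultimately have "\<not> 0 < trans_at S t x" using prop_pos[OF t(1) space_paths_restrict[OF x sub]] t(2) by auto
 moreover have "0 <= trans_at S t x"
  proof (cases "t = 1")
  case False
  then have "t - 1 : {1..horizon S}" using t(1) by auto
  from xs[OF this] xs[OF t(1)] show ?thesis using False by (simp add: trans_at_def trans_nonneg)
 qed (use t(1) xs in \<open>auto simp: trans_at_def intro!: init_nonneg\<close>)
 ultimately have "trans_at S t x = 0" by simp
 then have "joint_dens S x = 0" using t(1) by (auto simp: joint_dens_def)
 then show ?thesis using True by (simp add: post_dens_def)
qed (simp add: lik_ratio_def)

lemma joint_measurable: "joint_dens S : bm (paths S {0<..horizon S})"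
 using borel_measurable_integrable[OF joint_integrable] by (simp add: atLeast1AtMost_eq)

lemma
 shows target_measurable: "target : bm (paths S {0<..horizon S})"
  and target_integrable: "integrable (marg (horizon S)) target"
  and target_integral: "(LINT x|marg (horizon S). target x) = post_mean S"
proof -
 note [measurable] = joint_measurable prod_prop_at_measurable test_measurable[unfolded atLeast1AtMost_eq]
 show m[measurable]: "target : bm (paths S {0<..horizon S})" unfolding lik_ratio_def post_dens_def by measurable
 have d: "marg (horizon S) = density (paths S {0<..horizon S}) (%x. ennreal (\<Prod>t=1..horizon S. prop_at S t x))"
  unfolding prop_law_eq_marg[symmetric] prop_law_def by (simp add: atLeast1AtMost_eq)
 have nn: "AE x in paths S {0<..horizon S}. 0 <= (\<Prod>t=1..horizon S. prop_at S t x)" by (intro AE_I2 prod_prop_at_nonneg)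
 have e: "(\<Prod>t=1..horizon S. prop_at S t x) *\<^sub>R target x = test_fun S x * post_dens S x" if "x : space (paths S {0<..horizon S})" for x
  using lik_ratio_mult[OF that] by (simp add: mult_ac)
 have i: "integrable (paths S {0<..horizon S}) (%x. test_fun S x * post_dens S x)" using test_integrable by (simp add: atLeast1AtMost_eq)
 show "integrable (marg (horizon S)) target" unfolding d
  by (subst integrable_density[OF m prod_prop_at_measurable nn]) (rule Bochner_Integration.integrable_cong[THEN iffD2, OF refl e i])
 show "(LINT x|marg (horizon S). target x) = post_mean S"
  unfolding d integral_density[OF m prod_prop_at_measurable nn] post_mean_def unfolding atLeast1AtMost_eq[of "horizon S", symmetric]
  by (rule Bochner_Integration.integral_cong[OF refl]) (rule e, simp add: atLeast1AtMost_eq)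
qed

end

sublocale smc_model \<subseteq> clt: smc_clt S target by unfold_locales (rule target_measurable target_integrable)+

context smc_model begin

lemma psi_eq: "clt.psi = post_mean S" by (simp add: clt.psi_def target_integral)

subsection \<open>The estimator as an average over joined paths\<close>

lemma blk_le: "t : {0<..st j} ==> blk S t : {1..j}"
proof -
 assume "t : {0<..st j}"
 then have "t - 1 < j * T" by (auto simp: blk_start_def)
 then have "(t - 1) div T < j" using blk_len_pos by (simp add: div_less_iff_less_mult)
 then show ?thesis by (simp add: blk_def)
qed

text \<open>\<open>joined_path\<close> cut after \<open>j\<close> blocks, as the induction in
  \<open>emp_eq_sum\<close> needs it.\<close>

definition jpath :: "nat => (nat => nat => (nat => 'x) \<times> real) => (nat => nat) => nat => 'x" where
 "jpath j w k = (\<lambda>t\<in>{0<..st j}. fst (w (blk S t) (k (blk S t))) t)"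

lemma jpath_Suc:
 assumes j: "j < n_blocks S"
 shows "jpath (Suc j) w (k(Suc j := i)) = mrg (st j) (st j + T) (jpath j w k) (fst (w (Suc j) i))"
proof (rule ext)
 fix t
 interpret smc_block S "Suc j" by (rule block[OF j])
 consider "t : {0<..st j}" | "t : {st j<..st j + T}" | "t \<notin> {0<..st j + T}" by force
 then show "jpath (Suc j) w (k(Suc j := i)) t = mrg (st j) (st j + T) (jpath j w k) (fst (w (Suc j) i)) t"
 proof cases
  case 1
  then show ?thesis using blk_le[OF 1] by (auto simp: jpath_def st_Suc mrg_def merge_def)
 next
  case 2
  then show ?thesis using blk_a'[OF 2] by (auto simp: jpath_def st_Suc mrg_def merge_def)
 next
  case 3
  then show ?thesis by (auto simp: jpath_def st_Suc mrg_def merge_def)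
 qed
qed

lemma emp_eq_sum:
 "j <= n_blocks S ==> emp j K w phi = (\<Sum>k\<in>{1..j} \<rightarrow>\<^sub>E {1..K}. (\<Prod>n=1..j. snd (w n (k n))) * phi (jpath j w k)) / real K ^ j"
proof (induction j arbitrary: phi)
 case 0
 then show ?case by (simp add: jpath_def)
next
 case (Suc j)
 then have j: "j < n_blocks S" by simp
 let ?f = "%k. (\<Prod>n=1..Suc j. snd (w n (k n))) * phi (jpath (Suc j) w k)"
 have "(\<Sum>k\<in>{1..Suc j} \<rightarrow>\<^sub>E {1..K}. ?f k) = (\<Sum>(i, k)\<in>{1..K} \<times> ({1..j} \<rightarrow>\<^sub>E {1..K}). ?f (k(Suc j := i)))"
  unfolding atLeastAtMost_Suc_insert PiE_insert_eq by (subst sum.reindex[OF inj_combinator]) (auto simp: case_prod_beta' intro!: sum.cong)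
 also have "... = (\<Sum>i=1..K. \<Sum>k\<in>{1..j} \<rightarrow>\<^sub>E {1..K}. ?f (k(Suc j := i)))" by (simp add: sum.cartesian_product)
 also have "... = (\<Sum>i=1..K. snd (w (Suc j) i) * (\<Sum>k\<in>{1..j} \<rightarrow>\<^sub>E {1..K}. (\<Prod>n=1..j. snd (w n (k n))) *
   phi (mrg (st j) (st j + T) (jpath j w k) (fst (w (Suc j) i)))))" unfolding sum_distrib_left
 proof (intro sum.cong refl)
  fix i k
  have "(\<Prod>n=1..j. snd (w n ((k(Suc j := i)) n))) = (\<Prod>n=1..j. snd (w n (k n)))" by (intro prod.cong) auto
  then show "?f (k(Suc j := i)) = snd (w (Suc j) i) * ((\<Prod>n=1..j. snd (w n (k n))) * phi (mrg (st j) (st j + T) (jpath j w k) (fst (w (Suc j) i))))"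
   by (simp add: jpath_Suc[OF j])
 qed
 finally show ?case unfolding emp.simps Suc.IH[OF less_imp_le[OF j]]
  by (simp only: times_divide_eq_right sum_divide_distrib[symmetric] divide_divide_eq_left power_Suc2)
qed

lemma psi_hat_eq: "psi_hat S K w = emp (n_blocks S) K w target"
proof -
 have "joined_path S w k = jpath (n_blocks S) w k" for k by (simp add: joined_path_def jpath_def horizon_def blk_start_def atLeast1AtMost_eq)
 then show ?thesis by (simp add: psi_hat_def emp_eq_sum joined_H_def mult_ac)
qed

subsection \<open>Conditional expectations\<close>

text \<open>Every set of the coordinate algebra is the preimage of a set in the path space over
  \<open>I\<close>, so the characterising property of the conditional expectation only has to be
  tested there.\<close>

lemma cond_exp_coord:
 assumes I: "I \<subseteq> {0<..horizon S}" and f: "integrable (prop_law S) f"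
  and G: "G : bm (paths S I)" and Gi: "integrable (prop_law S) (%x. G (restrict x I))"
  and eq: "\<And>A. A : sets (paths S I) ==>
   (LINT x|prop_law S. indicator A (restrict x I) * f x) = (LINT x|prop_law S. indicator A (restrict x I) * G (restrict x I))"
 shows "AE x in prop_law S. real_cond_exp (prop_law S) (coord_alg S I) f x = G (restrict x I)"
proof -
 interpret prob_space "prop_law S" by (rule prob_space_prop_law)
 have r: "(%x. restrict x I) : prop_law S \<rightarrow>\<^sub>M paths S I" by (rule measurable_prop_law_restrict[OF I])
 have sp: "(%x. restrict x I) : space (prop_law S) \<rightarrow> space (paths S I)" using measurable_space[OF r] by auto
 have s: "sets (coord_alg S I) = {(%x. restrict x I) -` A \<inter> space (prop_law S) | A. A : sets (paths S I)}"
  unfolding coord_alg_def by (rule sets_vimage_algebra2[OF sp])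
 interpret finite_measure_subalgebra "prop_law S" "coord_alg S I"
 proof
  show "subalgebra (prop_law S) (coord_alg S I)" unfolding subalgebra_def s using measurable_sets[OF r] by (auto simp: coord_alg_def)
 qed
 show ?thesis
 proof (rule real_cond_exp_charact[OF _ f Gi])
  show "(%x. G (restrict x I)) : bm (coord_alg S I)"
   unfolding coord_alg_def by (rule mcomp[OF measurable_vimage_algebra1[OF sp] G])
  fix A assume "A : sets (coord_alg S I)"
  then obtain C where C: "C : sets (paths S I)" "A = (%x. restrict x I) -` C \<inter> space (prop_law S)" unfolding s by blast
  have "set_lebesgue_integral (prop_law S) A g = (LINT x|prop_law S. indicator C (restrict x I) * g x)" for g :: "_ => real"
   unfolding set_lebesgue_integral_def C(2) by (intro Bochner_Integration.integral_cong refl) (auto split: split_indicator)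
  then show "set_lebesgue_integral (prop_law S) A f = set_lebesgue_integral (prop_law S) A (%x. G (restrict x I))" using eq[OF C(1)] by simp
 qed
qed

lemma
 fixes G :: "_ => real"
 assumes t: "t <= horizon S" and G: "G : bm (paths S {0<..t})"
 shows integrable_marg_restrict: "integrable (prop_law S) (%x. G (restrict x {0<..t})) \<longleftrightarrow> integrable (marg t) G"
  and integral_marg_restrict: "(LINT x|prop_law S. G (restrict x {0<..t})) = (LINT x|marg t. G x)"
proof -
 have r: "(%x. restrict x {0<..t}) : prop_law S \<rightarrow>\<^sub>M paths S {0<..t}" using t by (intro measurable_prop_law_restrict) auto
 show "integrable (prop_law S) (%x. G (restrict x {0<..t})) \<longleftrightarrow> integrable (marg t) G"
  "(LINT x|prop_law S. G (restrict x {0<..t})) = (LINT x|marg t. G x)"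
  unfolding distr_marg_restrict[OF t, symmetric] by (simp_all add: integrable_distr_eq[OF r G] integral_distr[OF r G])
qed

text \<open>Conditioning on the first \<open>t\<close> coordinates leaves an integral along a run,
  on which the indicator of an event of these coordinates is almost surely constant and can be
  pulled out.\<close>

lemma f_fun_AE:
 assumes t: "t : {1..horizon S}"
 shows "AE x in prop_law S. f_fun S t x = clt.fh t (restrict x {0<..t})"
proof -
 have t': "t <= horizon S" using t by simp
 note fm = clt.fh_measurable[OF t']
 have ti: "integrable (prop_law S) target" unfolding prop_law_eq_marg by (rule target_integrable)
 have "AE x in prop_law S. real_cond_exp (prop_law S) (coord_alg S {0<..t}) target x = clt.fh t (restrict x {0<..t})"
 proof (rule cond_exp_coord[OF _ ti fm])
  show "{0<..t} \<subseteq> {0<..horizon S}" using t by auto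
  show "integrable (prop_law S) (%x. clt.fh t (restrict x {0<..t}))" unfolding integrable_marg_restrict[OF t' fm] by (rule clt.integrable_fh[OF t'])
  fix A assume A: "A : sets (paths S {0<..t})"
  let ?r = "horizon S - t" and ?g = "%x. indicator A (restrict x {0<..t}) * target x"
  interpret mg: prob_space "marg t" by (rule prob_space_marg[OF t'])
  have iA: "(indicator A :: _ => real) : bm (paths S {0<..t})" using A by measurable
  have k: "(%z. path_run S 0 t z ?r) : marg t \<rightarrow>\<^sub>M prob_algebra (paths S {0<..horizon S})" using run_kernel0[of t ?r] t' by simp
  have gi: "integrable (marg t \<bind> (%z. path_run S 0 t z ?r)) ?g"
  proof -
   have "(%x. indicator A (restrict x {0<..t}) :: real) : bm (prop_law S)"
    by (rule mcomp[OF measurable_prop_law_restrict iA]) (use t in auto)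
   then have "integrable (prop_law S) ?g"
    by (intro Bochner_Integration.integrable_bound[OF ti] borel_measurable_times borel_measurable_integrable[OF ti] AE_I2) (auto split: split_indicator)
   then show ?thesis using prop_law_eq_bind[OF t'] by simp
  qed
  have "(LINT x|prop_law S. ?g x) = (LINT z|marg t. LINT x|path_run S 0 t z ?r. ?g x)"
   unfolding prop_law_eq_bind[OF t'] by (rule integral_bind[OF k mg.not_empty gi])
  also have "... = (LINT z|marg t. indicator A z * clt.fh t z)"
  proof (rule Bochner_Integration.integral_cong[OF refl])
   fix z assume "z : space (marg t)"
   then have z: "z : space (paths S {0<..t})" by (simp add: space_marg[OF t'])
   have s: "sets (path_run S 0 t z ?r) = sets (paths S {0<..horizon S})" using sets_run[of 0 t ?r z] t' z by simp
   have m1: "(%x. indicator A (restrict x {0<..t}) :: real) : bm (path_run S 0 t z ?r)" unfolding mcs[OF s refl]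
    by (rule mcomp[OF measurable_paths_restrict iA]) (use t in auto)
   have m2: "target : bm (path_run S 0 t z ?r)" unfolding mcs[OF s refl] by (rule target_measurable)
   have "AE x in path_run S 0 t z ?r. indicator A (restrict x {0<..t}) = (indicator A z :: real)"
    by (rule AE_run_restrict[OF _ _ z iA]) (use t' in auto)
   then have "(LINT x|path_run S 0 t z ?r. ?g x) = (LINT x|path_run S 0 t z ?r. indicator A z * target x)"
    using m1 m2 by (intro integral_cong_AE) (auto elim!: eventually_mono)
   then show "(LINT x|path_run S 0 t z ?r. ?g x) = indicator A z * clt.fh t z" by (simp add: clt.fh_def)
  qed
  also have "... = (LINT x|prop_law S. indicator A (restrict x {0<..t}) * clt.fh t (restrict x {0<..t}))"
   using iA fm by (intro integral_marg_restrict[OF t', symmetric]) (rule borel_measurable_times)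
  finally show "(LINT x|prop_law S. ?g x) = (LINT x|prop_law S. indicator A (restrict x {0<..t}) * clt.fh t (restrict x {0<..t}))" .
 qed
 then show ?thesis using t by (simp add: f_fun_def atLeast1AtMost_eq)
qed

end

context smc_block begin

lemma distr_block_restrict:
 assumes n: "n <= T"
 shows "distr (prop_law S) (B n) (%x. restrict x {a<..a + n}) = Q n"
proof -
 interpret pair_prob_space "marg a" "Q n" by (rule pair_prob_space_marg_Q[OF n])
 have r: "(%x. restrict x {0<..a + n}) : prop_law S \<rightarrow>\<^sub>M paths S {0<..a + n}"
  using a_n_le[OF n] by (intro measurable_prop_law_restrict) auto
 have r2: "(%x. restrict x {a<..a + n}) : paths S {0<..a + n} \<rightarrow>\<^sub>M B n" by (rule measurable_paths_restrict) auto
 have sn: "snd : marg a \<Otimes>\<^sub>M Q n \<rightarrow>\<^sub>M B n"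
  using measurable_snd[of "marg a" "Q n"] unfolding mcs[OF refl sets_Q[OF n]] .
 have "{0<..a + n} \<inter> {a<..a + n} = {a<..a + n}" by auto
 then have "distr (prop_law S) (B n) (%x. restrict x {a<..a + n})
  = distr (distr (prop_law S) (paths S {0<..a + n}) (%x. restrict x {0<..a + n})) (B n) (%x. restrict x {a<..a + n})"
  by (simp add: distr_distr[OF r2 r] comp_def restrict_restrict)
 also have "... = distr (marg a \<Otimes>\<^sub>M Q n) (B n) ((%x. restrict x {a<..a + n}) \<circ> (%(x, y). mrg a (a + n) x y))"
  unfolding distr_marg_restrict[OF a_n_le[OF n]] marg_eq_distr[OF n] by (rule distr_distr[OF r2 mrg_pair_measurable[OF n]])
 also have "... = distr (marg a \<Otimes>\<^sub>M Q n) (B n) snd"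
  by (intro distr_cong refl) (auto simp: mrg_restrict_right space_pair_measure space_Q[OF n] restrict_space_paths)
 also have "... = Q n"
 proof (rule measure_eqI)
  fix A assume "A : sets (distr (marg a \<Otimes>\<^sub>M Q n) (B n) snd)"
  then have A: "A : sets (B n)" by simp
  then have "snd -` A \<inter> space (marg a \<Otimes>\<^sub>M Q n) = space (marg a) \<times> A"
   using sets.sets_into_space[OF A] by (auto simp: space_pair_measure space_Q[OF n])
  then show "emeasure (distr (marg a \<Otimes>\<^sub>M Q n) (B n) snd) A = emeasure (Q n) A"
   using A by (simp add: emeasure_distr[OF sn] M2.emeasure_pair_measure_Times sets_Q[OF n] M1.emeasure_space_1)
 qed (simp add: sets_Q[OF n])
 finally show ?thesis .
qed

lemma block_restrict_measurable: "n <= T ==> (%x. restrict x {a<..a + n}) : prop_law S \<rightarrow>\<^sub>M B n"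
 using a_n_le[of n] by (intro measurable_prop_law_restrict) auto

lemma
 fixes G :: "_ => real"
 assumes n: "n <= T" and G: "G : bm (B n)"
 shows integrable_block_restrict: "integrable (prop_law S) (%x. G (restrict x {a<..a + n})) \<longleftrightarrow> integrable (Q n) G"
  and integral_block_restrict: "(LINT x|prop_law S. G (restrict x {a<..a + n})) = (LINT x|Q n. G x)" unfolding distr_block_restrict[OF n, symmetric]
 by (simp_all add: integrable_distr_eq[OF block_restrict_measurable[OF n] G] integral_distr[OF block_restrict_measurable[OF n] G])

end

context smc_model begin

lemma f_blk_AE:
 assumes j: "j < n_blocks S" and n: "n <= T"
 shows "AE x in prop_law S. f_blk S (Suc j) (st j + n) x = clt.gs j n (restrict x {st j<..st j + n})"
proof -
 interpret smc_block S "Suc j" by (rule block[OF j])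
 show ?thesis
 proof (cases "n = 0")
  \<comment> \<open>At the start of a block \<open>f_blk\<close> is the constant f_0 by convention,
    not a conditional expectation. \<open>gs j 0\<close> has the same value, because joining an
    empty block path changes nothing.\<close>
  case True
  have "clt.gs j 0 y = post_mean S" for y
  proof -
   have "(LINT x|marg a. clt.fh a (mrg a a x y)) = (LINT x|marg a. clt.fh a x)"
    by (rule Bochner_Integration.integral_cong[OF refl]) (simp add: space_marg[OF a_le] mrg_self)
   then show ?thesis by (simp add: clt.gs_def clt.integral_fh[OF a_le] psi_eq)
  qed
  then show ?thesis using True by (simp add: f_blk_def f_fun_def)
 next
  case False
  let ?t = "a + n" and ?I = "{a<..a + n}"
  have t: "?t : {1..horizon S}" using False a_n_le[OF n] by auto
  have t': "?t <= horizon S" using t by simp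
  interpret pair_prob_space "marg a" "Q n" by (rule pair_prob_space_marg_Q[OF n])
  interpret pl: prob_space "prop_law S" by (rule prob_space_prop_law)
  note fm = clt.fh_measurable[OF t'] and gm = clt.gs_measurable[OF j n]
  have fi: "integrable (prop_law S) (%x. clt.fh ?t (restrict x {0<..?t}))"
   unfolding integrable_marg_restrict[OF t' fm] by (rule clt.integrable_fh[OF t'])
  have fmm: "f_fun S ?t : bm (prop_law S)" using t by (simp add: f_fun_def)
  have ffi: "integrable (prop_law S) (f_fun S ?t)" using f_fun_AE[OF t] integrable_cong_AE[OF fmm borel_measurable_integrable[OF fi]] fi by simp
  have "AE x in prop_law S. real_cond_exp (prop_law S) (coord_alg S ?I) (f_fun S ?t) x = clt.gs j n (restrict x ?I)"
  proof (rule cond_exp_coord[OF _ ffi gm])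
   show "?I \<subseteq> {0<..horizon S}" using t' by auto
   show "integrable (prop_law S) (%x. clt.gs j n (restrict x ?I))" unfolding integrable_block_restrict[OF n gm] by (rule clt.gs_integrable[OF j n])
   fix A assume A: "A : sets (B n)"
   then have iA: "(indicator A :: _ => real) : bm (B n)" by measurable
   have r2: "(%x. restrict x ?I) : paths S {0<..?t} \<rightarrow>\<^sub>M B n" by (rule measurable_paths_restrict) auto
   let ?g = "%z. indicator A (restrict z ?I) * clt.fh ?t z"
   have g: "?g : bm (paths S {0<..?t})" by (intro borel_measurable_times fm mcomp[OF r2 iA])
   have m1: "(%x. indicator A (restrict x ?I) :: real) : bm (prop_law S)"
    by (rule mcomp[OF block_restrict_measurable[OF n] iA])
   have "{0<..?t} \<inter> ?I = ?I" by auto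
   have "(LINT x|prop_law S. indicator A (restrict x ?I) * f_fun S ?t x) = (LINT x|prop_law S. ?g (restrict x {0<..?t}))"
   proof (rule integral_cong_AE)
    show "(%x. indicator A (restrict x ?I) * f_fun S ?t x) : bm (prop_law S)" using m1 fmm by measurable
    show "(%x. ?g (restrict x {0<..?t})) : bm (prop_law S)"
     by (rule mcomp[OF measurable_prop_law_restrict g]) (use t' in auto)
    show "AE x in prop_law S. indicator A (restrict x ?I) * f_fun S ?t x = ?g (restrict x {0<..?t})"
     using f_fun_AE[OF t] by eventually_elim (simp add: restrict_restrict \<open>{0<..?t} \<inter> ?I = ?I\<close>)
   qed
   also have "... = (LINT z|marg ?t. ?g z)" by (rule integral_marg_restrict[OF t' g])
   also have "... = (LINT z|(marg a \<Otimes>\<^sub>M Q n). (case z of (x, y) => ?g (mrg a ?t x y)))"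
    unfolding marg_eq_distr[OF n] integral_distr[OF mrg_pair_measurable[OF n] g] by (simp add: case_prod_beta')
   also have "... = (LINT y|Q n. LINT x|marg a. ?g (mrg a ?t x y))"
   proof (rule integral_snd[symmetric])
    have "integrable (marg ?t) ?g"
    proof (rule Bochner_Integration.integrable_bound[OF clt.integrable_fh[OF t']])
     show "?g : bm (marg ?t)" using g unfolding mcs[OF sets_marg[OF t'] refl] .
    qed (auto split: split_indicator)
    then show "integrable (marg a \<Otimes>\<^sub>M Q n) (%(x, y). ?g (mrg a ?t x y))"
     unfolding marg_eq_distr[OF n] integrable_distr_eq[OF mrg_pair_measurable[OF n] g] by (simp add: case_prod_beta')
   qed
   also have "... = (LINT y|Q n. indicator A y * clt.gs j n y)" by (rule Bochner_Integration.integral_cong[OF refl])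
     (simp add: mrg_restrict_right space_Q[OF n] restrict_space_paths clt.gs_def)
   also have "... = (LINT x|prop_law S. indicator A (restrict x ?I) * clt.gs j n (restrict x ?I))"
    by (rule integral_block_restrict[OF n, symmetric]) (intro borel_measurable_times iA gm)
   finally show "(LINT x|prop_law S. indicator A (restrict x ?I) * f_fun S ?t x) = (LINT x|prop_law S. indicator A (restrict x ?I) * clt.gs j n (restrict x ?I))" .
  qed
  then show ?thesis using False by (simp add: f_blk_def)
 qed
qed

end

section \<open>The normal law, and sums over pairs and blocks\<close>

lemma
 assumes v: "0 <= v"
 shows real_distribution_normal_law: "real_distribution (normal_law v)"
  and char_normal_law: "char (normal_law v) t = exp (- (t\<^sup>2 * v / 2))"
proof -
 have "real_distribution (normal_law v) & char (normal_law v) t = exp (- (t\<^sup>2 * v / 2))"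
 proof (cases "v = 0")
  \<comment> \<open>For variance 0 the law is the point mass at 0, whose characteristic function is
    the constant 1.\<close>
  case True
  have "prob_space (return borel (0::real))" by (rule prob_space_return) simp
  then show ?thesis using True by (simp add: normal_law_def real_distribution_def real_distribution_axioms_def char_def integral_return)
 next
  case False
  then have v0: "0 < v" using v by simp
  interpret N: real_distribution std_normal_distribution by (rule real_dist_normal_dist)
  have "distributed std_normal_distribution lborel (%x. x) std_normal_density" by (simp add: distributed_def distr_id2)
  from N.normal_density_affine[OF this, of "sqrt v" 0] v0
  have "distributed std_normal_distribution lborel (%x. sqrt v * x) (normal_density 0 (sqrt v))" by simp
  then have e: "normal_law v = distr std_normal_distribution lborel (%x. sqrt v * x)" using False by (simp add: distributed_def normal_law_def)
  have "char (normal_law v) t = (CLINT x|std_normal_distribution. iexp (t * (sqrt v * x)))" unfolding char_def e by (subst integral_distr) auto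
  also have "... = char std_normal_distribution (t * sqrt v)" by (simp add: char_def mult.assoc)
  also have "... = exp (- (t\<^sup>2 * v / 2))" using v by (simp add: char_std_normal_distribution power_mult_distrib)
  finally have "char (normal_law v) t = exp (- (t\<^sup>2 * v / 2))" .
  moreover have "prob_space (normal_law v)" unfolding e by (rule N.prob_space_distr) simp
  ultimately show ?thesis using False by (simp add: real_distribution_def real_distribution_axioms_def normal_law_def)
 qed
 then show "real_distribution (normal_law v)" "char (normal_law v) t = exp (- (t\<^sup>2 * v / 2))" by auto
qed

lemma sum_pairs: "(\<Sum>u=1..2 * N. f u) = (\<Sum>t<N. f (2 * Suc t - 1) + f (2 * Suc t))" for f :: "nat => real"
proof (induction N)
 case (Suc N)
 have "{1..2 * Suc N} = insert (2 * Suc N) (insert (2 * Suc N - 1) {1..2 * N})" by auto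
 then have "(\<Sum>u=1..2 * Suc N. f u) = f (2 * Suc N) + (f (2 * Suc N - 1) + (\<Sum>u=1..2 * N. f u))"
  by (simp del: mult_Suc_right) (subst sum.insert; simp)
 then show ?case using Suc by (simp del: mult_Suc_right)
qed simp

lemma sum_blocks: "(\<Sum>t<M * T. f t) = (\<Sum>j<M. \<Sum>n<T. f (j * T + n))" for f :: "nat => real"
proof -
 have "sum f {j * T..<j * T + T} = (\<Sum>n<T. f (j * T + n))" for j
  using sum.shift_bounds_nat_ivl[of f 0 "j * T" T] by (simp add: lessThan_atLeast0 add.commute)
 then show ?thesis using sum.nat_group[of f T M] by simp
qed

section \<open>Identification of the variance and the limit theorem\<close>

context smc_model begin

lemma h_fun_restrict: "s <= t ==> h_fun S s (restrict x {0<..t}) = h_fun S s x" by (simp add: h_fun_def prod_weight_restrict)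

text \<open>As h_t and h_{t-1} are positive, the moment with their sum bounds the one with either of
  them. The conditional expectation is exchanged for its version \<open>fh\<close> almost
  everywhere.\<close>

lemma clt_sq:
 assumes second_moments: "\<And>t. t : {1..horizon S} ==>
   (\<integral>\<^sup>+x. ennreal ((f_fun S t x)^2 * (h_fun S t x + h_fun S (t - 1) x)) \<partial>prop_law S) < \<infinity>"
 shows "smc_clt_sq S target"
proof -
 have main: "(\<integral>\<^sup>+x. ennreal (h_fun S s x * (clt.fh t x)^2) \<partial>marg t) < \<infinity>"
  if t: "t : {1..horizon S}" and s: "s = t \<or> s = t - 1" for s t
 proof -
  have t': "t <= horizon S" and st: "s <= t" and s': "s <= horizon S" using t s by auto
  have r: "(%x. restrict x {0<..t}) : prop_law S \<rightarrow>\<^sub>M paths S {0<..t}" using t' by (intro measurable_prop_law_restrict) auto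
  have hm: "h_fun S s : bm (paths S {0<..t})"
  proof -
   have "(%x. h_fun S s (restrict x {0<..s})) : bm (paths S {0<..t})"
    by (rule mcomp[OF measurable_paths_restrict h_fun_measurable[OF s']]) (use st in auto)
   then show ?thesis by (simp add: h_fun_restrict)
  qed
  have hp: "0 < h_fun S u x" if "x : space (prop_law S)" "u <= horizon S" for u x
  proof -
   have "restrict x {0<..u} : space (paths S {0<..u})"
    using that by (intro space_paths_restrict[where I="{0<..horizon S}"]) (auto simp: space_prop_law)
   from h_fun_pos[OF that(2) this] show ?thesis by (simp add: h_fun_restrict)
  qed
  have m: "(%x. ennreal (h_fun S s x * (clt.fh t x)^2)) : bm (paths S {0<..t})"
   by (intro mcomp[OF _ measurable_ennreal] borel_measurable_times borel_measurable_power hm clt.fh_measurable t')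
  have "(\<integral>\<^sup>+x. ennreal (h_fun S s x * (clt.fh t x)^2) \<partial>marg t) = (\<integral>\<^sup>+x. ennreal (h_fun S s x * (clt.fh t (restrict x {0<..t}))^2) \<partial>prop_law S)"
   unfolding distr_marg_restrict[OF t', symmetric] by (subst nn_integral_distr[OF r]) (use m in \<open>simp_all add: h_fun_restrict[OF st]\<close>)
  also have "... <= (\<integral>\<^sup>+x. ennreal ((f_fun S t x)^2 * (h_fun S t x + h_fun S (t - 1) x)) \<partial>prop_law S)"
  proof (rule nn_integral_mono_AE)
   show "AE x in prop_law S. ennreal (h_fun S s x * (clt.fh t (restrict x {0<..t}))^2) <= ennreal ((f_fun S t x)^2 * (h_fun S t x + h_fun S (t - 1) x))"
    using f_fun_AE[OF t] AE_space
   proof eventually_elim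
    case (elim x)
    have "h_fun S s x <= h_fun S t x + h_fun S (t - 1) x"
     using s hp[OF elim(2) t'] hp[OF elim(2) order_trans[OF diff_le_self t'], of 1] by (elim disjE) auto
    then have "h_fun S s x * (f_fun S t x)^2 <= (f_fun S t x)\<^sup>2 * (h_fun S t x + h_fun S (t - 1) x)"
     by (subst mult.commute) (intro mult_left_mono, auto)
    then show ?case unfolding elim(1) by (rule ennreal_leI)
   qed
  qed
  also have "... < \<infinity>" by (rule second_moments[OF t])
  finally show ?thesis .
 qed
 show ?thesis
 proof
  show "(\<integral>\<^sup>+x. ennreal (h_fun S t x * (clt.fh t x)^2) \<partial>marg t) < \<infinity>" if "t : {1..horizon S}" for t
   using main[OF that] by blast
  show "(\<integral>\<^sup>+x. ennreal (h_fun S t x * (clt.fh (Suc t) x)^2) \<partial>marg (Suc t)) < \<infinity>" if "t < horizon S" for t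
   using main[of "Suc t" t] that by auto
 qed
qed

lemma f_blk_measurable: "f_blk S m t : bm (prop_law S)" by (simp add: f_blk_def f_fun_def)

text \<open>The odd term is a difference of two separately finite integrals. In the even term the
  square is expanded: the cross term uses that the backward mean has expectation
  \<open>post_mean S\<close>, the last term that \<open>1 / h\<close> integrates to 1.\<close>

lemma
 assumes sq: "smc_clt_sq S target" and j: "j < n_blocks S" and n: "n < T"
 defines "t \<equiv> st j + Suc n" and "g \<equiv> clt.gs j T"
 shows sig_odd: "integrable (prop_law S) (sig_integrand S (2 * t - 1))" "sig2 S (2 * t - 1) = smc_block_sq.var_prop S (Suc j) g n"
  and sig_even: "integrable (prop_law S) (sig_integrand S (2 * t))" "sig2 S (2 * t) = smc_block_sq.var_res S (Suc j) g n"
proof -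
 interpret c: smc_clt_sq S target by (rule sq)
 interpret smc_block_sq S "Suc j" g unfolding g_def by (rule c.block_sq[OF j])
 interpret pl: prob_space "prop_law S" by (rule prob_space_prop_law)
 let ?r = "%k x. restrict x {a<..a + k}"
 have n': "Suc n <= T" "n <= T" using n by auto
 have bt: "blk S t = Suc j" unfolding t_def using blk_a[OF n] by (simp add: add_Suc_right)
 have f: "AE x in prop_law S. f_blk S (Suc j) (a + k) x = gn k (?r k x)" if k: "k <= T" for k
 proof -
  have "AE y in Q k. clt.gs j k y = gn k y" using clt.AE_gs[OF j k] unfolding gn_def unfolding g_def by eventually_elim simp
  then have "AE x in prop_law S. clt.gs j k (?r k x) = gn k (?r k x)"
   unfolding distr_block_restrict[OF k, symmetric] by (rule AE_distrD[OF block_restrict_measurable[OF k]])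
  with f_blk_AE[OF j k] show ?thesis by eventually_elim simp
 qed
 have hr: "h k (?r i x) = h k x" if "k <= i" "k <= T" for k i x
 proof -
  have "{a<..a + i} \<inter> {a<..a + k} = {a<..a + k}" using that(1) by auto
  then show ?thesis using h_restrict[OF that(2), of "?r i x"] h_restrict[OF that(2), of x] by (simp add: restrict_restrict)
 qed
 have gm: "gn k : bm (B k)" if "k <= T" for k using gn_measurable[OF that] .
 have hm: "h k : bm (prop_law S)" if "k <= T" for k
  using mcomp[OF block_restrict_measurable[OF that] h_measurable[OF that order_refl]] by (simp add: hr[OF order_refl that])
 have sqm: "(%x. h k x * (gn i x)^2) : bm (B i)" if "k <= i" "i <= T" for k i
  using that by (intro borel_measurable_times borel_measurable_power gm h_measurable) auto
 have i1: "integrable (prop_law S) (%x. h n x * (gn (Suc n) (?r (Suc n) x))^2)"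
  and e1: "(LINT x|prop_law S. h n x * (gn (Suc n) (?r (Suc n) x))^2) = (LINT x|Q (Suc n). h n x * (gn (Suc n) x)^2)"
  using integrable_block_restrict[OF n'(1) sqm, of n] integral_block_restrict[OF n'(1) sqm, of n] sq_prev[OF n] n' by (simp_all add: hr)
 have i2: "integrable (prop_law S) (%x. h n x * (gn n (?r n x))^2)"
  and e2: "(LINT x|prop_law S. h n x * (gn n (?r n x))^2) = (LINT x|Q n. h n x * (gn n x)^2)"
  using integrable_block_restrict[OF n'(2) sqm, of n] integral_block_restrict[OF n'(2) sqm, of n] sq_integrable[OF n'(2)] n' by (simp_all add: hr)
 have i3: "integrable (prop_law S) (%x. h (Suc n) x * (gn (Suc n) (?r (Suc n) x))^2)"
  and e3: "(LINT x|prop_law S. h (Suc n) x * (gn (Suc n) (?r (Suc n) x))^2) = (LINT x|Q (Suc n). h (Suc n) x * (gn (Suc n) x)^2)"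
  using integrable_block_restrict[OF n'(1) sqm, of "Suc n"] integral_block_restrict[OF n'(1) sqm, of "Suc n"] sq_next[OF n] n' by (simp_all add: hr)
 have i4: "integrable (prop_law S) (%x. gn (Suc n) (?r (Suc n) x))"
  and e4: "(LINT x|prop_law S. gn (Suc n) (?r (Suc n) x)) = g0"
  using integrable_block_restrict[OF n'(1) gm[OF n'(1)]] integral_block_restrict[OF n'(1) gm[OF n'(1)]]
   integrable_gn[OF n'(1)] integral_gn[OF n'(1)] by simp_all
 have "(%x. 1 / h (Suc n) x) : bm (B (Suc n))" using n'(1) by (intro borel_measurable_divide borel_measurable_const h_measurable) auto
 from integrable_block_restrict[OF n'(1) this] integral_block_restrict[OF n'(1) this] inverse_h_integral[OF n'(1)]
 have i5: "integrable (prop_law S) (%x. 1 / h (Suc n) x)" and e5: "(LINT x|prop_law S. 1 / h (Suc n) x) = 1" using n'(1) by (simp_all add: hr)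
 have psi: "post_mean S = g0" unfolding psi_eq[symmetric] g0_def unfolding g_def by (rule clt.gs_integral[OF j order_refl, symmetric])
 have tm1: "t - 1 = a + n" by (simp add: t_def add_Suc_right)
 have odd: "sig_integrand S (2 * t - 1) = (%x. ((f_blk S (Suc j) t x)^2 - (f_blk S (Suc j) (a + n) x)\<^sup>2) * h n x)"
 proof -
  have "(2 * t - 1 + 1) div 2 = t" "odd (2 * t - 1)" by (auto simp: t_def add_Suc_right)
  then show ?thesis using tm1 by (auto simp: sig_integrand_def bt Let_def)
 qed
 have even: "sig_integrand S (2 * t) = (%x. (f_blk S (Suc j) t x * h (Suc n) x - g0)\<^sup>2 / h (Suc n) x)"
 proof -
  have "(2 * t + 1) div 2 = t" by simp
  then have "sig_integrand S (2 * t) = (%x. (f_blk S (blk S t) t x * h_blk S (blk S t) t x - f_fun S 0 x)\<^sup>2 / h_blk S (blk S t) t x)"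
   by (simp add: sig_integrand_def Let_def fun_eq_iff)
  then show ?thesis unfolding bt psi[symmetric] unfolding f_fun_def t_def by simp
 qed
 let ?o = "%x. h n x * (gn (Suc n) (?r (Suc n) x))^2 - h n x * (gn n (?r n x))^2"
 let ?e = "%x. (h (Suc n) x * (gn (Suc n) (?r (Suc n) x))^2 - 2 * g0 * gn (Suc n) (?r (Suc n) x)) + g0\<^sup>2 * (1 / h (Suc n) x)"
 have io: "integrable (prop_law S) ?o" using i1 i2 by (rule Bochner_Integration.integrable_diff)
 have ie: "integrable (prop_law S) ?e"
  by (intro Bochner_Integration.integrable_add Bochner_Integration.integrable_diff integrable_mult_right i3 i4 i5)
 have mo: "sig_integrand S (2 * t - 1) : bm (prop_law S)" unfolding odd
  by (intro borel_measurable_times borel_measurable_diff borel_measurable_power f_blk_measurable hm n')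
 have me: "sig_integrand S (2 * t) : bm (prop_law S)" unfolding even
  by (intro borel_measurable_divide borel_measurable_times borel_measurable_diff borel_measurable_power f_blk_measurable hm n' borel_measurable_const)
 have ao: "AE x in prop_law S. sig_integrand S (2 * t - 1) x = ?o x"
  using f[OF n'(1)] f[OF n'(2)] unfolding odd t_def[symmetric] by eventually_elim (simp add: algebra_simps)
 have ae: "AE x in prop_law S. sig_integrand S (2 * t) x = ?e x" using f[OF n'(1)] AE_space unfolding even t_def[symmetric]
 proof eventually_elim
  case (elim x)
  have "?r (Suc n) x : space (B (Suc n))" using measurable_space[OF block_restrict_measurable[OF n'(1)] elim(2)] .
  from h_pos[OF n'(1) order_refl this] have hp: "0 < h (Suc n) x" using n'(1) by (simp add: hr)
  have "(p * q - r)^2 / q = (q * p\<^sup>2 - 2 * r * p) + r\<^sup>2 * (1 / q)" if "0 < q" for p q r :: real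
   using that by (simp add: power2_eq_square field_simps)
  from this[OF hp] show ?case unfolding t_def elim(1)[unfolded t_def] .
 qed
 show "integrable (prop_law S) (sig_integrand S (2 * t - 1))" using integrable_cong_AE[OF mo borel_measurable_integrable[OF io] ao] io by simp
 show "integrable (prop_law S) (sig_integrand S (2 * t))" using integrable_cong_AE[OF me borel_measurable_integrable[OF ie] ae] ie by simp
 show "sig2 S (2 * t - 1) = var_prop n" unfolding sig2_def integral_cong_AE[OF mo borel_measurable_integrable[OF io] ao]
  using Bochner_Integration.integral_diff[OF i1 i2] by (simp add: e1 e2 var_prop_def)
 have "(LINT x|prop_law S. ?e x) = ((LINT x|prop_law S. h (Suc n) x * (gn (Suc n) (?r (Suc n) x))^2)
   - (LINT x|prop_law S. 2 * g0 * gn (Suc n) (?r (Suc n) x))) + (LINT x|prop_law S. g0\<^sup>2 * (1 / h (Suc n) x))"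
  by (subst Bochner_Integration.integral_add, intro Bochner_Integration.integrable_diff integrable_mult_right i3 i4,
    rule integrable_mult_right[OF i5], subst Bochner_Integration.integral_diff, rule i3, rule integrable_mult_right[OF i4], rule refl)
 also have "... = var_res n" unfolding integral_mult_right_zero e3 e4 e5 var_res_def by (simp add: power2_eq_square)
 finally show "sig2 S (2 * t) = var_res n" unfolding sig2_def integral_cong_AE[OF me borel_measurable_integrable[OF ie] ae] .
qed

lemma time_index:
 assumes "u : {1..2 * horizon S}"
 obtains j n where "j < n_blocks S" "n < T" "u = 2 * (st j + Suc n) - 1 \<or> u = 2 * (st j + Suc n)"
proof -
 define t where "t = (u - 1) div 2"
 have t: "t < n_blocks S * T" "u = 2 * Suc t - 1 \<or> u = 2 * Suc t" using assms by (auto simp: t_def horizon_def)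
 have e: "t = t div T * T + t mod T" by simp
 show ?thesis
 proof
  show "t div T < n_blocks S" using t(1) blk_len_pos by (simp add: div_less_iff_less_mult)
  show "t mod T < T" using blk_len_pos by simp
  show "u = 2 * (st (t div T) + Suc (t mod T)) - 1 \<or> u = 2 * (st (t div T) + Suc (t mod T))"
   using t(2) by (simp add: blk_start_def)
 qed
qed

lemma sum_sig2:
 assumes sq: "smc_clt_sq S target"
 shows "(\<Sum>u=1..2 * horizon S. sig2 S u) = (\<Sum>j<n_blocks S. smc_clt_sq.block_var S target j)"
 unfolding sum_pairs horizon_def sum_blocks smc_clt_sq.block_var_def[OF sq]
 using sig_odd(2)[OF sq] sig_even(2)[OF sq] by (intro sum.cong refl) (simp add: blk_start_def add_Suc_right)

lemma smc_law_eq: "smc_law S K = Om (n_blocks S) K" unfolding smc_law_def Om_def by (rule PiM_cong) (auto simp: fl_def)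

text \<open>\<open>psi_hat_eq\<close> and \<open>psi_eq\<close> turn the scaled estimation error
  into the error whose characteristic function \<open>cfe\<close> was followed through the blocks,
  so that Levy's continuity theorem applies.\<close>

lemma
 assumes sq: "smc_clt_sq S target" and v: "v = (\<Sum>j<n_blocks S. smc_clt_sq.block_var S target j)"
 shows var_nonneg: "0 <= v"
  and weak_conv_psi_hat: "weak_conv_m (%K. distr (smc_law S K) borel (%w. sqrt (real K) * (psi_hat S K w - post_mean S))) (normal_law v)"
proof -
 interpret c: smc_clt_sq S target by (rule sq)
 have lim: "c.cfe (n_blocks S) s \<longlonglongrightarrow> exp (- (s\<^sup>2 * v / 2))" for s using c.cfe_tendsto[OF order_refl, of s] unfolding v .
 have "cmod (c.cfe (n_blocks S) s K) <= 1" for s K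
 proof -
  interpret O: prob_space "Om (n_blocks S) (Suc K)" by (rule prob_space_Om)
  have "cmod (c.cfe (n_blocks S) s K) <= (LINT w|Om (n_blocks S) (Suc K). 1)" unfolding c.cfe_def by (rule order_trans[OF integral_norm_bound]) simp
  then show ?thesis by (simp add: O.prob_space)
 qed
 \<comment> \<open>Nonnegativity of the variance comes for free: the limit at \<open>s = 1\<close>
   of characteristic functions has modulus at most 1, and here it is
   \<open>exp (- v / 2)\<close>.\<close>
 then have "cmod (complex_of_real (exp (- (1\<^sup>2 * v / 2)))) <= 1" by (intro Lim_bounded[OF tendsto_norm[OF lim[of 1]]]) auto
 then show v0: "0 <= v" by simp
 let ?X = "%K w. sqrt (real K) * (psi_hat S K w - post_mean S)"
 let ?D = "%K. distr (smc_law S K) borel (?X K)"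
 have U: "st (n_blocks S) = horizon S" by (simp add: blk_start_def horizon_def)
 have tm: "target : bm (paths S {0<..st (n_blocks S)})" unfolding U by (rule target_measurable)
 have Xm: "?X K : bm (Om (n_blocks S) K)" for K unfolding psi_hat_eq
  by (intro borel_measurable_times[OF borel_measurable_const] borel_measurable_diff borel_measurable_const emp_measurable_Om[OF order_refl tm])
 have "weak_conv_m (%K. ?D (Suc K)) (normal_law v)"
 proof (rule levy_continuity)
  show "real_distribution (?D (Suc K))" for K unfolding smc_law_eq using prob_space.prob_space_distr[OF prob_space_Om Xm, of "Suc K"]
   by (simp add: real_distribution_def real_distribution_axioms_def)
  show "real_distribution (normal_law v)" by (rule real_distribution_normal_law[OF v0])
  show "(%K. char (?D (Suc K)) s) \<longlonglongrightarrow> char (normal_law v) s" for s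
  proof -
   have "char (?D (Suc K)) s = c.cfe (n_blocks S) s K" for K
   proof -
    have "char (?D (Suc K)) s = (CLINT w|Om (n_blocks S) (Suc K). iexp (s * ?X (Suc K) w))"
     unfolding char_def smc_law_eq by (subst integral_distr[OF Xm]) auto
    also have "... = c.cfe (n_blocks S) s K" unfolding c.cfe_def
    proof (rule integral_cong_AE)
     note [measurable] = Xm[of "Suc K"]
     show "(%w. iexp (s * ?X (Suc K) w)) : bm (Om (n_blocks S) (Suc K))" by measurable
     have [measurable]: "(%w. emp (n_blocks S) (Suc K) w (clt.fh (st (n_blocks S)))) : bm (Om (n_blocks S) (Suc K))"
      by (intro emp_measurable_Om order_refl clt.fh_measurable) (simp add: U)
     show "(%w. iexp (s * (sqrt (real (Suc K)) * (emp (n_blocks S) (Suc K) w (clt.fh (st (n_blocks S))) - clt.psi)))) : bm (Om (n_blocks S) (Suc K))" by measurable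
     \<comment> \<open>\<open>fh_horizon\<close> needs its argument to lie in the path space, which
       is known for joined paths only almost surely.\<close>
     have "AE w in Om (n_blocks S) (Suc K). all_paths (n_blocks S) (Suc K) w (%x. x : space (paths S {0<..st (n_blocks S)}))"
      using AE_space by (intro AE_all_paths_measurable) (auto simp: U space_marg elim!: eventually_mono)
     then show "AE w in Om (n_blocks S) (Suc K). iexp (s * ?X (Suc K) w)
      = iexp (s * (sqrt (real (Suc K)) * (emp (n_blocks S) (Suc K) w (clt.fh (st (n_blocks S))) - clt.psi)))"
     proof eventually_elim
      case (elim w)
      have "emp (n_blocks S) (Suc K) w (clt.fh (st (n_blocks S))) = emp (n_blocks S) (Suc K) w target"
       by (rule emp_cong[OF all_paths_mono[OF elim]]) (simp add: U clt.fh_horizon)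
      then show ?case by (simp only: psi_hat_eq psi_eq)
     qed
    qed
    finally show ?thesis .
   qed
   then show ?thesis using lim[of s] by (simp add: char_normal_law[OF v0])
  qed
 qed
 \<comment> \<open>The sequence was shifted by one to exclude \<open>K = 0\<close>; undoing the
   shift does not affect the limit.\<close>
 then show "weak_conv_m ?D (normal_law v)" unfolding weak_conv_m_def weak_conv_def by (auto intro: LIMSEQ_imp_Suc)
qed

end

theorem theorem2:
 fixes S :: "('x, 'y) smc" and \<sigma>sq :: real
 assumes model: "smc_model S"
  and second_moments: "\<And>t. t \<in> {1..horizon S} \<Longrightarrow>
   (\<integral>\<^sup>+x. ennreal ((f_fun S t x)\<^sup>2 * (h_fun S t x + h_fun S (t - 1) x)) \<partial>prop_law S) < \<infinity>"
  and sigma_sq: "\<sigma>sq = (\<Sum>u\<in>{1..2 * horizon S}. sig2 S u)"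
 shows "(\<forall>u\<in>{1..2 * horizon S}. integrable (prop_law S) (sig_integrand S u))
  \<and> 0 \<le> \<sigma>sq
  \<and> weak_conv_m
    (\<lambda>K. distr (smc_law S K) borel (\<lambda>\<omega>. sqrt (real K) * (psi_hat S K \<omega> - post_mean S)))
    (normal_law \<sigma>sq)"
proof -
 interpret smc_model S by (rule model)
 have sq: "smc_clt_sq S target" by (rule clt_sq[OF second_moments])
 have v: "\<sigma>sq = (\<Sum>j<n_blocks S. smc_clt_sq.block_var S target j)" unfolding sigma_sq by (rule sum_sig2[OF sq])
 have "integrable (prop_law S) (sig_integrand S u)" if u: "u : {1..2 * horizon S}" for u
  using time_index[OF u] sig_odd(1)[OF sq] sig_even(1)[OF sq] by metis
 with var_nonneg[OF sq v] weak_conv_psi_hat[OF sq v] show ?thesis by blast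
qed

end
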